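(* Let $(H,B)$ be a Rota-Baxter Hopf algebra of weight $-1$ and let $(H_+,H_-,\rhd,\lhd)$ be the matched pair of Hopf algebras on $(H,B)$. Let $C:H_-\bowtie H_+\to H_-\bowtie H_+$ be the first member of the projection homomorphism pair $(C,\widetilde{C})$ on $(H_+,H_-,\rhd,\lhd)$ given in the context, and let $H_1=\operatorname{Im}C$. Define $B_1:H_1\to H_1$ by $$B_1((x,y))=C\big((x,\epsilon(y)1_H)\big),\quad \forall\,(x,y)\in H_1,$$ and $\widetilde{B_1}:H_1\to H_1$ by $$\widetilde{B_1}((x,y))=(x_1,y_1)\,B_1\big(S((x_2,y_2))\big),\quad \forall\,(x,y)\in H_1.$$ Then $(H_1,B_1)$ is a Rota-Baxter Hopf algebra of weight $-1$ that is Rota-Baxter isomorphic to $(H,\widetilde{B})$, and $(H_1,\widetilde{B_1})$ is a Rota-Baxter Hopf algebra of weight $-1$ that is Rota-Baxter isomorphic to $(H,B)$.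
   Context: The base field $\mathbb{K}$ has characteristic $0$; Hopf algebras are written $(H,\cdot,1,\Delta,\epsilon,S)$ and Sweedler notation $\Delta(x)=x_1\otimes x_2$ is used. A coalgebra map is a linear map $f$ with $\Delta\circ f=(f\otimes f)\circ\Delta$ and $\epsilon\circ f=\epsilon$. Rota-Baxter Hopf algebra of weight $-1$: a pair $(H,B)$ where $H$ is a cocommutative Hopf algebra and $B:H\to H$ is a coalgebra map with $B(x)B(y)=B\big(B(x_1)\,y\,S(B(x_2))\,x_3\big)$ for all $x,y\in H$. $(H,B)$ and $(H',B')$ are Rota-Baxter isomorphic if there is a bijective Hopf algebra homomorphism $f:H\to H'$ with $f\circ B=B'\circ f$. Put $\widetilde{B}(x)=x_1B(S(x_2))$ (again a Rota-Baxter operator of weight $-1$ on $H$), $S_B(x)=S(B(x_1))S(x_2)B(x_3)$, $H_+=\operatorname{Im}B$ and $H_-=\operatorname{Im}\widetilde{B}$ (Hopf subalgebras of $H$). The matched pair of Hopf algebras on $(H,B)$ is $(H_+,H_-,\rhd,\lhd)$ with $B(x)\rhd\widetilde{B}(y)=\widetilde{B}(B(x_1)yS(B(x_2)))\in H_-$ and $B(x)\lhd\widetilde{B}(y)=S\big(B(S(\widetilde{B}(y_1))S_B(x)\widetilde{B}(y_2))\big)\in H_+$ for $x,y\in H$. Its double cross product $H_-\bowtie H_+$ is the Hopf algebra on $H_-\otimes H_+$ with product $(a\otimes x)(a'\otimes x')=a(x_1\rhd a'_1)\otimes(x_2\lhd a'_2)x'$, unit $1\otimes1$ and the usual tensor product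 coalgebra structure. The element $a\otimes x$ is written $(a,x)$; formulas on such elements are extended linearly, and $S((x,y))$ is the antipode of $H_-\bowtie H_+$. The projection homomorphism pair $(C,\widetilde{C})$ on $(H_+,H_-,\rhd,\lhd)$ consists of the idempotent Hopf algebra endomorphisms of $H_-\bowtie H_+$ given for $x,y\in H$ by $C((\widetilde{B}(x),B(y)))=\big(\widetilde{B}(\widetilde{B}(x_1)B(y_1)),\,S(B(S(\widetilde{B}(x_2)B(y_2))))\big)$ and $\widetilde{C}((\widetilde{B}(x),B(y)))=\big(\widetilde{B}(S(B(S(x_1))B(y_1))),\,S(B(\widetilde{B}(x_2)\widetilde{B}(S(y_2))))\big)$; they satisfy $C(z_1)\widetilde{C}(z_2)=z$ for all $z$. $\operatorname{Im}C$ is a Hopf subalgebra of $H_-\bowtie H_+$. *)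

theory Defs
  imports Complex_Main "HOL-Library.Function_Algebras"
begin

section \<open>Linear maps between subspaces\<close>

text \<open>
  All vector spaces live as subspaces inside an ambient additive group equipped with a scalar
  multiplication satisfying \<^const>\<open>vector_space\<close>.
\<close>

definition linear_on ::
  "('k::field \<Rightarrow> 'a::ab_group_add \<Rightarrow> 'a) \<Rightarrow> ('k \<Rightarrow> 'b::ab_group_add \<Rightarrow> 'b) \<Rightarrow>
   'a set \<Rightarrow> 'b set \<Rightarrow> ('a \<Rightarrow> 'b) \<Rightarrow> bool" where
  "linear_on s s' V W f \<longleftrightarrow>
     (\<forall>x\<in>V. f x \<in> W) \<and>
     (\<forall>x\<in>V. \<forall>y\<in>V. f (x + y) = f x + f y) \<and>
     (\<forall>c. \<forall>x\<in>V. f (s c x) = s' c (f x))"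

definition bilinear_on ::
  "('k::field \<Rightarrow> 'a::ab_group_add \<Rightarrow> 'a) \<Rightarrow> ('k \<Rightarrow> 'b::ab_group_add \<Rightarrow> 'b) \<Rightarrow>
   ('k \<Rightarrow> 'c::ab_group_add \<Rightarrow> 'c) \<Rightarrow>
   'a set \<Rightarrow> 'b set \<Rightarrow> 'c set \<Rightarrow> ('a \<Rightarrow> 'b \<Rightarrow> 'c) \<Rightarrow> bool" where
  "bilinear_on s1 s2 s3 V W U f \<longleftrightarrow>
     (\<forall>x\<in>V. linear_on s2 s3 W U (\<lambda>y. f x y)) \<and>
     (\<forall>y\<in>W. linear_on s1 s3 V U (\<lambda>x. f x y))"


section \<open>Tensor products\<close>

text \<open>
  The pure tensor of \<open>x\<close> and \<open>y\<close> is evaluation at \<open>(x, y)\<close>, as a functional on the space of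
  bilinear forms; \<open>V \<otimes> W\<close> is the span of the pure tensors with factors in \<open>V\<close> and \<open>W\<close>.
  Over a field this is the algebraic tensor product (see \<open>tensor_lift_pure\<close> below for
  its universal property), and for subspaces \<open>V' \<subseteq> V\<close> and
  \<open>W' \<subseteq> W\<close> the space \<open>V' \<otimes> W'\<close> is literally a subspace of \<open>V \<otimes> W\<close>.
  Functions that are not bilinear forms are sent to \<open>0\<close>, so that they carry no information.
\<close>

type_synonym ('k, 'a, 'b) tensor = "('a \<Rightarrow> 'b \<Rightarrow> 'k) \<Rightarrow> 'k"

definition pure_tensor ::
  "('k::field \<Rightarrow> 'a::ab_group_add \<Rightarrow> 'a) \<Rightarrow> ('k \<Rightarrow> 'b::ab_group_add \<Rightarrow> 'b) \<Rightarrow>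
   'a \<Rightarrow> 'b \<Rightarrow> ('k, 'a, 'b) tensor" where
  "pure_tensor s1 s2 x y =
     (\<lambda>\<beta>. if bilinear_on s1 s2 (*) UNIV UNIV UNIV \<beta> then \<beta> x y else 0)"

definition tensor_scale :: "'k::field \<Rightarrow> ('k, 'a, 'b) tensor \<Rightarrow> ('k, 'a, 'b) tensor" where
  "tensor_scale c t = (\<lambda>\<beta>. c * t \<beta>)"

definition tensor_space ::
  "('k::field \<Rightarrow> 'a::ab_group_add \<Rightarrow> 'a) \<Rightarrow> ('k \<Rightarrow> 'b::ab_group_add \<Rightarrow> 'b) \<Rightarrow>
   'a set \<Rightarrow> 'b set \<Rightarrow> ('k, 'a, 'b) tensor set" where
  "tensor_space s1 s2 V W =
     module.span tensor_scale {pure_tensor s1 s2 x y | x y. x \<in> V \<and> y \<in> W}"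

text \<open>
  Linear extension of \<open>x \<otimes> y \<mapsto> \<Phi> x y\<close> to \<open>V \<otimes> W\<close>: write \<open>t\<close> as a finite sum of pure tensors and
  apply \<open>\<Phi>\<close> to each summand. For \<open>\<Phi>\<close> bilinear on \<open>V \<times> W\<close> the result does not depend on the
  chosen presentation of \<open>t\<close> (\<open>tensor_lift_sum\<close>).
\<close>

definition tensor_lift ::
  "('k::field \<Rightarrow> 'a::ab_group_add \<Rightarrow> 'a) \<Rightarrow> ('k \<Rightarrow> 'b::ab_group_add \<Rightarrow> 'b) \<Rightarrow>
   'a set \<Rightarrow> 'b set \<Rightarrow> ('a \<Rightarrow> 'b \<Rightarrow> 'c::ab_group_add) \<Rightarrow> ('k, 'a, 'b) tensor \<Rightarrow> 'c" where
  "tensor_lift s1 s2 V W \<Phi> t =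
     (\<Sum>(x, y)\<leftarrow>(SOME xs. set xs \<subseteq> V \<times> W \<and> (\<Sum>(x, y)\<leftarrow>xs. pure_tensor s1 s2 x y) = t). \<Phi> x y)"


lemma vector_space_tensor_scale: "vector_space (tensor_scale :: 'k::field \<Rightarrow> ('k, 'a, 'b) tensor \<Rightarrow> _)"
  by unfold_locales (auto simp: tensor_scale_def fun_eq_iff algebra_simps)

lemma tensor_lift_sum:
  fixes s1 :: "'k::field \<Rightarrow> 'a::ab_group_add \<Rightarrow> 'a" and s2 :: "'k \<Rightarrow> 'b::ab_group_add \<Rightarrow> 'b"
    and s3 :: "'k \<Rightarrow> 'c::ab_group_add \<Rightarrow> 'c" and \<Phi> :: "'a \<Rightarrow> 'b \<Rightarrow> 'c"
  assumes vs: "vector_space s1" "vector_space s2" "vector_space s3"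
    and sub: "module.subspace s1 V" "module.subspace s2 W"
    and bil: "bilinear_on s1 s2 s3 V W UNIV \<Phi>"
    and xs: "set xs \<subseteq> V \<times> W"
  shows "tensor_lift s1 s2 V W \<Phi> (\<Sum>(x, y)\<leftarrow>xs. pure_tensor s1 s2 x y) = (\<Sum>(x, y)\<leftarrow>xs. \<Phi> x y)"
proof -
  interpret v1: vector_space s1 by fact
  interpret v2: vector_space s2 by fact
  interpret v3: vector_space s3 by fact
  interpret k: vector_space "(*) :: 'k \<Rightarrow> 'k \<Rightarrow> 'k"
    by unfold_locales (auto simp: algebra_simps)
  interpret p11: vector_space_pair s1 s1 ..
  interpret p22: vector_space_pair s2 s2 ..
  interpret p3k: vector_space_pair s3 "(*) :: 'k \<Rightarrow> 'k \<Rightarrow> 'k" ..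
  have proj1: "\<exists>g. Vector_Spaces.linear s1 s1 g \<and> range g \<subseteq> V \<and> (\<forall>v\<in>V. g v = v)"
    using p11.linear_exists_left_inverse_on[OF v1.linear_id sub(1)] by auto
  have proj2: "\<exists>g. Vector_Spaces.linear s2 s2 g \<and> range g \<subseteq> W \<and> (\<forall>v\<in>W. g v = v)"
    using p22.linear_exists_left_inverse_on[OF v2.linear_id sub(2)] by auto
  obtain g where g: "Vector_Spaces.linear s1 s1 g" "range g \<subseteq> V" "\<And>v. v \<in> V \<Longrightarrow> g v = v"
    using proj1 by auto
  obtain h where h: "Vector_Spaces.linear s2 s2 h" "range h \<subseteq> W" "\<And>v. v \<in> W \<Longrightarrow> h v = v"
    using proj2 by auto
  interpret g: Vector_Spaces.linear s1 s1 g by fact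
  interpret h: Vector_Spaces.linear s2 s2 h by fact
  have gV: "g v \<in> V" and hW: "h w \<in> W" for v w using g h by auto
  have eval: "f (\<Sum>(x, y)\<leftarrow>zs. \<Phi> x y) =
      (\<Sum>(x, y)\<leftarrow>zs. pure_tensor s1 s2 x y) (\<lambda>x y. f (\<Phi> (g x) (h y)))"
    if f: "Vector_Spaces.linear s3 (*) f" and zs: "set zs \<subseteq> V \<times> W" for f zs
  proof -
    interpret f: Vector_Spaces.linear s3 "(*)" f by fact
    have "bilinear_on s1 s2 (*) UNIV UNIV UNIV (\<lambda>x y. f (\<Phi> (g x) (h y)))"
      using bil gV hW unfolding bilinear_on_def linear_on_def
      by (simp add: g.add g.scale h.add h.scale f.add f.scale)
    then show ?thesis using zs
      by (induction zs) (auto simp: f.add f.zero pure_tensor_def g h)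
  qed
  have sep: "u = v" if "\<And>f. Vector_Spaces.linear s3 (*) f \<Longrightarrow> f u = f v" for u v
  proof (rule ccontr)
    assume "u \<noteq> v"
    then have "v3.independent {u - v}" by (simp add: v3.dependent_single)
    then obtain f where "Vector_Spaces.linear s3 (*) f" "f (u - v) = 1"
      using p3k.linear_independent_extend[of "{u - v}" "\<lambda>_. 1"] by auto
    with that[of f] show False
      using Vector_Spaces.linear.axioms module_hom.diff
      by (metis Vector_Spaces.linear_def cancel_comm_monoid_add_class.diff_cancel zero_neq_one)
  qed
  define ys where "ys = (SOME ys. set ys \<subseteq> V \<times> W \<and>
    (\<Sum>(x, y)\<leftarrow>ys. pure_tensor s1 s2 x y) = (\<Sum>(x, y)\<leftarrow>xs. pure_tensor s1 s2 x y))"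
  have ys: "set ys \<subseteq> V \<times> W"
    "(\<Sum>(x, y)\<leftarrow>ys. pure_tensor s1 s2 x y) = (\<Sum>(x, y)\<leftarrow>xs. pure_tensor s1 s2 x y)"
    using someI[where P = "\<lambda>ys. set ys \<subseteq> V \<times> W \<and>
      (\<Sum>(x, y)\<leftarrow>ys. pure_tensor s1 s2 x y) = (\<Sum>(x, y)\<leftarrow>xs. pure_tensor s1 s2 x y)", of xs] xs
    unfolding ys_def by auto
  have "(\<Sum>(x, y)\<leftarrow>ys. \<Phi> x y) = (\<Sum>(x, y)\<leftarrow>xs. \<Phi> x y)"
    by (rule sep) (simp add: eval xs ys)
  then show ?thesis by (simp add: tensor_lift_def ys_def)
qed

lemma tensor_lift_pure:
  fixes s1 :: "'k::field \<Rightarrow> 'a::ab_group_add \<Rightarrow> 'a" and s2 :: "'k \<Rightarrow> 'b::ab_group_add \<Rightarrow> 'b"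
    and s3 :: "'k \<Rightarrow> 'c::ab_group_add \<Rightarrow> 'c" and \<Phi> :: "'a \<Rightarrow> 'b \<Rightarrow> 'c"
  assumes "vector_space s1" "vector_space s2" "vector_space s3"
    and "module.subspace s1 V" "module.subspace s2 W"
    and "bilinear_on s1 s2 s3 V W UNIV \<Phi>" "x \<in> V" "y \<in> W"
  shows "tensor_lift s1 s2 V W \<Phi> (pure_tensor s1 s2 x y) = \<Phi> x y"
  using tensor_lift_sum[OF assms(1-6), of "[(x, y)]"] assms by simp


section \<open>Hopf algebras\<close>

text \<open>
  A Hopf algebra has a subspace \<open>carrier\<close> of an ambient vector space as its underlying space; only
  the values of the operations on the carrier matter. A Hopf subalgebra is obtained by shrinking
  the carrier.
\<close>

record ('k, 'a) hopf =
  carrier :: "'a set"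
  scale :: "'k \<Rightarrow> 'a \<Rightarrow> 'a"
  mult :: "'a \<Rightarrow> 'a \<Rightarrow> 'a"  (infixl "\<cdot>\<index>" 70)
  one :: "'a"  ("\<one>\<index>")
  comult :: "'a \<Rightarrow> ('k, 'a, 'a) tensor"
  counit :: "'a \<Rightarrow> 'k"
  antipode :: "'a \<Rightarrow> 'a"

abbreviation tensor_of ::
  "('k::field, 'a::ab_group_add) hopf \<Rightarrow> ('k, 'b::ab_group_add) hopf \<Rightarrow>
   'a \<Rightarrow> 'b \<Rightarrow> ('k, 'a, 'b) tensor" where
  "tensor_of G H \<equiv> pure_tensor (scale G) (scale H)"

abbreviation lift_of ::
  "('k::field, 'a::ab_group_add) hopf \<Rightarrow> ('k, 'b::ab_group_add) hopf \<Rightarrow>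
   ('a \<Rightarrow> 'b \<Rightarrow> 'c::ab_group_add) \<Rightarrow> ('k, 'a, 'b) tensor \<Rightarrow> 'c" where
  "lift_of G H \<equiv> tensor_lift (scale G) (scale H) (carrier G) (carrier H)"

text \<open>
  Sweedler notation: \<open>sweedler H (\<lambda>u v. \<Phi> u v) x\<close> is \<open>\<Phi> x\<^sub>1 x\<^sub>2\<close>, and
  \<open>sweedler3 H (\<lambda>u v w. \<Phi> u v w) x\<close> is \<open>\<Phi> x\<^sub>1 x\<^sub>2 x\<^sub>3\<close>.
\<close>

definition sweedler ::
  "('k::field, 'a::ab_group_add) hopf \<Rightarrow> ('a \<Rightarrow> 'a \<Rightarrow> 'c::ab_group_add) \<Rightarrow> 'a \<Rightarrow> 'c" where
  "sweedler H \<Phi> x = lift_of H H \<Phi> (comult H x)"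

definition sweedler3 ::
  "('k::field, 'a::ab_group_add) hopf \<Rightarrow> ('a \<Rightarrow> 'a \<Rightarrow> 'a \<Rightarrow> 'c::ab_group_add) \<Rightarrow> 'a \<Rightarrow> 'c" where
  "sweedler3 H \<Phi> x = sweedler H (\<lambda>u y. sweedler H (\<lambda>v w. \<Phi> u v w) y) x"

definition is_antipode ::
  "('k::field, 'a::ab_group_add) hopf \<Rightarrow> ('a \<Rightarrow> 'a) \<Rightarrow> bool" where
  "is_antipode H S \<longleftrightarrow>
     linear_on (scale H) (scale H) (carrier H) (carrier H) S \<and>
     (\<forall>x\<in>carrier H. sweedler H (\<lambda>u v. S u \<cdot>\<^bsub>H\<^esub> v) x = scale H (counit H x) \<one>\<^bsub>H\<^esub>) \<and>
     (\<forall>x\<in>carrier H. sweedler H (\<lambda>u v. u \<cdot>\<^bsub>H\<^esub> S v) x = scale H (counit H x) \<one>\<^bsub>H\<^esub>)"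

locale hopf_algebra =
  fixes H :: "('k::field, 'a::ab_group_add) hopf" (structure)
  assumes vector_space: "vector_space (scale H)"
    and subspace: "module.subspace (scale H) (carrier H)"
    and mult_bilinear:
      "bilinear_on (scale H) (scale H) (scale H) (carrier H) (carrier H) (carrier H) (mult H)"
    and mult_assoc:
      "\<lbrakk>x \<in> carrier H; y \<in> carrier H; z \<in> carrier H\<rbrakk> \<Longrightarrow> (x \<cdot> y) \<cdot> z = x \<cdot> (y \<cdot> z)"
    and one_closed: "\<one> \<in> carrier H"
    and one_left: "x \<in> carrier H \<Longrightarrow> \<one> \<cdot> x = x"
    and one_right: "x \<in> carrier H \<Longrightarrow> x \<cdot> \<one> = x"
    and comult_linear:
      "linear_on (scale H) tensor_scale (carrier H)
         (tensor_space (scale H) (scale H) (carrier H) (carrier H)) (comult H)"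
    and counit_linear: "linear_on (scale H) (*) (carrier H) UNIV (counit H)"
    and coassoc:
      "x \<in> carrier H \<Longrightarrow>
         sweedler H (\<lambda>u w. sweedler H
           (\<lambda>p q. pure_tensor (scale H) tensor_scale p (tensor_of H H q w)) u) x =
         sweedler H (\<lambda>u w. pure_tensor (scale H) tensor_scale u (comult H w)) x"
    and counit_left: "x \<in> carrier H \<Longrightarrow> sweedler H (\<lambda>u v. scale H (counit H u) v) x = x"
    and counit_right: "x \<in> carrier H \<Longrightarrow> sweedler H (\<lambda>u v. scale H (counit H v) u) x = x"
    and comult_mult:
      "\<lbrakk>x \<in> carrier H; y \<in> carrier H\<rbrakk> \<Longrightarrow>
         comult H (x \<cdot> y) =
         sweedler H (\<lambda>u v. sweedler H (\<lambda>p q. tensor_of H H (u \<cdot> p) (v \<cdot> q)) y) x"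
    and comult_one: "comult H \<one> = tensor_of H H \<one> \<one>"
    and counit_mult:
      "\<lbrakk>x \<in> carrier H; y \<in> carrier H\<rbrakk> \<Longrightarrow> counit H (x \<cdot> y) = counit H x * counit H y"
    and counit_one: "counit H \<one> = 1"
    and antipode: "is_antipode H (antipode H)"

locale cocommutative_hopf_algebra = hopf_algebra +
  assumes cocommutative:
    "x \<in> carrier H \<Longrightarrow> sweedler H (\<lambda>u v. tensor_of H H v u) x = comult H x"

definition coalgebra_map ::
  "('k::field, 'a::ab_group_add) hopf \<Rightarrow> ('k, 'b::ab_group_add) hopf \<Rightarrow> ('a \<Rightarrow> 'b) \<Rightarrow> bool" where
  "coalgebra_map H G f \<longleftrightarrow>
     linear_on (scale H) (scale G) (carrier H) (carrier G) f \<and>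
     (\<forall>x\<in>carrier H. comult G (f x) = sweedler H (\<lambda>u v. tensor_of G G (f u) (f v)) x) \<and>
     (\<forall>x\<in>carrier H. counit G (f x) = counit H x)"

definition hopf_hom ::
  "('k::field, 'a::ab_group_add) hopf \<Rightarrow> ('k, 'b::ab_group_add) hopf \<Rightarrow> ('a \<Rightarrow> 'b) \<Rightarrow> bool" where
  "hopf_hom H G f \<longleftrightarrow>
     coalgebra_map H G f \<and>
     (\<forall>x\<in>carrier H. \<forall>y\<in>carrier H. f (x \<cdot>\<^bsub>H\<^esub> y) = f x \<cdot>\<^bsub>G\<^esub> f y) \<and>
     f \<one>\<^bsub>H\<^esub> = \<one>\<^bsub>G\<^esub> \<and>
     (\<forall>x\<in>carrier H. f (antipode H x) = antipode G (f x))"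


section \<open>Rota-Baxter Hopf algebras of weight \<open>-1\<close>\<close>

locale rota_baxter_hopf = cocommutative_hopf_algebra +
  fixes B
  assumes coalgebra_map: "coalgebra_map H H B"
    and rota_baxter:
      "\<lbrakk>x \<in> carrier H; y \<in> carrier H\<rbrakk> \<Longrightarrow>
         B x \<cdot> B y = B (sweedler3 H (\<lambda>u v w. B u \<cdot> y \<cdot> antipode H (B v) \<cdot> w) x)"

definition rota_baxter_isomorphic ::
  "('k::field, 'a::ab_group_add) hopf \<Rightarrow> ('a \<Rightarrow> 'a) \<Rightarrow>
   ('k, 'b::ab_group_add) hopf \<Rightarrow> ('b \<Rightarrow> 'b) \<Rightarrow> bool" where
  "rota_baxter_isomorphic H B H' B' \<longleftrightarrow>
     (\<exists>f. hopf_hom H H' f \<and> bij_betw f (carrier H) (carrier H') \<and>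
          (\<forall>x\<in>carrier H. f (B x) = B' (f x)))"

definition rb_tilde ::
  "('k::field, 'a::ab_group_add) hopf \<Rightarrow> ('a \<Rightarrow> 'a) \<Rightarrow> 'a \<Rightarrow> 'a" where
  "rb_tilde H B x = sweedler H (\<lambda>u v. u \<cdot>\<^bsub>H\<^esub> B (antipode H v)) x"

definition rb_antipode ::
  "('k::field, 'a::ab_group_add) hopf \<Rightarrow> ('a \<Rightarrow> 'a) \<Rightarrow> 'a \<Rightarrow> 'a" where
  "rb_antipode H B x =
     sweedler3 H (\<lambda>u v w. antipode H (B u) \<cdot>\<^bsub>H\<^esub> antipode H v \<cdot>\<^bsub>H\<^esub> B w) x"

definition rb_plus ::
  "('k::field, 'a::ab_group_add) hopf \<Rightarrow> ('a \<Rightarrow> 'a) \<Rightarrow> ('k, 'a) hopf" where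
  "rb_plus H B = H\<lparr>carrier := B ` carrier H\<rparr>"

definition rb_minus ::
  "('k::field, 'a::ab_group_add) hopf \<Rightarrow> ('a \<Rightarrow> 'a) \<Rightarrow> ('k, 'a) hopf" where
  "rb_minus H B = H\<lparr>carrier := rb_tilde H B ` carrier H\<rparr>"


section \<open>The matched pair and its double cross product\<close>

text \<open>
  \<open>double_cross A X l r\<close> is \<open>A \<bowtie> X\<close> for actions \<open>l x a = x \<rhd> a \<in> A\<close> and \<open>r x a = x \<lhd> a \<in> X\<close>
  of elements \<open>x\<close> of \<open>X\<close> and \<open>a\<close> of \<open>A\<close>. Its antipode is pinned down as the convolution inverse
  of the identity, which is unique on the carrier.
\<close>

definition double_cross_bialgebra ::
  "('k::field, 'a::ab_group_add) hopf \<Rightarrow> ('k, 'b::ab_group_add) hopf \<Rightarrow>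
   ('b \<Rightarrow> 'a \<Rightarrow> 'a) \<Rightarrow> ('b \<Rightarrow> 'a \<Rightarrow> 'b) \<Rightarrow> ('k, ('k, 'a, 'b) tensor) hopf" where
  "double_cross_bialgebra A X l r =
     \<lparr>carrier = tensor_space (scale A) (scale X) (carrier A) (carrier X),
      scale = tensor_scale,
      mult = (\<lambda>z w. lift_of A X (\<lambda>a x. lift_of A X (\<lambda>a' x'.
        sweedler X (\<lambda>x1 x2. sweedler A (\<lambda>a1 a2.
          tensor_of A X (a \<cdot>\<^bsub>A\<^esub> l x1 a1) (r x2 a2 \<cdot>\<^bsub>X\<^esub> x')) a') x) w) z),
      one = tensor_of A X \<one>\<^bsub>A\<^esub> \<one>\<^bsub>X\<^esub>,
      comult = lift_of A X (\<lambda>a x. sweedler A (\<lambda>a1 a2. sweedler X (\<lambda>x1 x2.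
        pure_tensor tensor_scale tensor_scale (tensor_of A X a1 x1) (tensor_of A X a2 x2)) x) a),
      counit = lift_of A X (\<lambda>a x. counit A a * counit X x),
      antipode = undefined\<rparr>"

definition double_cross ::
  "('k::field, 'a::ab_group_add) hopf \<Rightarrow> ('k, 'b::ab_group_add) hopf \<Rightarrow>
   ('b \<Rightarrow> 'a \<Rightarrow> 'a) \<Rightarrow> ('b \<Rightarrow> 'a \<Rightarrow> 'b) \<Rightarrow> ('k, ('k, 'a, 'b) tensor) hopf" where
  "double_cross A X l r =
     (double_cross_bialgebra A X l r)
       \<lparr>antipode := SOME S. is_antipode (double_cross_bialgebra A X l r) S\<rparr>"

text \<open>
  The actions and the projection are prescribed by formulas in \<open>x\<close> and \<open>y\<close> on the elements
  \<open>B x \<in> H\<^sub>+\<close> and \<open>rb_tilde H B y \<in> H\<^sub>-\<close>. The right-hand sides depend only on these elements, so we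
  evaluate them at arbitrary preimages.
\<close>

definition rb_act_left ::
  "('k::field, 'a::ab_group_add) hopf \<Rightarrow> ('a \<Rightarrow> 'a) \<Rightarrow> 'a \<Rightarrow> 'a \<Rightarrow> 'a" where
  "rb_act_left H B b a =
     (let x = inv_into (carrier H) B b;
          y = inv_into (carrier H) (rb_tilde H B) a
      in rb_tilde H B (sweedler H (\<lambda>x1 x2. B x1 \<cdot>\<^bsub>H\<^esub> y \<cdot>\<^bsub>H\<^esub> antipode H (B x2)) x))"

definition rb_act_right ::
  "('k::field, 'a::ab_group_add) hopf \<Rightarrow> ('a \<Rightarrow> 'a) \<Rightarrow> 'a \<Rightarrow> 'a \<Rightarrow> 'a" where
  "rb_act_right H B b a =
     (let x = inv_into (carrier H) B b;
          y = inv_into (carrier H) (rb_tilde H B) a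
      in antipode H (B (sweedler H (\<lambda>y1 y2.
           antipode H (rb_tilde H B y1) \<cdot>\<^bsub>H\<^esub> rb_antipode H B x \<cdot>\<^bsub>H\<^esub> rb_tilde H B y2) y)))"

definition rb_double_cross ::
  "('k::field, 'a::ab_group_add) hopf \<Rightarrow> ('a \<Rightarrow> 'a) \<Rightarrow> ('k, ('k, 'a, 'a) tensor) hopf" where
  "rb_double_cross H B =
     double_cross (rb_minus H B) (rb_plus H B) (rb_act_left H B) (rb_act_right H B)"

definition rb_projection ::
  "('k::field, 'a::ab_group_add) hopf \<Rightarrow> ('a \<Rightarrow> 'a) \<Rightarrow> ('k, 'a, 'a) tensor \<Rightarrow> ('k, 'a, 'a) tensor" where
  "rb_projection H B =
     lift_of (rb_minus H B) (rb_plus H B) (\<lambda>a b.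
       let x = inv_into (carrier H) (rb_tilde H B) a;
           y = inv_into (carrier H) B b
       in sweedler H (\<lambda>x1 x2. sweedler H (\<lambda>y1 y2.
            tensor_of H H
              (rb_tilde H B (rb_tilde H B x1 \<cdot>\<^bsub>H\<^esub> B y1))
              (antipode H (B (antipode H (rb_tilde H B x2 \<cdot>\<^bsub>H\<^esub> B y2))))) y) x)"

definition rb_image ::
  "('k::field, 'a::ab_group_add) hopf \<Rightarrow> ('a \<Rightarrow> 'a) \<Rightarrow> ('k, ('k, 'a, 'a) tensor) hopf" where
  "rb_image H B =
     (rb_double_cross H B)\<lparr>carrier := rb_projection H B ` carrier (rb_double_cross H B)\<rparr>"

definition rb_image_op ::
  "('k::field, 'a::ab_group_add) hopf \<Rightarrow> ('a \<Rightarrow> 'a) \<Rightarrow> ('k, 'a, 'a) tensor \<Rightarrow> ('k, 'a, 'a) tensor" where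
  "rb_image_op H B z =
     rb_projection H B
       (lift_of (rb_minus H B) (rb_plus H B)
          (\<lambda>x y. tensor_of H H x (scale H (counit H y) \<one>\<^bsub>H\<^esub>)) z)"

end

(*
  Put N = rb_tilde H B and P x = B (S x). The map sigma g = N g_1 (x) S (P g_2) from H to the double cross product
  is an injective homomorphism of Hopf algebras, because multiplication mu of H satisfies mu (sigma g) = g.
  The projection is C = sigma o mu, so H_1 = Im C is a copy of H, and B_1 (sigma g) = sigma (N g). Since
  the companion operator of N is B again, both parts follow by transport of structure along sigma.

  Identities in the double cross product are checked on points: for a cocommutative coalgebra C the
  coalgebra maps C -> H form a group with a Rota-Baxter operator, whose double cross product embeds
  in the product of that group with its Rota-Baxter descendant.

  The formulas for the actions use preimages, so one must know that N y = 0 implies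
  N (P x_1 y S (P x_2)) = 0. This is proved by showing that ker N is its own largest subspace stable under
  the coaction of Im N and the operators y -> P x_1 y S (P x_2).
*)

theory Submission
  imports Defs
begin

section \<open>Linear algebra and tensors\<close>

text \<open>In group terms the identity for \<open>P\<close> says that \<open>P\<close> is
  multiplicative for the descendant product \<open>x \<circ> y\<close>, which is x (P x) y (P x)^-1;
  so is \<open>N x\<close>, which is x (P x). The matched pair records how values of these two
  homomorphisms move past each other, and sigma is g \<mapsto> (g, T g) read through
  \<open>N\<close> and \<open>P\<close>, where \<open>T\<close> inverts for \<circ>. The obstacle is
  that the kernel of \<open>N\<close> is only a subspace. In a group, N n = 1 gives n \<circ> c = c
  n, so that conjugation by P w and conjugation by w in the descendant agree on n, and N (P w y (P
  w)^-1) depends only on N y. Over a field the kernel must first be related to such coinvariant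
  elements, a statement in the spirit of Newman's theorem on kernels of maps of cocommutative Hopf
  algebras. Maximality of \<open>core\<close> permits coinvariants modulo \<open>core\<close>, and
  finite-dimensional cyclic modules over the functionals supply enough of them. The right action
  chooses a preimage under \<open>B\<close>; the same kernel statement covers it, applied to (H, N),
  whose companion operator is \<open>B\<close>.\<close>

definition vsp :: "('k::field \<Rightarrow> 'a::ab_group_add \<Rightarrow> 'a) \<Rightarrow> 'a set \<Rightarrow> bool" where
  "vsp s V \<longleftrightarrow> vector_space s \<and> module.subspace s V"

lemma vsp_module: "vsp s V \<Longrightarrow> module s"
  unfolding vsp_def using module_iff_vector_space by blast

lemma vsp_vs: "vsp s V \<Longrightarrow> vector_space s"
  unfolding vsp_def by blast

lemma vsp_sub: "vsp s V \<Longrightarrow> module.subspace s V"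
  unfolding vsp_def by blast

lemma vsp_UNIV: "vector_space s \<Longrightarrow> vsp s UNIV"
  unfolding vsp_def using module.subspace_UNIV module_iff_vector_space by blast

lemma vsp_0: "vsp s V \<Longrightarrow> 0 \<in> V"
  by (metis module.subspace_0 vsp_module vsp_sub)

lemma vsp_add: "vsp s V \<Longrightarrow> x \<in> V \<Longrightarrow> y \<in> V \<Longrightarrow> x + y \<in> V"
  by (metis module.subspace_add vsp_module vsp_sub)

lemma vsp_scale: "vsp s V \<Longrightarrow> x \<in> V \<Longrightarrow> s c x \<in> V"
  by (metis module.subspace_scale vsp_module vsp_sub)

lemma vsp_diff: "vsp s V \<Longrightarrow> x \<in> V \<Longrightarrow> y \<in> V \<Longrightarrow> x - y \<in> V"
  by (metis module.subspace_diff vsp_module vsp_sub)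

lemma vspI:
  "vector_space s \<Longrightarrow> 0 \<in> V \<Longrightarrow> (\<And>x y. x \<in> V \<Longrightarrow> y \<in> V \<Longrightarrow> x + y \<in> V) \<Longrightarrow>
   (\<And>c x. x \<in> V \<Longrightarrow> s c x \<in> V) \<Longrightarrow> vsp s V"
  unfolding vsp_def using module.subspaceI module_iff_vector_space by metis

lemma vsp_sum_list: "vsp s V \<Longrightarrow> (\<And>x. x \<in> set xs \<Longrightarrow> f x \<in> V) \<Longrightarrow> (\<Sum>x\<leftarrow>xs. f x) \<in> V"
  by (induction xs) (auto simp: vsp_0 vsp_add)

lemma vsp_scale_0_left: "vsp s V \<Longrightarrow> s 0 x = 0"
  by (metis module.scale_zero_left vsp_module)

lemma vsp_scale_simps:
  assumes "vector_space s"
  shows "s c (x + y) = s c x + s c y" "s (c + d) x = s c x + s d x" "s c (s d x) = s (c * d) x"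
    "s 1 x = x" "s c 0 = 0" "s 0 x = 0" "s c (x - y) = s c x - s c y"
proof -
  interpret vector_space s by fact
  show "s c (x + y) = s c x + s c y" "s (c + d) x = s c x + s d x" "s c (s d x) = s (c * d) x"
    "s 1 x = x" "s c 0 = 0" "s 0 x = 0" "s c (x - y) = s c x - s c y"
    by (auto simp: scale_right_distrib scale_left_distrib scale_right_diff_distrib)
qed

lemma scale_sum_list: "vector_space s \<Longrightarrow> s c (\<Sum>x\<leftarrow>xs. f x) = (\<Sum>x\<leftarrow>xs. s c (f x))"
  by (induction xs) (auto simp: vsp_scale_simps)

lemma vs_field: "vector_space ((*) :: 'k::field \<Rightarrow> 'k \<Rightarrow> 'k)"
  by unfold_locales (auto simp: algebra_simps)

lemma linear_on_closed: "linear_on s s' V W f \<Longrightarrow> x \<in> V \<Longrightarrow> f x \<in> W"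
  unfolding linear_on_def by blast

lemma linear_on_add: "linear_on s s' V W f \<Longrightarrow> x \<in> V \<Longrightarrow> y \<in> V \<Longrightarrow> f (x + y) = f x + f y"
  unfolding linear_on_def by blast

lemma linear_on_scale: "linear_on s s' V W f \<Longrightarrow> x \<in> V \<Longrightarrow> f (s c x) = s' c (f x)"
  unfolding linear_on_def by blast

lemma linear_on_zero:
  assumes "vsp s V" "vector_space s'" "linear_on s s' V W f" shows "f 0 = 0"
  using linear_on_scale[OF assms(3) vsp_0[OF assms(1)], of 0] vsp_scale_0_left[OF assms(1)]
    vsp_scale_simps(6)[OF assms(2)] by metis

lemma linear_on_diff:
  assumes "vsp s V" "linear_on s s' V W f" "x \<in> V" "y \<in> V" shows "f (x - y) = f x - f y"
  using linear_on_add[OF assms(2) vsp_diff[OF assms(1,3,4)] assms(4)] by (simp add: eq_diff_eq)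

lemma linear_on_sum_list:
  assumes "vsp s V" "vector_space s'" "linear_on s s' V W f" "\<And>x. x \<in> set xs \<Longrightarrow> h x \<in> V"
  shows "f (\<Sum>x\<leftarrow>xs. h x) = (\<Sum>x\<leftarrow>xs. f (h x))"
  using assms(4)
  by (induction xs) (auto simp: linear_on_zero[OF assms(1-3)] linear_on_add[OF assms(3)] vsp_sum_list[OF assms(1)])

lemma linear_on_mono: "linear_on s s' V W f \<Longrightarrow> V' \<subseteq> V \<Longrightarrow> W \<subseteq> W' \<Longrightarrow> linear_on s s' V' W' f"
  unfolding linear_on_def by blast

lemma linear_on_cong: "linear_on s s' V W f \<Longrightarrow> vsp s V \<Longrightarrow> (\<And>x. x \<in> V \<Longrightarrow> g x = f x) \<Longrightarrow> linear_on s s' V W g"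
  unfolding linear_on_def by (simp add: vsp_add vsp_scale)

lemma linear_on_image:
  assumes "vsp s V" "vector_space s'" "linear_on s s' V W f" shows "vsp s' (f ` V)"
proof (rule vspI[OF assms(2)])
  show "0 \<in> f ` V" using linear_on_zero[OF assms] vsp_0[OF assms(1)] by (metis image_eqI)
  show "x + y \<in> f ` V" if "x \<in> f ` V" "y \<in> f ` V" for x y
    using that linear_on_add[OF assms(3)] vsp_add[OF assms(1)] by (metis (no_types, lifting) image_iff)
  show "s' c x \<in> f ` V" if "x \<in> f ` V" for c x
    using that linear_on_scale[OF assms(3)] vsp_scale[OF assms(1)] by (metis (no_types, lifting) image_iff)
qed

lemma bilinear_onI:
  "(\<And>x. x \<in> V \<Longrightarrow> linear_on s2 s3 W U (\<lambda>y. f x y)) \<Longrightarrow> (\<And>y. y \<in> W \<Longrightarrow> linear_on s1 s3 V U (\<lambda>x. f x y)) \<Longrightarrow>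
   bilinear_on s1 s2 s3 V W U f"
  unfolding bilinear_on_def by blast

lemma bilinear_onD1: "bilinear_on s1 s2 s3 V W U f \<Longrightarrow> x \<in> V \<Longrightarrow> linear_on s2 s3 W U (f x)"
  unfolding bilinear_on_def by simp

lemma bilinear_onD2: "bilinear_on s1 s2 s3 V W U f \<Longrightarrow> y \<in> W \<Longrightarrow> linear_on s1 s3 V U (\<lambda>x. f x y)"
  unfolding bilinear_on_def by simp

lemma bilinear_on_closed: "bilinear_on s1 s2 s3 V W U f \<Longrightarrow> x \<in> V \<Longrightarrow> y \<in> W \<Longrightarrow> f x y \<in> U"
  unfolding bilinear_on_def linear_on_def by simp

lemma bilinear_on_mono:
  "bilinear_on s1 s2 s3 V W U f \<Longrightarrow> V' \<subseteq> V \<Longrightarrow> W' \<subseteq> W \<Longrightarrow> U \<subseteq> U' \<Longrightarrow> bilinear_on s1 s2 s3 V' W' U' f"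
  unfolding bilinear_on_def by (meson linear_on_mono subsetD)

lemma bilinear_on_UNIV: "bilinear_on s1 s2 s3 V W U f \<Longrightarrow> bilinear_on s1 s2 s3 V W UNIV f"
  by (rule bilinear_on_mono) auto

lemma lin_id: "linear_on s s V V (\<lambda>x. x)"
  unfolding linear_on_def by simp

lemma lin_comp: "linear_on s' s'' W U g \<Longrightarrow> linear_on s s' V W f \<Longrightarrow> linear_on s s'' V U (\<lambda>x. g (f x))"
  unfolding linear_on_def by simp

lemma lin_bil1:
  "bilinear_on s1 s2 s3 V W U m \<Longrightarrow> linear_on s s1 Z V f \<Longrightarrow> y \<in> W \<Longrightarrow> linear_on s s3 Z U (\<lambda>x. m (f x) y)"
  unfolding bilinear_on_def linear_on_def by simp

lemma lin_bil2:
  "bilinear_on s1 s2 s3 V W U m \<Longrightarrow> linear_on s s2 Z W f \<Longrightarrow> y \<in> V \<Longrightarrow> linear_on s s3 Z U (\<lambda>x. m y (f x))"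
  unfolding bilinear_on_def linear_on_def by simp

lemma lin_zero: "vsp s' U \<Longrightarrow> linear_on s s' Z U (\<lambda>x. 0)"
  unfolding linear_on_def by (simp add: vsp_0 vsp_scale_simps vsp_vs)

lemma lin_add: "vsp s' U \<Longrightarrow> linear_on s s' Z U f \<Longrightarrow> linear_on s s' Z U g \<Longrightarrow> linear_on s s' Z U (\<lambda>x. f x + g x)"
  unfolding linear_on_def by (simp add: vsp_add vsp_scale_simps vsp_vs)

lemma lin_diff: "vsp s' U \<Longrightarrow> linear_on s s' Z U f \<Longrightarrow> linear_on s s' Z U g \<Longrightarrow> linear_on s s' Z U (\<lambda>x. f x - g x)"
  unfolding linear_on_def by (simp add: vsp_diff vsp_scale_simps vsp_vs)

lemma lin_scale1: "vsp s' U \<Longrightarrow> linear_on s (*) Z UNIV f \<Longrightarrow> y \<in> U \<Longrightarrow> linear_on s s' Z U (\<lambda>x. s' (f x) y)"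
  unfolding linear_on_def by (simp add: vsp_scale vsp_scale_simps vsp_vs)

lemma lin_scale2: "vsp s' U \<Longrightarrow> linear_on s s' Z U f \<Longrightarrow> linear_on s s' Z U (\<lambda>x. s' c (f x))"
  unfolding linear_on_def by (simp add: vsp_scale vsp_scale_simps vsp_vs mult.commute)

lemma lin_mult1: "linear_on s (*) Z UNIV f \<Longrightarrow> linear_on s (*) Z UNIV (\<lambda>x. f x * y)"
  unfolding linear_on_def by (simp add: algebra_simps)

lemma lin_mult2: "linear_on s (*) Z UNIV f \<Longrightarrow> linear_on s (*) Z UNIV (\<lambda>x. y * f x)"
  unfolding linear_on_def by (simp add: algebra_simps)

lemma lin_sum_list:
  "vsp s' U \<Longrightarrow> (\<And>p. p \<in> set xs \<Longrightarrow> linear_on s s' Z U (\<lambda>x. f x p)) \<Longrightarrow> linear_on s s' Z U (\<lambda>x. \<Sum>p\<leftarrow>xs. f x p)"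
  by (induction xs) (auto intro: lin_add lin_zero)

lemma sum_list_swap: "(\<Sum>x\<leftarrow>xs. \<Sum>y\<leftarrow>ys. f x y) = (\<Sum>y\<leftarrow>ys. \<Sum>x\<leftarrow>xs. f x y :: 'a::ab_group_add)"
  by (induction xs) (auto simp: sum_list_addf)

section \<open>Tensor spaces, lifts of bilinear maps, and slices of tensors\<close>

lemma vs_tensor: "vector_space (tensor_scale :: 'k::field \<Rightarrow> ('k, 'a, 'b) tensor \<Rightarrow> _)"
  by (rule vector_space_tensor_scale)

lemma pure_tensor_bilinear_UNIV:
  "bilinear_on s1 s2 tensor_scale UNIV UNIV UNIV (pure_tensor s1 s2)"
  unfolding bilinear_on_def linear_on_def pure_tensor_def tensor_scale_def by (auto simp: fun_eq_iff)

lemma module_tensor: "module (tensor_scale :: 'k::field \<Rightarrow> ('k, 'a, 'b) tensor \<Rightarrow> _)"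
  using vs_tensor module_iff_vector_space by blast

lemma pure_tensor_in: "x \<in> V \<Longrightarrow> y \<in> W \<Longrightarrow> pure_tensor s1 s2 x y \<in> tensor_space s1 s2 V W"
  unfolding tensor_space_def by (rule module.span_base[OF module_tensor]) blast

lemma tensor_space_vsp: "vsp tensor_scale (tensor_space s1 s2 V W)"
  unfolding tensor_space_def vsp_def
  using module.subspace_span[OF module_tensor] vs_tensor by blast

lemma pure_tensor_bilinear:
  "bilinear_on s1 s2 tensor_scale V W (tensor_space s1 s2 V W) (pure_tensor s1 s2)"
  using pure_tensor_bilinear_UNIV[of s1 s2] unfolding bilinear_on_def linear_on_def
  by (auto intro: pure_tensor_in)

text \<open>The scalars of a linear combination are absorbed into the left factors, so a list of
  pairs without coefficients presents every tensor, as the choice in \<open>tensor_lift\<close>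
  requires.\<close>

lemma tensor_space_ex:
  assumes V: "vsp s1 V" and t: "t \<in> tensor_space s1 s2 V W"
  shows "\<exists>xs. set xs \<subseteq> V \<times> W \<and> (\<Sum>(x, y)\<leftarrow>xs. pure_tensor s1 s2 x y) = t"
proof -
  interpret module "tensor_scale :: 'a \<Rightarrow> ('a,'b,'c) tensor \<Rightarrow> _" by (rule module_tensor)
  show ?thesis using t unfolding tensor_space_def
  proof (induction rule: span_induct_alt)
    case base
    show ?case by (rule exI[of _ "[]"]) simp
  next
    case (step c p t)
    then obtain x y xs where *: "x \<in> V" "y \<in> W" "p = pure_tensor s1 s2 x y" "set xs \<subseteq> V \<times> W"
       "(\<Sum>(x, y)\<leftarrow>xs. pure_tensor s1 s2 x y) = t" by auto
    have "tensor_scale c p = pure_tensor s1 s2 (s1 c x) y"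
      using * linear_on_scale[OF bilinear_onD2[OF pure_tensor_bilinear_UNIV]] by (metis UNIV_I)
    with * show ?case by (intro exI[of _ "(s1 c x, y) # xs"]) (auto simp: vsp_scale[OF V])
  qed
qed

text \<open>Names the list chosen by \<open>tensor_lift\<close>. A lift is then a finite sum over a
  fixed list, and additivity or exchange of such sums holds for every integrand, bilinear or
  not.\<close>

definition tensor_rep ::
  "('k::field \<Rightarrow> 'a::ab_group_add \<Rightarrow> 'a) \<Rightarrow> ('k \<Rightarrow> 'b::ab_group_add \<Rightarrow> 'b) \<Rightarrow>
   'a set \<Rightarrow> 'b set \<Rightarrow> ('k, 'a, 'b) tensor \<Rightarrow> ('a \<times> 'b) list" where
  "tensor_rep s1 s2 V W t =
    (SOME xs. set xs \<subseteq> V \<times> W \<and> (\<Sum>(x, y)\<leftarrow>xs. pure_tensor s1 s2 x y) = t)"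

lemma tensor_lift_rep: "tensor_lift s1 s2 V W \<Phi> t = (\<Sum>(x, y)\<leftarrow>tensor_rep s1 s2 V W t. \<Phi> x y)"
  unfolding tensor_lift_def tensor_rep_def ..

lemma tensor_rep:
  assumes "vsp s1 V" "t \<in> tensor_space s1 s2 V W"
  shows "set (tensor_rep s1 s2 V W t) \<subseteq> V \<times> W"
    "(\<Sum>(x, y)\<leftarrow>tensor_rep s1 s2 V W t. pure_tensor s1 s2 x y) = t"
  using someI_ex[OF tensor_space_ex[OF assms]] unfolding tensor_rep_def by auto

lemma lift_sum:
  assumes "vsp s1 V" "vsp s2 W" "vector_space s3" "bilinear_on s1 s2 s3 V W U \<Phi>" "set xs \<subseteq> V \<times> W"
  shows "tensor_lift s1 s2 V W \<Phi> (\<Sum>(x, y)\<leftarrow>xs. pure_tensor s1 s2 x y) = (\<Sum>(x, y)\<leftarrow>xs. \<Phi> x y)"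
  by (rule tensor_lift_sum) (use assms in \<open>auto simp: vsp_def intro: bilinear_on_UNIV\<close>)

lemma lift_pure:
  assumes "vsp s1 V" "vsp s2 W" "vector_space s3" "bilinear_on s1 s2 s3 V W U \<Phi>" "x \<in> V" "y \<in> W"
  shows "tensor_lift s1 s2 V W \<Phi> (pure_tensor s1 s2 x y) = \<Phi> x y"
  using lift_sum[OF assms(1-4), of "[(x,y)]"] assms by simp

lemma lift_linear:
  assumes V: "vsp s1 V" and W: "vsp s2 W" and U: "vsp s3 U" and b: "bilinear_on s1 s2 s3 V W U \<Phi>"
  shows "linear_on tensor_scale s3 (tensor_space s1 s2 V W) U (tensor_lift s1 s2 V W \<Phi>)"
  unfolding linear_on_def
proof (intro conjI ballI allI)
  note [simp] = lift_sum[OF V W vsp_vs[OF U] b]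
  fix t assume "t \<in> tensor_space s1 s2 V W"
  from tensor_space_ex[OF V this] obtain xs where xs: "set xs \<subseteq> V \<times> W"
    "t = (\<Sum>(x, y)\<leftarrow>xs. pure_tensor s1 s2 x y)" by auto
  show "tensor_lift s1 s2 V W \<Phi> t \<in> U"
    using xs by (auto intro!: vsp_sum_list[OF U] bilinear_on_closed[OF b])
  { fix t' assume "t' \<in> tensor_space s1 s2 V W"
    from tensor_space_ex[OF V this] obtain ys where ys: "set ys \<subseteq> V \<times> W"
      "t' = (\<Sum>(x, y)\<leftarrow>ys. pure_tensor s1 s2 x y)" by auto
    have "t + t' = (\<Sum>(x, y)\<leftarrow>xs@ys. pure_tensor s1 s2 x y)" using xs ys by simp
    then show "tensor_lift s1 s2 V W \<Phi> (t + t') = tensor_lift s1 s2 V W \<Phi> t + tensor_lift s1 s2 V W \<Phi> t'"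
      using xs ys lift_sum[OF V W vsp_vs[OF U] b, of "xs@ys"] by simp }
  fix c
  \<comment> \<open>Scaling the left entries of a presentation of \<open>t\<close> presents the
    scaled tensor, so \<open>lift_sum\<close> evaluates the lift whichever list was chosen.\<close>
  have s: "tensor_scale c t = (\<Sum>(x, y)\<leftarrow>map (\<lambda>(x,y). (s1 c x, y)) xs. pure_tensor s1 s2 x y)"
    unfolding xs(2) scale_sum_list[OF vs_tensor]
    by (simp add: o_def case_prod_unfold linear_on_scale[OF bilinear_onD2[OF pure_tensor_bilinear_UNIV]])
  have xs': "set (map (\<lambda>(x,y). (s1 c x, y)) xs) \<subseteq> V \<times> W" using xs by (auto simp: vsp_scale[OF V])
  have c: "(\<Sum>(x, y)\<leftarrow>xs. \<Phi> (s1 c x) y) = (\<Sum>(x, y)\<leftarrow>xs. s3 c (\<Phi> x y))"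
    using xs(1) by (intro arg_cong[of _ _ sum_list] map_cong) (auto simp: linear_on_scale[OF bilinear_onD2[OF b]])
  have "tensor_lift s1 s2 V W \<Phi> (tensor_scale c t) = (\<Sum>(x, y)\<leftarrow>xs. \<Phi> (s1 c x) y)"
    unfolding s lift_sum[OF V W vsp_vs[OF U] b xs'] by (simp add: o_def case_prod_unfold)
  also have "\<dots> = s3 c (tensor_lift s1 s2 V W \<Phi> t)"
    unfolding c xs(2) lift_sum[OF V W vsp_vs[OF U] b xs(1)] scale_sum_list[OF vsp_vs[OF U]]
    by (simp add: case_prod_unfold)
  finally show "tensor_lift s1 s2 V W \<Phi> (tensor_scale c t) = s3 c (tensor_lift s1 s2 V W \<Phi> t)" .
qed

lemma tensor_space_linear_eq:
  assumes "vsp s1 V" "vector_space s3" "linear_on tensor_scale s3 (tensor_space s1 s2 V W) U f"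
    "linear_on tensor_scale s3 (tensor_space s1 s2 V W) U' g"
    "\<And>x y. x \<in> V \<Longrightarrow> y \<in> W \<Longrightarrow> f (pure_tensor s1 s2 x y) = g (pure_tensor s1 s2 x y)"
    "t \<in> tensor_space s1 s2 V W"
  shows "f t = g t"
proof -
  from tensor_space_ex[OF assms(1,6)] obtain xs where xs: "set xs \<subseteq> V \<times> W"
    "t = (\<Sum>(x, y)\<leftarrow>xs. pure_tensor s1 s2 x y)" by auto
  have t: "t = (\<Sum>p\<leftarrow>xs. pure_tensor s1 s2 (fst p) (snd p))" using xs by (simp add: case_prod_unfold)
  have p: "\<And>p. p \<in> set xs \<Longrightarrow> pure_tensor s1 s2 (fst p) (snd p) \<in> tensor_space s1 s2 V W"
    using xs(1) by (auto simp: subset_iff intro!: pure_tensor_in)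
  have "f t = (\<Sum>p\<leftarrow>xs. f (pure_tensor s1 s2 (fst p) (snd p)))"
    unfolding t by (rule linear_on_sum_list[OF tensor_space_vsp assms(2,3) p])
  also have "\<dots> = (\<Sum>p\<leftarrow>xs. g (pure_tensor s1 s2 (fst p) (snd p)))"
    using xs(1) by (intro arg_cong[of _ _ sum_list] map_cong) (auto simp: subset_iff intro!: assms(5))
  also have "\<dots> = g t"
    unfolding t by (rule linear_on_sum_list[OF tensor_space_vsp assms(2,4) p, symmetric])
  finally show ?thesis .
qed

text \<open>For a subspace \<open>M\<close>, the hypothesis on slices says that the tensor lies in
  \<open>V \<otimes> M\<close>. Expanding the left factors in a basis of \<open>V\<close> makes
  coordinate slices the right factors, and there \<open>\<Phi>\<close> lands in \<open>Z\<close>.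
  The kernel argument uses this in place of quotient spaces.\<close>

lemma slice_in:
  assumes V: "vsp s1 V" and W: "vsp s2 W" and Z: "vsp s3 Z"
    and b: "bilinear_on s1 s2 s3 V W Y \<Phi>" and xs: "set xs \<subseteq> V \<times> W"
    and sl: "\<And>\<chi>. linear_on s1 (*) V UNIV \<chi> \<Longrightarrow> (\<Sum>(u, v)\<leftarrow>xs. s2 (\<chi> u) v) \<in> M"
    and \<Phi>: "\<And>u v. u \<in> V \<Longrightarrow> v \<in> M \<Longrightarrow> v \<in> W \<Longrightarrow> \<Phi> u v \<in> Z"
  shows "(\<Sum>(u, v)\<leftarrow>xs. \<Phi> u v) \<in> Z"
proof -
  interpret v1: vector_space s1 using V by (rule vsp_vs)
  interpret v2: vector_space s2 using W by (rule vsp_vs)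
  interpret v3: vector_space s3 using Z by (rule vsp_vs)
  obtain B where B: "B \<subseteq> V" "v1.independent B" "V \<subseteq> v1.span B" by (rule v1.maximal_independent_subset)
  \<comment> \<open>The finitely many basis vectors that occur in the left factors, so that one
    finite sum serves all pairs.\<close>
  define F where "F = (\<Union>p\<in>set xs. {b. v1.representation B (fst p) b \<noteq> 0})"
  have F: "finite F" "F \<subseteq> V"
    unfolding F_def using B(1) v1.representation_ne_zero by (auto simp: v1.finite_representation)
  have BV: "u \<in> v1.span B" if "u \<in> V" for u using B(3) that by auto
  have \<chi>: "linear_on s1 (*) V UNIV (\<lambda>u. v1.representation B u b)" for b
    unfolding linear_on_def using B(2) BV by (simp add: v1.representation_add v1.representation_scale)
  have rep: "u = (\<Sum>b\<in>F. s1 (v1.representation B u b) b)" if "(u,v) \<in> set xs" for u v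
  proof -
    have u: "u \<in> v1.span B" using that xs by (auto intro!: BV)
    have "{b. v1.representation B u b \<noteq> 0} \<subseteq> F" unfolding F_def using that by force
    then have "(\<Sum>b\<in>F. s1 (v1.representation B u b) b)
      = (\<Sum>b | v1.representation B u b \<noteq> 0. s1 (v1.representation B u b) b)"
      by (intro sum.mono_neutral_right[OF F(1)]) auto
    then show ?thesis using v1.sum_nonzero_representation_eq[OF B(2) u] by simp
  qed
  have lsum: "f (\<Sum>b\<in>A. h b) = (\<Sum>b\<in>A. f (h b))"
    if "linear_on s1 s3 V Y f" "\<And>b. b \<in> A \<Longrightarrow> h b \<in> V" "finite A" for f h and A :: "'b set"
    using that(3,2)
  proof (induction A rule: finite_induct)
    case (insert a A)
    have "sum h A \<in> V" using insert.prems
      by (intro module.subspace_sum[OF vsp_module[OF V] vsp_sub[OF V]]) auto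
    then show ?case using insert by (simp add: linear_on_add[OF that(1)])
  qed (simp add: linear_on_zero[OF V v3.vector_space_axioms that(1)])
  have "(\<Sum>(u, v)\<leftarrow>xs. \<Phi> u v) = (\<Sum>(u, v)\<leftarrow>xs. \<Sum>b\<in>F. \<Phi> b (s2 (v1.representation B u b) v))"
  proof (intro arg_cong[of _ _ sum_list] map_cong refl, clarify)
    fix u v assume uv: "(u,v) \<in> set xs"
    then have in': "u \<in> V" "v \<in> W" using xs by auto
    have "\<Phi> u v = \<Phi> (\<Sum>b\<in>F. s1 (v1.representation B u b) b) v" using rep[OF uv] by simp
    also have "\<dots> = (\<Sum>b\<in>F. \<Phi> (s1 (v1.representation B u b) b) v)"
      using F V in' by (intro lsum[OF bilinear_onD2[OF b]]) (auto intro: vsp_scale)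
    also have "\<dots> = (\<Sum>b\<in>F. \<Phi> b (s2 (v1.representation B u b) v))"
      using F in' by (intro sum.cong refl)
        (auto simp: linear_on_scale[OF bilinear_onD2[OF b]] linear_on_scale[OF bilinear_onD1[OF b]] subset_iff)
    finally show "\<Phi> u v = \<dots>" .
  qed
  also have "\<dots> = (\<Sum>b\<in>F. \<Sum>(u, v)\<leftarrow>xs. \<Phi> b (s2 (v1.representation B u b) v))"
    using F(1) by (induction xs) (auto simp: sum.distrib)
  also have "\<dots> = (\<Sum>b\<in>F. \<Phi> b (\<Sum>(u, v)\<leftarrow>xs. s2 (v1.representation B u b) v))"
  proof (intro sum.cong refl)
    fix b' assume "b' \<in> F"
    then have "b' \<in> V" using F by auto
    let ?h = "\<lambda>p. s2 (v1.representation B (fst p) b') (snd p)"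
    have W': "\<And>p. p \<in> set xs \<Longrightarrow> ?h p \<in> W"
      using xs by (auto simp: subset_iff intro!: vsp_scale[OF W])
    have "\<Phi> b' (\<Sum>p\<leftarrow>xs. ?h p) = (\<Sum>p\<leftarrow>xs. \<Phi> b' (?h p))"
      by (rule linear_on_sum_list[OF W v3.vector_space_axioms bilinear_onD1[OF b \<open>b' \<in> V\<close>] W'])
    then show "(\<Sum>(u, v)\<leftarrow>xs. \<Phi> b' (s2 (v1.representation B u b') v)) = \<Phi> b' (\<Sum>(u, v)\<leftarrow>xs. s2 (v1.representation B u b') v)"
      by (simp add: case_prod_unfold)
  qed
  also have "\<dots> \<in> Z"
  proof (rule module.subspace_sum[OF vsp_module[OF Z] vsp_sub[OF Z]])
    fix b' assume "b' \<in> F"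
    then have "b' \<in> V" using F by auto
    then show "\<Phi> b' (\<Sum>(u, v)\<leftarrow>xs. s2 (v1.representation B u b') v) \<in> Z"
      using sl[OF \<chi>] xs by (intro \<Phi>) (auto simp: subset_iff intro!: vsp_sum_list[OF W] vsp_scale[OF W])
  qed
  finally show ?thesis .
qed

section \<open>Sweedler calculus\<close>

lemma sweedler_sum:
  "sweedler C \<Phi> x =
    (\<Sum>(u, v)\<leftarrow>tensor_rep (scale C) (scale C) (carrier C) (carrier C) (comult C x). \<Phi> u v)"
  unfolding sweedler_def tensor_lift_rep ..

text \<open>Both sides are sums over two fixed lists. This separates the Sweedler factors of
  independent variables.\<close>

lemma sweedler_swap:
  "sweedler C (\<lambda>u v. sweedler D (\<lambda>p q. F u v p q) y) x = sweedler D (\<lambda>p q. sweedler C (\<lambda>u v. F u v p q) x) y"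
  unfolding sweedler_sum case_prod_unfold by (rule sum_list_swap)

lemma lin_sweedler_param:
  assumes "vsp s' U" "\<And>u v. u \<in> carrier C \<Longrightarrow> v \<in> carrier C \<Longrightarrow> linear_on s s' Z U (\<lambda>z. \<Phi> z u v)"
    "set (tensor_rep (scale C) (scale C) (carrier C) (carrier C) (comult C x)) \<subseteq> carrier C \<times> carrier C"
  shows "linear_on s s' Z U (\<lambda>z. sweedler C (\<Phi> z) x)"
  unfolding sweedler_sum case_prod_unfold
  by (rule lin_sum_list[OF assms(1)]) (use assms in \<open>auto simp: subset_iff\<close>)

definition trilinear_on where
  "trilinear_on C s U \<Phi> \<longleftrightarrow>
    (\<forall>v\<in>carrier C. \<forall>w\<in>carrier C. linear_on (scale C) s (carrier C) U (\<lambda>u. \<Phi> u v w)) \<and>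
    (\<forall>u\<in>carrier C. \<forall>w\<in>carrier C. linear_on (scale C) s (carrier C) U (\<lambda>v. \<Phi> u v w)) \<and>
    (\<forall>u\<in>carrier C. \<forall>v\<in>carrier C. linear_on (scale C) s (carrier C) U (\<lambda>w. \<Phi> u v w))"

lemma trilinear_onI:
  assumes "\<And>v w. v \<in> carrier C \<Longrightarrow> w \<in> carrier C \<Longrightarrow> linear_on (scale C) s (carrier C) U (\<lambda>u. \<Phi> u v w)"
    "\<And>u w. u \<in> carrier C \<Longrightarrow> w \<in> carrier C \<Longrightarrow> linear_on (scale C) s (carrier C) U (\<lambda>v. \<Phi> u v w)"
    "\<And>u v. u \<in> carrier C \<Longrightarrow> v \<in> carrier C \<Longrightarrow> linear_on (scale C) s (carrier C) U (\<lambda>w. \<Phi> u v w)"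
  shows "trilinear_on C s U \<Phi>"
  unfolding trilinear_on_def using assms by blast

text \<open>Carries the part of the calculus that rests on linearity of \<open>comult\<close> alone,
  so that it is available for \<open>tens A X\<close> while the coalgebra axioms there are still
  being proved.\<close>

locale comultiplication =
  fixes C :: "('k::field, 'a::ab_group_add) hopf" (structure)
  assumes vector_space: "vector_space (scale C)"
    and subspace: "module.subspace (scale C) (carrier C)"
    and comult_linear:
      "linear_on (scale C) tensor_scale (carrier C)
         (tensor_space (scale C) (scale C) (carrier C) (carrier C)) (comult C)"
begin

abbreviation "bilinear s U \<equiv> bilinear_on (scale C) (scale C) s (carrier C) (carrier C) U"

lemma vspC: "vsp (scale C) (carrier C)"
  unfolding vsp_def using vector_space subspace by blast

abbreviation "cop x \<equiv> tensor_rep (scale C) (scale C) (carrier C) (carrier C) (comult C x)"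

lemma comult_closed: "x \<in> carrier C \<Longrightarrow> comult C x \<in> tensor_space (scale C) (scale C) (carrier C) (carrier C)"
  by (rule linear_on_closed[OF comult_linear])

lemma cop:
  assumes "x \<in> carrier C"
  shows "set (cop x) \<subseteq> carrier C \<times> carrier C" "(\<Sum>(u, v)\<leftarrow>cop x. tensor_of C C u v) = comult C x"
  using tensor_rep[OF vspC comult_closed[OF assms]] by auto

lemma sweedler_cong:
  assumes "x \<in> carrier C" "\<And>u v. u \<in> carrier C \<Longrightarrow> v \<in> carrier C \<Longrightarrow> \<Phi> u v = \<Psi> u v"
  shows "sweedler C \<Phi> x = sweedler C \<Psi> x"
  unfolding sweedler_sum using cop(1)[OF assms(1)] assms(2)
  by (intro arg_cong[of _ _ sum_list] map_cong) auto

lemma sweedler_closed: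
  assumes "x \<in> carrier C" "vsp s U"
    "\<And>u v. u \<in> carrier C \<Longrightarrow> v \<in> carrier C \<Longrightarrow> \<Phi> u v \<in> U"
  shows "sweedler C \<Phi> x \<in> U"
  unfolding sweedler_sum using cop(1)[OF assms(1)] assms(3)
  by (intro vsp_sum_list[OF assms(2)]) auto

lemma sweedler_hom:
  assumes "x \<in> carrier C" "vsp s V" "Vector_Spaces.vector_space s'" "linear_on s s' V W f"
    "\<And>u v. u \<in> carrier C \<Longrightarrow> v \<in> carrier C \<Longrightarrow> \<Phi> u v \<in> V"
  shows "f (sweedler C \<Phi> x) = sweedler C (\<lambda>u v. f (\<Phi> u v)) x"
proof -
  have *: "\<And>p. p \<in> set (cop x) \<Longrightarrow> \<Phi> (fst p) (snd p) \<in> V"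
    using cop(1)[OF assms(1)] assms(5) by (auto simp: subset_iff)
  show ?thesis unfolding sweedler_sum case_prod_unfold by (rule linear_on_sum_list[OF assms(2-4) *])
qed

lemma sweedler_add: "sweedler C (\<lambda>u v. \<Phi> u v + \<Psi> u v) x = sweedler C \<Phi> x + sweedler C \<Psi> x"
  unfolding sweedler_sum case_prod_unfold by (simp add: sum_list_addf)

lemma sweedler_diff: "sweedler C (\<lambda>u v. \<Phi> u v - \<Psi> u v) x = sweedler C \<Phi> x - sweedler C \<Psi> x"
  using sweedler_add[of "\<lambda>u v. \<Phi> u v - \<Psi> u v" \<Psi>] by simp

lemma lin_sweedler_arg:
  assumes U: "vsp s U" and b: "bilinear s U \<Phi>"
  shows "linear_on (scale C) s (carrier C) U (sweedler C \<Phi>)"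
proof -
  have "sweedler C \<Phi> = (\<lambda>x. tensor_lift (scale C) (scale C) (carrier C) (carrier C) \<Phi> (comult C x))"
    unfolding sweedler_def ..
  then show ?thesis using lin_comp[OF lift_linear[OF vspC vspC U b] comult_linear] by simp
qed

lemma lin_sweedler:
  assumes U: "vsp s U" and f: "linear_on s' (scale C) Z (carrier C) f"
    and "\<And>v. v \<in> carrier C \<Longrightarrow> linear_on (scale C) s (carrier C) U (\<lambda>u. \<Phi> u v)"
    and "\<And>u. u \<in> carrier C \<Longrightarrow> linear_on (scale C) s (carrier C) U (\<lambda>v. \<Phi> u v)"
  shows "linear_on s' s Z U (\<lambda>z. sweedler C \<Phi> (f z))"
  using lin_comp[OF lin_sweedler_arg[OF U bilinear_onI] f] assms(3,4) by blast

lemma lin_param: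
  assumes "x \<in> carrier C" "vsp s' U" "\<And>u v. u \<in> carrier C \<Longrightarrow> v \<in> carrier C \<Longrightarrow> linear_on s s' Z U (\<lambda>z. \<Phi> z u v)"
  shows "linear_on s s' Z U (\<lambda>z. sweedler C (\<Phi> z) x)"
  by (rule lin_sweedler_param[OF assms(2,3) cop(1)[OF assms(1)]])

lemma sweedler_comult:
  assumes "x \<in> carrier C" "vsp s U" "bilinear s U \<Phi>" "set xs \<subseteq> carrier C \<times> carrier C"
    "comult C x = (\<Sum>(u, v)\<leftarrow>xs. tensor_of C C u v)"
  shows "sweedler C \<Phi> x = (\<Sum>(u, v)\<leftarrow>xs. \<Phi> u v)"
  unfolding sweedler_def assms(5) by (rule lift_sum[OF vspC vspC vsp_vs[OF assms(2)] assms(3,4)])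

lemma lift_comult: "tensor_lift (scale C) (scale C) (carrier C) (carrier C) \<Phi> (comult C x) = sweedler C \<Phi> x"
  unfolding sweedler_def ..

lemma sweedler_pure: "x \<in> carrier C \<Longrightarrow> sweedler C (\<lambda>u v. tensor_of C C u v) x = comult C x"
  unfolding sweedler_sum by (rule cop(2))

end

text \<open>Coalgebras reuse the \<open>hopf\<close> record, so that one constant
  \<open>sweedler\<close> serves \<open>H\<close>, its images and their tensor products.\<close>

locale cocommutative_coalgebra = comultiplication +
  assumes counit_linear: "linear_on (scale C) (*) (carrier C) UNIV (counit C)"
    and coassoc:
      "x \<in> carrier C \<Longrightarrow>
         sweedler C (\<lambda>u w. sweedler C
           (\<lambda>p q. pure_tensor (scale C) tensor_scale p (tensor_of C C q w)) u) x =
         sweedler C (\<lambda>u w. pure_tensor (scale C) tensor_scale u (comult C w)) x"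
    and counit_left: "x \<in> carrier C \<Longrightarrow> sweedler C (\<lambda>u v. scale C (counit C u) v) x = x"
    and counit_right: "x \<in> carrier C \<Longrightarrow> sweedler C (\<lambda>u v. scale C (counit C v) u) x = x"
    and cocommutative:
      "x \<in> carrier C \<Longrightarrow> sweedler C (\<lambda>u v. tensor_of C C v u) x = comult C x"

sublocale cocommutative_hopf_algebra \<subseteq> coalg: cocommutative_coalgebra H
  by (intro cocommutative_coalgebra.intro comultiplication.intro cocommutative_coalgebra_axioms.intro)
    (fact vector_space subspace comult_linear counit_linear coassoc counit_left counit_right cocommutative)+

context cocommutative_coalgebra
begin

text \<open>The axiom speaks of pure tensors only; applying the lift of \<open>\<Phi>\<close> to it
  transfers it to every bilinear expression.\<close>

lemma cocomm:
  assumes x: "x \<in> carrier C" and U: "vsp s U" and b: "bilinear s U \<Phi>"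
  shows "sweedler C (\<lambda>u v. \<Phi> v u) x = sweedler C \<Phi> x"
proof -
  let ?L = "tensor_lift (scale C) (scale C) (carrier C) (carrier C) \<Phi>"
  have "sweedler C \<Phi> x = ?L (sweedler C (\<lambda>u v. tensor_of C C v u) x)"
    unfolding cocommutative[OF x] lift_comult ..
  also have "\<dots> = sweedler C (\<lambda>u v. ?L (tensor_of C C v u)) x"
    by (rule sweedler_hom[OF x tensor_space_vsp vsp_vs[OF U] lift_linear[OF vspC vspC U b]]) (rule pure_tensor_in)
  also have "\<dots> = sweedler C (\<lambda>u v. \<Phi> v u) x"
    by (intro sweedler_cong[OF x] lift_pure[OF vspC vspC vsp_vs[OF U] b])
  finally show ?thesis ..
qed

lemma trilinear_partial:
  assumes "trilinear_on C s U \<Phi>" "p \<in> carrier C"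
  shows "bilinear s U (\<Phi> p)"
  using assms unfolding trilinear_on_def by (intro bilinear_onI) auto

text \<open>The axiom is an identity in a space of the form
  \<open>V \<otimes> (V \<otimes> V)\<close>. A trilinear \<open>\<Phi>\<close> factors through this
  space in two stages, \<open>L p\<close> for the last two arguments and then \<open>M\<close> for
  the first.\<close>

lemma coassoc3:
  assumes x: "x \<in> carrier C" and U: "vsp s U" and tri: "trilinear_on C s U \<Phi>"
  shows "sweedler C (\<lambda>u w. sweedler C (\<lambda>p q. \<Phi> p q w) u) x = sweedler C (\<lambda>u w. sweedler C (\<lambda>p q. \<Phi> u p q) w) x"
proof -
  let ?TS = "tensor_space (scale C) (scale C) (carrier C) (carrier C)"
  define L where "L = (\<lambda>p. tensor_lift (scale C) (scale C) (carrier C) (carrier C) (\<Phi> p))"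
  note LU = vsp_vs[OF U]
  have L: "linear_on tensor_scale s ?TS U (L p)" if "p \<in> carrier C" for p
    unfolding L_def by (rule lift_linear[OF vspC vspC U trilinear_partial[OF tri that]])
  have L': "linear_on (scale C) s (carrier C) U (\<lambda>p. L p t)" if t: "t \<in> ?TS" for t
    unfolding L_def tensor_lift_rep case_prod_unfold
    using tensor_rep(1)[OF vspC t] tri
    by (intro lin_sum_list[OF U]) (auto simp: trilinear_on_def subset_iff)
  have bL: "bilinear_on (scale C) tensor_scale s (carrier C) ?TS U L"
    by (intro bilinear_onI L L')
  define M where "M = tensor_lift (scale C) tensor_scale (carrier C) ?TS L"
  let ?TT = "tensor_space (scale C) tensor_scale (carrier C) ?TS"
  have M: "linear_on tensor_scale s ?TT U M"
    unfolding M_def by (rule lift_linear[OF vspC tensor_space_vsp U bL])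
  have Mp: "M (pure_tensor (scale C) tensor_scale p t) = L p t" if "p \<in> carrier C" "t \<in> ?TS" for p t
    unfolding M_def by (rule lift_pure[OF vspC tensor_space_vsp LU bL that])
  have Lp: "L p (tensor_of C C q w) = \<Phi> p q w" if "p \<in> carrier C" "q \<in> carrier C" "w \<in> carrier C" for p q w
    unfolding L_def by (rule lift_pure[OF vspC vspC LU trilinear_partial[OF tri that(1)] that(2,3)])
  have "M (sweedler C (\<lambda>u w. sweedler C (\<lambda>p q. pure_tensor (scale C) tensor_scale p (tensor_of C C q w)) u) x)
      = sweedler C (\<lambda>u w. sweedler C (\<lambda>p q. \<Phi> p q w) u) x"
    by (subst sweedler_hom[OF x tensor_space_vsp LU M]
       sweedler_cong[OF x sweedler_hom[OF _ tensor_space_vsp LU M]] |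
       (rule sweedler_closed sweedler_cong) | (rule pure_tensor_in) | (rule x tensor_space_vsp) | assumption | simp add: Mp Lp pure_tensor_in)+
  moreover have "M (sweedler C (\<lambda>u w. pure_tensor (scale C) tensor_scale u (comult C w)) x)
      = sweedler C (\<lambda>u w. sweedler C (\<lambda>p q. \<Phi> u p q) w) x"
    apply (subst sweedler_hom[OF x tensor_space_vsp LU M])
     apply (intro pure_tensor_in comult_closed; assumption)
    apply (rule sweedler_cong[OF x])
    apply (simp add: Mp comult_closed)
    apply (simp add: L_def lift_comult)
    done
  ultimately show ?thesis using coassoc[OF x] by simp
qed

lemma counit_left':
  assumes x: "x \<in> carrier C" and U: "vsp s U" and f: "linear_on (scale C) s (carrier C) U f"
  shows "sweedler C (\<lambda>u v. s (counit C u) (f v)) x = f x"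
proof -
  have "f (sweedler C (\<lambda>u v. scale C (counit C u) v) x) = sweedler C (\<lambda>u v. f (scale C (counit C u) v)) x"
    by (rule sweedler_hom[OF x vspC vsp_vs[OF U] f]) (rule vsp_scale[OF vspC])
  also have "\<dots> = sweedler C (\<lambda>u v. s (counit C u) (f v)) x"
    by (intro sweedler_cong[OF x] linear_on_scale[OF f])
  finally show ?thesis using counit_left[OF x] by simp
qed

lemma counit_right':
  assumes x: "x \<in> carrier C" and U: "vsp s U" and f: "linear_on (scale C) s (carrier C) U f"
  shows "sweedler C (\<lambda>u v. s (counit C v) (f u)) x = f x"
proof -
  have "f (sweedler C (\<lambda>u v. scale C (counit C v) u) x) = sweedler C (\<lambda>u v. f (scale C (counit C v) u)) x"
    by (rule sweedler_hom[OF x vspC vsp_vs[OF U] f]) (rule vsp_scale[OF vspC])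
  also have "\<dots> = sweedler C (\<lambda>u v. s (counit C v) (f u)) x"
    by (intro sweedler_cong[OF x] linear_on_scale[OF f])
  finally show ?thesis using counit_right[OF x] by simp
qed

text \<open>Both claims regroup four Sweedler factors. For \<open>mid4\<close> the two middle ones
  are collected into a single factor by coassociativity, exchanged there by cocommutativity, and
  distributed again.\<close>

lemma interchange:
  assumes x: "x \<in> carrier C" and U: "vsp s U"
    and l1: "\<And>b c d. b \<in> carrier C \<Longrightarrow> c \<in> carrier C \<Longrightarrow> d \<in> carrier C \<Longrightarrow> linear_on (scale C) s (carrier C) U (\<lambda>a. \<Phi> a b c d)"
    and l2: "\<And>a c d. a \<in> carrier C \<Longrightarrow> c \<in> carrier C \<Longrightarrow> d \<in> carrier C \<Longrightarrow> linear_on (scale C) s (carrier C) U (\<lambda>b. \<Phi> a b c d)"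
    and l3: "\<And>a b d. a \<in> carrier C \<Longrightarrow> b \<in> carrier C \<Longrightarrow> d \<in> carrier C \<Longrightarrow> linear_on (scale C) s (carrier C) U (\<lambda>c. \<Phi> a b c d)"
    and l4: "\<And>a b c. a \<in> carrier C \<Longrightarrow> b \<in> carrier C \<Longrightarrow> c \<in> carrier C \<Longrightarrow> linear_on (scale C) s (carrier C) U (\<lambda>d. \<Phi> a b c d)"
  shows coassoc4: "sweedler C (\<lambda>u v. sweedler C (\<lambda>a b. sweedler C (\<lambda>c d. \<Phi> a b c d) v) u) x
      = sweedler C (\<lambda>a v. sweedler C (\<lambda>m d. sweedler C (\<lambda>b c. \<Phi> a b c d) m) v) x" (is "?A = ?B")
    and mid4: "sweedler C (\<lambda>u v. sweedler C (\<lambda>a b. sweedler C (\<lambda>c d. \<Phi> a b c d) v) u) x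
      = sweedler C (\<lambda>u v. sweedler C (\<lambda>a c. sweedler C (\<lambda>b d. \<Phi> a b c d) v) u) x"
proof -
  have A: "sweedler C (\<lambda>u v. sweedler C (\<lambda>a b. sweedler C (\<lambda>c d. F a b c d) v) u) x
      = sweedler C (\<lambda>a v. sweedler C (\<lambda>m d. sweedler C (\<lambda>b c. F a b c d) m) v) x"
    if l: "\<And>b c d. b \<in> carrier C \<Longrightarrow> c \<in> carrier C \<Longrightarrow> d \<in> carrier C \<Longrightarrow> linear_on (scale C) s (carrier C) U (\<lambda>a. F a b c d)"
      "\<And>a c d. a \<in> carrier C \<Longrightarrow> c \<in> carrier C \<Longrightarrow> d \<in> carrier C \<Longrightarrow> linear_on (scale C) s (carrier C) U (\<lambda>b. F a b c d)"
      "\<And>a b d. a \<in> carrier C \<Longrightarrow> b \<in> carrier C \<Longrightarrow> d \<in> carrier C \<Longrightarrow> linear_on (scale C) s (carrier C) U (\<lambda>c. F a b c d)"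
      "\<And>a b c. a \<in> carrier C \<Longrightarrow> b \<in> carrier C \<Longrightarrow> c \<in> carrier C \<Longrightarrow> linear_on (scale C) s (carrier C) U (\<lambda>d. F a b c d)"
    for F
  proof -
    have "sweedler C (\<lambda>u v. sweedler C (\<lambda>a b. sweedler C (\<lambda>c d. F a b c d) v) u) x
       = sweedler C (\<lambda>a v. sweedler C (\<lambda>b w. sweedler C (\<lambda>c d. F a b c d) w) v) x"
      by (rule coassoc3[OF x U, of "\<lambda>a b v. sweedler C (\<lambda>c d. F a b c d) v"])
        (intro trilinear_onI lin_param[OF _ U] lin_sweedler[OF U lin_id] l; assumption)
    also have "\<dots> = sweedler C (\<lambda>a v. sweedler C (\<lambda>m d. sweedler C (\<lambda>b c. F a b c d) m) v) x"
      by (rule sweedler_cong[OF x], rule coassoc3[OF _ U, symmetric], assumption)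
        (intro trilinear_onI l; assumption)
    finally show ?thesis .
  qed
  show "?A = ?B" by (rule A[OF l1 l2 l3 l4])
  also have "\<dots> = sweedler C (\<lambda>a v. sweedler C (\<lambda>m d. sweedler C (\<lambda>c b. \<Phi> a b c d) m) v) x"
    by (intro sweedler_cong[OF x] sweedler_cong cocomm[OF _ U] bilinear_onI l2 l3; assumption)
  also have "\<dots> = sweedler C (\<lambda>u v. sweedler C (\<lambda>a c. sweedler C (\<lambda>b d. \<Phi> a b c d) v) u) x"
    by (rule A[symmetric]; rule l1 l2 l3 l4)
  finally show "?A = sweedler C (\<lambda>u v. sweedler C (\<lambda>a c. sweedler C (\<lambda>b d. \<Phi> a b c d) v) u) x" .
qed

end

lemmas lin_pure1 = lin_bil1[OF pure_tensor_bilinear]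
lemmas lin_pure2 = lin_bil2[OF pure_tensor_bilinear]

lemma coalgebra_map_linear: "coalgebra_map C G f \<Longrightarrow> linear_on (scale C) (scale G) (carrier C) (carrier G) f"
  unfolding coalgebra_map_def by blast

lemma coalgebra_map_closed: "coalgebra_map C G f \<Longrightarrow> x \<in> carrier C \<Longrightarrow> f x \<in> carrier G"
  using coalgebra_map_linear linear_on_closed by metis

lemma coalgebra_map_comult:
  "coalgebra_map C G f \<Longrightarrow> x \<in> carrier C \<Longrightarrow> comult G (f x) = sweedler C (\<lambda>u v. tensor_of G G (f u) (f v)) x"
  unfolding coalgebra_map_def by blast

lemma coalgebra_map_counit: "coalgebra_map C G f \<Longrightarrow> x \<in> carrier C \<Longrightarrow> counit G (f x) = counit C x"
  unfolding coalgebra_map_def by blast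

text \<open>Change of variables: \<open>f\<close> turns the Sweedler factors of \<open>x\<close>
  into those of \<open>f x\<close>. Formulas about elements of an image are pulled back to the
  source in this way.\<close>

lemma sweedler_map:
  assumes C: "comultiplication C" and G: "vsp (scale G) (carrier G)" and f: "coalgebra_map C G f"
    and x: "x \<in> carrier C" and U: "vsp s U"
    and b: "bilinear_on (scale G) (scale G) s (carrier G) (carrier G) U \<Phi>"
  shows "sweedler G \<Phi> (f x) = sweedler C (\<lambda>u v. \<Phi> (f u) (f v)) x"
proof -
  interpret C: comultiplication C by fact
  let ?L = "tensor_lift (scale G) (scale G) (carrier G) (carrier G) \<Phi>"
  have "sweedler G \<Phi> (f x) = ?L (sweedler C (\<lambda>u v. tensor_of G G (f u) (f v)) x)"
    unfolding sweedler_def[of G] coalgebra_map_comult[OF f x] ..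
  also have "\<dots> = sweedler C (\<lambda>u v. ?L (tensor_of G G (f u) (f v))) x"
    by (rule C.sweedler_hom[OF x tensor_space_vsp vsp_vs[OF U] lift_linear[OF G G U b]])
      (intro pure_tensor_in coalgebra_map_closed[OF f])
  also have "\<dots> = sweedler C (\<lambda>u v. \<Phi> (f u) (f v)) x"
    by (intro C.sweedler_cong[OF x] lift_pure[OF G G vsp_vs[OF U] b] coalgebra_map_closed[OF f])
  finally show ?thesis .
qed

lemma coalgebra_map_comp:
  assumes C: "comultiplication C" and G: "vsp (scale G) (carrier G)" and K: "vsp (scale K) (carrier K)"
    and f: "coalgebra_map C G f" and g: "coalgebra_map G K g"
  shows "coalgebra_map C K (\<lambda>x. g (f x))"
  unfolding coalgebra_map_def
proof (intro conjI ballI)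
  show "linear_on (scale C) (scale K) (carrier C) (carrier K) (\<lambda>x. g (f x))"
    by (rule lin_comp[OF coalgebra_map_linear[OF g] coalgebra_map_linear[OF f]])
  fix x assume x: "x \<in> carrier C"
  show "counit K (g (f x)) = counit C x"
    using coalgebra_map_counit[OF g] coalgebra_map_counit[OF f] coalgebra_map_closed[OF f x] x by simp
  have "comult K (g (f x)) = sweedler G (\<lambda>u v. tensor_of K K (g u) (g v)) (f x)"
    by (rule coalgebra_map_comult[OF g coalgebra_map_closed[OF f x]])
  also have "\<dots> = sweedler C (\<lambda>u v. tensor_of K K (g (f u)) (g (f v))) x"
    by (rule sweedler_map[OF C G f x tensor_space_vsp[of "scale K" "scale K" "carrier K" "carrier K"]])
      (intro bilinear_onI lin_pure1 lin_pure2 coalgebra_map_linear[OF g] coalgebra_map_closed[OF g])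
  finally show "comult K (g (f x)) = sweedler C (\<lambda>u v. tensor_of K K (g (f u)) (g (f v))) x" .
qed

section \<open>Tensor products and generalized points of coalgebras\<close>

text \<open>Carrier, scaling, comultiplication and counit are those of
  \<open>double_cross_bialgebra\<close>, so the coalgebra part of a double cross product is this
  coalgebra whatever the actions are.\<close>

definition tens ::
  "('k::field, 'a::ab_group_add) hopf \<Rightarrow> ('k, 'b::ab_group_add) hopf \<Rightarrow> ('k, ('k, 'a, 'b) tensor) hopf" where
  "tens A X =
     \<lparr>carrier = tensor_space (scale A) (scale X) (carrier A) (carrier X),
      scale = tensor_scale, mult = undefined, one = undefined,
      comult = lift_of A X (\<lambda>a x. sweedler A (\<lambda>a1 a2. sweedler X (\<lambda>x1 x2.
        pure_tensor tensor_scale tensor_scale (tensor_of A X a1 x1) (tensor_of A X a2 x2)) x) a),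
      counit = lift_of A X (\<lambda>a x. counit A a * counit X x),
      antipode = undefined\<rparr>"

lemma tens_simps [simp]:
  "carrier (tens A X) = tensor_space (scale A) (scale X) (carrier A) (carrier X)"
  "scale (tens A X) = tensor_scale"
  unfolding tens_def by simp_all

locale coalgebra_pair = A: cocommutative_coalgebra A + X: cocommutative_coalgebra X
  for A :: "('k::field, 'a::ab_group_add) hopf" and X :: "('k, 'b::ab_group_add) hopf"
begin

abbreviation "TS \<equiv> tensor_space (scale A) (scale X) (carrier A) (carrier X)"
abbreviation "pt \<equiv> tensor_of A X"

lemma pt_in: "a \<in> carrier A \<Longrightarrow> x \<in> carrier X \<Longrightarrow> pt a x \<in> TS"
  by (rule pure_tensor_in)

lemma bilinear_sw_sw:
  assumes U: "vsp s U" and b: "bilinear_on tensor_scale tensor_scale s TS TS U \<Omega>"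
  shows "bilinear_on (scale A) (scale X) s (carrier A) (carrier X) U
    (\<lambda>a x. sweedler A (\<lambda>a1 a2. sweedler X (\<lambda>x1 x2. \<Omega> (pt a1 x1) (pt a2 x2)) x) a)"
  by (intro bilinear_onI A.lin_sweedler[OF U lin_id] X.lin_sweedler[OF U lin_id]
     X.lin_param[OF _ U] A.lin_param[OF _ U] lin_bil1[OF b] lin_bil2[OF b] lin_pure1 lin_pure2 lin_id pt_in; assumption)

lemma comult_bilinear:
  "bilinear_on (scale A) (scale X) tensor_scale (carrier A) (carrier X) (tensor_space tensor_scale tensor_scale TS TS)
    (\<lambda>a x. sweedler A (\<lambda>a1 a2. sweedler X (\<lambda>x1 x2.
        pure_tensor tensor_scale tensor_scale (pt a1 x1) (pt a2 x2)) x) a)"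
  by (rule bilinear_sw_sw[OF tensor_space_vsp pure_tensor_bilinear])

lemma tens_comult_pure:
  "a \<in> carrier A \<Longrightarrow> x \<in> carrier X \<Longrightarrow> comult (tens A X) (pt a x) = sweedler A (\<lambda>a1 a2. sweedler X (\<lambda>x1 x2.
        pure_tensor tensor_scale tensor_scale (pt a1 x1) (pt a2 x2)) x) a"
  unfolding tens_def by (simp add: lift_pure[OF A.vspC X.vspC vs_tensor comult_bilinear])

lemma counit_bilinear: "bilinear_on (scale A) (scale X) (*) (carrier A) (carrier X) UNIV (\<lambda>a x. counit A a * counit X x)"
  by (intro bilinear_onI lin_mult1 lin_mult2 A.counit_linear X.counit_linear)

lemma tens_counit_pure:
  "a \<in> carrier A \<Longrightarrow> x \<in> carrier X \<Longrightarrow> counit (tens A X) (pt a x) = counit A a * counit X x"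
  unfolding tens_def by (simp add: lift_pure[OF A.vspC X.vspC vs_field counit_bilinear])

lemma tens_comultiplication: "comultiplication (tens A X)"
  by (rule comultiplication.intro)
    (use tensor_space_vsp vs_tensor lift_linear[OF A.vspC X.vspC tensor_space_vsp comult_bilinear]
     in \<open>auto simp: vsp_def tens_def\<close>)

sublocale T: comultiplication "tens A X"
  by (rule tens_comultiplication)

lemma sweedler_tens:
  assumes a: "a \<in> carrier A" and x: "x \<in> carrier X" and U: "vsp s U"
    and b: "bilinear_on tensor_scale tensor_scale s TS TS U \<Omega>"
  shows "sweedler (tens A X) \<Omega> (pt a x) = sweedler A (\<lambda>a1 a2. sweedler X (\<lambda>x1 x2. \<Omega> (pt a1 x1) (pt a2 x2)) x) a"
proof -
  let ?P = "pure_tensor tensor_scale tensor_scale :: ('k, 'a, 'b) tensor \<Rightarrow> ('k, 'a, 'b) tensor \<Rightarrow> _"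
  let ?L = "tensor_lift tensor_scale tensor_scale TS TS \<Omega>"
  note L = lift_linear[OF tensor_space_vsp tensor_space_vsp U b]
  have P: "?P (pt a1 x1) (pt a2 x2) \<in> tensor_space tensor_scale tensor_scale TS TS"
    if "a1 \<in> carrier A" "x1 \<in> carrier X" "a2 \<in> carrier A" "x2 \<in> carrier X" for a1 a2 x1 x2
    using that by (intro pure_tensor_in)
  have "sweedler (tens A X) \<Omega> (pt a x) = ?L (comult (tens A X) (pt a x))"
    unfolding sweedler_def by simp
  also have "\<dots> = sweedler A (\<lambda>a1 a2. ?L (sweedler X (\<lambda>x1 x2. ?P (pt a1 x1) (pt a2 x2)) x)) a"
    unfolding tens_comult_pure[OF a x]
    by (rule A.sweedler_hom[OF a tensor_space_vsp vsp_vs[OF U] L]) (intro X.sweedler_closed[OF x tensor_space_vsp] P)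
  also have "\<dots> = sweedler A (\<lambda>a1 a2. sweedler X (\<lambda>x1 x2. ?L (?P (pt a1 x1) (pt a2 x2))) x) a"
    by (intro A.sweedler_cong[OF a] X.sweedler_hom[OF x tensor_space_vsp vsp_vs[OF U] L] P)
  also have "\<dots> = sweedler A (\<lambda>a1 a2. sweedler X (\<lambda>x1 x2. \<Omega> (pt a1 x1) (pt a2 x2)) x) a"
    by (intro A.sweedler_cong[OF a] X.sweedler_cong[OF x] lift_pure[OF tensor_space_vsp tensor_space_vsp vsp_vs[OF U] b] pt_in)
  finally show ?thesis .
qed

lemma tens_eqI:
  assumes "vector_space s" "linear_on tensor_scale s TS U f" "linear_on tensor_scale s TS U' g"
    "\<And>a x. a \<in> carrier A \<Longrightarrow> x \<in> carrier X \<Longrightarrow> f (pt a x) = g (pt a x)" "t \<in> TS"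
  shows "f t = g t"
  by (rule tensor_space_linear_eq[OF A.vspC assms(1-5)])

lemma T_lin_sweedler:
  "vsp s U \<Longrightarrow> bilinear_on tensor_scale tensor_scale s TS TS U \<Omega> \<Longrightarrow> linear_on tensor_scale s TS U (sweedler (tens A X) \<Omega>)"
  using T.lin_sweedler_arg[of s U \<Omega>] by simp

lemma T_lin_param:
  "t \<in> TS \<Longrightarrow> vsp s' U \<Longrightarrow> (\<And>u v. u \<in> TS \<Longrightarrow> v \<in> TS \<Longrightarrow> linear_on s s' Z U (\<lambda>z. \<Phi> z u v)) \<Longrightarrow>
  linear_on s s' Z U (\<lambda>z. sweedler (tens A X) (\<Phi> z) t)"
  by (rule T.lin_param) simp_all

lemma pt_scale: "tensor_scale (c * d) (pt a x) = pt (scale A c a) (scale X d x)"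
proof -
  note b = pure_tensor_bilinear_UNIV[of "scale A" "scale X"]
  have "pt (scale A c a) (scale X d x) = tensor_scale c (pt a (scale X d x))"
    by (rule linear_on_scale[OF bilinear_onD2[OF b]]) auto
  also have "pt a (scale X d x) = tensor_scale d (pt a x)"
    by (rule linear_on_scale[OF bilinear_onD1[OF b]]) auto
  finally show ?thesis by (simp add: tensor_scale_def fun_eq_iff algebra_simps)
qed

lemma bilinear_P: "bilinear_on tensor_scale tensor_scale tensor_scale TS TS (tensor_space tensor_scale tensor_scale TS TS)
  (pure_tensor tensor_scale tensor_scale)"
  by (rule pure_tensor_bilinear)

lemma bilinear_counit_scale:
  "bilinear_on tensor_scale tensor_scale tensor_scale TS TS TS (\<lambda>u v. tensor_scale (counit (tens A X) u) v)"
  "bilinear_on tensor_scale tensor_scale tensor_scale TS TS TS (\<lambda>u v. tensor_scale (counit (tens A X) v) u)"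
proof -
  have "linear_on tensor_scale (*) TS UNIV (counit (tens A X))"
    using lift_linear[OF A.vspC X.vspC vsp_UNIV[OF vs_field] counit_bilinear] by (simp add: tens_def)
  note l = lin_scale1[OF tensor_space_vsp this] lin_scale2[OF tensor_space_vsp lin_id]
  show "bilinear_on tensor_scale tensor_scale tensor_scale TS TS TS (\<lambda>u v. tensor_scale (counit (tens A X) u) v)"
    "bilinear_on tensor_scale tensor_scale tensor_scale TS TS TS (\<lambda>u v. tensor_scale (counit (tens A X) v) u)"
    by (intro bilinear_onI l; assumption)+
qed

text \<open>Each axiom is an equation between linear maps on the tensor space, so pure tensors
  suffice. There the sums over \<open>A\<close> and over \<open>X\<close> are separated and the same
  axiom is applied in each factor.\<close>

lemma coalgebra: "cocommutative_coalgebra (tens A X)"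
proof (intro cocommutative_coalgebra.intro tens_comultiplication cocommutative_coalgebra_axioms.intro)
  let ?P = "pure_tensor tensor_scale tensor_scale :: ('k, 'a, 'b) tensor \<Rightarrow> ('k, 'a, 'b) tensor \<Rightarrow> _"
  let ?Q = "pure_tensor tensor_scale tensor_scale :: ('k, 'a, 'b) tensor \<Rightarrow> ('k, ('k, 'a, 'b) tensor, ('k, 'a, 'b) tensor) tensor \<Rightarrow> _"
  let ?TT = "tensor_space tensor_scale tensor_scale TS TS :: ('k, ('k, 'a, 'b) tensor, ('k, 'a, 'b) tensor) tensor set"
  let ?TTT = "tensor_space tensor_scale tensor_scale TS ?TT :: ('k, ('k, 'a, 'b) tensor, ('k, ('k, 'a, 'b) tensor, ('k, 'a, 'b) tensor) tensor) tensor set"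
  have Qb: "bilinear_on tensor_scale tensor_scale tensor_scale TS ?TT ?TTT ?Q" by (rule pure_tensor_bilinear)
  have comult: "linear_on tensor_scale tensor_scale TS ?TT (comult (tens A X))"
    using T.comult_linear by simp
  have P_in: "?P u v \<in> ?TT" if "u \<in> TS" "v \<in> TS" for u v using that by (rule pure_tensor_in)
  note vTTT = tensor_space_vsp[of tensor_scale tensor_scale TS ?TT]
  note vTT = tensor_space_vsp[of tensor_scale tensor_scale TS TS]
  note vTS = tensor_space_vsp[of "scale A" "scale X" "carrier A" "carrier X"]
  show "linear_on (scale (tens A X)) (*) (carrier (tens A X)) UNIV (counit (tens A X))"
    using lift_linear[OF A.vspC X.vspC vsp_UNIV[OF vs_field] counit_bilinear] by (simp add: tens_def)
  fix t assume "t \<in> carrier (tens A X)"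
  then have t: "t \<in> TS" by simp
  have ca: "sweedler (tens A X) (\<lambda>u w. sweedler (tens A X) (\<lambda>p q. ?Q p (?P q w)) u) t =
         sweedler (tens A X) (\<lambda>u w. ?Q u (comult (tens A X) w)) t"
  proof (rule tens_eqI[where f = "sweedler (tens A X) (\<lambda>u w. sweedler (tens A X) (\<lambda>p q. ?Q p (?P q w)) u)"
      and g = "sweedler (tens A X) (\<lambda>u w. ?Q u (comult (tens A X) w))", OF vs_tensor _ _ _ t])
    have bin: "bilinear_on tensor_scale tensor_scale tensor_scale TS TS ?TTT (\<lambda>p q. ?Q p (?P q w))" if "w \<in> TS" for w
      by (intro bilinear_onI lin_bil1[OF Qb] lin_bil2[OF Qb] lin_bil1[OF bilinear_P] lin_id P_in that; assumption)
    have b1: "bilinear_on tensor_scale tensor_scale tensor_scale TS TS ?TTT (\<lambda>u w. sweedler (tens A X) (\<lambda>p q. ?Q p (?P q w)) u)"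
    proof (rule bilinear_onI)
      show "linear_on tensor_scale tensor_scale TS ?TTT (\<lambda>w. sweedler (tens A X) (\<lambda>p q. ?Q p (?P q w)) u)" if "u \<in> TS" for u
        by (intro T_lin_param[OF that vTTT] lin_bil2[OF Qb] lin_bil2[OF bilinear_P] lin_id; assumption)
      show "linear_on tensor_scale tensor_scale TS ?TTT (\<lambda>u. sweedler (tens A X) (\<lambda>p q. ?Q p (?P q w)) u)" if "w \<in> TS" for w
        by (rule T_lin_sweedler[OF vTTT bin[OF that]])
    qed
    have b2: "bilinear_on tensor_scale tensor_scale tensor_scale TS TS ?TTT (\<lambda>u w. ?Q u (comult (tens A X) w))"
      by (intro bilinear_onI lin_bil1[OF Qb] lin_bil2[OF Qb] comult lin_id linear_on_closed[OF comult]; assumption)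
    show "linear_on tensor_scale tensor_scale TS ?TTT (sweedler (tens A X) (\<lambda>u w. sweedler (tens A X) (\<lambda>p q. ?Q p (?P q w)) u))"
      by (rule T_lin_sweedler[OF vTTT b1])
    show "linear_on tensor_scale tensor_scale TS ?TTT (sweedler (tens A X) (\<lambda>u w. ?Q u (comult (tens A X) w)))"
      by (rule T_lin_sweedler[OF vTTT b2])
    fix a x assume a: "a \<in> carrier A" and x: "x \<in> carrier X"
    let ?F = "\<lambda>a1 a2 a3 x1 x2 x3. ?Q (pt a1 x1) (?P (pt a2 x2) (pt a3 x3))"
    have lF: "linear_on (scale A) tensor_scale (carrier A) ?TTT (\<lambda>a1. ?F a1 a2 a3 x1 x2 x3)"
         "linear_on (scale A) tensor_scale (carrier A) ?TTT (\<lambda>a2. ?F a1 a2 a3 x1 x2 x3)"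
         "linear_on (scale A) tensor_scale (carrier A) ?TTT (\<lambda>a3. ?F a1 a2 a3 x1 x2 x3)"
         "linear_on (scale X) tensor_scale (carrier X) ?TTT (\<lambda>x1. ?F a1 a2 a3 x1 x2 x3)"
         "linear_on (scale X) tensor_scale (carrier X) ?TTT (\<lambda>x2. ?F a1 a2 a3 x1 x2 x3)"
         "linear_on (scale X) tensor_scale (carrier X) ?TTT (\<lambda>x3. ?F a1 a2 a3 x1 x2 x3)"
      if "a1 \<in> carrier A" "a2 \<in> carrier A" "a3 \<in> carrier A" "x1 \<in> carrier X" "x2 \<in> carrier X" "x3 \<in> carrier X"
      for a1 a2 a3 x1 x2 x3
      by (intro lin_bil1[OF Qb] lin_bil2[OF Qb] lin_bil1[OF bilinear_P] lin_bil2[OF bilinear_P] lin_pure1 lin_pure2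
         lin_id P_in pt_in that)+
    have "sweedler (tens A X) (\<lambda>u w. sweedler (tens A X) (\<lambda>p q. ?Q p (?P q w)) u) (pt a x)
        = sweedler A (\<lambda>a' a3. sweedler X (\<lambda>x' x3. sweedler (tens A X) (\<lambda>p q. ?Q p (?P q (pt a3 x3))) (pt a' x')) x) a"
      by (rule sweedler_tens[OF a x vTTT b1])
    also have "\<dots> = sweedler A (\<lambda>a' a3. sweedler X (\<lambda>x' x3.
        sweedler A (\<lambda>a1 a2. sweedler X (\<lambda>x1 x2. ?F a1 a2 a3 x1 x2 x3) x') a') x) a"
      by (intro A.sweedler_cong[OF a] X.sweedler_cong[OF x] sweedler_tens[OF _ _ vTTT bin] pt_in)
    also have "\<dots> = sweedler A (\<lambda>a' a3. sweedler A (\<lambda>a1 a2. sweedler X (\<lambda>x' x3.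
        sweedler X (\<lambda>x1 x2. ?F a1 a2 a3 x1 x2 x3) x') x) a') a"
      by (intro A.sweedler_cong[OF a] sweedler_swap)
    also have "\<dots> = sweedler A (\<lambda>a1 a'. sweedler A (\<lambda>a2 a3. sweedler X (\<lambda>x' x3.
        sweedler X (\<lambda>x1 x2. ?F a1 a2 a3 x1 x2 x3) x') x) a') a"
      by (rule A.coassoc3[OF a vTTT])
        (intro trilinear_onI X.lin_param[OF x vTTT] X.lin_param[OF _ vTTT] lF; assumption)
    also have "\<dots> = sweedler A (\<lambda>a1 a'. sweedler A (\<lambda>a2 a3. sweedler X (\<lambda>x1 x'.
        sweedler X (\<lambda>x2 x3. ?F a1 a2 a3 x1 x2 x3) x') x) a') a"
      by (intro A.sweedler_cong[OF a] A.sweedler_cong X.coassoc3[OF x vTTT] trilinear_onI lF; assumption)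
    also have "\<dots> = sweedler A (\<lambda>a1 a'. sweedler X (\<lambda>x1 x'. sweedler A (\<lambda>a2 a3.
        sweedler X (\<lambda>x2 x3. ?F a1 a2 a3 x1 x2 x3) x') a') x) a"
      by (intro A.sweedler_cong[OF a] sweedler_swap)
    also have "\<dots> = sweedler A (\<lambda>a1 a'. sweedler X (\<lambda>x1 x'. ?Q (pt a1 x1) (comult (tens A X) (pt a' x'))) x) a"
    proof (intro A.sweedler_cong[OF a] X.sweedler_cong[OF x])
      fix a1 a' x1 x' assume *: "a1 \<in> carrier A" "a' \<in> carrier A" "x1 \<in> carrier X" "x' \<in> carrier X"
      have l: "linear_on tensor_scale tensor_scale ?TT ?TTT (?Q (pt a1 x1))"
        by (rule bilinear_onD1[OF Qb pt_in[OF *(1,3)]])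
      have "?Q (pt a1 x1) (comult (tens A X) (pt a' x')) = sweedler A (\<lambda>a2 a3.
          ?Q (pt a1 x1) (sweedler X (\<lambda>x2 x3. ?P (pt a2 x2) (pt a3 x3)) x')) a'"
        unfolding tens_comult_pure[OF *(2,4)]
        by (rule A.sweedler_hom[OF *(2) vTT vs_tensor l]) (intro X.sweedler_closed[OF *(4) vTT] P_in pt_in)
      also have "\<dots> = sweedler A (\<lambda>a2 a3. sweedler X (\<lambda>x2 x3. ?F a1 a2 a3 x1 x2 x3) x') a'"
        by (intro A.sweedler_cong[OF *(2)] X.sweedler_hom[OF *(4) vTT vs_tensor l] P_in pt_in)
      finally show "sweedler A (\<lambda>a2 a3. sweedler X (\<lambda>x2 x3. ?F a1 a2 a3 x1 x2 x3) x') a'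
        = ?Q (pt a1 x1) (comult (tens A X) (pt a' x'))" ..
    qed
    also have "\<dots> = sweedler (tens A X) (\<lambda>u w. ?Q u (comult (tens A X) w)) (pt a x)"
      by (rule sweedler_tens[OF a x vTTT b2, symmetric])
    finally show "sweedler (tens A X) (\<lambda>u w. sweedler (tens A X) (\<lambda>p q. ?Q p (?P q w)) u) (pt a x)
      = sweedler (tens A X) (\<lambda>u w. ?Q u (comult (tens A X) w)) (pt a x)" .
  qed
  then show "sweedler (tens A X) (\<lambda>u w. sweedler (tens A X)
           (\<lambda>p q. pure_tensor (scale (tens A X)) tensor_scale p (tensor_of (tens A X) (tens A X) q w)) u) t =
         sweedler (tens A X) (\<lambda>u w. pure_tensor (scale (tens A X)) tensor_scale u (comult (tens A X) w)) t"
    by simp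
  have "sweedler (tens A X) (\<lambda>u v. tensor_scale (counit (tens A X) u) v) t = t"
  proof (rule tens_eqI[where g = "\<lambda>t. t", OF vs_tensor T_lin_sweedler[OF vTS bilinear_counit_scale(1)] lin_id _ t])
    fix a x assume a: "a \<in> carrier A" and x: "x \<in> carrier X"
    have "sweedler (tens A X) (\<lambda>u v. tensor_scale (counit (tens A X) u) v) (pt a x)
       = sweedler A (\<lambda>a1 a2. sweedler X (\<lambda>x1 x2. tensor_scale (counit (tens A X) (pt a1 x1)) (pt a2 x2)) x) a"
      by (rule sweedler_tens[OF a x vTS bilinear_counit_scale(1)])
    also have "\<dots> = sweedler A (\<lambda>a1 a2. sweedler X (\<lambda>x1 x2. pt (scale A (counit A a1) a2) (scale X (counit X x1) x2)) x) a"
      by (intro A.sweedler_cong[OF a] X.sweedler_cong[OF x]) (simp add: tens_counit_pure pt_scale)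
    also have "\<dots> = sweedler A (\<lambda>a1 a2. pt (scale A (counit A a1) a2) x) a"
    proof (rule A.sweedler_cong[OF a])
      fix a1 a2 assume *: "a1 \<in> carrier A" "a2 \<in> carrier A"
      have "pt (scale A (counit A a1) a2) (sweedler X (\<lambda>x1 x2. scale X (counit X x1) x2) x)
        = sweedler X (\<lambda>x1 x2. pt (scale A (counit A a1) a2) (scale X (counit X x1) x2)) x"
        by (rule X.sweedler_hom[OF x X.vspC vs_tensor lin_pure2[OF lin_id vsp_scale[OF A.vspC *(2)]]]) (rule vsp_scale[OF X.vspC])
      then show "sweedler X (\<lambda>x1 x2. pt (scale A (counit A a1) a2) (scale X (counit X x1) x2)) x = pt (scale A (counit A a1) a2) x"
        using X.counit_left[OF x] by simp
    qed
    also have "\<dots> = pt (sweedler A (\<lambda>a1 a2. scale A (counit A a1) a2) a) x"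
      by (rule A.sweedler_hom[OF a A.vspC vs_tensor lin_pure1[OF lin_id x], symmetric]) (intro vsp_scale[OF A.vspC])
    finally show "sweedler (tens A X) (\<lambda>u v. tensor_scale (counit (tens A X) u) v) (pt a x) = pt a x"
      using A.counit_left[OF a] by simp
  qed
  then show "sweedler (tens A X) (\<lambda>u v. scale (tens A X) (counit (tens A X) u) v) t = t" by simp
  have cc: "sweedler (tens A X) (\<lambda>u v. ?P v u) t = comult (tens A X) t"
  proof (rule tens_eqI[where f = "sweedler (tens A X) (\<lambda>u v. ?P v u)", OF vs_tensor _ comult _ t])
    have b: "bilinear_on tensor_scale tensor_scale tensor_scale TS TS ?TT (\<lambda>u v. ?P v u)"
      by (intro bilinear_onI lin_bil1[OF bilinear_P] lin_bil2[OF bilinear_P] lin_id)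
    show "linear_on tensor_scale tensor_scale TS ?TT (sweedler (tens A X) (\<lambda>u v. ?P v u))"
      by (rule T_lin_sweedler[OF vTT b])
    fix a x assume a: "a \<in> carrier A" and x: "x \<in> carrier X"
    have "sweedler (tens A X) (\<lambda>u v. ?P v u) (pt a x) = sweedler A (\<lambda>a1 a2. sweedler X (\<lambda>x1 x2. ?P (pt a2 x2) (pt a1 x1)) x) a"
      by (rule sweedler_tens[OF a x vTT b])
    also have "\<dots> = sweedler A (\<lambda>a1 a2. sweedler X (\<lambda>x1 x2. ?P (pt a2 x1) (pt a1 x2)) x) a"
      by (intro A.sweedler_cong[OF a] X.cocomm[OF x vTT, where \<Phi> = "\<lambda>x1 x2. ?P (pt _ x1) (pt _ x2)"] bilinear_onI lin_bil1[OF bilinear_P] lin_bil2[OF bilinear_P]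
        lin_pure2 lin_id pt_in; assumption)
    also have "\<dots> = sweedler A (\<lambda>a1 a2. sweedler X (\<lambda>x1 x2. ?P (pt a1 x1) (pt a2 x2)) x) a"
      by (rule A.cocomm[OF a vTT, where \<Phi> = "\<lambda>a1 a2. sweedler X (\<lambda>x1 x2. ?P (pt a1 x1) (pt a2 x2)) x"])
        (intro bilinear_onI X.lin_param[OF x vTT] lin_bil1[OF bilinear_P] lin_bil2[OF bilinear_P]
        lin_pure1 lin_id pt_in; assumption)
    finally show "sweedler (tens A X) (\<lambda>u v. ?P v u) (pt a x) = comult (tens A X) (pt a x)"
      unfolding tens_comult_pure[OF a x] .
  qed
  then show "sweedler (tens A X) (\<lambda>u v. tensor_of (tens A X) (tens A X) v u) t = comult (tens A X) t" by simp
  \<comment> \<open>The right counit law comes from the left one by the cocommutativity just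
    proved.\<close>
  have "sweedler (tens A X) (\<lambda>u v. tensor_scale (counit (tens A X) v) u) t
     = sweedler (tens A X) (\<lambda>u v. tensor_scale (counit (tens A X) u) v) t"
  proof -
    let ?\<Phi> = "\<lambda>u v. tensor_scale (counit (tens A X) u) v"
    let ?L = "tensor_lift tensor_scale tensor_scale TS TS ?\<Phi>"
    note b = bilinear_counit_scale(1)
    have "sweedler (tens A X) ?\<Phi> t = ?L (sweedler (tens A X) (\<lambda>u v. ?P v u) t)"
      unfolding cc using T.lift_comult[of ?\<Phi> t] by simp
    also have "\<dots> = sweedler (tens A X) (\<lambda>u v. ?L (?P v u)) t"
      by (rule T.sweedler_hom[OF _ vTT vs_tensor lift_linear[OF vTS vTS vTS b]]) (use t P_in in auto)
    also have "\<dots> = sweedler (tens A X) (\<lambda>u v. ?\<Phi> v u) t"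
      using t by (intro T.sweedler_cong lift_pure[OF vTS vTS vs_tensor b]) auto
    finally show ?thesis ..
  qed
  then show "sweedler (tens A X) (\<lambda>u v. scale (tens A X) (counit (tens A X) v) u) t = t"
    using \<open>sweedler (tens A X) (\<lambda>u v. tensor_scale (counit (tens A X) u) v) t = t\<close> by simp
qed

end

lemma coalgebra_map_cong:
  assumes "cocommutative_coalgebra C" "coalgebra_map C G f" "\<And>x. x \<in> carrier C \<Longrightarrow> g x = f x"
  shows "coalgebra_map C G g"
proof -
  interpret C: cocommutative_coalgebra C by fact
  show ?thesis unfolding coalgebra_map_def
  proof (intro conjI ballI)
    show "linear_on (scale C) (scale G) (carrier C) (carrier G) g"
      by (rule linear_on_cong[OF coalgebra_map_linear[OF assms(2)] C.vspC assms(3)])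
    fix x assume x: "x \<in> carrier C"
    have "sweedler C (\<lambda>u v. tensor_of G G (g u) (g v)) x = sweedler C (\<lambda>u v. tensor_of G G (f u) (f v)) x"
      by (rule C.sweedler_cong[OF x]) (simp add: assms(3))
    then show "comult G (g x) = sweedler C (\<lambda>u v. tensor_of G G (g u) (g v)) x"
      using coalgebra_map_comult[OF assms(2) x] assms(3)[OF x] by simp
    show "counit G (g x) = counit C x"
      using coalgebra_map_counit[OF assms(2) x] assms(3)[OF x] by simp
  qed
qed

text \<open>
  The coalgebra maps \<open>C \<rightarrow> A\<close>, normalized to vanish off the carrier of \<open>C\<close> so that two of them are equal as
  functions as soon as they agree on \<open>C\<close>. If \<open>A\<close> is a cocommutative Hopf algebra they form a group
  under convolution, and an identity between coalgebra maps on \<open>H \<otimes> H\<close> becomes an identity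
  between elements of the group of \<open>H \<otimes> H\<close>-points, evaluated at the two projections.
\<close>

definition points where
  "points C A = {f. coalgebra_map C A f \<and> (\<forall>c. c \<notin> carrier C \<longrightarrow> f c = 0)}"

text \<open>Among cocommutative coalgebras the tensor product is the categorical product. This is
  the point with coordinates \<open>f\<close> and \<open>g\<close>; \<open>proj1\<close> and
  \<open>proj2\<close> are the projections.\<close>

definition pairing where
  "pairing C A X f g = (\<lambda>c. if c \<in> carrier C then sweedler C (\<lambda>u v. tensor_of A X (f u) (g v)) c else 0)"

definition proj1 where
  "proj1 A X = (\<lambda>t. if t \<in> carrier (tens A X) then lift_of A X (\<lambda>a x. scale A (counit X x) a) t else 0)"

definition proj2 where
  "proj2 A X = (\<lambda>t. if t \<in> carrier (tens A X) then lift_of A X (\<lambda>a x. scale X (counit A a) x) t else 0)"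

lemma points_map: "f \<in> points C A \<Longrightarrow> coalgebra_map C A f"
  unfolding points_def by blast

lemma points_outside: "f \<in> points C A \<Longrightarrow> c \<notin> carrier C \<Longrightarrow> f c = 0"
  unfolding points_def by blast

lemma points_eqI:
  "f \<in> points C A \<Longrightarrow> g \<in> points C A \<Longrightarrow> (\<And>c. c \<in> carrier C \<Longrightarrow> f c = g c) \<Longrightarrow> f = g"
  by (rule ext) (metis points_outside)

lemma points_closed: "f \<in> points C A \<Longrightarrow> x \<in> carrier C \<Longrightarrow> f x \<in> carrier A"
  using coalgebra_map_closed points_map by metis

lemma points_comp:
  assumes "comultiplication C" "vsp (scale G) (carrier G)" "vsp (scale K) (carrier K)"
    "f \<in> points C G" "coalgebra_map G K g"
  shows "(\<lambda>c. g (f c)) \<in> points C K"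
  using coalgebra_map_comp[OF assms(1-3) points_map[OF assms(4)] assms(5)] points_outside[OF assms(4)]
    linear_on_zero[OF assms(2) vsp_vs[OF assms(3)] coalgebra_map_linear[OF assms(5)]]
  unfolding points_def by simp

context coalgebra_pair
begin

interpretation T: cocommutative_coalgebra "tens A X" by (rule coalgebra)

lemma proj1_bilinear: "bilinear_on (scale A) (scale X) (scale A) (carrier A) (carrier X) (carrier A) (\<lambda>a x. scale A (counit X x) a)"
  by (intro bilinear_onI lin_scale1[OF A.vspC] lin_scale2[OF A.vspC] X.counit_linear lin_id)

lemma proj2_bilinear: "bilinear_on (scale A) (scale X) (scale X) (carrier A) (carrier X) (carrier X) (\<lambda>a x. scale X (counit A a) x)"
  by (intro bilinear_onI lin_scale1[OF X.vspC] lin_scale2[OF X.vspC] A.counit_linear lin_id)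

lemma proj1_pure: "a \<in> carrier A \<Longrightarrow> x \<in> carrier X \<Longrightarrow> proj1 A X (pt a x) = scale A (counit X x) a"
  unfolding proj1_def by (simp add: pt_in lift_pure[OF A.vspC X.vspC A.vector_space proj1_bilinear])

lemma proj2_pure: "a \<in> carrier A \<Longrightarrow> x \<in> carrier X \<Longrightarrow> proj2 A X (pt a x) = scale X (counit A a) x"
  unfolding proj2_def by (simp add: pt_in lift_pure[OF A.vspC X.vspC X.vector_space proj2_bilinear])

lemma proj1_linear: "linear_on tensor_scale (scale A) TS (carrier A) (proj1 A X)"
  by (rule linear_on_cong[OF lift_linear[OF A.vspC X.vspC A.vspC proj1_bilinear] tensor_space_vsp])
    (simp add: proj1_def)

lemma proj2_linear: "linear_on tensor_scale (scale X) TS (carrier X) (proj2 A X)"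
  by (rule linear_on_cong[OF lift_linear[OF A.vspC X.vspC X.vspC proj2_bilinear] tensor_space_vsp])
    (simp add: proj2_def)

lemma counit_T: "linear_on tensor_scale (*) TS UNIV (counit (tens A X))"
  using T.counit_linear by simp

text \<open>\<open>proj1\<close> applies the counit to the second coordinate, and the counit law
  then removes that Sweedler factor of \<open>x\<close>; only \<open>a\<close> remains
  split.\<close>

lemma evalL:
  assumes a: "a \<in> carrier A" and x: "x \<in> carrier X" and U: "vsp s U"
    and m: "bilinear_on s1 s2 s U1 U2 U m" and F: "linear_on (scale A) s1 (carrier A) U1 F"
    and K: "linear_on tensor_scale s2 TS U2 K"
  shows "sweedler (tens A X) (\<lambda>u v. m (F (proj1 A X u)) (K v)) (pt a x) = sweedler A (\<lambda>a1 a2. m (F a1) (K (pt a2 x))) a"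
proof -
  note F1 = linear_on_closed[OF F] and K1 = linear_on_closed[OF K]
  note p1 = linear_on_closed[OF proj1_linear]
  have "sweedler (tens A X) (\<lambda>u v. m (F (proj1 A X u)) (K v)) (pt a x)
     = sweedler A (\<lambda>a1 a2. sweedler X (\<lambda>x1 x2. m (F (proj1 A X (pt a1 x1))) (K (pt a2 x2))) x) a"
    by (rule sweedler_tens[OF a x U]) (intro bilinear_onI lin_bil1[OF m] lin_bil2[OF m] lin_comp[OF F] K proj1_linear F1 K1 p1)
  also have "\<dots> = sweedler A (\<lambda>a1 a2. m (F a1) (K (pt a2 x))) a"
  proof (rule A.sweedler_cong[OF a])
    fix a1 a2 assume *: "a1 \<in> carrier A" "a2 \<in> carrier A"
    have l: "linear_on (scale X) s (carrier X) U (\<lambda>x2. m (F a1) (K (pt a2 x2)))"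
      by (intro lin_bil2[OF m] F1 lin_comp[OF K] lin_pure2 lin_id *)
    have "sweedler X (\<lambda>x1 x2. m (F (proj1 A X (pt a1 x1))) (K (pt a2 x2))) x
       = sweedler X (\<lambda>x1 x2. s (counit X x1) (m (F a1) (K (pt a2 x2)))) x"
      using * by (intro X.sweedler_cong[OF x])
        (simp add: proj1_pure linear_on_scale[OF F] linear_on_scale[OF bilinear_onD2[OF m]] K1 F1 pt_in)
    then show "sweedler X (\<lambda>x1 x2. m (F (proj1 A X (pt a1 x1))) (K (pt a2 x2))) x = m (F a1) (K (pt a2 x))"
      using X.counit_left'[OF x U l] by simp
  qed
  finally show ?thesis .
qed

lemma evalR:
  assumes a: "a \<in> carrier A" and x: "x \<in> carrier X" and U: "vsp s U"
    and m: "bilinear_on s1 s2 s U1 U2 U m" and F: "linear_on tensor_scale s1 TS U1 F"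
    and K: "linear_on (scale X) s2 (carrier X) U2 K"
  shows "sweedler (tens A X) (\<lambda>u v. m (F u) (K (proj2 A X v))) (pt a x) = sweedler X (\<lambda>x1 x2. m (F (pt a x1)) (K x2)) x"
proof -
  note F1 = linear_on_closed[OF F] and K1 = linear_on_closed[OF K]
  note p2 = linear_on_closed[OF proj2_linear]
  have "sweedler (tens A X) (\<lambda>u v. m (F u) (K (proj2 A X v))) (pt a x)
     = sweedler A (\<lambda>a1 a2. sweedler X (\<lambda>x1 x2. m (F (pt a1 x1)) (K (proj2 A X (pt a2 x2)))) x) a"
    by (rule sweedler_tens[OF a x U]) (intro bilinear_onI lin_bil1[OF m] lin_bil2[OF m] lin_comp[OF K] F proj2_linear F1 K1 p2)
  also have "\<dots> = sweedler X (\<lambda>x1 x2. sweedler A (\<lambda>a1 a2. m (F (pt a1 x1)) (K (proj2 A X (pt a2 x2)))) a) x"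
    by (rule sweedler_swap)
  also have "\<dots> = sweedler X (\<lambda>x1 x2. m (F (pt a x1)) (K x2)) x"
  proof (rule X.sweedler_cong[OF x])
    fix x1 x2 assume *: "x1 \<in> carrier X" "x2 \<in> carrier X"
    have l: "linear_on (scale A) s (carrier A) U (\<lambda>a1. m (F (pt a1 x1)) (K x2))"
      by (intro lin_bil1[OF m] K1 lin_comp[OF F] lin_pure1 lin_id *)
    have "sweedler A (\<lambda>a1 a2. m (F (pt a1 x1)) (K (proj2 A X (pt a2 x2)))) a
       = sweedler A (\<lambda>a1 a2. s (counit A a2) (m (F (pt a1 x1)) (K x2))) a"
      using * by (intro A.sweedler_cong[OF a])
        (simp add: proj2_pure linear_on_scale[OF K] linear_on_scale[OF bilinear_onD1[OF m]] K1 F1 pt_in)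
    then show "sweedler A (\<lambda>a1 a2. m (F (pt a1 x1)) (K (proj2 A X (pt a2 x2)))) a = m (F (pt a x1)) (K x2)"
      using A.counit_right'[OF a U l] by simp
  qed
  finally show ?thesis .
qed

text \<open>At independent variables no Sweedler sum survives. This is how an identity in a group of
  points of \<open>tens A X\<close>, taken at the two projections, becomes an identity in two free
  variables.\<close>

lemma eval_indep:
  assumes a: "a \<in> carrier A" and x: "x \<in> carrier X" and U: "vsp s U"
    and m: "bilinear_on s1 s2 s U1 U2 U m" and F: "linear_on (scale A) s1 (carrier A) U1 F"
    and K: "linear_on (scale X) s2 (carrier X) U2 K"
  shows "sweedler (tens A X) (\<lambda>u v. m (F (proj1 A X u)) (K (proj2 A X v))) (pt a x) = m (F a) (K x)"
proof -
  note F1 = linear_on_closed[OF F] and K1 = linear_on_closed[OF K]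
  have l: "linear_on (scale A) s (carrier A) U (\<lambda>a1. m (F a1) (K x))"
    by (intro lin_bil1[OF m] K1[OF x] F)
  have "sweedler (tens A X) (\<lambda>u v. m (F (proj1 A X u)) (K (proj2 A X v))) (pt a x)
     = sweedler A (\<lambda>a1 a2. m (F a1) (K (proj2 A X (pt a2 x)))) a"
    by (rule evalL[OF a x U m F lin_comp[OF K proj2_linear]])
  also have "\<dots> = sweedler A (\<lambda>a1 a2. s (counit A a2) (m (F a1) (K x))) a"
    using x by (intro A.sweedler_cong[OF a])
      (simp add: proj2_pure linear_on_scale[OF K] linear_on_scale[OF bilinear_onD1[OF m]] K1 F1)
  also have "\<dots> = m (F a) (K x)" by (rule A.counit_right'[OF a U l])
  finally show ?thesis .
qed

lemma proj1_point: "proj1 A X \<in> points (tens A X) A"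
  unfolding points_def mem_Collect_eq
proof (intro conjI allI impI)
  show "proj1 A X c = 0" if "c \<notin> carrier (tens A X)" for c using that unfolding proj1_def by simp
  show "coalgebra_map (tens A X) A (proj1 A X)" unfolding coalgebra_map_def
  proof (intro conjI ballI)
    show "linear_on (scale (tens A X)) (scale A) (carrier (tens A X)) (carrier A) (proj1 A X)"
      using proj1_linear by simp
    fix t assume "t \<in> carrier (tens A X)"
    then have t: "t \<in> TS" by simp
    show "counit A (proj1 A X t) = counit (tens A X) t"
      by (rule tens_eqI[OF vs_field lin_comp[OF A.counit_linear proj1_linear] counit_T _ t])
        (simp add: proj1_pure linear_on_scale[OF A.counit_linear] tens_counit_pure)
    have b: "bilinear_on tensor_scale tensor_scale tensor_scale TS TS (tensor_space (scale A) (scale A) (carrier A) (carrier A))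
      (\<lambda>u v. tensor_of A A (proj1 A X u) (proj1 A X v))"
      by (intro bilinear_onI lin_pure1 lin_pure2 proj1_linear linear_on_closed[OF proj1_linear])
    show "comult A (proj1 A X t) = sweedler (tens A X) (\<lambda>u v. tensor_of A A (proj1 A X u) (proj1 A X v)) t"
    proof (rule tens_eqI[OF vs_tensor lin_comp[OF A.comult_linear proj1_linear] T_lin_sweedler[OF tensor_space_vsp b] _ t])
      fix a x assume a: "a \<in> carrier A" and x: "x \<in> carrier X"
      have "sweedler (tens A X) (\<lambda>u v. tensor_of A A (proj1 A X u) (proj1 A X v)) (pt a x)
         = sweedler A (\<lambda>a1 a2. tensor_of A A a1 (scale A (counit X x) a2)) a"
        using evalL[OF a x tensor_space_vsp pure_tensor_bilinear lin_id proj1_linear] x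
        by (simp add: proj1_pure cong: A.sweedler_cong[OF a])
      also have "\<dots> = sweedler A (\<lambda>a1 a2. tensor_scale (counit X x) (tensor_of A A a1 a2)) a"
        by (intro A.sweedler_cong[OF a] linear_on_scale[OF bilinear_onD1[OF pure_tensor_bilinear]])
      also have "\<dots> = tensor_scale (counit X x) (sweedler A (\<lambda>a1 a2. tensor_of A A a1 a2) a)"
        by (rule A.sweedler_hom[OF a tensor_space_vsp vs_tensor lin_scale2[OF tensor_space_vsp lin_id], symmetric])
          (rule pure_tensor_in)
      also have "sweedler A (\<lambda>a1 a2. tensor_of A A a1 a2) a = comult A a"
        unfolding sweedler_sum using A.cop(2)[OF a] .
      finally show "comult A (proj1 A X (pt a x)) = sweedler (tens A X) (\<lambda>u v. tensor_of A A (proj1 A X u) (proj1 A X v)) (pt a x)"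
        using a x by (simp add: proj1_pure linear_on_scale[OF A.comult_linear])
    qed
  qed
qed

lemma proj2_point: "proj2 A X \<in> points (tens A X) X"
  unfolding points_def mem_Collect_eq
proof (intro conjI allI impI)
  show "proj2 A X c = 0" if "c \<notin> carrier (tens A X)" for c using that unfolding proj2_def by simp
  show "coalgebra_map (tens A X) X (proj2 A X)" unfolding coalgebra_map_def
  proof (intro conjI ballI)
    show "linear_on (scale (tens A X)) (scale X) (carrier (tens A X)) (carrier X) (proj2 A X)"
      using proj2_linear by simp
    fix t assume "t \<in> carrier (tens A X)"
    then have t: "t \<in> TS" by simp
    show "counit X (proj2 A X t) = counit (tens A X) t"
      by (rule tens_eqI[OF vs_field lin_comp[OF X.counit_linear proj2_linear] counit_T _ t])
        (simp add: proj2_pure linear_on_scale[OF X.counit_linear] tens_counit_pure)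
    have b: "bilinear_on tensor_scale tensor_scale tensor_scale TS TS (tensor_space (scale X) (scale X) (carrier X) (carrier X))
      (\<lambda>u v. tensor_of X X (proj2 A X u) (proj2 A X v))"
      by (intro bilinear_onI lin_pure1 lin_pure2 proj2_linear linear_on_closed[OF proj2_linear])
    show "comult X (proj2 A X t) = sweedler (tens A X) (\<lambda>u v. tensor_of X X (proj2 A X u) (proj2 A X v)) t"
    proof (rule tens_eqI[OF vs_tensor lin_comp[OF X.comult_linear proj2_linear] T_lin_sweedler[OF tensor_space_vsp b] _ t])
      fix a x assume a: "a \<in> carrier A" and x: "x \<in> carrier X"
      have "sweedler (tens A X) (\<lambda>u v. tensor_of X X (proj2 A X u) (proj2 A X v)) (pt a x)
         = sweedler X (\<lambda>x1 x2. tensor_of X X (scale X (counit A a) x1) x2) x"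
        using evalR[OF a x tensor_space_vsp pure_tensor_bilinear proj2_linear lin_id] a
        by (simp add: proj2_pure cong: X.sweedler_cong[OF x])
      also have "\<dots> = sweedler X (\<lambda>x1 x2. tensor_scale (counit A a) (tensor_of X X x1 x2)) x"
        by (intro X.sweedler_cong[OF x] linear_on_scale[OF bilinear_onD2[OF pure_tensor_bilinear]])
      also have "\<dots> = tensor_scale (counit A a) (sweedler X (\<lambda>x1 x2. tensor_of X X x1 x2) x)"
        by (rule X.sweedler_hom[OF x tensor_space_vsp vs_tensor lin_scale2[OF tensor_space_vsp lin_id], symmetric])
          (rule pure_tensor_in)
      also have "sweedler X (\<lambda>x1 x2. tensor_of X X x1 x2) x = comult X x"
        unfolding sweedler_sum using X.cop(2)[OF x] .
      finally show "comult X (proj2 A X (pt a x)) = sweedler (tens A X) (\<lambda>u v. tensor_of X X (proj2 A X u) (proj2 A X v)) (pt a x)"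
        using a x by (simp add: proj2_pure linear_on_scale[OF X.comult_linear])
    qed
  qed
qed

text \<open>Comultiplying the pairing yields \<open>f, f, g, g\<close> on four consecutive Sweedler
  factors, sorted as first with third and second with fourth, whereas the tensor square needs first
  with second and third with fourth. Cocommutativity of \<open>C\<close> mends this through
  \<open>mid4\<close>.\<close>

lemma pairing_point:
  assumes C: "cocommutative_coalgebra C" and f: "f \<in> points C A" and g: "g \<in> points C X"
  shows "pairing C A X f g \<in> points C (tens A X)"
proof -
  interpret C: cocommutative_coalgebra C by fact
  note fl = coalgebra_map_linear[OF points_map[OF f]] and gl = coalgebra_map_linear[OF points_map[OF g]]
  note fc = points_closed[OF f] and gc = points_closed[OF g]
  note vTT = tensor_space_vsp[of tensor_scale tensor_scale TS TS]
  let ?P = "pure_tensor tensor_scale tensor_scale :: ('k, 'a, 'b) tensor \<Rightarrow> ('k, 'a, 'b) tensor \<Rightarrow> _"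
  let ?h = "sweedler C (\<lambda>u v. pt (f u) (g v))"
  have h: "linear_on (scale C) tensor_scale (carrier C) TS ?h"
    by (intro C.lin_sweedler_arg[OF tensor_space_vsp] bilinear_onI lin_pure1 lin_pure2 fl gl fc gc)
  have h2: "linear_on (scale C) tensor_scale (carrier C) TS (pairing C A X f g)"
    by (rule linear_on_cong[OF h C.vspC]) (simp add: pairing_def)
  have "coalgebra_map C (tens A X) (pairing C A X f g)"
    unfolding coalgebra_map_def
  proof (intro conjI ballI)
    show "linear_on (scale C) (scale (tens A X)) (carrier C) (carrier (tens A X)) (pairing C A X f g)"
      using h2 by simp
    fix c assume c: "c \<in> carrier C"
    have "counit (tens A X) (?h c) = sweedler C (\<lambda>u v. counit (tens A X) (pt (f u) (g v))) c"
      by (rule C.sweedler_hom[OF c tensor_space_vsp vs_field counit_T]) (intro pt_in fc gc)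
    also have "\<dots> = sweedler C (\<lambda>u v. counit C u * counit C v) c"
      by (intro C.sweedler_cong[OF c]) (simp add: tens_counit_pure fc gc
        coalgebra_map_counit[OF points_map[OF f]] coalgebra_map_counit[OF points_map[OF g]])
    also have "\<dots> = counit C c"
      by (rule C.counit_left'[OF c vsp_UNIV[OF vs_field] C.counit_linear])
    finally show "counit (tens A X) (pairing C A X f g c) = counit C c"
      using c by (simp add: pairing_def)
    have l: "linear_on (scale C) tensor_scale (carrier C) (tensor_space tensor_scale tensor_scale TS TS) (\<lambda>a. ?P (pt (f a) (g b)) (pt (f c) (g d)))"
      "linear_on (scale C) tensor_scale (carrier C) (tensor_space tensor_scale tensor_scale TS TS) (\<lambda>b. ?P (pt (f a) (g b)) (pt (f c) (g d)))"
      "linear_on (scale C) tensor_scale (carrier C) (tensor_space tensor_scale tensor_scale TS TS) (\<lambda>c. ?P (pt (f a) (g b)) (pt (f c) (g d)))"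
      "linear_on (scale C) tensor_scale (carrier C) (tensor_space tensor_scale tensor_scale TS TS) (\<lambda>d. ?P (pt (f a) (g b)) (pt (f c) (g d)))"
      if "a \<in> carrier C" "b \<in> carrier C" "c \<in> carrier C" "d \<in> carrier C" for a b c d
      by (intro lin_bil1[OF bilinear_P] lin_bil2[OF bilinear_P] lin_pure1 lin_pure2 fl gl pt_in fc gc that)+
    have P_in: "?P u v \<in> tensor_space tensor_scale tensor_scale TS TS" if "u \<in> TS" "v \<in> TS" for u v
      using that by (rule pure_tensor_in)
    have "comult (tens A X) (?h c) = sweedler C (\<lambda>u v. comult (tens A X) (pt (f u) (g v))) c"
      by (rule C.sweedler_hom[OF c tensor_space_vsp vs_tensor T.comult_linear[simplified]]) (intro pt_in fc gc)
    also have "\<dots> = sweedler C (\<lambda>u v. sweedler A (\<lambda>a1 a2. sweedler X (\<lambda>x1 x2. ?P (pt a1 x1) (pt a2 x2)) (g v)) (f u)) c"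
      by (intro C.sweedler_cong[OF c] tens_comult_pure fc gc)
    also have "\<dots> = sweedler C (\<lambda>u v. sweedler C (\<lambda>u1 u2. sweedler X (\<lambda>x1 x2. ?P (pt (f u1) x1) (pt (f u2) x2)) (g v)) u) c"
      by (intro C.sweedler_cong[OF c] sweedler_map[OF C.comultiplication_axioms A.vspC points_map[OF f] _ vTT]
        bilinear_onI X.lin_param[OF _ vTT] lin_bil1[OF bilinear_P] lin_bil2[OF bilinear_P] lin_pure1 lin_id pt_in gc; assumption)
    also have "\<dots> = sweedler C (\<lambda>u v. sweedler C (\<lambda>u1 u2. sweedler C (\<lambda>v1 v2. ?P (pt (f u1) (g v1)) (pt (f u2) (g v2))) v) u) c"
      by (intro C.sweedler_cong[OF c] C.sweedler_cong sweedler_map[OF C.comultiplication_axioms X.vspC points_map[OF g] _ vTT]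
        bilinear_onI lin_bil1[OF bilinear_P] lin_bil2[OF bilinear_P] lin_pure2 lin_id pt_in fc; assumption)
    also have "\<dots> = sweedler C (\<lambda>u v. sweedler C (\<lambda>u1 v1. sweedler C (\<lambda>u2 v2. ?P (pt (f u1) (g v1)) (pt (f u2) (g v2))) v) u) c"
      by (rule C.mid4[OF c vTT]; rule l; assumption)
    also have "\<dots> = sweedler C (\<lambda>u v. sweedler C (\<lambda>u1 v1. ?P (pt (f u1) (g v1)) (?h v)) u) c"
      by (intro C.sweedler_cong[OF c] C.sweedler_cong C.sweedler_hom[symmetric, OF _ tensor_space_vsp vs_tensor bilinear_onD1[OF bilinear_P]] pt_in fc gc)
    also have "\<dots> = sweedler C (\<lambda>u v. ?P (?h u) (?h v)) c"
      by (intro C.sweedler_cong[OF c] C.sweedler_hom[symmetric, OF _ tensor_space_vsp vs_tensor bilinear_onD2[OF bilinear_P]]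
        linear_on_closed[OF h] pt_in fc gc)
    also have "\<dots> = sweedler C (\<lambda>u v. ?P (pairing C A X f g u) (pairing C A X f g v)) c"
      by (intro C.sweedler_cong[OF c]) (simp add: pairing_def)
    finally show "comult (tens A X) (pairing C A X f g c)
      = sweedler C (\<lambda>u v. tensor_of (tens A X) (tens A X) (pairing C A X f g u) (pairing C A X f g v)) c"
      using c by (simp add: pairing_def)
  qed
  then show ?thesis unfolding points_def by (simp add: pairing_def)
qed

end

context cocommutative_coalgebra
begin

text \<open>Evaluate the convolution of \<open>g\<close>, \<open>f\<close> and \<open>h\<close> in
  two ways. Associativity is asked only on the values of these three maps, because one application
  concerns the product of the double cross product, where just this much is at hand.\<close>

lemma conv_inverse_unique:
  assumes U: "vsp s U" and m: "bilinear_on s s s U U U m"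
    and g: "linear_on (scale C) s (carrier C) U g" and f: "linear_on (scale C) s (carrier C) U f"
    and h: "linear_on (scale C) s (carrier C) U h"
    and assoc: "\<And>u v w. u \<in> carrier C \<Longrightarrow> v \<in> carrier C \<Longrightarrow> w \<in> carrier C \<Longrightarrow> m (m (g u) (f v)) (h w) = m (g u) (m (f v) (h w))"
    and e: "e \<in> U" "\<And>u. u \<in> carrier C \<Longrightarrow> m e (h u) = h u" "\<And>u. u \<in> carrier C \<Longrightarrow> m (g u) e = g u"
    and gf: "\<And>x. x \<in> carrier C \<Longrightarrow> sweedler C (\<lambda>u v. m (g u) (f v)) x = s (counit C x) e"
    and fh: "\<And>x. x \<in> carrier C \<Longrightarrow> sweedler C (\<lambda>u v. m (f u) (h v)) x = s (counit C x) e"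
    and x: "x \<in> carrier C"
  shows "g x = h x"
proof -
  note gc = linear_on_closed[OF g] and fc = linear_on_closed[OF f] and hc = linear_on_closed[OF h]
  note mc = bilinear_on_closed[OF m]
  have "h x = sweedler C (\<lambda>u w. s (counit C u) (h w)) x"
    by (rule counit_left'[OF x U h, symmetric])
  also have "\<dots> = sweedler C (\<lambda>u w. m (sweedler C (\<lambda>p q. m (g p) (f q)) u) (h w)) x"
    by (intro sweedler_cong[OF x]) (simp add: gf linear_on_scale[OF bilinear_onD2[OF m]] e hc)
  also have "\<dots> = sweedler C (\<lambda>u w. sweedler C (\<lambda>p q. m (m (g p) (f q)) (h w)) u) x"
    by (intro sweedler_cong[OF x] sweedler_hom[OF _ U vsp_vs[OF U] bilinear_onD2[OF m]] mc gc fc hc)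
  also have "\<dots> = sweedler C (\<lambda>u w. sweedler C (\<lambda>p q. m (m (g u) (f p)) (h q)) w) x"
    by (rule coassoc3[OF x U]) (intro trilinear_onI lin_bil1[OF m] lin_bil2[OF m] g f h mc gc fc hc; assumption)
  also have "\<dots> = sweedler C (\<lambda>u w. sweedler C (\<lambda>p q. m (g u) (m (f p) (h q))) w) x"
    by (intro sweedler_cong[OF x] sweedler_cong assoc)
  also have "\<dots> = sweedler C (\<lambda>u w. m (g u) (sweedler C (\<lambda>p q. m (f p) (h q)) w)) x"
    by (intro sweedler_cong[OF x] sweedler_hom[symmetric, OF _ U vsp_vs[OF U] bilinear_onD1[OF m]] mc gc fc hc)
  also have "\<dots> = sweedler C (\<lambda>u w. s (counit C w) (g u)) x"
    by (intro sweedler_cong[OF x]) (simp add: fh linear_on_scale[OF bilinear_onD1[OF m]] e gc)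
  also have "\<dots> = g x" by (rule counit_right'[OF x U g])
  finally show ?thesis ..
qed

end

section \<open>Cocommutative Hopf algebras\<close>

context cocommutative_hopf_algebra
begin

abbreviation "HH \<equiv> tensor_space (scale H) (scale H) (carrier H) (carrier H)"

lemma Hlin1: "linear_on s (scale H) Z (carrier H) f \<Longrightarrow> y \<in> carrier H \<Longrightarrow> linear_on s (scale H) Z (carrier H) (\<lambda>x. f x \<cdot> y)"
  by (rule lin_bil1[OF mult_bilinear])

lemma Hlin2: "linear_on s (scale H) Z (carrier H) f \<Longrightarrow> y \<in> carrier H \<Longrightarrow> linear_on s (scale H) Z (carrier H) (\<lambda>x. y \<cdot> f x)"
  by (rule lin_bil2[OF mult_bilinear])

lemma mult_closed: "x \<in> carrier H \<Longrightarrow> y \<in> carrier H \<Longrightarrow> x \<cdot> y \<in> carrier H"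
  by (rule bilinear_on_closed[OF mult_bilinear])

lemma scale_mult_left: "x \<in> carrier H \<Longrightarrow> y \<in> carrier H \<Longrightarrow> scale H c x \<cdot> y = scale H c (x \<cdot> y)"
  by (rule linear_on_scale[OF bilinear_onD2[OF mult_bilinear]])

lemma scale_mult_right: "x \<in> carrier H \<Longrightarrow> y \<in> carrier H \<Longrightarrow> x \<cdot> scale H c y = scale H c (x \<cdot> y)"
  by (rule linear_on_scale[OF bilinear_onD1[OF mult_bilinear]])

lemma antipode_linear: "linear_on (scale H) (scale H) (carrier H) (carrier H) (antipode H)"
  using antipode unfolding is_antipode_def by blast

lemma antipode_closed: "x \<in> carrier H \<Longrightarrow> antipode H x \<in> carrier H"
  by (rule linear_on_closed[OF antipode_linear])

lemma antipode_left: "x \<in> carrier H \<Longrightarrow> sweedler H (\<lambda>u v. antipode H u \<cdot> v) x = scale H (counit H x) \<one>"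
  using antipode unfolding is_antipode_def by blast

lemma antipode_right: "x \<in> carrier H \<Longrightarrow> sweedler H (\<lambda>u v. u \<cdot> antipode H v) x = scale H (counit H x) \<one>"
  using antipode unfolding is_antipode_def by blast

lemma pair: "coalgebra_pair H H"
  by (intro coalgebra_pair.intro coalg.cocommutative_coalgebra_axioms)

text \<open>The convolution of two points is their \<open>pairing\<close> followed by this map,
  hence again a point.\<close>

lemma mult_map: "coalgebra_map (tens H H) H (tensor_lift (scale H) (scale H) (carrier H) (carrier H) (mult H))"
proof -
  interpret P: coalgebra_pair H H by (rule pair)
  interpret T: cocommutative_coalgebra "tens H H" by (rule P.coalgebra)
  let ?M = "tensor_lift (scale H) (scale H) (carrier H) (carrier H) (mult H)"
  note Ml = lift_linear[OF coalg.vspC coalg.vspC coalg.vspC mult_bilinear]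
  note Mc = linear_on_closed[OF Ml]
  have Mp: "?M (tensor_of H H x y) = x \<cdot> y" if "x \<in> carrier H" "y \<in> carrier H" for x y
    by (rule lift_pure[OF coalg.vspC coalg.vspC vector_space mult_bilinear that])
  have b: "bilinear_on tensor_scale tensor_scale tensor_scale HH HH HH (\<lambda>u v. tensor_of H H (?M u) (?M v))"
    by (intro bilinear_onI lin_pure1 lin_pure2 Ml Mc)
  show ?thesis unfolding coalgebra_map_def
  proof (intro conjI ballI)
    show "linear_on (scale (tens H H)) (scale H) (carrier (tens H H)) (carrier H) ?M" using Ml by simp
    fix t assume "t \<in> carrier (tens H H)"
    then have t: "t \<in> HH" by simp
    show "counit H (?M t) = counit (tens H H) t"
      by (rule P.tens_eqI[OF vs_field lin_comp[OF counit_linear Ml] P.counit_T _ t])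
        (simp add: Mp counit_mult P.tens_counit_pure)
    show "comult H (?M t) = sweedler (tens H H) (\<lambda>u v. tensor_of H H (?M u) (?M v)) t"
    proof (rule P.tens_eqI[OF vs_tensor lin_comp[OF comult_linear Ml] P.T_lin_sweedler[OF tensor_space_vsp b] _ t])
      fix x y assume xy: "x \<in> carrier H" "y \<in> carrier H"
      have "sweedler (tens H H) (\<lambda>u v. tensor_of H H (?M u) (?M v)) (tensor_of H H x y)
        = sweedler H (\<lambda>a1 a2. sweedler H (\<lambda>x1 x2. tensor_of H H (?M (tensor_of H H a1 x1)) (?M (tensor_of H H a2 x2))) y) x"
        by (rule P.sweedler_tens[OF xy tensor_space_vsp b])
      also have "\<dots> = sweedler H (\<lambda>a1 a2. sweedler H (\<lambda>x1 x2. tensor_of H H (a1 \<cdot> x1) (a2 \<cdot> x2)) y) x"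
        by (intro coalg.sweedler_cong xy) (simp add: Mp)
      finally show "comult H (?M (tensor_of H H x y)) = sweedler (tens H H) (\<lambda>u v. tensor_of H H (?M u) (?M v)) (tensor_of H H x y)"
        using xy by (simp add: Mp comult_mult)
    qed
  qed
qed

text \<open>The product of the algebra \<open>H \<otimes> H\<close>, in which the comultiplication
  of \<open>H\<close> gets a convolution inverse.\<close>

definition tensor_mult where
  "tensor_mult t t' = lift_of H H (\<lambda>u v. lift_of H H (\<lambda>p q. tensor_of H H (u \<cdot> p) (v \<cdot> q)) t') t"

lemma inner_bilinear:
  "u \<in> carrier H \<Longrightarrow> v \<in> carrier H \<Longrightarrow>
   bilinear_on (scale H) (scale H) tensor_scale (carrier H) (carrier H) HH (\<lambda>p q. tensor_of H H (u \<cdot> p) (v \<cdot> q))"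
  by (intro bilinear_onI lin_pure1 lin_pure2 Hlin2 lin_id mult_closed; assumption)

lemma tensor_mult_inner_linear:
  "u \<in> carrier H \<Longrightarrow> v \<in> carrier H \<Longrightarrow> linear_on tensor_scale tensor_scale HH HH (lift_of H H (\<lambda>p q. tensor_of H H (u \<cdot> p) (v \<cdot> q)))"
  by (rule lift_linear[OF coalg.vspC coalg.vspC tensor_space_vsp inner_bilinear])

lemma tensor_mult_outer_bilinear:
  assumes t: "t \<in> HH"
  shows "bilinear_on (scale H) (scale H) tensor_scale (carrier H) (carrier H) HH (\<lambda>u v. lift_of H H (\<lambda>p q. tensor_of H H (u \<cdot> p) (v \<cdot> q)) t)"
  unfolding tensor_lift_rep case_prod_unfold using tensor_rep(1)[OF coalg.vspC t]
  by (intro bilinear_onI lin_sum_list[OF tensor_space_vsp] lin_pure1 lin_pure2 Hlin1 lin_id mult_closed; auto)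

lemma tensor_mult_bilinear: "bilinear_on tensor_scale tensor_scale tensor_scale HH HH HH tensor_mult"
proof (rule bilinear_onI)
  show "linear_on tensor_scale tensor_scale HH HH (tensor_mult t)" if t: "t \<in> HH" for t
    unfolding tensor_mult_def[abs_def] tensor_lift_rep[of _ _ _ _ "\<lambda>u v. lift_of H H (\<lambda>p q. tensor_of H H (u \<cdot> p) (v \<cdot> q)) _" t] case_prod_unfold
    using tensor_rep(1)[OF coalg.vspC t]
    by (intro lin_sum_list[OF tensor_space_vsp] tensor_mult_inner_linear) auto
  show "linear_on tensor_scale tensor_scale HH HH (\<lambda>t. tensor_mult t t')" if t: "t' \<in> HH" for t'
    unfolding tensor_mult_def[abs_def] by (rule lift_linear[OF coalg.vspC coalg.vspC tensor_space_vsp tensor_mult_outer_bilinear[OF t]])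
qed

lemma tensor_mult_pure:
  assumes "u \<in> carrier H" "v \<in> carrier H" "p \<in> carrier H" "q \<in> carrier H"
  shows "tensor_mult (tensor_of H H u v) (tensor_of H H p q) = tensor_of H H (u \<cdot> p) (v \<cdot> q)"
proof -
  have "tensor_mult (tensor_of H H u v) (tensor_of H H p q) = lift_of H H (\<lambda>p q. tensor_of H H (u \<cdot> p) (v \<cdot> q)) (tensor_of H H p q)"
    unfolding tensor_mult_def by (rule lift_pure[OF coalg.vspC coalg.vspC vs_tensor tensor_mult_outer_bilinear assms(1,2)]) (rule pure_tensor_in[OF assms(3,4)])
  also have "\<dots> = tensor_of H H (u \<cdot> p) (v \<cdot> q)"
    by (rule lift_pure[OF coalg.vspC coalg.vspC vs_tensor inner_bilinear[OF assms(1,2)] assms(3,4)])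
  finally show ?thesis .
qed

lemma comult_tensor_mult: "x \<in> carrier H \<Longrightarrow> y \<in> carrier H \<Longrightarrow> comult H (x \<cdot> y) = tensor_mult (comult H x) (comult H y)"
  unfolding comult_mult tensor_mult_def sweedler_def ..

lemma HH_in: "u \<in> carrier H \<Longrightarrow> v \<in> carrier H \<Longrightarrow> tensor_of H H u v \<in> HH"
  by (rule pure_tensor_in)

lemma tensor_mult_assoc:
  assumes "t1 \<in> HH" "t2 \<in> HH" "t3 \<in> HH" shows "tensor_mult (tensor_mult t1 t2) t3 = tensor_mult t1 (tensor_mult t2 t3)"
proof -
  interpret P: coalgebra_pair H H by (rule pair)
  note b = tensor_mult_bilinear and mc = bilinear_on_closed[OF tensor_mult_bilinear]
  have 1: "tensor_mult (tensor_mult (tensor_of H H u v) (tensor_of H H p q)) (tensor_of H H r s) = tensor_mult (tensor_of H H u v) (tensor_mult (tensor_of H H p q) (tensor_of H H r s))"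
    if "u \<in> carrier H" "v \<in> carrier H" "p \<in> carrier H" "q \<in> carrier H" "r \<in> carrier H" "s \<in> carrier H" for u v p q r s
    using that by (simp add: tensor_mult_pure mult_closed mult_assoc)
  have 2: "tensor_mult (tensor_mult (tensor_of H H u v) (tensor_of H H p q)) t3 = tensor_mult (tensor_of H H u v) (tensor_mult (tensor_of H H p q) t3)"
    if "u \<in> carrier H" "v \<in> carrier H" "p \<in> carrier H" "q \<in> carrier H" for u v p q
    by (rule P.tens_eqI[where f = "\<lambda>t3. tensor_mult (tensor_mult (tensor_of H H u v) (tensor_of H H p q)) t3" and
          g = "\<lambda>t3. tensor_mult (tensor_of H H u v) (tensor_mult (tensor_of H H p q) t3)" and U = HH and U' = HH, OF vs_tensor _ _ 1[OF that] assms(3)])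
      (intro bilinear_onD1[OF b] lin_bil2[OF b] lin_id mc HH_in that; assumption)+
  have 3: "tensor_mult (tensor_mult (tensor_of H H u v) t2) t3 = tensor_mult (tensor_of H H u v) (tensor_mult t2 t3)"
    if "u \<in> carrier H" "v \<in> carrier H" for u v
    by (rule P.tens_eqI[where f = "\<lambda>t2. tensor_mult (tensor_mult (tensor_of H H u v) t2) t3" and
          g = "\<lambda>t2. tensor_mult (tensor_of H H u v) (tensor_mult t2 t3)" and U = HH and U' = HH, OF vs_tensor _ _ 2[OF that] assms(2)])
      (intro lin_bil1[OF b] lin_bil2[OF b] lin_id mc HH_in that assms; assumption)+
  show ?thesis
    by (rule P.tens_eqI[where f = "\<lambda>t1. tensor_mult (tensor_mult t1 t2) t3" and
          g = "\<lambda>t1. tensor_mult t1 (tensor_mult t2 t3)" and U = HH and U' = HH, OF vs_tensor _ _ 3 assms(1)])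
      (intro lin_bil1[OF b] lin_bil2[OF b] lin_id mc HH_in assms; assumption)+
qed

lemma tensor_mult_one: "t \<in> HH \<Longrightarrow> tensor_mult (tensor_of H H \<one> \<one>) t = t" "t \<in> HH \<Longrightarrow> tensor_mult t (tensor_of H H \<one> \<one>) = t"
proof -
  interpret P: coalgebra_pair H H by (rule pair)
  assume t: "t \<in> HH"
  show "tensor_mult (tensor_of H H \<one> \<one>) t = t"
    by (rule P.tens_eqI[where f = "tensor_mult (tensor_of H H \<one> \<one>)" and g = "\<lambda>t. t", OF vs_tensor bilinear_onD1[OF tensor_mult_bilinear] lin_id _ t])
      (auto simp: one_closed tensor_mult_pure one_left intro: HH_in)
  show "tensor_mult t (tensor_of H H \<one> \<one>) = t"
    by (rule P.tens_eqI[where f = "\<lambda>t. tensor_mult t (tensor_of H H \<one> \<one>)" and g = "\<lambda>t. t", OF vs_tensor bilinear_onD2[OF tensor_mult_bilinear] lin_id _ t])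
      (auto simp: one_closed tensor_mult_pure one_right intro: HH_in)
qed

lemma antipode_counit: "x \<in> carrier H \<Longrightarrow> counit H (antipode H x) = counit H x"
proof -
  assume x: "x \<in> carrier H"
  have "counit H (antipode H x) = sweedler H (\<lambda>u v. counit H v * counit H (antipode H u)) x"
    by (rule coalg.counit_right'[OF x vsp_UNIV[OF vs_field] lin_comp[OF counit_linear antipode_linear], symmetric])
  also have "\<dots> = sweedler H (\<lambda>u v. counit H (antipode H u \<cdot> v)) x"
    by (intro coalg.sweedler_cong[OF x]) (simp add: counit_mult antipode_closed)
  also have "\<dots> = counit H (sweedler H (\<lambda>u v. antipode H u \<cdot> v) x)"
    by (rule coalg.sweedler_hom[OF x coalg.vspC vs_field counit_linear, symmetric]) (intro mult_closed antipode_closed)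
  also have "\<dots> = counit H x"
    using linear_on_scale[OF counit_linear one_closed] by (simp add: antipode_left[OF x] counit_one)
  finally show ?thesis .
qed

text \<open>The comultiplication after the antipode, and the antipode on both factors after the
  comultiplication, are both convolution inverses of \<open>comult H\<close> with values in
  \<open>H \<otimes> H\<close>. For the second map this uses cocommutativity.\<close>

lemma antipode_map: "coalgebra_map H H (antipode H)"
  unfolding coalgebra_map_def
proof (intro conjI ballI antipode_linear antipode_counit)
  fix x assume x: "x \<in> carrier H"
  note S = antipode_linear and Sc = antipode_closed
  let ?g = "\<lambda>x. comult H (antipode H x)"
  let ?h = "sweedler H (\<lambda>u v. tensor_of H H (antipode H u) (antipode H v))"
  have g: "linear_on (scale H) tensor_scale (carrier H) HH ?g" by (rule lin_comp[OF comult_linear S])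
  have h: "linear_on (scale H) tensor_scale (carrier H) HH ?h"
    by (intro coalg.lin_sweedler_arg[OF tensor_space_vsp] bilinear_onI lin_pure1 lin_pure2 S Sc)
  note vHH = tensor_space_vsp[of "scale H" "scale H" "carrier H" "carrier H"]
  note dl = comult_linear and dc = linear_on_closed[OF comult_linear]
  have gf: "sweedler H (\<lambda>u v. tensor_mult (?g u) (comult H v)) y = tensor_scale (counit H y) (tensor_of H H \<one> \<one>)"
    if y: "y \<in> carrier H" for y
  proof -
    have "sweedler H (\<lambda>u v. tensor_mult (comult H (antipode H u)) (comult H v)) y = sweedler H (\<lambda>u v. comult H (antipode H u \<cdot> v)) y"
      by (intro coalg.sweedler_cong[OF y]) (simp add: comult_tensor_mult Sc)
    also have "\<dots> = comult H (sweedler H (\<lambda>u v. antipode H u \<cdot> v) y)"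
      by (rule coalg.sweedler_hom[OF y coalg.vspC vs_tensor comult_linear, symmetric]) (intro mult_closed Sc)
    finally show ?thesis
      by (simp add: antipode_left[OF y] linear_on_scale[OF comult_linear one_closed] comult_one)
  qed
  have fh: "sweedler H (\<lambda>u v. tensor_mult (comult H u) (?h v)) y = tensor_scale (counit H y) (tensor_of H H \<one> \<one>)"
    if y: "y \<in> carrier H" for y
  proof -
    let ?F = "\<lambda>a b c d. tensor_of H H (a \<cdot> antipode H c) (b \<cdot> antipode H d)"
    have Fl: "linear_on (scale H) tensor_scale (carrier H) HH (\<lambda>a. ?F a b c d)"
      "linear_on (scale H) tensor_scale (carrier H) HH (\<lambda>b. ?F a b c d)"
      "linear_on (scale H) tensor_scale (carrier H) HH (\<lambda>c. ?F a b c d)"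
      "linear_on (scale H) tensor_scale (carrier H) HH (\<lambda>d. ?F a b c d)"
      if "a \<in> carrier H" "b \<in> carrier H" "c \<in> carrier H" "d \<in> carrier H" for a b c d
      by (intro lin_pure1 lin_pure2 Hlin1 Hlin2 lin_id S mult_closed Sc that)+
    have "tensor_mult (comult H u) (?h v) = sweedler H (\<lambda>a b. sweedler H (\<lambda>c d. ?F a b c d) v) u"
      if uv: "u \<in> carrier H" "v \<in> carrier H" for u v
    proof -
      have "comult H u = sweedler H (\<lambda>a b. tensor_of H H a b) u"
        unfolding sweedler_sum using coalg.cop(2)[OF uv(1)] by simp
      then have "tensor_mult (comult H u) (?h v) = tensor_mult (sweedler H (\<lambda>a b. tensor_of H H a b) u) (?h v)" by simp
      also have "\<dots> = sweedler H (\<lambda>a b. tensor_mult (tensor_of H H a b) (?h v)) u"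
        by (rule coalg.sweedler_hom[OF uv(1) vHH vs_tensor bilinear_onD2[OF tensor_mult_bilinear linear_on_closed[OF h uv(2)]]]) (rule HH_in)
      also have "\<dots> = sweedler H (\<lambda>a b. sweedler H (\<lambda>c d. tensor_mult (tensor_of H H a b) (tensor_of H H (antipode H c) (antipode H d))) v) u"
        by (intro coalg.sweedler_cong[OF uv(1)] coalg.sweedler_hom[OF uv(2) vHH vs_tensor bilinear_onD1[OF tensor_mult_bilinear]] HH_in Sc)
      also have "\<dots> = sweedler H (\<lambda>a b. sweedler H (\<lambda>c d. ?F a b c d) v) u"
        by (intro coalg.sweedler_cong[OF uv(1)] coalg.sweedler_cong[OF uv(2)] tensor_mult_pure Sc)
      finally show ?thesis .
    qed
    then have "sweedler H (\<lambda>u v. tensor_mult (comult H u) (?h v)) y = sweedler H (\<lambda>u v. sweedler H (\<lambda>a b. sweedler H (\<lambda>c d. ?F a b c d) v) u) y"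
      by (intro coalg.sweedler_cong[OF y])
    \<comment> \<open>After the exchange each element stands next to the antipode that cancels
      it.\<close>
    also have "\<dots> = sweedler H (\<lambda>u v. sweedler H (\<lambda>a c. sweedler H (\<lambda>b d. ?F a b c d) v) u) y"
      by (rule coalg.mid4[OF y vHH]; rule Fl; assumption)
    also have "\<dots> = sweedler H (\<lambda>u v. tensor_scale (counit H u) (tensor_scale (counit H v) (tensor_of H H \<one> \<one>))) y"
    proof (rule coalg.sweedler_cong[OF y])
      fix u v assume uv: "u \<in> carrier H" "v \<in> carrier H"
      have "sweedler H (\<lambda>a c. sweedler H (\<lambda>b d. ?F a b c d) v) u = sweedler H (\<lambda>a c. tensor_of H H (a \<cdot> antipode H c) (sweedler H (\<lambda>b d. b \<cdot> antipode H d) v)) u"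
        by (intro coalg.sweedler_cong[OF uv(1)] coalg.sweedler_hom[symmetric, OF uv(2) coalg.vspC vs_tensor bilinear_onD1[OF pure_tensor_bilinear[of _ _ "carrier H" "carrier H"]]] mult_closed Sc)
      also have "\<dots> = tensor_of H H (sweedler H (\<lambda>a c. a \<cdot> antipode H c) u) (sweedler H (\<lambda>b d. b \<cdot> antipode H d) v)"
        by (rule coalg.sweedler_hom[symmetric, OF uv(1) coalg.vspC vs_tensor bilinear_onD2[OF pure_tensor_bilinear[of _ _ "carrier H" "carrier H"]]])
         (intro coalg.sweedler_closed[OF uv(2) coalg.vspC] mult_closed Sc; assumption)+
      also have "\<dots> = tensor_scale (counit H u) (tensor_scale (counit H v) (tensor_of H H \<one> \<one>))"
        apply (simp add: antipode_right uv linear_on_scale[OF bilinear_onD1[OF pure_tensor_bilinear_UNIV]]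
            linear_on_scale[OF bilinear_onD2[OF pure_tensor_bilinear_UNIV]])
        apply (simp add: tensor_scale_def mult.left_commute)
        done
      finally show "sweedler H (\<lambda>a c. sweedler H (\<lambda>b d. ?F a b c d) v) u = tensor_scale (counit H u) (tensor_scale (counit H v) (tensor_of H H \<one> \<one>))" .
    qed
    also have "\<dots> = tensor_scale (counit H y) (tensor_of H H \<one> \<one>)"
      by (rule coalg.counit_left'[OF y vHH]) (intro lin_scale1[OF vHH] counit_linear HH_in one_closed)
    finally show ?thesis .
  qed
  show "?g x = ?h x"
  proof (rule coalg.conv_inverse_unique[where m = tensor_mult and f = "comult H" and e = "tensor_of H H \<one> \<one>"])
    show "vsp tensor_scale HH" by (rule vHH)
    show "bilinear_on tensor_scale tensor_scale tensor_scale HH HH HH tensor_mult" by (rule tensor_mult_bilinear)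
    show "linear_on (scale H) tensor_scale (carrier H) HH ?g" by (rule g)
    show "linear_on (scale H) tensor_scale (carrier H) HH (comult H)" by (rule comult_linear)
    show "linear_on (scale H) tensor_scale (carrier H) HH ?h" by (rule h)
    fix u assume u: "u \<in> carrier H"
    note gu = linear_on_closed[OF g u] and hu = linear_on_closed[OF h u]
    show "tensor_mult (tensor_of H H \<one> \<one>) (?h u) = ?h u" by (rule tensor_mult_one(1)[OF hu])
    show "tensor_mult (?g u) (tensor_of H H \<one> \<one>) = ?g u" by (rule tensor_mult_one(2)[OF gu])
    show "tensor_mult (tensor_mult (?g u) (comult H v)) (?h w) = tensor_mult (?g u) (tensor_mult (comult H v) (?h w))"
      if "v \<in> carrier H" "w \<in> carrier H" for v w
      by (rule tensor_mult_assoc[OF gu dc[OF that(1)] linear_on_closed[OF h that(2)]])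
  qed (rule HH_in[OF one_closed one_closed] gf fh x; assumption?)+
qed

end

section \<open>Rota-Baxter groups\<close>

locale abstract_group =
  fixes G :: "'a set" and mul :: "'a \<Rightarrow> 'a \<Rightarrow> 'a" (infixl "\<odot>" 70) and e :: 'a
    and inv :: "'a \<Rightarrow> 'a"
  assumes mul_closed [simp]: "x \<in> G \<Longrightarrow> y \<in> G \<Longrightarrow> x \<odot> y \<in> G"
    and e_closed [simp]: "e \<in> G"
    and inv_closed [simp]: "x \<in> G \<Longrightarrow> inv x \<in> G"
    and assoc: "x \<in> G \<Longrightarrow> y \<in> G \<Longrightarrow> z \<in> G \<Longrightarrow> (x \<odot> y) \<odot> z = x \<odot> (y \<odot> z)"
    and e_left [simp]: "x \<in> G \<Longrightarrow> e \<odot> x = x"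
    and inv_left [simp]: "x \<in> G \<Longrightarrow> inv x \<odot> x = e"
begin

lemma inv_left_assoc [simp]: "x \<in> G \<Longrightarrow> y \<in> G \<Longrightarrow> inv x \<odot> (x \<odot> y) = y"
  by (simp add: assoc[symmetric])

lemma inv_right [simp]:
  assumes x: "x \<in> G" shows "x \<odot> inv x = e"
proof -
  have "x \<odot> inv x = (inv (inv x) \<odot> inv x) \<odot> (x \<odot> inv x)" using x by (simp del: inv_left_assoc)
  also have "\<dots> = inv (inv x) \<odot> (inv x \<odot> (x \<odot> inv x))" using x by (intro assoc) simp_all
  also have "\<dots> = e" using x by simp
  finally show ?thesis .
qed

lemma e_right [simp]:
  assumes x: "x \<in> G" shows "x \<odot> e = x"
proof -
  have "x \<odot> e = x \<odot> (inv x \<odot> x)" using x by simp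
  also have "\<dots> = (x \<odot> inv x) \<odot> x" using x by (intro assoc[symmetric]) simp_all
  finally show ?thesis using x by simp
qed

lemma inv_right_assoc [simp]: "x \<in> G \<Longrightarrow> y \<in> G \<Longrightarrow> x \<odot> (inv x \<odot> y) = y"
  by (simp add: assoc[symmetric])

lemma right_cancel: "x \<in> G \<Longrightarrow> y \<in> G \<Longrightarrow> z \<in> G \<Longrightarrow> y \<odot> x = z \<odot> x \<Longrightarrow> y = z"
  by (metis assoc e_right inv_closed inv_right)

lemma inv_unique: "x \<in> G \<Longrightarrow> y \<in> G \<Longrightarrow> x \<odot> y = e \<Longrightarrow> inv x = y"
  by (metis e_right inv_closed inv_left_assoc)

lemma inv_inv [simp]: "x \<in> G \<Longrightarrow> inv (inv x) = x"
  by (rule inv_unique) simp_all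

lemma inv_mul [simp]: "x \<in> G \<Longrightarrow> y \<in> G \<Longrightarrow> inv (x \<odot> y) = inv y \<odot> inv x"
  by (rule inv_unique) (simp_all add: assoc)

lemma inv_e [simp]: "inv e = e"
  by (rule inv_unique) simp_all

end

text \<open>The identity \<open>rb\<close> is that of a Rota-Baxter operator of weight 1 on a group.
  Weight -1 becomes weight 1 on passing from \<open>B\<close> to \<open>P\<close>.\<close>

locale rb_group = abstract_group +
  fixes P :: "'a \<Rightarrow> 'a"
  assumes P_closed [simp]: "x \<in> G \<Longrightarrow> P x \<in> G"
    and rb: "x \<in> G \<Longrightarrow> y \<in> G \<Longrightarrow> P x \<odot> P y = P (x \<odot> P x \<odot> y \<odot> inv (P x))"
begin

lemma P_e [simp]: "P e = e"
proof -
  have "P e \<odot> P e = P e" using rb[of e e] by simp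
  then show ?thesis by (metis P_closed e_closed inv_left inv_left_assoc)
qed

text \<open>The product of the descendant group. \<open>T\<close> will be its inverse and
  \<open>N\<close> a second homomorphism, besides \<open>P\<close>, from the descendant to the
  original group; \<open>lam\<close> is the action of the descendant by conjugation with values of
  \<open>P\<close>.\<close>

definition circ (infixl "\<circ>" 70) where "x \<circ> y = x \<odot> P x \<odot> y \<odot> inv (P x)"
definition N where "N x = x \<odot> P x"
definition T where "T x = inv (P x) \<odot> inv x \<odot> P x"
definition lam where "lam x y = P x \<odot> y \<odot> inv (P x)"
text \<open>Solved from \<open>lam x y \<circ> rho x y = x \<circ> y\<close>: the two actions of the
  matched pair are the two factors of a product in the descendant.\<close>

definition rho where "rho x y = T (lam x y) \<circ> (x \<circ> y)"

lemma closed [simp]: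
  "x \<in> G \<Longrightarrow> y \<in> G \<Longrightarrow> x \<circ> y \<in> G" "x \<in> G \<Longrightarrow> N x \<in> G" "x \<in> G \<Longrightarrow> T x \<in> G"
  "x \<in> G \<Longrightarrow> y \<in> G \<Longrightarrow> lam x y \<in> G"
  unfolding circ_def N_def T_def lam_def by simp_all

lemma rho_closed [simp]: "x \<in> G \<Longrightarrow> y \<in> G \<Longrightarrow> rho x y \<in> G"
  unfolding rho_def by simp

lemma N_inv_P: "x \<in> G \<Longrightarrow> N x \<odot> inv (P x) = x"
  by (simp add: N_def assoc)

lemma P_circ [simp]: "x \<in> G \<Longrightarrow> y \<in> G \<Longrightarrow> P (x \<circ> y) = P x \<odot> P y"
  unfolding circ_def by (simp add: rb)

text \<open>Once \<open>P\<close> of the inner product is evaluated by \<open>P_circ\<close>, both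
  sides are the same word.\<close>

lemma circ_assoc: "x \<in> G \<Longrightarrow> y \<in> G \<Longrightarrow> z \<in> G \<Longrightarrow> (x \<circ> y) \<circ> z = x \<circ> (y \<circ> z)"
  unfolding circ_def[of _ z] circ_def[of x "y \<circ> z"] P_circ by (simp add: assoc circ_def)

lemma circ_T [simp]: "x \<in> G \<Longrightarrow> x \<circ> T x = e"
  unfolding circ_def T_def by (simp add: assoc)

lemma e_circ [simp]: "x \<in> G \<Longrightarrow> e \<circ> x = x" "x \<in> G \<Longrightarrow> x \<circ> e = x"
  unfolding circ_def by (simp_all add: assoc)

lemma P_T [simp]: "x \<in> G \<Longrightarrow> P (T x) = inv (P x)"
  using P_circ[of x "T x"] inv_unique[of "P x" "P (T x)"] by simp

lemma T_circ [simp]: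
  assumes "x \<in> G" shows "T x \<circ> x = e"
proof -
  have "T x \<circ> x = T x \<odot> inv (P x) \<odot> x \<odot> P x" using assms by (simp add: circ_def)
  then show ?thesis using assms by (simp add: T_def assoc)
qed

lemma circ_cancel: "x \<in> G \<Longrightarrow> y \<in> G \<Longrightarrow> T x \<circ> (x \<circ> y) = y" "x \<in> G \<Longrightarrow> y \<in> G \<Longrightarrow> x \<circ> (T x \<circ> y) = y"
  by (simp_all add: circ_assoc[symmetric])

lemma T_unique: "x \<in> G \<Longrightarrow> y \<in> G \<Longrightarrow> x \<circ> y = e \<Longrightarrow> T x = y"
  by (metis circ_cancel(1) closed(3) e_circ(2))

lemma T_T [simp]: "x \<in> G \<Longrightarrow> T (T x) = x"
  by (rule T_unique) simp_all

lemma T_mul: "x \<in> G \<Longrightarrow> y \<in> G \<Longrightarrow> T (x \<circ> y) = T y \<circ> T x"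
  by (rule T_unique) (simp_all add: circ_assoc circ_cancel)

lemma N_circ [simp]: "x \<in> G \<Longrightarrow> y \<in> G \<Longrightarrow> N (x \<circ> y) = N x \<odot> N y"
  unfolding N_def P_circ by (simp add: circ_def assoc)

lemma N_T [simp]:
  assumes "x \<in> G" shows "N (T x) = inv (N x)"
proof -
  have "N (T x) = T x \<odot> inv (P x)" using assms by (simp add: N_def)
  then show ?thesis using assms by (simp add: N_def T_def assoc)
qed

lemma lam_circ_rho: "x \<in> G \<Longrightarrow> y \<in> G \<Longrightarrow> lam x y \<circ> rho x y = x \<circ> y"
  unfolding rho_def by (simp add: circ_cancel)

text \<open>Moves a value of \<open>P\<close> to the right past a value of \<open>N\<close>. Applied
  to the middle of \<open>N a \<odot> P x \<odot> N b \<odot> P y\<close>, it makes the first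
  component of \<open>emb\<close> multiplicative.\<close>

lemma N_lam: "x \<in> G \<Longrightarrow> y \<in> G \<Longrightarrow> N (lam x y) \<odot> P (rho x y) = P x \<odot> N y"
proof -
  assume xy: "x \<in> G" "y \<in> G"
  have "N (lam x y) \<odot> P (rho x y) = lam x y \<odot> (P (lam x y) \<odot> (inv (P (lam x y)) \<odot> (P x \<odot> P y)))"
    using xy by (simp add: N_def rho_def assoc)
  then show ?thesis using xy by (simp add: lam_def N_def assoc)
qed

lemma circ_N: "x \<in> G \<Longrightarrow> y \<in> G \<Longrightarrow> x \<circ> y = N x \<odot> y \<odot> inv (N x) \<odot> x"
  unfolding circ_def N_def by (simp add: assoc)

text \<open>This is the shape in which the right action is prescribed. The product of
  \<open>T (rho x y)\<close> and \<open>T (lam x y)\<close> in the descendant is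
  \<open>T y \<circ> T x\<close>; expanding it once through \<open>N\<close> and once through
  \<open>P\<close> gives two words ending in \<open>T y\<close>, which cancels.\<close>

lemma rho_alt:
  assumes "x \<in> G" "y \<in> G" shows "rho x y = T (inv (N y) \<odot> T x \<odot> N y)"
proof -
  let ?r = "T (rho x y)" and ?l = "T (lam x y)"
  have r: "?r = T y \<circ> (T x \<circ> lam x y)"
    unfolding rho_def using assms by (simp add: T_mul circ_assoc)
  have "?r \<circ> ?l = T y \<circ> T x" unfolding r using assms by (simp add: circ_assoc)
  also have "\<dots> = N (T y) \<odot> T x \<odot> inv (N (T y)) \<odot> T y" using assms by (intro circ_N) simp_all
  finally have 1: "?r \<circ> ?l = inv (N y) \<odot> T x \<odot> N y \<odot> T y" using assms by simp
  have PR: "P ?r = inv (P y) \<odot> inv (P x) \<odot> P (lam x y)" unfolding r using assms by (simp add: assoc)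
  have "?r \<circ> ?l = ?r \<odot> P ?r \<odot> ?l \<odot> inv (P ?r)" by (simp add: circ_def)
  also have "\<dots> = ?r \<odot> (inv (P y) \<odot> inv (P x) \<odot> P (lam x y) \<odot> ?l \<odot> inv (P (lam x y)) \<odot> P x \<odot> P y)"
    unfolding PR using assms by (simp add: assoc)
  also have "\<dots> = ?r \<odot> T y"
    using assms by (simp add: T_def[of "lam x y"] assoc) (simp add: lam_def T_def assoc)
  finally have 2: "?r \<odot> T y = inv (N y) \<odot> T x \<odot> N y \<odot> T y" using 1 by simp
  have "?r = inv (N y) \<odot> T x \<odot> N y"
    by (rule right_cancel[OF _ _ _ 2]) (use assms in simp_all)
  then have "T ?r = T (inv (N y) \<odot> T x \<odot> N y)" by (rule arg_cong)
  then show ?thesis using assms by simp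
qed

text \<open>
  \<open>emb\<close> maps pairs injectively to the product of \<open>(G, \<odot>)\<close> and \<open>(G, \<circ>)\<close>, and \<open>pmul\<close> is the multiplication
  that makes it a homomorphism: this is where associativity and inverses of the double cross product come from.
\<close>

definition pmul where
  "pmul p q = (fst p \<circ> lam (snd p) (fst q), rho (snd p) (fst q) \<circ> snd q)"

definition emb where "emb p = (N (fst p) \<odot> P (snd p), fst p \<circ> snd p)"

lemma pmul_closed: "p \<in> G \<times> G \<Longrightarrow> q \<in> G \<times> G \<Longrightarrow> pmul p q \<in> G \<times> G"
  unfolding pmul_def by (auto simp: mem_Times_iff)

text \<open>For a pair (a, x) the second component determines \<open>P a \<odot> P x\<close>, and
  dividing the first component \<open>a \<odot> P a \<odot> P x\<close> by it leaves
  \<open>a\<close>; then \<open>x\<close> follows from the second component.\<close>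

lemma emb_inj: "p \<in> G \<times> G \<Longrightarrow> q \<in> G \<times> G \<Longrightarrow> emb p = emb q \<Longrightarrow> p = q"
proof -
  have *: "fst p = fst (emb p) \<odot> inv (P (snd (emb p)))" "snd p = T (fst p) \<circ> snd (emb p)" if "p \<in> G \<times> G" for p
    using that unfolding emb_def by (auto simp: N_def assoc circ_cancel)
  assume pq: "p \<in> G \<times> G" "q \<in> G \<times> G" and eq: "emb p = emb q"
  have 1: "fst p = fst q" using *(1)[OF pq(1)] *(1)[OF pq(2)] eq by simp
  have "snd p = snd q" using *(2)[OF pq(1)] *(2)[OF pq(2)] eq 1 by simp
  with 1 show "p = q" by (rule prod_eqI)
qed

lemma emb_pmul:
  assumes "p \<in> G \<times> G" "q \<in> G \<times> G"
  shows "emb (pmul p q) = (fst (emb p) \<odot> fst (emb q), snd (emb p) \<circ> snd (emb q))"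
proof -
  obtain a x b y where pq: "p = (a, x)" "q = (b, y)" "a \<in> G" "x \<in> G" "b \<in> G" "y \<in> G"
    using assms by auto
  have "N (a \<circ> lam x b) \<odot> P (rho x b \<circ> y) = N a \<odot> (N (lam x b) \<odot> P (rho x b)) \<odot> P y"
    using pq by (simp add: assoc)
  moreover have "a \<circ> lam x b \<circ> (rho x b \<circ> y) = a \<circ> (lam x b \<circ> rho x b) \<circ> y"
    using pq by (simp add: circ_assoc)
  ultimately show ?thesis
    unfolding pq emb_def pmul_def using pq(3-) by (simp add: N_lam lam_circ_rho assoc circ_assoc)
qed

lemma pmul_assoc:
  assumes "p \<in> G \<times> G" "q \<in> G \<times> G" "r \<in> G \<times> G"
  shows "pmul (pmul p q) r = pmul p (pmul q r)"
proof (rule emb_inj)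
  have "fst (emb p) \<in> G" "snd (emb p) \<in> G" if "p \<in> G \<times> G" for p
    using that unfolding emb_def by auto
  then show "emb (pmul (pmul p q) r) = emb (pmul p (pmul q r))"
    using assms by (simp add: emb_pmul pmul_closed assoc circ_assoc)
qed (intro pmul_closed assms)+

text \<open>For a pair (a, x) this is \<open>pmul (e, T x) (T a, e)\<close>, the inverses of the two
  factors in reversed order.\<close>

definition pinv where "pinv p = (lam (T (snd p)) (T (fst p)), rho (T (snd p)) (T (fst p)))"

lemma lam_e [simp]: "x \<in> G \<Longrightarrow> lam x e = e" "x \<in> G \<Longrightarrow> lam e x = x"
  unfolding lam_def by simp_all

lemma T_e [simp]: "T e = e"
  unfolding T_def by simp

lemma rho_e [simp]: "x \<in> G \<Longrightarrow> rho x e = x" "x \<in> G \<Longrightarrow> rho e x = e"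
  unfolding rho_def by simp_all

lemma pmul_e: "p \<in> G \<times> G \<Longrightarrow> pmul p (e, e) = p" "p \<in> G \<times> G \<Longrightarrow> pmul (e, e) p = p"
  unfolding pmul_def by auto

lemma pinv_closed: "p \<in> G \<times> G \<Longrightarrow> pinv p \<in> G \<times> G"
  unfolding pinv_def by (auto simp: mem_Times_iff)

lemma emb_pinv: "p \<in> G \<times> G \<Longrightarrow> emb (pinv p) = (inv (fst (emb p)), T (snd (emb p)))"
  unfolding emb_def pinv_def by (auto simp: N_lam lam_circ_rho T_mul)

lemma pmul_pinv:
  assumes "p \<in> G \<times> G" shows "pmul p (pinv p) = (e, e)" "pmul (pinv p) p = (e, e)"
proof -
  have *: "fst (emb p) \<in> G" "snd (emb p) \<in> G" using assms unfolding emb_def by auto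
  have ee: "emb (e, e) = (e, e)" unfolding emb_def N_def by simp
  have "(e, e) \<in> G \<times> G" by simp
  show "pmul p (pinv p) = (e, e)"
    by (rule emb_inj[OF pmul_closed[OF assms pinv_closed[OF assms]] \<open>(e, e) \<in> G \<times> G\<close>])
      (simp add: ee emb_pmul[OF assms pinv_closed[OF assms]] emb_pinv[OF assms] *)
  show "pmul (pinv p) p = (e, e)"
    by (rule emb_inj[OF pmul_closed[OF pinv_closed[OF assms] assms] \<open>(e, e) \<in> G \<times> G\<close>])
      (simp add: ee emb_pmul[OF pinv_closed[OF assms] assms] emb_pinv[OF assms] *)
qed

text \<open>Under \<open>emb\<close> this becomes (x, e), the copy of the original group in the
  product, which is why it is multiplicative.\<close>

definition sig where "sig x = (x, T x)"

lemma sig_closed: "x \<in> G \<Longrightarrow> sig x \<in> G \<times> G"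
  unfolding sig_def by simp

lemma sig_mul:
  assumes "x \<in> G" "y \<in> G" shows "pmul (sig x) (sig y) = sig (x \<odot> y)"
proof (rule emb_inj)
  have *: "emb (sig x) = (x, e)" if "x \<in> G" for x
    using that unfolding emb_def sig_def by (simp add: N_def assoc)
  show "emb (pmul (sig x) (sig y)) = emb (sig (x \<odot> y))"
    using assms by (simp add: emb_pmul sig_closed *)
qed (intro pmul_closed sig_closed mul_closed assms)+

end

section \<open>Groups of points of a Rota-Baxter Hopf algebra\<close>

lemma (in cocommutative_coalgebra) id_point: "(\<lambda>x. if x \<in> carrier C then x else 0) \<in> points C C"
  unfolding points_def mem_Collect_eq
proof (intro conjI allI impI)
  have "coalgebra_map C C (\<lambda>x. x)"
    unfolding coalgebra_map_def using lin_id[of "scale C" "carrier C"] cop(2)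
    by (auto simp: sweedler_sum)
  then show "coalgebra_map C C (\<lambda>x. if x \<in> carrier C then x else 0)"
    by (rule coalgebra_map_cong[OF cocommutative_coalgebra_axioms]) simp
qed simp

context coalgebra_pair
begin

lemma eval_swap:
  assumes a: "a \<in> carrier A" and x: "x \<in> carrier X" and U: "vsp s U"
    and m: "bilinear_on s2 s1 s U2 U1 U m" and F: "linear_on (scale A) s1 (carrier A) U1 F"
    and K: "linear_on (scale X) s2 (carrier X) U2 K"
  shows "sweedler (tens A X) (\<lambda>u v. m (K (proj2 A X u)) (F (proj1 A X v))) (pt a x) = m (K x) (F a)"
proof -
  interpret T: cocommutative_coalgebra "tens A X" by (rule coalgebra)
  have m': "bilinear_on s1 s2 s U1 U2 U (\<lambda>p q. m q p)"
    using m unfolding bilinear_on_def by auto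
  have "sweedler (tens A X) (\<lambda>u v. m (K (proj2 A X u)) (F (proj1 A X v))) (pt a x)
    = sweedler (tens A X) (\<lambda>u v. m (K (proj2 A X v)) (F (proj1 A X u))) (pt a x)"
    using a x by (intro T.cocomm[symmetric, OF _ U] bilinear_onI)
      (auto intro!: pt_in lin_bil1[OF m] lin_bil2[OF m] lin_comp[OF F proj1_linear] lin_comp[OF K proj2_linear]
       linear_on_closed[OF F] linear_on_closed[OF K] linear_on_closed[OF proj1_linear] linear_on_closed[OF proj2_linear])
  also have "\<dots> = m (K x) (F a)" by (rule eval_indep[OF a x U m' F K])
  finally show ?thesis .
qed

end

definition cmul where
  "cmul C H f g = (\<lambda>c. if c \<in> carrier C then sweedler C (\<lambda>u v. mult H (f u) (g v)) c else 0)"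

definition cone where
  "cone C H = (\<lambda>c. if c \<in> carrier C then scale H (counit C c) (one H) else 0)"

locale hopf_points = C: cocommutative_coalgebra C + H: cocommutative_hopf_algebra H
  for C :: "('k::field, 'c::ab_group_add) hopf" and H :: "('k, 'a::ab_group_add) hopf"
begin

abbreviation "lin f \<equiv> linear_on (scale C) (scale H) (carrier C) (carrier H) f"

lemma cmul_lin: "lin f \<Longrightarrow> lin g \<Longrightarrow> lin (cmul C H f g)"
  by (rule linear_on_cong[OF C.lin_sweedler_arg[OF H.coalg.vspC, of "\<lambda>u v. mult H (f u) (g v)"] C.vspC])
    (auto simp: cmul_def intro!: bilinear_onI H.Hlin1 H.Hlin2 intro: linear_on_closed)

text \<open>Stated for linear maps rather than points, because it is later applied to the constant
  maps \<open>const x\<close>, which in general are no coalgebra maps.\<close>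

lemma cmul_assoc_lin:
  assumes f: "lin f" and g: "lin g" and h: "lin h"
  shows "cmul C H (cmul C H f g) h = cmul C H f (cmul C H g h)"
proof
  fix c
  note fc = linear_on_closed[OF f] and gc = linear_on_closed[OF g] and hc = linear_on_closed[OF h]
  note V = H.coalg.vspC
  show "cmul C H (cmul C H f g) h c = cmul C H f (cmul C H g h) c"
  proof (cases "c \<in> carrier C")
    case c: True
    have "cmul C H (cmul C H f g) h c = sweedler C (\<lambda>u w. mult H (sweedler C (\<lambda>p q. mult H (f p) (g q)) u) (h w)) c"
      unfolding cmul_def using c by (auto intro!: C.sweedler_cong[OF c])
    also have "\<dots> = sweedler C (\<lambda>u w. sweedler C (\<lambda>p q. mult H (mult H (f p) (g q)) (h w)) u) c"
      by (intro C.sweedler_cong[OF c] C.sweedler_hom[OF _ V vsp_vs[OF V] bilinear_onD2[OF H.mult_bilinear]] H.mult_closed fc gc hc)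
    also have "\<dots> = sweedler C (\<lambda>u w. sweedler C (\<lambda>p q. mult H (mult H (f u) (g p)) (h q)) w) c"
      by (rule C.coassoc3[OF c V]) (intro trilinear_onI H.Hlin1 H.Hlin2 f g h H.mult_closed fc gc hc; assumption)
    also have "\<dots> = sweedler C (\<lambda>u w. sweedler C (\<lambda>p q. mult H (f u) (mult H (g p) (h q))) w) c"
      by (intro C.sweedler_cong[OF c] C.sweedler_cong H.mult_assoc fc gc hc)
    also have "\<dots> = sweedler C (\<lambda>u w. mult H (f u) (sweedler C (\<lambda>p q. mult H (g p) (h q)) w)) c"
      by (intro C.sweedler_cong[OF c] C.sweedler_hom[symmetric, OF _ V vsp_vs[OF V] bilinear_onD1[OF H.mult_bilinear]] H.mult_closed fc gc hc)
    also have "\<dots> = cmul C H f (cmul C H g h) c"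
      unfolding cmul_def using c by (auto intro!: C.sweedler_cong[OF c])
    finally show ?thesis .
  qed (simp add: cmul_def)
qed

lemma points_lin: "f \<in> points C H \<Longrightarrow> lin f"
  by (rule coalgebra_map_linear[OF points_map])

lemma cmul_point:
  assumes f: "f \<in> points C H" and g: "g \<in> points C H" shows "cmul C H f g \<in> points C H"
proof -
  let ?M = "tensor_lift (scale H) (scale H) (carrier H) (carrier H) (mult H)"
  interpret P: coalgebra_pair H H by (rule H.pair)
  note Ml = lift_linear[OF H.coalg.vspC H.coalg.vspC H.coalg.vspC H.mult_bilinear]
  have p: "pairing C H H f g \<in> points C (tens H H)"
    by (rule P.pairing_point[OF C.cocommutative_coalgebra_axioms f g])
  have "(\<lambda>c. ?M (pairing C H H f g c)) \<in> points C H"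
    by (rule points_comp[OF C.comultiplication_axioms _ H.coalg.vspC p H.mult_map]) (simp add: tensor_space_vsp)
  also have "(\<lambda>c. ?M (pairing C H H f g c)) = cmul C H f g"
  proof
    fix c show "?M (pairing C H H f g c) = cmul C H f g c"
    proof (cases "c \<in> carrier C")
      case c: True
      have "?M (pairing C H H f g c) = sweedler C (\<lambda>u v. ?M (tensor_of H H (f u) (g v))) c"
        unfolding pairing_def using c
        by (auto intro!: C.sweedler_hom[OF c tensor_space_vsp H.vector_space Ml] P.pt_in points_closed[OF f] points_closed[OF g])
      also have "\<dots> = cmul C H f g c"
        unfolding cmul_def using c
        by (auto intro!: C.sweedler_cong[OF c] lift_pure[OF H.coalg.vspC H.coalg.vspC H.vector_space H.mult_bilinear] points_closed[OF f] points_closed[OF g])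
      finally show ?thesis .
    next
      case False
      then show ?thesis using linear_on_zero[OF tensor_space_vsp H.vector_space Ml] by (simp add: pairing_def cmul_def)
    qed
  qed
  finally show ?thesis .
qed

lemma cone_lin: "lin (cone C H)"
  by (rule linear_on_cong[OF lin_scale1[OF H.coalg.vspC C.counit_linear H.one_closed] C.vspC]) (simp add: cone_def)

lemma cone_point: "cone C H \<in> points C H"
  unfolding points_def mem_Collect_eq coalgebra_map_def
proof (intro conjI ballI allI impI cone_lin)
  fix c assume c: "c \<in> carrier C"
  show "counit H (cone C H c) = counit C c"
    using c by (simp add: cone_def linear_on_scale[OF H.counit_linear H.one_closed] H.counit_one)
  have "sweedler C (\<lambda>u v. tensor_of H H (cone C H u) (cone C H v)) c
    = sweedler C (\<lambda>u v. tensor_scale (counit C u) (tensor_scale (counit C v) (tensor_of H H (one H) (one H)))) c"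
    by (intro C.sweedler_cong[OF c]) (simp add: cone_def linear_on_scale[OF bilinear_onD1[OF pure_tensor_bilinear_UNIV]]
      linear_on_scale[OF bilinear_onD2[OF pure_tensor_bilinear_UNIV]] tensor_scale_def mult.left_commute)
  also have "\<dots> = tensor_scale (counit C c) (tensor_of H H (one H) (one H))"
    by (rule C.counit_left'[OF c tensor_space_vsp[of "scale H" "scale H" "carrier H" "carrier H"]]) (intro lin_scale1[OF tensor_space_vsp] C.counit_linear H.HH_in H.one_closed)
  finally show "comult H (cone C H c) = sweedler C (\<lambda>u v. tensor_of H H (cone C H u) (cone C H v)) c"
    using c by (simp add: cone_def linear_on_scale[OF H.comult_linear H.one_closed] H.comult_one)
qed (simp add: cone_def)

lemma cone_left:
  assumes f: "lin f" and f0: "\<And>c. c \<notin> carrier C \<Longrightarrow> f c = 0"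
  shows "cmul C H (cone C H) f = f"
proof
  fix c show "cmul C H (cone C H) f c = f c"
  proof (cases "c \<in> carrier C")
    case c: True
    have "cmul C H (cone C H) f c = sweedler C (\<lambda>u v. scale H (counit C u) (f v)) c"
      unfolding cmul_def using c linear_on_closed[OF f]
      by (auto intro!: C.sweedler_cong[OF c] simp: cone_def H.scale_mult_left H.one_closed H.one_left)
    also have "\<dots> = f c" by (rule C.counit_left'[OF c H.coalg.vspC f])
    finally show ?thesis .
  qed (simp add: cmul_def f0)
qed

lemma sweedler_point:
  assumes f: "f \<in> points C H" and c: "c \<in> carrier C" and U: "vsp s U"
    and b: "bilinear_on (scale H) (scale H) s (carrier H) (carrier H) U \<Phi>"
  shows "sweedler C (\<lambda>u v. \<Phi> (f u) (f v)) c = sweedler H \<Phi> (f c)"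
  by (rule sweedler_map[symmetric, OF C.comultiplication_axioms H.coalg.vspC points_map[OF f] c U b])

lemma antipode_point: "f \<in> points C H \<Longrightarrow> (\<lambda>c. antipode H (f c)) \<in> points C H"
  by (rule points_comp[OF C.comultiplication_axioms H.coalg.vspC H.coalg.vspC _ H.antipode_map])

lemma antipode_point_left:
  assumes f: "f \<in> points C H" shows "cmul C H (\<lambda>c. antipode H (f c)) f = cone C H"
proof
  fix c show "cmul C H (\<lambda>c. antipode H (f c)) f c = cone C H c"
  proof (cases "c \<in> carrier C")
    case c: True
    have "sweedler C (\<lambda>u v. mult H (antipode H (f u)) (f v)) c = sweedler H (\<lambda>u v. mult H (antipode H u) v) (f c)"
      by (rule sweedler_point[OF f c H.coalg.vspC])
        (intro bilinear_onI H.Hlin1 H.Hlin2 lin_id H.antipode_linear H.antipode_closed; assumption)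
    then show ?thesis
      using c coalgebra_map_counit[OF points_map[OF f] c] points_closed[OF f c]
      by (simp add: cmul_def cone_def H.antipode_left)
  qed (simp add: cmul_def cone_def)
qed

text \<open>The inverse of a point is its composite with the antipode. That this composite is a
  point is the content of \<open>antipode_map\<close>, so cocommutativity of \<open>H\<close> enters
  here.\<close>

sublocale G: abstract_group "points C H" "cmul C H" "cone C H" "\<lambda>f c. antipode H (f c)"
proof
  show "cmul C H (cone C H) f = f" if "f \<in> points C H" for f
    by (rule cone_left[OF points_lin[OF that] points_outside[OF that]])
qed (auto intro: cmul_point cone_point antipode_point cmul_assoc_lin points_lin antipode_point_left)

end

context cocommutative_hopf_algebra
begin

lemma points_self: "hopf_points H H"
  by (intro hopf_points.intro coalg.cocommutative_coalgebra_axioms cocommutative_hopf_algebra_axioms)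

abbreviation "idp \<equiv> (\<lambda>x. if x \<in> carrier H then x else 0)"

text \<open>In the group of \<open>H\<close>-points of \<open>H\<close> this is the involutivity of
  inversion, taken at the identity point.\<close>

lemma antipode_antipode: "x \<in> carrier H \<Longrightarrow> antipode H (antipode H x) = x"
proof -
  interpret Q: hopf_points H H by (rule points_self)
  assume x: "x \<in> carrier H"
  show ?thesis using fun_cong[OF Q.G.inv_inv[OF coalg.id_point], of x] x by simp
qed

lemma antipode_one: "antipode H \<one> = \<one>"
  using antipode_left[OF one_closed] 
proof -
  have "sweedler H (\<lambda>u v. antipode H u \<cdot> v) \<one> = antipode H \<one> \<cdot> \<one>"
    using coalg.sweedler_comult[OF one_closed coalg.vspC, of "\<lambda>u v. antipode H u \<cdot> v" "[(\<one>, \<one>)]"]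
    by (simp add: one_closed comult_one bilinear_onI Hlin1 Hlin2 antipode_linear antipode_closed lin_id)
  then show ?thesis using antipode_left[OF one_closed] antipode_closed[OF one_closed]
    by (simp add: counit_one one_right vsp_scale_simps(4)[OF vector_space])
qed

end

locale rb_points = C: cocommutative_coalgebra C + R: rota_baxter_hopf H B
  for C :: "('k::field, 'c::ab_group_add) hopf" and H :: "('k, 'a::ab_group_add) hopf" and B :: "'a \<Rightarrow> 'a"
begin

sublocale Q: hopf_points C H
  by (intro hopf_points.intro C.cocommutative_coalgebra_axioms R.cocommutative_hopf_algebra_axioms)

lemma B_point: "f \<in> points C H \<Longrightarrow> (\<lambda>c. B (f c)) \<in> points C H"
  by (rule points_comp[OF C.comultiplication_axioms R.coalg.vspC R.coalg.vspC _ R.coalgebra_map])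

text \<open>The identity for \<open>H\<close> at \<open>f u\<close> and \<open>g v\<close> splits
  \<open>u\<close> into three factors and leaves \<open>g\<close> on the last of four.
  Coassociativity and cocommutativity move \<open>g\<close> to the second place, where the
  expression is a word in the convolution product.\<close>

lemma B_points:
  assumes f: "f \<in> points C H" and g: "g \<in> points C H"
  shows "cmul C H (\<lambda>c. B (f c)) (\<lambda>c. B (g c)) =
    (\<lambda>c. B (cmul C H (\<lambda>c. B (f c)) (cmul C H g (cmul C H (\<lambda>c. antipode H (B (f c))) f)) c))"
proof
  fix c
  note fl = Q.points_lin[OF f] and gl = Q.points_lin[OF g] and fc = points_closed[OF f] and gc = points_closed[OF g]
  note Bl = coalgebra_map_linear[OF R.coalgebra_map] and Bc = coalgebra_map_closed[OF R.coalgebra_map]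
  note Sl = R.antipode_linear and Sc = R.antipode_closed and mc = R.mult_closed and V = R.coalg.vspC
  let ?m = "mult H" and ?S = "antipode H"
  show "cmul C H (\<lambda>c. B (f c)) (\<lambda>c. B (g c)) c = B (cmul C H (\<lambda>c. B (f c)) (cmul C H g (cmul C H (\<lambda>c. ?S (B (f c))) f)) c)"
  proof (cases "c \<in> carrier C")
    case c: True
    define \<Phi> where "\<Phi> = (\<lambda>p q w v. ?m (?m (?m (B (f p)) (g v)) (?S (B (f q)))) (f w))"
    have \<Phi>c: "\<Phi> p q w v \<in> carrier H" if "p \<in> carrier C" "q \<in> carrier C" "w \<in> carrier C" "v \<in> carrier C" for p q w v
      unfolding \<Phi>_def by (intro mc Bc Sc fc gc that)
    have \<Phi>l: "Q.lin (\<lambda>p. \<Phi> p q w v)" "Q.lin (\<lambda>q. \<Phi> p q w v)" "Q.lin (\<lambda>w. \<Phi> p q w v)" "Q.lin (\<lambda>v. \<Phi> p q w v)"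
      if "p \<in> carrier C" "q \<in> carrier C" "w \<in> carrier C" "v \<in> carrier C" for p q w v
      unfolding \<Phi>_def by (intro R.Hlin1 R.Hlin2 lin_comp[OF Sl] lin_comp[OF Bl] fl gl mc Bc Sc fc gc that)+
    have 1: "?m (B (f u)) (B (g v)) = B (sweedler C (\<lambda>p r. sweedler C (\<lambda>q w. \<Phi> p q w v) r) u)"
      if uv: "u \<in> carrier C" "v \<in> carrier C" for u v
    proof -
      have "?m (B (f u)) (B (g v)) = B (sweedler3 H (\<lambda>p q w. ?m (?m (?m (B p) (g v)) (?S (B q))) w) (f u))"
        by (rule R.rota_baxter[OF fc[OF uv(1)] gc[OF uv(2)]])
      also have "sweedler3 H (\<lambda>p q w. ?m (?m (?m (B p) (g v)) (?S (B q))) w) (f u)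
        = sweedler C (\<lambda>p r. sweedler H (\<lambda>q w. ?m (?m (?m (B (f p)) (g v)) (?S (B q))) w) (f r)) u"
        unfolding sweedler3_def
        by (rule Q.sweedler_point[symmetric, OF f uv(1) V])
          (intro bilinear_onI R.coalg.lin_param[OF _ V] R.coalg.lin_sweedler[OF V] R.Hlin1 R.Hlin2
            lin_comp[OF Sl] Bl lin_id mc Bc Sc gc uv; assumption)
      also have "\<dots> = sweedler C (\<lambda>p r. sweedler C (\<lambda>q w. \<Phi> p q w v) r) u"
        unfolding \<Phi>_def
        by (rule C.sweedler_cong[OF uv(1)], rule Q.sweedler_point[symmetric, OF f _ V], assumption)
          (intro bilinear_onI R.Hlin1 R.Hlin2 lin_comp[OF Sl] Bl lin_id mc Bc Sc gc fc uv; assumption)+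
      finally show ?thesis .
    qed
    have "cmul C H (\<lambda>c. B (f c)) (\<lambda>c. B (g c)) c = sweedler C (\<lambda>u v. B (sweedler C (\<lambda>p r. sweedler C (\<lambda>q w. \<Phi> p q w v) r) u)) c"
      unfolding cmul_def using c by (auto intro!: C.sweedler_cong[OF c] 1)
    also have "\<dots> = B (sweedler C (\<lambda>u v. sweedler C (\<lambda>p r. sweedler C (\<lambda>q w. \<Phi> p q w v) r) u) c)"
      by (rule C.sweedler_hom[symmetric, OF c V vsp_vs[OF V] Bl]) (intro C.sweedler_closed[OF _ V] \<Phi>c; assumption)
    also have "sweedler C (\<lambda>u v. sweedler C (\<lambda>p r. sweedler C (\<lambda>q w. \<Phi> p q w v) r) u) c
      = sweedler C (\<lambda>p s. sweedler C (\<lambda>r v. sweedler C (\<lambda>q w. \<Phi> p q w v) r) s) c"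
      by (rule C.coassoc3[OF c V, of "\<lambda>p r v. sweedler C (\<lambda>q w. \<Phi> p q w v) r"])
        (intro trilinear_onI C.lin_param[OF _ V] C.lin_sweedler[OF V lin_id] \<Phi>l; assumption)
    also have "\<dots> = sweedler C (\<lambda>p s. sweedler C (\<lambda>v r. sweedler C (\<lambda>q w. \<Phi> p q w v) r) s) c"
      by (rule C.sweedler_cong[OF c], rule C.cocomm[OF _ V, of _ "\<lambda>v r. sweedler C (\<lambda>q w. \<Phi> _ q w v) r"], assumption)
        (intro bilinear_onI C.lin_param[OF _ V] C.lin_sweedler[OF V lin_id] \<Phi>l; assumption)+
    also have "\<dots> = sweedler C (\<lambda>p s. sweedler C (\<lambda>v r. ?m (B (f p)) (?m (g v) (sweedler C (\<lambda>q w. ?m (?S (B (f q))) (f w)) r))) s) c"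
    proof (intro C.sweedler_cong[OF c] C.sweedler_cong)
      fix p s v r assume *: "p \<in> carrier C" "v \<in> carrier C" "r \<in> carrier C"
      have l: "linear_on (scale H) (scale H) (carrier H) (carrier H) (\<lambda>z. ?m (B (f p)) (?m (g v) z))"
        by (intro R.Hlin2 lin_id Bc fc gc *)
      have "?m (B (f p)) (?m (g v) (sweedler C (\<lambda>q w. ?m (?S (B (f q))) (f w)) r))
        = sweedler C (\<lambda>q w. ?m (B (f p)) (?m (g v) (?m (?S (B (f q))) (f w)))) r"
        by (rule C.sweedler_hom[OF *(3) V vsp_vs[OF V] l]) (intro mc Bc Sc fc; assumption)
      also have "\<dots> = sweedler C (\<lambda>q w. \<Phi> p q w v) r"
        unfolding \<Phi>_def by (intro C.sweedler_cong[OF *(3)]) (simp add: R.mult_assoc mc Bc Sc fc gc *)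
      finally show "sweedler C (\<lambda>q w. \<Phi> p q w v) r = ?m (B (f p)) (?m (g v) (sweedler C (\<lambda>q w. ?m (?S (B (f q))) (f w)) r))" ..
    qed
    also have "\<dots> = sweedler C (\<lambda>p s. ?m (B (f p)) (sweedler C (\<lambda>v r. ?m (g v) (sweedler C (\<lambda>q w. ?m (?S (B (f q))) (f w)) r)) s)) c"
      by (intro C.sweedler_cong[OF c] C.sweedler_hom[symmetric, OF _ V vsp_vs[OF V] bilinear_onD1[OF R.mult_bilinear]]
        C.sweedler_closed[OF _ V] mc Bc Sc fc gc; assumption)
    also have "\<dots> = cmul C H (\<lambda>c. B (f c)) (cmul C H g (cmul C H (\<lambda>c. ?S (B (f c))) f)) c"
      unfolding cmul_def using c by (auto intro!: C.sweedler_cong[OF c] C.sweedler_cong arg_cong2[of _ _ _ _ ?m])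
    finally show ?thesis .
  qed (simp add: cmul_def linear_on_zero[OF V R.vector_space Bl])
qed

text \<open>On points the identity for \<open>B\<close> reads B x B y = B (B x y (B x)^-1 x).
  Replacing both arguments by their inverses makes the argument on the right the inverse of x (P x)
  y (P x)^-1.\<close>

sublocale G: rb_group "points C H" "cmul C H" "cone C H" "\<lambda>f c. antipode H (f c)" "\<lambda>f c. B (antipode H (f c))"
proof (intro rb_group.intro Q.G.abstract_group_axioms rb_group_axioms.intro)
  fix f g assume f: "f \<in> points C H" and g: "g \<in> points C H"
  show Pf: "(\<lambda>c. B (antipode H (f c))) \<in> points C H" by (rule B_point[OF Q.antipode_point[OF f]])
  have eq: "(\<lambda>c. antipode H (cmul C H (cmul C H (cmul C H f (\<lambda>c. B (antipode H (f c)))) g) (\<lambda>c. antipode H (B (antipode H (f c)))) c))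
    = cmul C H (\<lambda>c. B (antipode H (f c))) (cmul C H (\<lambda>c. antipode H (g c)) (cmul C H (\<lambda>c. antipode H (B (antipode H (f c)))) (\<lambda>c. antipode H (f c))))"
    using f g Pf Q.antipode_point[OF Pf] Q.antipode_point[OF f] Q.antipode_point[OF g] Q.G.inv_inv[OF Pf]
    by (simp add: Q.G.inv_mul Q.G.assoc Q.cmul_point)
  show "cmul C H (\<lambda>c. B (antipode H (f c))) (\<lambda>c. B (antipode H (g c))) =
    (\<lambda>c. B (antipode H (cmul C H (cmul C H (cmul C H f (\<lambda>c. B (antipode H (f c)))) g) (\<lambda>c. antipode H (B (antipode H (f c)))) c)))"
    unfolding B_points[OF Q.antipode_point[OF f] Q.antipode_point[OF g]] by (rule ext) (simp add: fun_cong[OF eq])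
qed

end

text \<open>This is \<open>slice_in\<close> for the tensor
  \<open>F x\<^sub>1 \<otimes> K x\<^sub>2\<close>.\<close>

lemma sweedler_slice:
  assumes C: "comultiplication C" and x: "x \<in> carrier C"
    and V1: "vsp s1 V1" and V2: "vsp s2 V2" and Z: "vsp s3 Z"
    and F: "linear_on (scale C) s1 (carrier C) V1 F" and K: "linear_on (scale C) s2 (carrier C) V2 K"
    and b: "bilinear_on s1 s2 s3 V1 V2 Y \<Phi>"
    and sl: "\<And>\<chi>. linear_on s1 (*) V1 UNIV \<chi> \<Longrightarrow> sweedler C (\<lambda>u v. s2 (\<chi> (F u)) (K v)) x \<in> M"
    and \<Phi>: "\<And>u v. u \<in> V1 \<Longrightarrow> v \<in> M \<Longrightarrow> v \<in> V2 \<Longrightarrow> \<Phi> u v \<in> Z"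
  shows "sweedler C (\<lambda>u v. \<Phi> (F u) (K v)) x \<in> Z"
proof -
  interpret comultiplication C by fact
  let ?xs = "map (\<lambda>(u, v). (F u, K v)) (cop x)"
  have "(\<Sum>(u, v)\<leftarrow>?xs. \<Phi> u v) \<in> Z"
  proof (rule slice_in[OF V1 V2 Z b _ _ \<Phi>])
    show "set ?xs \<subseteq> V1 \<times> V2"
      using cop(1)[OF x] linear_on_closed[OF F] linear_on_closed[OF K] by auto
    show "(\<Sum>(u, v)\<leftarrow>?xs. s2 (\<chi> u) v) \<in> M" if "linear_on s1 (*) V1 UNIV \<chi>" for \<chi>
      using sl[OF that] by (simp add: sweedler_sum o_def case_prod_unfold)
  qed
  then show ?thesis by (simp add: sweedler_sum o_def case_prod_unfold)
qed

context hopf_points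
begin

lemma cmul_natural:
  assumes F: "linear_on (scale H) (scale H) (carrier H) (carrier H) F"
    and K: "linear_on (scale H) (scale H) (carrier H) (carrier H) K" and f: "f \<in> points C H"
  shows "cmul C H (\<lambda>c. F (f c)) (\<lambda>c. K (f c)) = (\<lambda>c. sweedler H (\<lambda>u v. mult H (F u) (K v)) (f c))"
proof
  fix c
  have b: "bilinear_on (scale H) (scale H) (scale H) (carrier H) (carrier H) (carrier H) (\<lambda>u v. mult H (F u) (K v))"
    by (intro bilinear_onI H.Hlin1 H.Hlin2 F K linear_on_closed[OF F] linear_on_closed[OF K])
  show "cmul C H (\<lambda>c. F (f c)) (\<lambda>c. K (f c)) c = sweedler H (\<lambda>u v. mult H (F u) (K v)) (f c)"
  proof (cases "c \<in> carrier C")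
    case c: True
    then show ?thesis unfolding cmul_def using sweedler_point[OF f c H.coalg.vspC b] by simp
  next
    case False
    then show ?thesis
      using linear_on_zero[OF H.coalg.vspC H.vector_space H.coalg.lin_sweedler_arg[OF H.coalg.vspC b]] points_outside[OF f False]
      by (simp add: cmul_def)
  qed
qed

text \<open>In Sweedler formulas for conjugation the outer factors split one leg and
  \<open>g\<close> takes the other. Moving \<open>g\<close> between them identifies the formula with
  a convolution word.\<close>

lemma conj_conv:
  assumes F: "lin F" and g: "lin g" and K: "lin K" and c: "c \<in> carrier C"
  shows "sweedler C (\<lambda>u v. sweedler C (\<lambda>p q. mult H (F p) (mult H (g v) (K q))) u) c = cmul C H F (cmul C H g K) c"
proof -
  note Fc = linear_on_closed[OF F] and gc = linear_on_closed[OF g] and Kc = linear_on_closed[OF K]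
  note V = H.coalg.vspC
  let ?\<Phi> = "\<lambda>p q v. mult H (F p) (mult H (g v) (K q))"
  have l: "lin (\<lambda>p. ?\<Phi> p q v)" "lin (\<lambda>q. ?\<Phi> p q v)" "lin (\<lambda>v. ?\<Phi> p q v)"
    if "p \<in> carrier C" "q \<in> carrier C" "v \<in> carrier C" for p q v
    by (intro H.Hlin1 H.Hlin2 F g K H.mult_closed Fc gc Kc that)+
  have "sweedler C (\<lambda>u v. sweedler C (\<lambda>p q. ?\<Phi> p q v) u) c = sweedler C (\<lambda>p v. sweedler C (\<lambda>q r. ?\<Phi> p q r) v) c"
    by (rule C.coassoc3[OF c V]) (intro trilinear_onI l; assumption)
  also have "\<dots> = sweedler C (\<lambda>p v. sweedler C (\<lambda>r q. ?\<Phi> p q r) v) c"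
    by (rule C.sweedler_cong[OF c], rule C.cocomm[OF _ V, of _ "\<lambda>r q. ?\<Phi> _ q r"], assumption)
      (intro bilinear_onI l; assumption)
  also have "\<dots> = sweedler C (\<lambda>p v. mult H (F p) (sweedler C (\<lambda>r q. mult H (g r) (K q)) v)) c"
    by (intro C.sweedler_cong[OF c] C.sweedler_hom[symmetric, OF _ V vsp_vs[OF V] bilinear_onD1[OF H.mult_bilinear]] H.mult_closed Fc gc Kc)
  also have "\<dots> = cmul C H F (cmul C H g K) c"
    unfolding cmul_def using c by (auto intro!: C.sweedler_cong[OF c])
  finally show ?thesis .
qed

text \<open>Convolving with this map is multiplication by \<open>x\<close>, so a Sweedler formula
  with a fixed element becomes a word in the convolution algebra and can be simplified
  there.\<close>

definition const where "const x = (\<lambda>c. if c \<in> carrier C then scale H (counit C c) x else 0)"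

lemma const_lin: "x \<in> carrier H \<Longrightarrow> lin (const x)"
  by (rule linear_on_cong[OF lin_scale1[OF H.coalg.vspC C.counit_linear] C.vspC]) (simp_all add: const_def)

lemma cmul_const_left:
  assumes x: "x \<in> carrier H" and f: "lin f" and c: "c \<in> carrier C"
  shows "cmul C H (const x) f c = mult H x (f c)"
proof -
  have "cmul C H (const x) f c = sweedler C (\<lambda>u v. scale H (counit C u) (mult H x (f v))) c"
    unfolding cmul_def using c linear_on_closed[OF f] x
    by (auto intro!: C.sweedler_cong[OF c] simp: const_def H.scale_mult_left)
  also have "\<dots> = mult H x (f c)"
    by (rule C.counit_left'[OF c H.coalg.vspC H.Hlin2[OF f x]])
  finally show ?thesis .
qed

lemma cmul_const_right:
  assumes x: "x \<in> carrier H" and f: "lin f" and c: "c \<in> carrier C"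
  shows "cmul C H f (const x) c = mult H (f c) x"
proof -
  have "cmul C H f (const x) c = sweedler C (\<lambda>u v. scale H (counit C v) (mult H (f u) x)) c"
    unfolding cmul_def using c linear_on_closed[OF f] x
    by (auto intro!: C.sweedler_cong[OF c] simp: const_def H.scale_mult_right)
  also have "\<dots> = mult H (f c) x"
    by (rule C.counit_right'[OF c H.coalg.vspC H.Hlin1[OF f x]])
  finally show ?thesis .
qed

lemma cmul_inv_lin:
  assumes f: "f \<in> points C H" and g: "lin g" "\<And>c. c \<notin> carrier C \<Longrightarrow> g c = 0"
  shows "cmul C H (\<lambda>c. antipode H (f c)) (cmul C H f g) = g" "cmul C H f (cmul C H (\<lambda>c. antipode H (f c)) g) = g"
proof -
  note a = antipode_point[OF f]
  show "cmul C H (\<lambda>c. antipode H (f c)) (cmul C H f g) = g"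
    unfolding cmul_assoc_lin[OF points_lin[OF a] points_lin[OF f] g(1), symmetric] G.inv_left[OF f]
    by (rule cone_left[OF g])
  show "cmul C H f (cmul C H (\<lambda>c. antipode H (f c)) g) = g"
    unfolding cmul_assoc_lin[OF points_lin[OF f] points_lin[OF a] g(1), symmetric] G.inv_right[OF f]
    by (rule cone_left[OF g])
qed

lemma cmul_outside: "c \<notin> carrier C \<Longrightarrow> cmul C H f g c = 0" "c \<notin> carrier C \<Longrightarrow> const x c = 0"
  by (simp_all add: cmul_def const_def)

lemma const_mult:
  assumes "x \<in> carrier H" "y \<in> carrier H" shows "cmul C H (const x) (const y) = const (mult H x y)"
proof
  fix c show "cmul C H (const x) (const y) c = const (mult H x y) c"
  proof (cases "c \<in> carrier C")
    case True
    then show ?thesis using cmul_const_left[OF assms(1) const_lin[OF assms(2)]] assms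
      by (simp add: const_def H.scale_mult_right)
  qed (simp add: cmul_outside)
qed

end

section \<open>The companion operator and the descendant product on the Hopf algebra itself\<close>

context rota_baxter_hopf
begin

abbreviation "N \<equiv> rb_tilde H B"
abbreviation "P x \<equiv> B (antipode H x)"

lemma rb_pointsI: "cocommutative_coalgebra C \<Longrightarrow> rb_points C H B"
  by (intro rb_points.intro rota_baxter_hopf_axioms)

interpretation pair: coalgebra_pair H H by (rule pair)
interpretation R1: rb_points H H B by (rule rb_pointsI[OF coalg.cocommutative_coalgebra_axioms])
interpretation R2: rb_points "tens H H" H B by (rule rb_pointsI[OF pair.coalgebra])

lemmas V = coalg.vspC

lemma B_lin: "linear_on (scale H) (scale H) (carrier H) (carrier H) B"
  by (rule coalgebra_map_linear[OF coalgebra_map])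

lemma P_lin: "linear_on (scale H) (scale H) (carrier H) (carrier H) (\<lambda>x. P x)"
  by (rule lin_comp[OF B_lin antipode_linear])

lemma SP_lin: "linear_on (scale H) (scale H) (carrier H) (carrier H) (\<lambda>x. antipode H (P x))"
  by (rule lin_comp[OF antipode_linear P_lin])

lemma B_closed: "x \<in> carrier H \<Longrightarrow> B x \<in> carrier H"
  by (rule linear_on_closed[OF B_lin])

lemma N_alt: "N x = sweedler H (\<lambda>u v. u \<cdot> P v) x"
  unfolding rb_tilde_def ..

text \<open>The inverse for the descendant product in Sweedler form, bracketed like the group word
  \<open>inv (P x) \<odot> inv x \<odot> P x\<close>.\<close>

definition Tinv where
  "Tinv x = sweedler H (\<lambda>u v. sweedler H (\<lambda>p q. antipode H (P p) \<cdot> antipode H q) u \<cdot> P v) x"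

lemma N_lin: "linear_on (scale H) (scale H) (carrier H) (carrier H) N"
  unfolding rb_tilde_def[abs_def]
  by (intro coalg.lin_sweedler_arg[OF V] bilinear_onI Hlin1 Hlin2 lin_id P_lin B_closed antipode_closed)

lemma N_closed: "x \<in> carrier H \<Longrightarrow> N x \<in> carrier H"
  by (rule linear_on_closed[OF N_lin])

lemma Tinv_inner_lin: "linear_on (scale H) (scale H) (carrier H) (carrier H) (sweedler H (\<lambda>p q. antipode H (P p) \<cdot> antipode H q))"
  by (intro coalg.lin_sweedler_arg[OF V] bilinear_onI Hlin1 Hlin2 antipode_linear SP_lin B_closed antipode_closed)

lemma Tinv_lin: "linear_on (scale H) (scale H) (carrier H) (carrier H) Tinv"
  unfolding Tinv_def[abs_def]
  by (intro coalg.lin_sweedler_arg[OF V] bilinear_onI Hlin1 Hlin2 Tinv_inner_lin P_lin B_closed antipode_closed linear_on_closed[OF Tinv_inner_lin])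

lemma Tinv_closed: "x \<in> carrier H \<Longrightarrow> Tinv x \<in> carrier H"
  by (rule linear_on_closed[OF Tinv_lin])

end

context rb_points
begin

lemma N_point: "f \<in> points C H \<Longrightarrow> G.N f = (\<lambda>c. rb_tilde H B (f c))"
  unfolding G.N_def R.N_alt[abs_def] using Q.cmul_natural[OF lin_id R.P_lin] .

lemma T_point: "f \<in> points C H \<Longrightarrow> G.T f = (\<lambda>c. R.Tinv (f c))"
  unfolding G.T_def R.Tinv_def[abs_def]
  by (simp add: Q.cmul_natural[OF R.SP_lin R.antipode_linear] Q.cmul_natural[OF R.Tinv_inner_lin R.P_lin])

end

context rota_baxter_hopf
begin

interpretation pair: coalgebra_pair H H by (rule pair)
interpretation R1: rb_points H H B by (rule rb_pointsI[OF coalg.cocommutative_coalgebra_axioms])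
interpretation R2: rb_points "tens H H" H B by (rule rb_pointsI[OF pair.coalgebra])

text \<open>In the group of \<open>H\<close>-points of \<open>H\<close> the companion of the
  identity point is again a point, that is, a coalgebra map.\<close>

lemma N_map: "coalgebra_map H H N"
  by (rule coalgebra_map_cong[OF coalg.cocommutative_coalgebra_axioms points_map[OF R1.G.closed(2)[OF coalg.id_point]]])
    (simp add: R1.N_point[OF coalg.id_point])

lemma Tinv_map: "coalgebra_map H H Tinv"
  by (rule coalgebra_map_cong[OF coalg.cocommutative_coalgebra_axioms points_map[OF R1.G.closed(3)[OF coalg.id_point]]])
    (simp add: R1.T_point[OF coalg.id_point])

lemma P_map: "coalgebra_map H H (\<lambda>x. P x)"
  by (rule coalgebra_map_comp[OF coalg.comultiplication_axioms V V antipode_map coalgebra_map])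

lemma N_Tinv: "x \<in> carrier H \<Longrightarrow> N (Tinv x) = antipode H (N x)"
  using fun_cong[OF R1.G.N_T[OF coalg.id_point], of x]
  by (simp add: R1.N_point R1.T_point coalg.id_point R1.G.closed(3)[OF coalg.id_point, unfolded R1.T_point[OF coalg.id_point]])

lemma P_Tinv: "x \<in> carrier H \<Longrightarrow> P (Tinv x) = antipode H (P x)"
  using fun_cong[OF R1.G.P_T[OF coalg.id_point], of x]
  by (simp add: R1.T_point coalg.id_point)

text \<open>Sweedler forms of the group operations of the same names; in \<open>circ\<close> the
  initial \<open>x \<odot> P x\<close> is collected into \<open>N x\<close>, so that
  \<open>x\<close> is split into two factors only.\<close>

definition circ where "circ x y = sweedler H (\<lambda>u v. N u \<cdot> (y \<cdot> antipode H (P v))) x"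
definition lam where "lam x y = sweedler H (\<lambda>u v. P u \<cdot> (y \<cdot> antipode H (P v))) x"
definition conj where "conj x y = sweedler H (\<lambda>u v. u \<cdot> (y \<cdot> antipode H v)) x"

lemma circ_bilinear: "bilinear_on (scale H) (scale H) (scale H) (carrier H) (carrier H) (carrier H) circ"
  unfolding circ_def[abs_def]
  by (intro bilinear_onI coalg.lin_param[OF _ V] coalg.lin_sweedler[OF V lin_id] Hlin1 Hlin2 N_lin SP_lin lin_id mult_closed N_closed
    B_closed antipode_closed; assumption)

lemma lam_bilinear: "bilinear_on (scale H) (scale H) (scale H) (carrier H) (carrier H) (carrier H) lam"
  unfolding lam_def[abs_def]
  by (intro bilinear_onI coalg.lin_param[OF _ V] coalg.lin_sweedler[OF V lin_id] Hlin1 Hlin2 P_lin SP_lin lin_id mult_closed N_closed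
    B_closed antipode_closed; assumption)

lemma conj_bilinear: "bilinear_on (scale H) (scale H) (scale H) (carrier H) (carrier H) (carrier H) conj"
  unfolding conj_def[abs_def]
  by (intro bilinear_onI coalg.lin_param[OF _ V] coalg.lin_sweedler[OF V lin_id] Hlin1 Hlin2 antipode_linear lin_id mult_closed N_closed
    B_closed antipode_closed; assumption)

lemmas circ_closed = bilinear_on_closed[OF circ_bilinear]
lemmas lam_closed = bilinear_on_closed[OF lam_bilinear]
lemmas conj_closed = bilinear_on_closed[OF conj_bilinear]

lemma conj_one: "y \<in> carrier H \<Longrightarrow> conj \<one> y = y"
  unfolding conj_def
  using coalg.sweedler_comult[OF one_closed V, of "\<lambda>u v. u \<cdot> (y \<cdot> antipode H v)" "[(\<one>, \<one>)]"]
  by (simp add: one_closed comult_one bilinear_onI Hlin1 Hlin2 antipode_linear antipode_closed lin_id mult_closed antipode_one one_left one_right)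

end

context rb_points
begin

lemma circ_point:
  assumes f: "f \<in> points C H" and g: "g \<in> points C H" and c: "c \<in> carrier C"
  shows "G.circ f g c = sweedler C (\<lambda>u v. R.circ (f u) (g v)) c"
proof -
  note fc = points_closed[OF f] and gc = points_closed[OF g]
  have "sweedler C (\<lambda>u v. R.circ (f u) (g v)) c
     = sweedler C (\<lambda>u v. sweedler C (\<lambda>p q. mult H (R.N (f p)) (mult H (g v) (antipode H (R.P (f q))))) u) c"
    unfolding R.circ_def
    by (rule C.sweedler_cong[OF c], rule Q.sweedler_point[symmetric, OF f _ R.V], assumption)
      (intro bilinear_onI R.Hlin1 R.Hlin2 R.N_lin R.SP_lin R.mult_closed R.N_closed R.B_closed R.antipode_closed gc; assumption)
  also have "\<dots> = cmul C H (\<lambda>c. R.N (f c)) (cmul C H g (\<lambda>c. antipode H (R.P (f c)))) c"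
    by (rule Q.conj_conv[OF lin_comp[OF R.N_lin Q.points_lin[OF f]] Q.points_lin[OF g] lin_comp[OF R.SP_lin Q.points_lin[OF f]] c])
  also have "\<dots> = G.circ f g c"
    unfolding N_point[OF f, symmetric] G.circ_def G.N_def[symmetric] using f g
    by (subst Q.G.assoc) (auto intro: Q.G.inv_closed[OF G.P_closed])
  finally show ?thesis ..
qed

lemma lam_point:
  assumes f: "f \<in> points C H" and g: "g \<in> points C H" and c: "c \<in> carrier C"
  shows "G.lam f g c = sweedler C (\<lambda>u v. R.lam (f u) (g v)) c"
proof -
  note fc = points_closed[OF f] and gc = points_closed[OF g]
  have "sweedler C (\<lambda>u v. R.lam (f u) (g v)) c
     = sweedler C (\<lambda>u v. sweedler C (\<lambda>p q. mult H (R.P (f p)) (mult H (g v) (antipode H (R.P (f q))))) u) c"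
    unfolding R.lam_def
    by (rule C.sweedler_cong[OF c], rule Q.sweedler_point[symmetric, OF f _ R.V], assumption)
      (intro bilinear_onI R.Hlin1 R.Hlin2 R.P_lin R.SP_lin R.mult_closed R.N_closed R.B_closed R.antipode_closed gc; assumption)
  also have "\<dots> = cmul C H (\<lambda>c. R.P (f c)) (cmul C H g (\<lambda>c. antipode H (R.P (f c)))) c"
    by (rule Q.conj_conv[OF lin_comp[OF R.P_lin Q.points_lin[OF f]] Q.points_lin[OF g] lin_comp[OF R.SP_lin Q.points_lin[OF f]] c])
  also have "\<dots> = G.lam f g c"
    unfolding G.lam_def using f g
    by (subst Q.G.assoc) (auto intro: Q.G.inv_closed[OF G.P_closed] G.P_closed)
  finally show ?thesis ..
qed

end

context rota_baxter_hopf
begin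

interpretation pair: coalgebra_pair H H by (rule pair)
interpretation R1: rb_points H H B by (rule rb_pointsI[OF coalg.cocommutative_coalgebra_axioms])
interpretation R2: rb_points "tens H H" H B by (rule rb_pointsI[OF pair.coalgebra])

abbreviation "p1 \<equiv> proj1 H H"
abbreviation "p2 \<equiv> proj2 H H"
abbreviation "pt \<equiv> tensor_of H H"

lemma pt_in_tens: "x \<in> carrier H \<Longrightarrow> y \<in> carrier H \<Longrightarrow> pt x y \<in> carrier (tens H H)"
  by (simp add: pair.pt_in)

lemma point2_sweedler:
  assumes W: "W \<in> points (tens H H) H" and x: "x \<in> carrier H" and y: "y \<in> carrier H" and U: "vsp s U"
    and b: "bilinear_on (scale H) (scale H) s (carrier H) (carrier H) U \<Phi>"
  shows "sweedler H \<Phi> (W (pt x y)) = sweedler H (\<lambda>x1 x2. sweedler H (\<lambda>y1 y2. \<Phi> (W (pt x1 y1)) (W (pt x2 y2))) y) x"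
proof -
  have Wl: "linear_on tensor_scale (scale H) HH (carrier H) W"
    using coalgebra_map_linear[OF points_map[OF W]] by simp
  have "sweedler H \<Phi> (W (pt x y)) = sweedler (tens H H) (\<lambda>u v. \<Phi> (W u) (W v)) (pt x y)"
    by (rule R2.Q.sweedler_point[symmetric, OF W pt_in_tens[OF x y] U b])
  also have "\<dots> = sweedler H (\<lambda>x1 x2. sweedler H (\<lambda>y1 y2. \<Phi> (W (pt x1 y1)) (W (pt x2 y2))) y) x"
    by (rule pair.sweedler_tens[OF x y U]) (intro bilinear_onI lin_bil1[OF b] lin_bil2[OF b] Wl linear_on_closed[OF Wl])
  finally show ?thesis .
qed

text \<open>The descendant product as a point of \<open>H \<otimes> H\<close>. Its laws in two
  variables are read off in the group of these points.\<close>

abbreviation "circ12 \<equiv> R2.G.circ p1 p2"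

lemma circ12: "x \<in> carrier H \<Longrightarrow> y \<in> carrier H \<Longrightarrow> circ12 (pt x y) = circ x y"
  using R2.circ_point[OF pair.proj1_point pair.proj2_point pt_in_tens] pair.eval_indep[OF _ _ V circ_bilinear lin_id lin_id]
  by simp

lemma circ12_point: "circ12 \<in> points (tens H H) H"
  by (rule R2.G.closed(1)[OF pair.proj1_point pair.proj2_point])

lemma sweedler_circ:
  assumes "x \<in> carrier H" "y \<in> carrier H" "vsp s U" "bilinear_on (scale H) (scale H) s (carrier H) (carrier H) U \<Phi>"
  shows "sweedler H \<Phi> (circ x y) = sweedler H (\<lambda>x1 x2. sweedler H (\<lambda>y1 y2. \<Phi> (circ x1 y1) (circ x2 y2)) y) x"
  using point2_sweedler[OF circ12_point assms] assms(1,2) unfolding circ12[OF assms(1,2)]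
  by (simp add: circ12 cong: coalg.sweedler_cong)

lemma N_circ: "x \<in> carrier H \<Longrightarrow> y \<in> carrier H \<Longrightarrow> N (circ x y) = N x \<cdot> N y"
proof -
  assume xy: "x \<in> carrier H" "y \<in> carrier H"
  have "N (circ12 (pt x y)) = cmul (tens H H) H (\<lambda>c. N (p1 c)) (\<lambda>c. N (p2 c)) (pt x y)"
    using fun_cong[OF R2.G.N_circ[OF pair.proj1_point pair.proj2_point], of "pt x y"]
    by (simp add: R2.N_point pair.proj1_point pair.proj2_point circ12_point)
  also have "\<dots> = N x \<cdot> N y"
    unfolding cmul_def using pair.eval_indep[OF xy V mult_bilinear N_lin N_lin] pt_in_tens[OF xy] by simp
  finally show ?thesis using circ12[OF xy] by simp
qed

lemma P_circ: "x \<in> carrier H \<Longrightarrow> y \<in> carrier H \<Longrightarrow> P (circ x y) = P x \<cdot> P y"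
proof -
  assume xy: "x \<in> carrier H" "y \<in> carrier H"
  have "P (circ12 (pt x y)) = cmul (tens H H) H (\<lambda>c. P (p1 c)) (\<lambda>c. P (p2 c)) (pt x y)"
    by (rule fun_cong[OF R2.G.P_circ[OF pair.proj1_point pair.proj2_point], of "pt x y"])
  also have "\<dots> = P x \<cdot> P y"
    unfolding cmul_def using pair.eval_indep[OF xy V mult_bilinear P_lin P_lin] pt_in_tens[OF xy] by simp
  finally show ?thesis using circ12[OF xy] by simp
qed

text \<open>This is \<open>x \<circ> (T x \<circ> y) = y\<close> at the two projections; only
  \<open>x\<close> occurs twice, so only \<open>x\<close> is split.\<close>

lemma circ_Tinv_circ:
  assumes x: "x \<in> carrier H" and y: "y \<in> carrier H"
  shows "sweedler H (\<lambda>u v. circ u (circ (Tinv v) y)) x = scale H (counit H x) y"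
proof -
  note p = pair.proj1_point pair.proj2_point
  note t = R2.G.closed(3)[OF p(1)]
  let ?K = "R2.G.circ (R2.G.T p1) p2"
  note K = R2.G.closed(1)[OF t p(2)]
  have Kl: "linear_on tensor_scale (scale H) HH (carrier H) ?K"
    using coalgebra_map_linear[OF points_map[OF K]] by simp
  have Ke: "?K (pt a y) = circ (Tinv a) y" if a: "a \<in> carrier H" for a
    using R2.circ_point[OF t p(2) pt_in_tens[OF a y]] pair.eval_indep[OF a y V circ_bilinear Tinv_lin lin_id]
    by (simp add: R2.T_point[OF p(1)])
  have "R2.G.circ p1 ?K (pt x y) = sweedler H (\<lambda>u v. circ u (?K (pt v y))) x"
    using R2.circ_point[OF p(1) K pt_in_tens[OF x y]] pair.evalL[OF x y V circ_bilinear lin_id Kl] by simp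
  also have "\<dots> = sweedler H (\<lambda>u v. circ u (circ (Tinv v) y)) x"
    by (rule coalg.sweedler_cong[OF x]) (simp add: Ke)
  finally show ?thesis using R2.G.circ_cancel(2)[OF p] by (simp add: pair.proj2_pure x y)
qed

text \<open>Conjugation of \<open>z\<close> by \<open>w\<close> in the descendant. Defining it
  through a point makes its compatibility with the comultiplication automatic; the explicit formula
  is \<open>ad_circ\<close>.\<close>

definition ad where "ad w z = R2.G.circ p1 (R2.G.circ p2 (R2.G.T p1)) (pt w z)"

lemma adp: "R2.G.circ p1 (R2.G.circ p2 (R2.G.T p1)) \<in> points (tens H H) H"
  by (intro R2.G.closed pair.proj1_point pair.proj2_point)

lemma ad_lin: "linear_on tensor_scale (scale H) HH (carrier H) (R2.G.circ p1 (R2.G.circ p2 (R2.G.T p1)))"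
  using coalgebra_map_linear[OF points_map[OF adp]] by simp

lemma ad_bilinear: "bilinear_on (scale H) (scale H) (scale H) (carrier H) (carrier H) (carrier H) ad"
  unfolding ad_def[abs_def] by (intro bilinear_onI lin_comp[OF ad_lin] lin_pure1 lin_pure2 lin_id)

lemmas ad_closed = bilinear_on_closed[OF ad_bilinear]

lemma sweedler_ad:
  assumes "x \<in> carrier H" "y \<in> carrier H" "vsp s U" "bilinear_on (scale H) (scale H) s (carrier H) (carrier H) U \<Phi>"
  shows "sweedler H \<Phi> (ad x y) = sweedler H (\<lambda>x1 x2. sweedler H (\<lambda>y1 y2. \<Phi> (ad x1 y1) (ad x2 y2)) y) x"
  unfolding ad_def by (rule point2_sweedler[OF adp assms])

text \<open>Behind it is the group identity
  \<open>w \<circ> z = (w \<circ> z \<circ> T w) \<circ> w\<close>; by cocommutativity either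
  Sweedler factor of \<open>w\<close> may go into \<open>ad\<close>.\<close>

lemma circ_ad:
  assumes w: "w \<in> carrier H" and z: "z \<in> carrier H"
  shows "circ w z = sweedler H (\<lambda>u v. circ (ad v z) u) w"
proof -
  note p = pair.proj1_point pair.proj2_point
  let ?A = "R2.G.circ p1 (R2.G.circ p2 (R2.G.T p1))"
  have b: "bilinear_on (scale H) (scale H) (scale H) (carrier H) (carrier H) (carrier H) (\<lambda>x y. circ y x)"
    using circ_bilinear unfolding bilinear_on_def by auto
  have "circ w z = R2.G.circ ?A p1 (pt w z)"
    using circ12[OF w z] p by (simp add: R2.G.circ_assoc)
  also have "\<dots> = sweedler (tens H H) (\<lambda>u v. circ (?A u) (p1 v)) (pt w z)"
    by (rule R2.circ_point[OF adp p(1) pt_in_tens[OF w z]])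
  also have "\<dots> = sweedler (tens H H) (\<lambda>u v. circ (?A v) (p1 u)) (pt w z)"
    by (rule R2.C.cocomm[symmetric, OF pt_in_tens[OF w z] V])
      (simp, intro bilinear_onI lin_bil1[OF circ_bilinear] lin_bil2[OF circ_bilinear] ad_lin pair.proj1_linear
        linear_on_closed[OF ad_lin] linear_on_closed[OF pair.proj1_linear])
  also have "\<dots> = sweedler H (\<lambda>u v. circ (ad v z) u) w"
    unfolding ad_def using pair.evalL[OF w z V b lin_id ad_lin] by simp
  finally show ?thesis .
qed

lemma ad_circ:
  assumes w: "w \<in> carrier H" and z: "z \<in> carrier H"
  shows "ad w z = sweedler H (\<lambda>u v. circ u (circ z (Tinv v))) w"
proof -
  note p = pair.proj1_point pair.proj2_point
  note t = R2.G.closed(3)[OF p(1)]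
  let ?K = "R2.G.circ p2 (R2.G.T p1)"
  note K = R2.G.closed(1)[OF p(2) t]
  have Kl: "linear_on tensor_scale (scale H) HH (carrier H) ?K"
    using coalgebra_map_linear[OF points_map[OF K]] by simp
  have Ke: "?K (pt a z) = circ z (Tinv a)" if a: "a \<in> carrier H" for a
    using R2.circ_point[OF p(2) t pt_in_tens[OF a z]] pair.eval_swap[OF a z V circ_bilinear Tinv_lin lin_id]
    by (simp add: R2.T_point[OF p(1)])
  have "ad w z = sweedler H (\<lambda>u v. circ u (?K (pt v z))) w"
    unfolding ad_def using R2.circ_point[OF p(1) K pt_in_tens[OF w z]] pair.evalL[OF w z V circ_bilinear lin_id Kl] by simp
  also have "\<dots> = sweedler H (\<lambda>u v. circ u (circ z (Tinv v))) w"
    by (rule coalg.sweedler_cong[OF w]) (simp add: Ke)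
  finally show ?thesis .
qed

lemma N_ad:
  assumes w: "w \<in> carrier H" and z: "z \<in> carrier H"
  shows "N (ad w z) = sweedler H (\<lambda>u v. N u \<cdot> (N z \<cdot> antipode H (N v))) w"
proof -
  have "N (ad w z) = sweedler H (\<lambda>u v. N (circ u (circ z (Tinv v)))) w"
    unfolding ad_circ[OF w z]
    by (rule coalg.sweedler_hom[OF w V vector_space N_lin]) (intro circ_closed z Tinv_closed)
  also have "\<dots> = sweedler H (\<lambda>u v. N u \<cdot> (N z \<cdot> antipode H (N v))) w"
    using z by (intro coalg.sweedler_cong[OF w]) (simp add: N_circ circ_closed Tinv_closed N_Tinv)
  finally show ?thesis .
qed

section \<open>Translations between the product, the descendant product and the conjugations\<close>

abbreviation "cm \<equiv> cmul H H"
abbreviation "idP \<equiv> (\<lambda>c. P (idp c))"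
abbreviation "idSP \<equiv> (\<lambda>c. antipode H (P (idp c)))"
abbreviation "idN \<equiv> (\<lambda>c. N (idp c))"
abbreviation "idS \<equiv> (\<lambda>c. antipode H (idp c))"

lemma id_points:
  "idp \<in> points H H" "idP \<in> points H H" "idSP \<in> points H H" "idN \<in> points H H" "idS \<in> points H H"
  using coalg.id_point R1.G.P_closed[OF coalg.id_point] R1.Q.antipode_point[OF R1.G.P_closed[OF coalg.id_point]]
    R1.G.closed(2)[OF coalg.id_point] R1.Q.antipode_point[OF coalg.id_point] by (simp_all add: R1.N_point)

lemmas id_lins = id_points[THEN R1.Q.points_lin]

lemma N_conv: "idN = cm idp idP"
  using R1.N_point[OF id_points(1)] unfolding R1.G.N_def by simp

abbreviation "kc \<equiv> R1.Q.const"
abbreviation "lamf z \<equiv> cm idP (cm (kc z) idSP)"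
abbreviation "circf z \<equiv> cm idN (cm (kc z) idSP)"

lemma lamf: "w \<in> carrier H \<Longrightarrow> z \<in> carrier H \<Longrightarrow> lamf z w = lam w z"
  unfolding lam_def cmul_def[of H H idP]
  by (auto intro!: coalg.sweedler_cong simp: R1.Q.cmul_const_left[OF _ id_lins(3)])

lemma circf: "w \<in> carrier H \<Longrightarrow> z \<in> carrier H \<Longrightarrow> circf z w = circ w z"
  unfolding circ_def cmul_def[of H H idN]
  by (auto intro!: coalg.sweedler_cong simp: R1.Q.cmul_const_left[OF _ id_lins(3)])

lemma ccm_lin: "R1.Q.lin f \<Longrightarrow> R1.Q.lin g \<Longrightarrow> R1.Q.lin (cm f g)"
  by (rule R1.Q.cmul_lin)

lemmas cassoc = R1.Q.cmul_assoc_lin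

text \<open>\<open>N\<close> is the convolution of the identity with \<open>P\<close>; splitting off
  the identity leaves the word of \<open>lam\<close>.\<close>

lemma circ_via_lam:
  assumes w: "w \<in> carrier H" and z: "z \<in> carrier H"
  shows "circ w z = sweedler H (\<lambda>u v. u \<cdot> lam v z) w"
proof -
  have "circf z = cm idp (lamf z)"
    unfolding N_conv by (intro cassoc id_lins ccm_lin R1.Q.const_lin z)
  then have "circ w z = cm idp (lamf z) w" using circf[OF w z] by simp
  also have "\<dots> = sweedler H (\<lambda>u v. u \<cdot> lam v z) w"
    unfolding cmul_def[of H H idp] using w z by (auto intro!: coalg.sweedler_cong simp: lamf)
  finally show ?thesis .
qed

lemma lam_via_circ:
  assumes w: "w \<in> carrier H" and z: "z \<in> carrier H"
  shows "lam w z = sweedler H (\<lambda>u v. antipode H u \<cdot> circ v z) w"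
proof -
  have l: "R1.Q.lin (lamf z)" by (intro id_lins ccm_lin R1.Q.const_lin z)
  have "circf z = cm idp (lamf z)"
    unfolding N_conv by (intro cassoc id_lins ccm_lin R1.Q.const_lin z)
  then have "cm idS (circf z) = lamf z"
    using R1.Q.cmul_inv_lin(1)[OF id_points(1) l] by (simp add: R1.Q.cmul_outside)
  then have "lam w z = cm idS (circf z) w" using lamf[OF w z] by simp
  also have "\<dots> = sweedler H (\<lambda>u v. antipode H u \<cdot> circ v z) w"
    unfolding cmul_def[of H H idS] using w z by (auto intro!: coalg.sweedler_cong simp: circf)
  finally show ?thesis .
qed

lemma lam_Tinv:
  assumes w: "w \<in> carrier H" and z: "z \<in> carrier H"
  shows "lam (Tinv w) z = cm idSP (cm (kc z) idP) w"
proof -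
  have "lam (Tinv w) z = sweedler H (\<lambda>u v. P (Tinv u) \<cdot> (z \<cdot> antipode H (P (Tinv v)))) w"
    unfolding lam_def
    by (rule sweedler_map[OF coalg.comultiplication_axioms V Tinv_map w V])
      (intro bilinear_onI Hlin1 Hlin2 P_lin SP_lin mult_closed B_closed antipode_closed z)
  also have "\<dots> = sweedler H (\<lambda>u v. antipode H (P u) \<cdot> (z \<cdot> P v)) w"
    by (intro coalg.sweedler_cong[OF w]) (simp add: P_Tinv antipode_antipode B_closed antipode_closed)
  also have "\<dots> = cm idSP (cm (kc z) idP) w"
    unfolding cmul_def[of H H idSP] using w z
    by (auto intro!: coalg.sweedler_cong simp: R1.Q.cmul_const_left[OF _ id_lins(2)])
  finally show ?thesis .
qed

text \<open>In a group \<open>x \<circ> lam (T x) z\<close> is the product of \<open>x\<close> and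
  \<open>z\<close>, because \<open>P (T x)\<close> inverts \<open>P x\<close>. It rewrites ordinary
  products as descendant products, for which \<open>N\<close> is multiplicative.\<close>

lemma mult_via_circ:
  assumes x: "x \<in> carrier H" and z: "z \<in> carrier H"
  shows "x \<cdot> z = sweedler H (\<lambda>u v. circ u (lam (Tinv v) z)) x"
proof -
  let ?g = "cm idSP (cm (kc z) idP)"
  have g: "R1.Q.lin ?g" by (intro id_lins ccm_lin R1.Q.const_lin z)
  note k = R1.Q.const_lin[OF z]
  have "sweedler H (\<lambda>u v. circ u (lam (Tinv v) z)) x
    = sweedler H (\<lambda>u v. sweedler H (\<lambda>p q. idN p \<cdot> (?g v \<cdot> idSP q)) u) x"
    unfolding circ_def using z
    by (intro coalg.sweedler_cong[OF x] coalg.sweedler_cong) (simp_all add: lam_Tinv)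
  also have "\<dots> = cm idN (cm ?g idSP) x"
    by (rule R1.Q.conj_conv[OF id_lins(4) g id_lins(3) x])
  also have "cm ?g idSP = cm idSP (cm (kc z) (cm idP idSP))"
    using k id_lins by (simp add: cassoc ccm_lin)
  also have "cm idP idSP = cone H H" by (rule R1.Q.G.inv_right[OF id_points(2)])
  also have "cm (kc z) (cone H H) = kc z"
    using R1.Q.const_mult[OF z one_closed] unfolding R1.Q.const_def[of \<one>] cone_def[symmetric]
    using z by (simp add: one_right)
  also have "cm idN (cm idSP (kc z)) = cm idp (cm idP (cm idSP (kc z)))"
    unfolding N_conv by (intro cassoc id_lins ccm_lin k)
  also have "cm idP (cm idSP (kc z)) = kc z"
    by (rule R1.Q.cmul_inv_lin(2)[OF id_points(2) k]) (simp add: R1.Q.cmul_outside)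
  also have "cm idp (kc z) x = x \<cdot> z"
    using R1.Q.cmul_const_right[OF z id_lins(1) x] x by simp
  finally show ?thesis ..
qed

lemma lam_mult:
  assumes w: "w \<in> carrier H" and c: "c \<in> carrier H" and m: "m \<in> carrier H"
  shows "lam w (c \<cdot> m) = sweedler H (\<lambda>u v. lam u c \<cdot> lam v m) w"
proof -
  note k = R1.Q.const_lin[OF c] R1.Q.const_lin[OF m]
  have "cm (lamf c) (lamf m) = cm idP (cm (kc c) (cm idSP (cm idP (cm (kc m) idSP))))"
    using k id_lins by (simp add: cassoc ccm_lin)
  also have "cm idSP (cm idP (cm (kc m) idSP)) = cm (kc m) idSP"
    by (rule R1.Q.cmul_inv_lin(1)[OF id_points(2) ccm_lin[OF k(2) id_lins(3)]]) (simp add: R1.Q.cmul_outside)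
  also have "cm (kc c) (cm (kc m) idSP) = cm (kc (c \<cdot> m)) idSP"
    unfolding R1.Q.const_mult[OF c m, symmetric] by (rule cassoc[symmetric, OF k id_lins(3)])
  finally have "lam w (c \<cdot> m) = cm (lamf c) (lamf m) w"
    using lamf[OF w mult_closed[OF c m]] by simp
  also have "\<dots> = sweedler H (\<lambda>u v. lam u c \<cdot> lam v m) w"
    unfolding cmul_def[of H H "lamf c"] using w c m by (auto intro!: coalg.sweedler_cong simp: lamf)
  finally show ?thesis .
qed

lemma conj_N:
  assumes w: "w \<in> carrier H" and z: "z \<in> carrier H"
  shows "conj (N w) z = cm idN (cm (kc z) (\<lambda>c. antipode H (N (idp c)))) w"
proof -
  have l: "R1.Q.lin (\<lambda>c. antipode H (N (idp c)))"
    by (rule R1.Q.points_lin[OF R1.Q.antipode_point[OF id_points(4)]])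
  have "conj (N w) z = sweedler H (\<lambda>u v. N u \<cdot> (z \<cdot> antipode H (N v))) w"
    unfolding conj_def
    by (rule sweedler_map[OF coalg.comultiplication_axioms V N_map w V])
      (intro bilinear_onI Hlin1 Hlin2 antipode_linear lin_id mult_closed antipode_closed z)
  also have "\<dots> = cm idN (cm (kc z) (\<lambda>c. antipode H (N (idp c)))) w"
    unfolding cmul_def[of H H idN] using w z
    by (auto intro!: coalg.sweedler_cong simp: R1.Q.cmul_const_left[OF _ l])
  finally show ?thesis .
qed

text \<open>Since (P m)^-1 is (N m)^-1 m, the word for \<open>m \<circ> c\<close> is the conjugate
  of \<open>c\<close> by \<open>N m\<close>, followed by \<open>m\<close>. Apart from its last
  factor it sees \<open>m\<close> only through \<open>N\<close>, which is what the coaction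
  controls.\<close>

lemma circ_via_conj:
  assumes m: "m \<in> carrier H" and c: "c \<in> carrier H"
  shows "circ m c = sweedler H (\<lambda>u v. conj (N u) c \<cdot> v) m"
proof -
  let ?sn = "\<lambda>c. antipode H (N (idp c))"
  have sn: "?sn \<in> points H H" by (rule R1.Q.antipode_point[OF id_points(4)])
  note l = R1.Q.points_lin[OF sn] and k = R1.Q.const_lin[OF c]
  have "?sn = cm idSP idS"
    using R1.Q.G.inv_mul[OF id_points(1) id_points(2)] unfolding N_conv[symmetric] by simp
  then have "cm ?sn idp = cm idSP (cm idS idp)" by (simp add: cassoc[OF id_lins(3,5,1)])
  also have "\<dots> = idSP"
    using R1.Q.G.inv_left[OF id_points(1)] R1.Q.G.e_right[OF id_points(3)] by simp
  finally have s: "cm ?sn idp = idSP" .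
  have "sweedler H (\<lambda>u v. conj (N u) c \<cdot> v) m = cm (cm idN (cm (kc c) ?sn)) idp m"
    unfolding cmul_def[of H H _ idp] using m c by (auto intro!: coalg.sweedler_cong simp: conj_N)
  also have "cm (cm idN (cm (kc c) ?sn)) idp = cm idN (cm (kc c) (cm ?sn idp))"
    using l k id_lins by (simp add: cassoc ccm_lin)
  also have "\<dots> = circf c" unfolding s ..
  finally show ?thesis using circf[OF m c] by simp
qed

end

section \<open>The kernel of the companion operator\<close>

lemma separating_functional:
  fixes s :: "'k::field \<Rightarrow> 'a::ab_group_add \<Rightarrow> 'a"
  assumes M: "vsp s M" and y: "y \<notin> M"
  shows "\<exists>\<omega>. linear_on s (*) UNIV UNIV \<omega> \<and> \<omega> y = 1 \<and> (\<forall>m\<in>M. \<omega> m = 0)"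
proof -
  interpret vector_space s by (rule vsp_vs[OF M])
  interpret k: Vector_Spaces.vector_space "(*) :: 'k \<Rightarrow> 'k \<Rightarrow> 'k" by (rule vs_field)
  interpret p: vector_space_pair s "(*) :: 'k \<Rightarrow> 'k \<Rightarrow> 'k" ..
  obtain D where D: "D \<subseteq> M" "independent D" "M \<subseteq> span D" by (rule maximal_independent_subset)
  have "span D = M" using D vsp_sub[OF M] by (metis span_subspace)
  then have yD: "y \<notin> D" and "y \<notin> span D" using y D by auto
  then have ind: "independent (insert y D)" using independent_insertI[OF _ D(2)] by blast
  obtain \<omega> where \<omega>: "Vector_Spaces.linear s (*) \<omega>" "\<forall>x\<in>insert y D. \<omega> x = (if x = y then 1 else 0)"
    using p.linear_independent_extend[OF ind, of "\<lambda>x. if x = y then 1 else 0"] by auto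
  interpret w: Vector_Spaces.linear s "(*)" \<omega> by (rule \<omega>(1))
  have "\<omega> m = 0" if "m \<in> M" for m
  proof -
    have "m \<in> span D" using that D by auto
    then show ?thesis by (rule w.eq_0_on_span[rotated]) (use \<omega>(2) yD in auto)
  qed
  then show ?thesis using \<omega>(2) by (intro exI[of _ \<omega>]) (auto simp: linear_on_def w.add w.scale)
qed

lemma linear_on_section:
  fixes s :: "'k::field \<Rightarrow> 'a::ab_group_add \<Rightarrow> 'a" and s' :: "'k \<Rightarrow> 'b::ab_group_add \<Rightarrow> 'b"
  assumes V: "vsp s V" and s': "vector_space s'" and f: "linear_on s s' V W f"
  shows "\<exists>g. linear_on s' s UNIV V g \<and> (\<forall>v\<in>V. f (g (f v)) = f v)"
proof -
  interpret v: vector_space s by (rule vsp_vs[OF V])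
  interpret v': Vector_Spaces.vector_space s' by (rule s')
  interpret p: vector_space_pair s s ..
  interpret q: vector_space_pair s s' ..
  obtain h where h: "Vector_Spaces.linear s s h" "range h \<subseteq> V" "\<And>v. v \<in> V \<Longrightarrow> h v = v"
    using p.linear_exists_left_inverse_on[OF v.linear_id vsp_sub[OF V]] by auto
  interpret h: Vector_Spaces.linear s s h by (rule h(1))
  have hV: "h x \<in> V" for x using h(2) by auto
  have "Vector_Spaces.linear s s' (\<lambda>x. f (h x))"
    by unfold_locales (simp_all add: h.add h.scale linear_on_add[OF f hV hV] linear_on_scale[OF f hV])
  from q.linear_exists_right_inverse_on[OF this vsp_sub[OF V]]
  obtain g where g: "range g \<subseteq> V" "Vector_Spaces.linear s' s g" "\<forall>v\<in>(\<lambda>x. f (h x)) ` V. f (h (g v)) = v" by auto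
  interpret g: Vector_Spaces.linear s' s g by (rule g(2))
  have gV: "g v \<in> V" for v using g(1) by auto
  have "f (g (f v)) = f v" if "v \<in> V" for v
    using g(3) that h(3)[OF gV] h(3)[OF that] by (metis image_eqI)
  then show ?thesis using gV by (intro exI[of _ g]) (auto simp: linear_on_def g.add g.scale)
qed

lemma subspace_eq_of_dim_le:
  fixes s :: "'k::field \<Rightarrow> 'a::ab_group_add \<Rightarrow> 'a"
  assumes U: "vsp s U" and W: "vsp s W" and sub: "U \<subseteq> W" and F: "finite F" "W \<subseteq> module.span s F"
    and dim: "vector_space.dim s W \<le> vector_space.dim s U"
  shows "U = W"
proof (rule ccontr)
  interpret vector_space s by (rule vsp_vs[OF U])
  assume "U \<noteq> W"
  then obtain w where w: "w \<in> W" "w \<notin> U" using sub by auto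
  obtain D where D: "D \<subseteq> U" "independent D" "U \<subseteq> span D" "card D = dim U" by (rule basis_exists)
  obtain E where E: "E \<subseteq> W" "independent E" "W \<subseteq> span E" "card E = dim W" by (rule basis_exists)
  have finE: "finite E" using independent_span_bound[OF F(1) E(2)] E(1) F(2) by auto
  have D': "finite D" using independent_span_bound[OF F(1) D(2)] D(1) sub F(2) by auto
  have "span D = U" using D vsp_sub[OF U] by (metis span_subspace)
  then have "w \<notin> D" "w \<notin> span D" using w D by auto
  then have "independent (insert w D)" using independent_insertI[OF _ D(2)] by blast
  then have "card (insert w D) \<le> card E"
    using independent_span_bound[OF finE, of "insert w D"] w(1) D(1) sub E(3) by auto
  then show False using \<open>w \<notin> D\<close> D' D(4) E(4) dim by simp
qed

context rota_baxter_hopf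
begin

abbreviation "fnl \<psi> \<equiv> linear_on (scale H) (*) (carrier H) UNIV \<psi>"

text \<open>
  \<open>hit \<psi> y = \<psi>(N y\<^sub>1) y\<^sub>2\<close> records how far \<open>y\<close> is from being invariant under the coaction of \<open>Im N\<close>.
\<close>

definition hit where "hit \<psi> y = sweedler H (\<lambda>u v. scale H (\<psi> (N u)) v) y"

text \<open>The convolution product of functionals. By \<open>hit_hit\<close> and
  \<open>hit_comm\<close> the functionals act on \<open>H\<close> through \<open>hit\<close> as a
  commutative algebra.\<close>

definition fconv where "fconv \<psi> \<phi> = sweedler H (\<lambda>p q. \<psi> p * \<phi> q)"

lemma scale_closed: "x \<in> carrier H \<Longrightarrow> scale H c x \<in> carrier H"
  by (rule vsp_scale[OF V])

lemma fnl_N: "fnl \<psi> \<Longrightarrow> fnl (\<lambda>x. \<psi> (N x))"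
  by (rule lin_comp[OF _ N_lin])

lemma hit_bil: "fnl \<psi> \<Longrightarrow> bilinear_on (scale H) (scale H) (scale H) (carrier H) (carrier H) (carrier H) (\<lambda>u v. scale H (\<psi> u) v)"
  by (intro bilinear_onI lin_scale1[OF V] lin_scale2[OF V] lin_id)

lemma hit_lin: "fnl \<psi> \<Longrightarrow> linear_on (scale H) (scale H) (carrier H) (carrier H) (hit \<psi>)"
  unfolding hit_def[abs_def]
  by (intro coalg.lin_sweedler_arg[OF V] bilinear_onI lin_scale1[OF V] lin_scale2[OF V] lin_id fnl_N)

lemma hit_closed: "fnl \<psi> \<Longrightarrow> x \<in> carrier H \<Longrightarrow> hit \<psi> x \<in> carrier H"
  by (rule linear_on_closed[OF hit_lin])

lemma fconv_fnl: "fnl \<psi> \<Longrightarrow> fnl \<phi> \<Longrightarrow> fnl (fconv \<psi> \<phi>)"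
  unfolding fconv_def by (intro coalg.lin_sweedler_arg[OF vsp_UNIV[OF vs_field]] bilinear_onI lin_mult1 lin_mult2)

lemma fconv_N:
  assumes \<psi>: "fnl \<psi>" and \<phi>: "fnl \<phi>" and x: "x \<in> carrier H"
  shows "fconv \<psi> \<phi> (N x) = sweedler H (\<lambda>p q. \<psi> (N p) * \<phi> (N q)) x"
  unfolding fconv_def
  by (rule sweedler_map[OF coalg.comultiplication_axioms V N_map x vsp_UNIV[OF vs_field]])
    (intro bilinear_onI lin_mult1 lin_mult2 \<psi> \<phi>)

lemma hit_hit:
  assumes \<psi>: "fnl \<psi>" and \<phi>: "fnl \<phi>" and z: "z \<in> carrier H"
  shows "hit \<phi> (hit \<psi> z) = hit (fconv \<psi> \<phi>) z"
proof -
  note \<psi>N = fnl_N[OF \<psi>] and \<phi>N = fnl_N[OF \<phi>]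
  note R = hit_lin[OF \<phi>]
  have "hit \<phi> (hit \<psi> z) = sweedler H (\<lambda>u v. hit \<phi> (scale H (\<psi> (N u)) v)) z"
    unfolding hit_def[of \<psi>] by (rule coalg.sweedler_hom[OF z V vector_space R]) (rule scale_closed)
  also have "\<dots> = sweedler H (\<lambda>u v. scale H (\<psi> (N u)) (hit \<phi> v)) z"
    by (intro coalg.sweedler_cong[OF z] linear_on_scale[OF R])
  also have "\<dots> = sweedler H (\<lambda>u w. sweedler H (\<lambda>p q. scale H (\<psi> (N u)) (scale H (\<phi> (N p)) q)) w) z"
    unfolding hit_def
    by (intro coalg.sweedler_cong[OF z] coalg.sweedler_hom[OF _ V vector_space lin_scale2[OF V lin_id]] scale_closed)
  also have "\<dots> = sweedler H (\<lambda>u w. sweedler H (\<lambda>p q. scale H (\<psi> (N p)) (scale H (\<phi> (N q)) w)) u) z"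
    by (rule coalg.coassoc3[symmetric, OF z V])
      (intro trilinear_onI lin_scale1[OF V] lin_scale2[OF V] lin_id \<psi>N \<phi>N scale_closed; assumption)
  also have "\<dots> = sweedler H (\<lambda>u w. scale H (fconv \<psi> \<phi> (N u)) w) z"
  proof (rule coalg.sweedler_cong[OF z])
    fix u w assume uw: "u \<in> carrier H" "w \<in> carrier H"
    have l: "linear_on (*) (scale H) UNIV (carrier H) (\<lambda>c. scale H c w)"
      by (rule lin_scale1[OF V lin_id uw(2)])
    show "sweedler H (\<lambda>p q. scale H (\<psi> (N p)) (scale H (\<phi> (N q)) w)) u = scale H (fconv \<psi> \<phi> (N u)) w"
      unfolding fconv_N[OF \<psi> \<phi> uw(1)]
      using coalg.sweedler_hom[OF uw(1) vsp_UNIV[OF vs_field] vector_space l, of "\<lambda>p q. \<psi> (N p) * \<phi> (N q)"]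
      by (simp add: vsp_scale_simps(3)[OF vector_space])
  qed
  finally show ?thesis unfolding hit_def[of "fconv \<psi> \<phi>"] .
qed

lemma fconv_comm: "fnl \<psi> \<Longrightarrow> fnl \<phi> \<Longrightarrow> x \<in> carrier H \<Longrightarrow> fconv \<psi> \<phi> x = fconv \<phi> \<psi> x"
  unfolding fconv_def
  using coalg.cocomm[of x "(*)" UNIV "\<lambda>p q. \<phi> p * \<psi> q"]
  by (simp add: mult.commute vsp_UNIV[OF vs_field] bilinear_onI lin_mult1 lin_mult2)

lemma hit_cong: "z \<in> carrier H \<Longrightarrow> (\<And>x. x \<in> carrier H \<Longrightarrow> \<psi> x = \<phi> x) \<Longrightarrow> hit \<psi> z = hit \<phi> z"
  unfolding hit_def by (rule coalg.sweedler_cong) (simp_all add: N_closed)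

lemma hit_comm: "fnl \<psi> \<Longrightarrow> fnl \<phi> \<Longrightarrow> z \<in> carrier H \<Longrightarrow> hit \<phi> (hit \<psi> z) = hit \<psi> (hit \<phi> z)"
  by (simp add: hit_hit) (rule hit_cong, simp_all add: fconv_comm)

lemma hit_counit: "z \<in> carrier H \<Longrightarrow> hit (counit H) z = z"
  unfolding hit_def using coalg.counit_left[of z] coalgebra_map_counit[OF N_map]
  by (simp cong: coalg.sweedler_cong)

lemma hit_diff: "fnl \<psi> \<Longrightarrow> fnl \<phi> \<Longrightarrow> hit (\<lambda>x. \<psi> x - \<phi> x) z = hit \<psi> z - hit \<phi> z"
  unfolding hit_def coalg.sweedler_diff[symmetric]
  by (rule arg_cong[of _ _ "\<lambda>\<Phi>. sweedler H \<Phi> z"]) (intro ext module.scale_left_diff_distrib[OF vsp_module[OF V]])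

lemma hit_add: "hit (\<lambda>x. \<psi> x + \<phi> x) z = hit \<psi> z + hit \<phi> z"
  unfolding hit_def coalg.sweedler_add[symmetric]
  by (rule arg_cong[of _ _ "\<lambda>\<Phi>. sweedler H \<Phi> z"]) (intro ext vsp_scale_simps(2)[OF vector_space])

lemma hit_scale: "z \<in> carrier H \<Longrightarrow> hit (\<lambda>x. c * \<psi> x) z = scale H c (hit \<psi> z)" if "fnl \<psi>"
proof -
  assume z: "z \<in> carrier H"
  have "scale H c (hit \<psi> z) = sweedler H (\<lambda>u v. scale H c (scale H (\<psi> (N u)) v)) z"
    unfolding hit_def by (rule coalg.sweedler_hom[OF z V vector_space lin_scale2[OF V lin_id]]) (rule scale_closed)
  then show ?thesis by (simp add: hit_def vsp_scale_simps(3)[OF vector_space])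
qed

text \<open>
  For \<open>M = 0\<close> this says \<open>N z\<^sub>1 \<otimes> z\<^sub>2 = 1 \<otimes> z\<close>.
\<close>

definition coinv where
  "coinv M z \<longleftrightarrow> z \<in> carrier H \<and> (\<forall>\<psi>. fnl \<psi> \<longrightarrow> hit \<psi> z - scale H (\<psi> \<one>) z \<in> M)"

text \<open>Replacing \<open>N z\<^sub>1 \<otimes> z\<^sub>2\<close> by \<open>1 \<otimes> z\<close>
  in a bilinear expression costs an element of \<open>Z\<close>; \<open>slice_in\<close> derives
  this from the slicewise condition in \<open>coinv\<close>.\<close>

lemma coinv_use:
  assumes z: "coinv M z" and Z: "vsp s Z"
    and b: "bilinear_on (scale H) (scale H) s (carrier H) (carrier H) Y \<Phi>"
    and \<Phi>: "\<And>u m. u \<in> carrier H \<Longrightarrow> m \<in> M \<Longrightarrow> m \<in> carrier H \<Longrightarrow> \<Phi> u m \<in> Z"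
  shows "sweedler H (\<lambda>u v. \<Phi> (N u) v) z - \<Phi> \<one> z \<in> Z"
proof -
  interpret vs: vector_space s by (rule vsp_vs[OF Z])
  interpret vH: Vector_Spaces.vector_space "scale H" by (rule vector_space)
  have zc: "z \<in> carrier H" using z unfolding coinv_def by blast
  \<comment> \<open>The difference of the two tensors must be presented by a list of pairs, so its
    minus sign is moved into the right factor.\<close>
  define nz where "nz = scale H (-1) z"
  have nzc: "nz \<in> carrier H" unfolding nz_def by (rule scale_closed[OF zc])
  have nz: "scale H a nz = - scale H a z" for a by (simp add: nz_def)
  let ?xs = "map (\<lambda>(u, v). (N u, v)) (coalg.cop z) @ [(\<one>, nz)]"
  have "(\<Sum>(u, v)\<leftarrow>?xs. \<Phi> u v) \<in> Z"
  proof (rule slice_in[OF V V Z b _ _ \<Phi>])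
    show "set ?xs \<subseteq> carrier H \<times> carrier H"
      using coalg.cop(1)[OF zc] by (auto simp: N_closed one_closed nzc)
    show "(\<Sum>(u, v)\<leftarrow>?xs. scale H (\<psi> u) v) \<in> M" if "fnl \<psi>" for \<psi>
    proof -
      have "(\<Sum>(u, v)\<leftarrow>?xs. scale H (\<psi> u) v) = hit \<psi> z - scale H (\<psi> \<one>) z"
        by (simp add: hit_def sweedler_sum o_def case_prod_unfold nz)
      then show ?thesis using z that unfolding coinv_def by simp
    qed
  qed
  moreover have "\<Phi> \<one> nz = - \<Phi> \<one> z"
    using linear_on_scale[OF bilinear_onD1[OF b one_closed] zc, of "-1"] by (simp add: nz_def)
  ultimately show ?thesis by (simp add: sweedler_sum o_def case_prod_unfold)
qed

definition kerN where "kerN = {y \<in> carrier H. N y = 0}"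

text \<open>
  The aim is \<open>ker N = core\<close>, since \<open>core\<close> is invariant under \<open>lam w\<close> by construction.
\<close>

definition stable where
  "stable U \<longleftrightarrow> vsp (scale H) U \<and> U \<subseteq> kerN \<and> (\<forall>\<psi> y. fnl \<psi> \<longrightarrow> y \<in> U \<longrightarrow> hit \<psi> y \<in> U) \<and>
    (\<forall>w\<in>carrier H. \<forall>y\<in>U. lam w y \<in> U)"

definition core where "core = \<Union>{U. stable U}"

lemma stableD:
  assumes "stable U"
  shows "vsp (scale H) U" "y \<in> U \<Longrightarrow> y \<in> carrier H" "y \<in> U \<Longrightarrow> N y = 0"
    "fnl \<psi> \<Longrightarrow> y \<in> U \<Longrightarrow> hit \<psi> y \<in> U" "w \<in> carrier H \<Longrightarrow> y \<in> U \<Longrightarrow> lam w y \<in> U"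
  using assms unfolding stable_def kerN_def by auto

lemma kerN_vsp: "vsp (scale H) kerN"
  by (rule vspI[OF vector_space])
    (auto simp: kerN_def vsp_0[OF V] vsp_add[OF V] vsp_scale[OF V] linear_on_add[OF N_lin] linear_on_scale[OF N_lin]
      linear_on_zero[OF V vector_space N_lin] vsp_scale_simps[OF vector_space])

text \<open>Because \<open>N\<close> is a coalgebra map, \<open>N (hit \<psi> y)\<close> is a slice
  of the comultiplication of \<open>N y\<close> and vanishes with it.\<close>

lemma hit_kerN: "fnl \<psi> \<Longrightarrow> y \<in> kerN \<Longrightarrow> hit \<psi> y \<in> kerN"
proof -
  assume \<psi>: "fnl \<psi>" and y: "y \<in> kerN"
  then have yc: "y \<in> carrier H" and y0: "N y = 0" unfolding kerN_def by auto
  have b: "bilinear_on (scale H) (scale H) (scale H) (carrier H) (carrier H) (carrier H) (\<lambda>u v. scale H (\<psi> u) v)" by (rule hit_bil[OF \<psi>])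
  have "N (hit \<psi> y) = sweedler H (\<lambda>u v. N (scale H (\<psi> (N u)) v)) y"
    unfolding hit_def by (rule coalg.sweedler_hom[OF yc V vector_space N_lin]) (rule scale_closed)
  also have "\<dots> = sweedler H (\<lambda>u v. scale H (\<psi> (N u)) (N v)) y"
    by (intro coalg.sweedler_cong[OF yc] linear_on_scale[OF N_lin])
  also have "\<dots> = sweedler H (\<lambda>u v. scale H (\<psi> u) v) (N y)"
    by (rule sweedler_map[symmetric, OF coalg.comultiplication_axioms V N_map yc V b])
  also have "\<dots> = 0" unfolding y0 by (rule linear_on_zero[OF V vector_space coalg.lin_sweedler_arg[OF V b]])
  finally show ?thesis unfolding kerN_def by (simp add: hit_closed[OF \<psi> yc])
qed

lemma core_upper: "stable U \<Longrightarrow> U \<subseteq> core"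
  unfolding core_def by auto

lemma stable_zero: "stable {0}"
  unfolding stable_def
  using vsp_0[OF kerN_vsp] linear_on_zero[OF V vector_space hit_lin] linear_on_zero[OF V vector_space bilinear_onD1[OF lam_bilinear]]
  by (auto intro!: vspI[OF vector_space] simp: vsp_scale_simps[OF vector_space])

text \<open>Makes the union \<open>core\<close> closed under addition, hence itself stable.\<close>

lemma stable_sum:
  assumes A: "stable A" and D: "stable D" shows "stable {x + y | x y. x \<in> A \<and> y \<in> D}"
  unfolding stable_def
proof (intro conjI allI impI ballI)
  note A' = stableD[OF A] and D' = stableD[OF D]
  let ?S = "{x + y | x y. x \<in> A \<and> y \<in> D}"
  show "vsp (scale H) ?S"
    using vector_space.subspace_sums[OF vector_space vsp_sub[OF A'(1)] vsp_sub[OF D'(1)]] vector_space unfolding vsp_def by auto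
  show "?S \<subseteq> kerN"
    using A D unfolding stable_def by (auto intro!: vsp_add[OF kerN_vsp])
  show "hit \<psi> y \<in> ?S" if "fnl \<psi>" "y \<in> ?S" for \<psi> y
    using that A'(2,4) D'(2,4) linear_on_add[OF hit_lin[OF that(1)]] by blast
  show "lam w y \<in> ?S" if "w \<in> carrier H" "y \<in> ?S" for w y
    using that A'(2,5) D'(2,5) linear_on_add[OF bilinear_onD1[OF lam_bilinear that(1)]] by blast
qed

lemma core_stable: "stable core"
  unfolding stable_def
proof (intro conjI allI impI ballI)
  show "vsp (scale H) core"
  proof (rule vspI[OF vector_space])
    show "0 \<in> core" using core_upper[OF stable_zero] by auto
    show "x + y \<in> core" if x: "x \<in> core" and y: "y \<in> core" for x y
    proof -
      obtain A where A: "stable A" "x \<in> A" using x unfolding core_def by auto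
      obtain D where D: "stable D" "y \<in> D" using y unfolding core_def by auto
      show ?thesis using core_upper[OF stable_sum[OF A(1) D(1)]] A(2) D(2) by auto
    qed
    show "scale H c x \<in> core" if "x \<in> core" for c x
      using that vsp_scale[OF stableD(1)] unfolding core_def by auto
  qed
  show "core \<subseteq> kerN" unfolding core_def stable_def by auto
  show "hit \<psi> y \<in> core" if "fnl \<psi>" "y \<in> core" for \<psi> y
    using that stableD(4)[OF _ that(1)] unfolding core_def by auto
  show "lam w y \<in> core" if "w \<in> carrier H" "y \<in> core" for w y
    using that stableD(5)[OF _ that(1)] unfolding core_def by auto
qed

lemmas core = stableD[OF core_stable]

text \<open>As \<open>N\<close> is multiplicative for \<open>circ\<close>, a left factor
  \<open>c\<close> merely translates the functional that acts on \<open>m\<close>.\<close>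

lemma hit_circ:
  assumes \<psi>: "fnl \<psi>" and c: "c \<in> carrier H" and m: "m \<in> carrier H"
  shows "hit \<psi> (circ c m) = sweedler H (\<lambda>c1 c2. circ c2 (hit (\<lambda>h. \<psi> (N c1 \<cdot> h)) m)) c"
proof -
  have l: "linear_on (scale H) (scale H) (carrier H) (carrier H) (circ x)" if "x \<in> carrier H" for x
    using bilinear_onD1[OF circ_bilinear that] .
  have "hit \<psi> (circ c m) = sweedler H (\<lambda>c1 c2. sweedler H (\<lambda>m1 m2. scale H (\<psi> (N (circ c1 m1))) (circ c2 m2)) m) c"
    unfolding hit_def
    by (rule sweedler_circ[OF c m V]) (intro bilinear_onI lin_scale1[OF V] lin_scale2[OF V] lin_id fnl_N[OF \<psi>])
  also have "\<dots> = sweedler H (\<lambda>c1 c2. sweedler H (\<lambda>m1 m2. circ c2 (scale H (\<psi> (N c1 \<cdot> N m1)) m2)) m) c"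
    by (intro coalg.sweedler_cong[OF c] coalg.sweedler_cong[OF m]) (simp add: N_circ linear_on_scale[OF l])
  also have "\<dots> = sweedler H (\<lambda>c1 c2. circ c2 (hit (\<lambda>h. \<psi> (N c1 \<cdot> h)) m)) c"
    unfolding hit_def
    by (intro coalg.sweedler_cong[OF c] coalg.sweedler_hom[symmetric, OF m V vector_space l] scale_closed)
  finally show ?thesis .
qed

lemma fnl_translate: "fnl \<psi> \<Longrightarrow> x \<in> carrier H \<Longrightarrow> fnl (\<lambda>h. \<psi> (x \<cdot> h))"
  by (rule lin_comp[OF _ bilinear_onD1[OF mult_bilinear]])

text \<open>By maximality it is enough that the span of all products \<open>c \<cdot> m\<close> with
  \<open>m\<close> in \<open>core\<close> is stable. \<open>mult_via_circ\<close> turns such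
  products into descendant products, which \<open>N\<close> and \<open>hit\<close> respect, and
  \<open>lam_mult\<close> handles \<open>lam\<close>.\<close>

lemma mult_core:
  assumes c: "c \<in> carrier H" and m: "m \<in> core" shows "c \<cdot> m \<in> core"
proof -
  interpret v: Vector_Spaces.vector_space "scale H" by (rule vector_space)
  let ?G = "{c \<cdot> m | c m. c \<in> carrier H \<and> m \<in> core}"
  let ?S = "v.span ?G"
  have S: "vsp (scale H) ?S" unfolding vsp_def using vector_space v.subspace_span by blast
  have G: "?G \<subseteq> carrier H" using core(2) mult_closed by auto
  then have SH: "?S \<subseteq> carrier H" by (rule v.span_minimal[OF _ vsp_sub[OF V]])
  have gS: "x \<cdot> m \<in> ?S" if "x \<in> carrier H" "m \<in> core" for x m
    using that by (intro v.span_base) auto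
  have map: "f y \<in> ?S" if f: "linear_on (scale H) (scale H) (carrier H) (carrier H) f"
    and g: "\<And>c m. c \<in> carrier H \<Longrightarrow> m \<in> core \<Longrightarrow> f (c \<cdot> m) \<in> ?S" and y: "y \<in> ?S" for f y
  proof -
    have "y \<in> carrier H \<and> f y \<in> ?S" using y
    proof (induction rule: v.span_induct_alt)
      case base
      show ?case using linear_on_zero[OF V vector_space f] vsp_0[OF S] vsp_0[OF V] by simp
    next
      case (step a x y)
      then have x: "x \<in> carrier H" "f x \<in> ?S" using G g by auto
      then show ?case using step
        by (simp add: linear_on_add[OF f] linear_on_scale[OF f] scale_closed vsp_add[OF V] vsp_add[OF S] vsp_scale[OF S])
    qed
    then show ?thesis by simp
  qed
  have circS: "circ x m \<in> ?S" if "x \<in> carrier H" "m \<in> core" for x m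
    unfolding circ_via_lam[OF that(1) core(2)[OF that(2)]]
    by (intro coalg.sweedler_closed[OF that(1) S] gS core(5) that)
  have eq: "x \<cdot> m = sweedler H (\<lambda>u v. circ u (lam (Tinv v) m)) x" if "x \<in> carrier H" "m \<in> core" for x m
    by (rule mult_via_circ[OF that(1) core(2)[OF that(2)]])
  have "stable ?S" unfolding stable_def
  proof (intro conjI allI impI ballI S)
    show "?S \<subseteq> kerN"
    proof (rule v.span_minimal[OF _ vsp_sub[OF kerN_vsp]], clarify)
      fix x m assume xm: "x \<in> carrier H" "m \<in> core"
      show "x \<cdot> m \<in> kerN" unfolding eq[OF xm]
        by (intro coalg.sweedler_closed[OF xm(1) kerN_vsp])
          (auto simp: kerN_def circ_closed core(2) lam_closed N_circ xm Tinv_closed core(3)[OF core(5)]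
            linear_on_zero[OF V vector_space bilinear_onD1[OF mult_bilinear]] N_closed)
    qed
    show "hit \<psi> y \<in> ?S" if \<psi>: "fnl \<psi>" and y: "y \<in> ?S" for \<psi> y
    proof (rule map[OF hit_lin[OF \<psi>] _ y])
      fix x m assume xm: "x \<in> carrier H" "m \<in> core"
      have "hit \<psi> (circ u m') \<in> ?S" if "u \<in> carrier H" "m' \<in> core" for u m'
        unfolding hit_circ[OF \<psi> that(1) core(2)[OF that(2)]]
        by (intro coalg.sweedler_closed[OF that(1) S] circS core(4) fnl_translate[OF \<psi>] N_closed that)
      then have 1: "hit \<psi> (circ u (lam (Tinv v) m)) \<in> ?S" if "u \<in> carrier H" "v \<in> carrier H" for u v
        using that core(5)[OF Tinv_closed[OF that(2)] xm(2)] by blast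
      have 2: "circ u (lam (Tinv v) m) \<in> carrier H" if "u \<in> carrier H" "v \<in> carrier H" for u v
        by (intro circ_closed lam_closed Tinv_closed core(2) that xm)
      have "hit \<psi> (x \<cdot> m) = sweedler H (\<lambda>u v. hit \<psi> (circ u (lam (Tinv v) m))) x"
        unfolding eq[OF xm] by (rule coalg.sweedler_hom[OF xm(1) V vector_space hit_lin[OF \<psi>] 2])
      then show "hit \<psi> (x \<cdot> m) \<in> ?S" using coalg.sweedler_closed[OF xm(1) S 1] by simp
    qed
    show "lam w y \<in> ?S" if w: "w \<in> carrier H" and y: "y \<in> ?S" for w y
    proof (rule map[OF bilinear_onD1[OF lam_bilinear w] _ y])
      fix x m assume xm: "x \<in> carrier H" "m \<in> core"
      show "lam w (x \<cdot> m) \<in> ?S"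
        unfolding lam_mult[OF w xm(1) core(2)[OF xm(2)]]
        by (intro coalg.sweedler_closed[OF w S] gS lam_closed core(5) xm)
    qed
  qed
  then show ?thesis using core_upper gS[OF c m] by auto
qed

lemma circ_core: "c \<in> carrier H \<Longrightarrow> m \<in> core \<Longrightarrow> circ c m \<in> core"
  unfolding circ_via_lam[OF _ core(2)]
  by (intro coalg.sweedler_closed[OF _ core(1)] mult_core core(5))

lemma conj_mult_bilinear:
  "c \<in> carrier H \<Longrightarrow> bilinear_on (scale H) (scale H) (scale H) (carrier H) (carrier H) (carrier H) (\<lambda>u v. conj u c \<cdot> v)"
  by (intro bilinear_onI Hlin1 Hlin2 lin_id bilinear_onD2[OF conj_bilinear] conj_closed; assumption)

text \<open>Closure of \<open>core\<close> under \<open>hit\<close> says that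
  \<open>N m\<^sub>1 \<otimes> m\<^sub>2\<close> lies in \<open>H \<otimes> core\<close>, so in
  \<open>circ_via_conj\<close> the right factors may be taken in \<open>core\<close>.\<close>

lemma core_circ:
  assumes m: "m \<in> core" and c: "c \<in> carrier H" shows "circ m c \<in> core"
  unfolding circ_via_conj[OF core(2)[OF m] c]
proof (rule sweedler_slice[OF coalg.comultiplication_axioms core(2)[OF m] V V core(1) N_lin lin_id conj_mult_bilinear[OF c]])
  show "sweedler H (\<lambda>u v. scale H (\<chi> (N u)) v) m \<in> core" if "fnl \<chi>" for \<chi>
    using core(4)[OF that m] unfolding hit_def .
qed (intro mult_core conj_closed c)

lemma ad_core: "w \<in> carrier H \<Longrightarrow> m \<in> core \<Longrightarrow> ad w m \<in> core"
  unfolding ad_circ[OF _ core(2)]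
  by (intro coalg.sweedler_closed[OF _ core(1)] circ_core core_circ Tinv_closed)

lemma coinv_diff:
  assumes M: "vsp (scale H) M" "M \<subseteq> carrier H" and z: "coinv M z" "coinv M y" shows "coinv M (z - y)"
  unfolding coinv_def
proof (intro conjI allI impI)
  have c: "z \<in> carrier H" "y \<in> carrier H" using z unfolding coinv_def by auto
  show "z - y \<in> carrier H" by (rule vsp_diff[OF V c])
  fix \<psi> assume \<psi>: "fnl \<psi>"
  have "hit \<psi> (z - y) - scale H (\<psi> \<one>) (z - y) = (hit \<psi> z - scale H (\<psi> \<one>) z) - (hit \<psi> y - scale H (\<psi> \<one>) y)"
    using linear_on_diff[OF V hit_lin[OF \<psi>] c] by (simp add: vsp_scale_simps[OF vector_space])
  then show "hit \<psi> (z - y) - scale H (\<psi> \<one>) (z - y) \<in> M"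
    using z \<psi> unfolding coinv_def by (simp add: vsp_diff[OF M(1)])
qed

lemma coinv_core_self: "m \<in> core \<Longrightarrow> coinv core m"
  unfolding coinv_def using core by (auto intro!: vsp_diff[OF core(1)] vsp_scale[OF core(1)])

text \<open>\<open>N (ad w z)\<close> is the conjugate of \<open>N z\<close> by \<open>N w\<close>,
  so the coaction on \<open>ad w z\<close> is a bilinear expression \<open>\<Phi>\<close> in
  \<open>N z\<^sub>1\<close> and \<open>z\<^sub>2\<close>. Coinvariance replaces
  \<open>N z\<^sub>1\<close> by \<open>1\<close>, whose conjugate collapses to the counit; the error
  stays in \<open>core\<close> since \<open>ad\<close> preserves it.\<close>

lemma ad_coinv:
  assumes w: "w \<in> carrier H" and z: "coinv core z" shows "coinv core (ad w z)"
  unfolding coinv_def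
proof (intro conjI allI impI)
  have zc: "z \<in> carrier H" using z unfolding coinv_def by blast
  show "ad w z \<in> carrier H" by (rule ad_closed[OF w zc])
  fix \<psi> assume \<psi>: "fnl \<psi>"
  let ?Q = "\<lambda>x h. sweedler H (\<lambda>p q. N p \<cdot> (h \<cdot> antipode H (N q))) x"
  have Q: "bilinear_on (scale H) (scale H) (scale H) (carrier H) (carrier H) (carrier H) ?Q"
    by (intro bilinear_onI coalg.lin_param[OF _ V] coalg.lin_sweedler[OF V lin_id] Hlin1 Hlin2 lin_comp[OF antipode_linear N_lin] N_lin lin_id mult_closed N_closed antipode_closed; assumption)
  define \<Phi> where "\<Phi> = (\<lambda>h v. sweedler H (\<lambda>w1 w2. scale H (\<psi> (?Q w1 h)) (ad w2 v)) w)"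
  have \<Phi>: "bilinear_on (scale H) (scale H) (scale H) (carrier H) (carrier H) (carrier H) \<Phi>"
    unfolding \<Phi>_def
    by (intro bilinear_onI coalg.lin_param[OF w V] lin_scale1[OF V] lin_scale2[OF V] lin_comp[OF \<psi>] bilinear_onD1[OF Q]
      bilinear_onD1[OF ad_bilinear] ad_closed; assumption)
  have "hit \<psi> (ad w z) = sweedler H (\<lambda>w1 w2. sweedler H (\<lambda>z1 z2. scale H (\<psi> (N (ad w1 z1))) (ad w2 z2)) z) w"
    unfolding hit_def
    by (rule sweedler_ad[OF w zc V]) (intro bilinear_onI lin_scale1[OF V] lin_scale2[OF V] lin_id fnl_N[OF \<psi>])
  also have "\<dots> = sweedler H (\<lambda>w1 w2. sweedler H (\<lambda>z1 z2. scale H (\<psi> (?Q w1 (N z1))) (ad w2 z2)) z) w"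
    by (intro coalg.sweedler_cong[OF w] coalg.sweedler_cong[OF zc]) (simp add: N_ad)
  also have "\<dots> = sweedler H (\<lambda>z1 z2. \<Phi> (N z1) z2) z"
    unfolding \<Phi>_def by (rule sweedler_swap)
  finally have 1: "hit \<psi> (ad w z) = sweedler H (\<lambda>z1 z2. \<Phi> (N z1) z2) z" .
  have "\<Phi> \<one> z = sweedler H (\<lambda>w1 w2. scale H (counit H w1) (scale H (\<psi> \<one>) (ad w2 z))) w"
    unfolding \<Phi>_def
  proof (rule coalg.sweedler_cong[OF w])
    fix w1 w2 assume *: "w1 \<in> carrier H" "w2 \<in> carrier H"
    have "?Q w1 \<one> = sweedler H (\<lambda>p q. N p \<cdot> antipode H (N q)) w1"
      by (intro coalg.sweedler_cong[OF *(1)]) (simp add: one_left antipode_closed N_closed)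
    also have "\<dots> = sweedler H (\<lambda>p q. p \<cdot> antipode H q) (N w1)"
      by (rule sweedler_map[symmetric, OF coalg.comultiplication_axioms V N_map *(1) V])
        (intro bilinear_onI Hlin1 Hlin2 antipode_linear lin_id antipode_closed)
    also have "\<dots> = scale H (counit H w1) \<one>"
      using coalgebra_map_counit[OF N_map *(1)] by (simp add: antipode_right N_closed *)
    finally have "?Q w1 \<one> = scale H (counit H w1) \<one>" .
    then show "scale H (\<psi> (?Q w1 \<one>)) (ad w2 z) = scale H (counit H w1) (scale H (\<psi> \<one>) (ad w2 z))"
      by (simp add: linear_on_scale[OF \<psi> one_closed] vsp_scale_simps(3)[OF vector_space])
  qed
  also have "\<dots> = scale H (\<psi> \<one>) (ad w z)"
    by (rule coalg.counit_left'[OF w V]) (intro lin_scale2[OF V] bilinear_onD2[OF ad_bilinear zc])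
  finally have 2: "\<Phi> \<one> z = scale H (\<psi> \<one>) (ad w z)" .
  have "sweedler H (\<lambda>u v. \<Phi> (N u) v) z - \<Phi> \<one> z \<in> core"
  proof (rule coinv_use[OF z core(1) \<Phi>])
    fix u m assume "u \<in> carrier H" "m \<in> core"
    then show "\<Phi> u m \<in> core" unfolding \<Phi>_def
      by (intro coalg.sweedler_closed[OF w core(1)] vsp_scale[OF core(1)] ad_core)
  qed
  then show "hit \<psi> (ad w z) - scale H (\<psi> \<one>) (ad w z) \<in> core" unfolding 1 2 .
qed

text \<open>If \<open>a\<close> is coinvariant modulo \<open>core\<close>, then
  \<open>circ_via_conj\<close> gives \<open>circ a u\<close> congruent to
  \<open>u \<cdot> a\<close>. Hence \<open>circ w z\<close>, which is
  \<open>w\<^sub>1 \<cdot> lam w\<^sub>2 z\<close>, is by \<open>circ_ad\<close> also congruent to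
  \<open>w\<^sub>1 \<cdot> ad w\<^sub>2 z\<close>, and the antipode cancels the left factor.\<close>

lemma lam_ad_coinv:
  assumes w: "w \<in> carrier H" and z: "coinv core z" shows "lam w z - ad w z \<in> core"
proof -
  have zc: "z \<in> carrier H" using z unfolding coinv_def by blast
  note adl = bilinear_onD2[OF ad_bilinear zc] and Sl = antipode_linear and Sc = antipode_closed
  have 1: "circ a u - u \<cdot> a \<in> core" if a: "coinv core a" and u: "u \<in> carrier H" for a u
  proof -
    have ac: "a \<in> carrier H" using a unfolding coinv_def by blast
    show ?thesis
      using coinv_use[OF a core(1) conj_mult_bilinear[OF u]] u
      unfolding circ_via_conj[OF ac u] by (simp add: conj_one mult_core conj_closed)
  qed
  have 2: "circ v z - sweedler H (\<lambda>p q. p \<cdot> ad q z) v \<in> core" if v: "v \<in> carrier H" for v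
    unfolding circ_ad[OF v zc] coalg.sweedler_diff[symmetric]
    by (intro coalg.sweedler_closed[OF v core(1)] 1 ad_coinv z)
  have "lam w z - sweedler H (\<lambda>u v. antipode H u \<cdot> sweedler H (\<lambda>p q. p \<cdot> ad q z) v) w
    = sweedler H (\<lambda>u v. antipode H u \<cdot> (circ v z - sweedler H (\<lambda>p q. p \<cdot> ad q z) v)) w"
    unfolding lam_via_circ[OF w zc] coalg.sweedler_diff[symmetric]
    by (intro coalg.sweedler_cong[OF w] linear_on_diff[symmetric, OF V bilinear_onD1[OF mult_bilinear]]
      Sc circ_closed zc coalg.sweedler_closed[OF _ V] mult_closed ad_closed)
  also have "\<dots> \<in> core"
    by (intro coalg.sweedler_closed[OF w core(1)] mult_core 2 Sc)
  finally have 3: "lam w z - sweedler H (\<lambda>u v. antipode H u \<cdot> sweedler H (\<lambda>p q. p \<cdot> ad q z) v) w \<in> core" .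
  have "sweedler H (\<lambda>u v. antipode H u \<cdot> sweedler H (\<lambda>p q. p \<cdot> ad q z) v) w
    = sweedler H (\<lambda>u v. sweedler H (\<lambda>p q. antipode H u \<cdot> (p \<cdot> ad q z)) v) w"
    by (intro coalg.sweedler_cong[OF w] coalg.sweedler_hom[OF _ V vector_space bilinear_onD1[OF mult_bilinear]] Sc mult_closed ad_closed zc)
  also have "\<dots> = sweedler H (\<lambda>u v. sweedler H (\<lambda>p q. antipode H p \<cdot> (q \<cdot> ad v z)) u) w"
    by (rule coalg.coassoc3[symmetric, OF w V])
      (intro trilinear_onI Hlin1 Hlin2 Sl adl lin_id mult_closed Sc ad_closed zc; assumption)
  also have "\<dots> = sweedler H (\<lambda>u v. scale H (counit H u) (ad v z)) w"
  proof (rule coalg.sweedler_cong[OF w])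
    fix u v assume uv: "u \<in> carrier H" "v \<in> carrier H"
    have "sweedler H (\<lambda>p q. antipode H p \<cdot> (q \<cdot> ad v z)) u = sweedler H (\<lambda>p q. (antipode H p \<cdot> q) \<cdot> ad v z) u"
      by (intro coalg.sweedler_cong[OF uv(1)]) (simp add: mult_assoc Sc ad_closed uv zc)
    also have "\<dots> = sweedler H (\<lambda>p q. antipode H p \<cdot> q) u \<cdot> ad v z"
      by (rule coalg.sweedler_hom[symmetric, OF uv(1) V vector_space bilinear_onD2[OF mult_bilinear ad_closed[OF uv(2) zc]]])
        (intro mult_closed Sc)
    finally show "sweedler H (\<lambda>p q. antipode H p \<cdot> (q \<cdot> ad v z)) u = scale H (counit H u) (ad v z)"
      by (simp add: antipode_left uv scale_mult_left one_closed one_left ad_closed zc)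
  qed
  also have "\<dots> = ad w z" by (rule coalg.counit_left'[OF w V adl])
  finally show ?thesis using 3 by simp
qed

lemma N_ad_zero: "w \<in> carrier H \<Longrightarrow> z \<in> carrier H \<Longrightarrow> N z = 0 \<Longrightarrow> N (ad w z) = 0"
proof -
  assume w: "w \<in> carrier H" and z: "z \<in> carrier H" "N z = 0"
  have "N (ad w z) = sweedler H (\<lambda>u v. 0) w"
    unfolding N_ad[OF w z(1)] z(2)
    by (intro coalg.sweedler_cong[OF w])
      (simp add: linear_on_zero[OF V vector_space bilinear_onD2[OF mult_bilinear]]
        linear_on_zero[OF V vector_space bilinear_onD1[OF mult_bilinear]] antipode_closed N_closed)
  then show ?thesis by (simp add: sweedler_sum case_prod_unfold)
qed

text \<open>
  On elements of \<open>ker N\<close> that are coinvariant modulo \<open>core\<close>, \<open>lam w\<close> and \<open>ad w\<close> agree modulo \<open>core\<close>, and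
  \<open>ad w\<close> preserves \<open>ker N\<close>. So these elements form a stable subspace, contained in \<open>core\<close> by maximality.
\<close>

lemma coinv_in_core:
  assumes z: "coinv core z" and z0: "N z = 0" shows "z \<in> core"
proof -
  let ?M = "{z. coinv core z \<and> N z = 0}"
  have coreH: "core \<subseteq> carrier H" using core(2) by auto
  have cc: "z \<in> carrier H" if "z \<in> ?M" for z using that unfolding coinv_def by blast
  have coreM: "m \<in> ?M" if "m \<in> core" for m using coinv_core_self[OF that] core(3)[OF that] by simp
  have diff: "x - y \<in> ?M" if "x \<in> ?M" "y \<in> ?M" for x y
    using that coinv_diff[OF core(1) coreH] linear_on_diff[OF V N_lin cc[OF that(1)] cc[OF that(2)]] by auto
  have zero: "0 \<in> ?M" by (rule coreM[OF vsp_0[OF core(1)]])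
  have vs: "vsp (scale H) ?M"
  proof (rule vspI[OF vector_space zero])
    show "x + y \<in> ?M" if "x \<in> ?M" "y \<in> ?M" for x y
      using diff[OF that(1) diff[OF zero that(2)]] by simp
    show "scale H c x \<in> ?M" if x: "x \<in> ?M" for c x
    proof -
      have "hit \<psi> (scale H c x) - scale H (\<psi> \<one>) (scale H c x) = scale H c (hit \<psi> x - scale H (\<psi> \<one>) x)" if "fnl \<psi>" for \<psi>
        using linear_on_scale[OF hit_lin[OF that] cc[OF x]]
        by (simp add: vsp_scale_simps[OF vector_space] mult.commute)
      moreover have "hit \<psi> x - scale H (\<psi> \<one>) x \<in> core" if "fnl \<psi>" for \<psi>
        using x that unfolding coinv_def by blast
      ultimately have "coinv core (scale H c x)"
        unfolding coinv_def using scale_closed[OF cc[OF x]] vsp_scale[OF core(1)] by metis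
      then show ?thesis using x cc[OF x] by (simp add: linear_on_scale[OF N_lin] vsp_scale_simps(5)[OF vector_space])
    qed
  qed
  have add_core: "x \<in> ?M" if "x - y \<in> core" "y \<in> ?M" for x y
    using vsp_add[OF vs coreM[OF that(1)] that(2)] by simp
  have "stable ?M" unfolding stable_def
  proof (intro conjI allI impI ballI vs)
    show "?M \<subseteq> kerN" using cc unfolding kerN_def by auto
    show "hit \<psi> y \<in> ?M" if "fnl \<psi>" "y \<in> ?M" for \<psi> y
      using that by (intro add_core[OF _ vsp_scale[OF vs that(2), of "\<psi> \<one>"]]) (auto simp: coinv_def)
    show "lam w y \<in> ?M" if "w \<in> carrier H" "y \<in> ?M" for w y
      using that by (intro add_core[OF lam_ad_coinv]) (auto intro: ad_coinv N_ad_zero cc)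
  qed
  then show ?thesis using core_upper z z0 by auto
qed

end

section \<open>Cyclic modules of the functionals, and the inclusion of the kernel in the
  core\<close>

context rota_baxter_hopf
begin

text \<open>The cyclic module generated by \<open>y\<close> under \<open>hit\<close>. It lies in a
  finite-dimensional space because \<open>comult H y\<close> is a finite sum, and this is what makes
  choices of minimal dimension effective.\<close>

definition orbit where "orbit y = {hit \<psi> y | \<psi>. fnl \<psi>}"

lemma orbit_vsp: "y \<in> carrier H \<Longrightarrow> vsp (scale H) (orbit y)"
proof (rule vspI[OF vector_space])
  assume y: "y \<in> carrier H"
  have f0: "fnl (\<lambda>x. 0)" by (rule lin_zero[OF vsp_UNIV[OF vs_field]])
  have "hit (\<lambda>x. 0) y = 0" unfolding hit_def
    by (simp add: sweedler_sum case_prod_unfold vsp_scale_simps[OF vector_space])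
  with f0 show "0 \<in> orbit y" unfolding orbit_def by (metis (mono_tags, lifting) mem_Collect_eq)
  show "a + b \<in> orbit y" if "a \<in> orbit y" "b \<in> orbit y" for a b
    using that lin_add[OF vsp_UNIV[OF vs_field]] hit_add unfolding orbit_def mem_Collect_eq by metis
  show "scale H c a \<in> orbit y" if "a \<in> orbit y" for c a
    using that lin_mult2 hit_scale y unfolding orbit_def mem_Collect_eq by metis
qed

lemma orbitI: "fnl \<psi> \<Longrightarrow> hit \<psi> y \<in> orbit y"
  unfolding orbit_def by auto

lemma orbitE: "v \<in> orbit y \<Longrightarrow> \<exists>\<psi>. fnl \<psi> \<and> v = hit \<psi> y"
  unfolding orbit_def by auto

lemma orbit_self: "y \<in> carrier H \<Longrightarrow> y \<in> orbit y"
  using orbitI[OF counit_linear, of y] by (simp add: hit_counit)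

lemma orbit_closed: "y \<in> carrier H \<Longrightarrow> v \<in> orbit y \<Longrightarrow> v \<in> carrier H"
  using orbitE hit_closed by blast

lemma orbit_sub: "y \<in> carrier H \<Longrightarrow> v \<in> orbit y \<Longrightarrow> orbit v \<subseteq> orbit y"
proof
  fix w assume y: "y \<in> carrier H" and v: "v \<in> orbit y" and w: "w \<in> orbit v"
  obtain \<psi> where 1: "fnl \<psi>" "v = hit \<psi> y" using orbitE[OF v] by blast
  obtain \<phi> where 2: "fnl \<phi>" "w = hit \<phi> v" using orbitE[OF w] by blast
  show "w \<in> orbit y" unfolding 2(2) 1(2) hit_hit[OF 1(1) 2(1) y] by (rule orbitI[OF fconv_fnl[OF 1(1) 2(1)]])
qed

lemma orbit_finite: "y \<in> carrier H \<Longrightarrow> \<exists>F. finite F \<and> orbit y \<subseteq> module.span (scale H) F"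
proof (intro exI[of _ "set (map snd (coalg.cop y))"] conjI subsetI)
  interpret v: Vector_Spaces.vector_space "scale H" by (rule vector_space)
  fix w assume "w \<in> orbit y"
  then obtain \<psi> where "w = hit \<psi> y" using orbitE by blast
  then have w: "w = (\<Sum>p\<leftarrow>coalg.cop y. scale H (\<psi> (N (fst p))) (snd p))"
    by (simp add: hit_def sweedler_sum case_prod_unfold)
  have S: "vsp (scale H) (v.span (set (map snd (coalg.cop y))))"
    unfolding vsp_def using vector_space v.subspace_span by blast
  show "w \<in> v.span (set (map snd (coalg.cop y)))"
    unfolding w by (rule vsp_sum_list[OF S], rule v.span_scale, rule v.span_base) simp
qed simp

text \<open>Take an orbit of least dimension; a selected \<open>v\<close> inside it spans a suborbit
  of no smaller dimension. With \<open>Q\<close> saying that \<open>v\<close> is outside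
  \<open>core\<close> this produces a simple quotient, with \<open>Q\<close> saying that
  \<open>v\<close> is nonzero a simple submodule.\<close>

lemma orbit_min:
  assumes K: "K \<subseteq> carrier H" "y0 \<in> K" and clos: "\<And>y v. y \<in> K \<Longrightarrow> v \<in> orbit y \<Longrightarrow> Q v \<Longrightarrow> v \<in> K"
  shows "\<exists>y\<in>K. \<forall>v\<in>orbit y. Q v \<longrightarrow> orbit v = orbit y"
proof -
  interpret v: Vector_Spaces.vector_space "scale H" by (rule vector_space)
  obtain y where y: "y \<in> K" "\<And>z. z \<in> K \<Longrightarrow> v.dim (orbit y) \<le> v.dim (orbit z)"
    using ex_has_least_nat[of "\<lambda>y. y \<in> K" y0 "\<lambda>y. v.dim (orbit y)"] K(2) by blast
  have yc: "y \<in> carrier H" using y K by auto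
  show ?thesis
  proof (intro bexI[OF _ y(1)] ballI impI)
    fix v assume v: "v \<in> orbit y" "Q v"
    obtain F where F: "finite F" "orbit y \<subseteq> v.span F" using orbit_finite[OF yc] by blast
    show "orbit v = orbit y"
      by (rule subspace_eq_of_dim_le[OF orbit_vsp[OF orbit_closed[OF yc v(1)]] orbit_vsp[OF yc] orbit_sub[OF yc v(1)] F])
        (rule y(2)[OF clos[OF y(1) v]])
  qed
qed

text \<open>
  For \<open>y \<in> ker N\<close> outside \<open>core\<close> with an orbit of minimal dimension, take \<open>x\<close> in the socle of that orbit.
  A functional \<open>\<omega>\<close> with \<open>\<omega> y = 1\<close> that kills \<open>core\<close> yields a colinear map \<open>j\<close> of the orbit modulo
  \<open>core\<close> into \<open>Im N\<close>; if \<open>g\<close> is a linear section of \<open>j\<close>, then \<open>k x = T x\<^sub>1 \<circ> g (N x\<^sub>2)\<close> produces elements of \<open>ker N\<close>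
  coinvariant modulo \<open>core\<close>. Hence they lie in \<open>core\<close>, and \<open>x = x\<^sub>1 \<omega>(x\<^sub>2 \<circ> k x\<^sub>3) = 0\<close>.
\<close>

lemma kerN_core: "kerN \<subseteq> core"
proof (rule ccontr)
  assume "\<not> kerN \<subseteq> core"
  then obtain y0 where y0: "y0 \<in> kerN - core" by auto
  have "\<exists>y\<in>kerN - core. \<forall>v\<in>orbit y. v \<notin> core \<longrightarrow> orbit v = orbit y"
    by (rule orbit_min[OF _ y0]) (use hit_kerN orbitE in \<open>force simp: kerN_def\<close>)+
  \<comment> \<open>The orbit of \<open>y\<close> is a simple module modulo \<open>core\<close>: any
    of its elements outside \<open>core\<close> generates it.\<close>
  then obtain y where y: "y \<in> kerN" "y \<notin> core" and gen: "\<And>v. v \<in> orbit y \<Longrightarrow> v \<notin> core \<Longrightarrow> orbit v = orbit y" by auto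
  have yc: "y \<in> carrier H" using y unfolding kerN_def by auto
  note Vy = orbit_vsp[OF yc]
  have Vker: "v \<in> kerN" if "v \<in> orbit y" for v using orbitE[OF that] hit_kerN y(1) by blast
  have Vc: "v \<in> carrier H" if "v \<in> orbit y" for v using Vker[OF that] unfolding kerN_def by auto
  have regen: "\<exists>\<phi>. fnl \<phi> \<and> y = hit \<phi> v" if "v \<in> orbit y" "v \<notin> core" for v
    using gen[OF that] orbit_self[OF yc] orbitE by blast
  let ?K = "orbit y - {0}"
  have y_ne: "y \<noteq> 0" using y(2) vsp_0[OF core(1)] by auto
  have "\<exists>x\<in>?K. \<forall>v\<in>orbit x. v \<noteq> 0 \<longrightarrow> orbit v = orbit x"
    by (rule orbit_min[of _ y]) (use Vc orbit_self[OF yc] y_ne orbit_sub[OF yc] in auto)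
  \<comment> \<open>The orbit of \<open>x\<close> is a simple submodule of the orbit of
    \<open>y\<close>.\<close>
  then obtain x where x: "x \<in> orbit y" "x \<noteq> 0" and xmin: "\<And>v. v \<in> orbit x \<Longrightarrow> v \<noteq> 0 \<Longrightarrow> orbit v = orbit x" by auto
  have xc: "x \<in> carrier H" by (rule Vc[OF x(1)])
  \<comment> \<open>The maximal ideal of functionals moving \<open>y\<close> into the core annihilates the socle element \<open>x\<close>.\<close>
  have ann: "hit \<psi> x = 0" if \<psi>: "fnl \<psi>" and m: "hit \<psi> y \<in> core" for \<psi>
  proof (rule ccontr)
    assume ne: "hit \<psi> x \<noteq> 0"
    have "orbit (hit \<psi> x) = orbit x" by (rule xmin[OF orbitI[OF \<psi>] ne])
    then obtain \<phi> where \<phi>: "fnl \<phi>" "x = hit \<phi> (hit \<psi> x)" using orbit_self[OF xc] orbitE by blast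
    let ?\<theta> = "fconv \<psi> \<phi>"
    \<comment> \<open>\<open>?\<theta>\<close> fixes \<open>x\<close> and moves \<open>y\<close>
      into \<open>core\<close>, so its complement \<open>?\<xi>\<close> kills \<open>x\<close> and
      leaves \<open>y\<close> outside \<open>core\<close>. Then \<open>y\<close> is recovered from
      \<open>hit ?\<xi> y\<close>, and commuting the functionals forces \<open>x\<close> to
      vanish.\<close>
    let ?\<xi> = "\<lambda>h. counit H h - ?\<theta> h"
    have \<theta>: "fnl ?\<theta>" by (rule fconv_fnl[OF \<psi> \<phi>(1)])
    have \<xi>: "fnl ?\<xi>" by (rule lin_diff[OF vsp_UNIV[OF vs_field] counit_linear \<theta>])
    have "hit ?\<theta> y \<in> core" using core(4)[OF \<phi>(1) m] hit_hit[OF \<psi> \<phi>(1) yc] by simp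
    then have n: "hit ?\<xi> y \<notin> core"
      using y(2) vsp_add[OF core(1), of "hit ?\<xi> y" "hit ?\<theta> y"] by (auto simp: hit_diff[OF counit_linear \<theta>] hit_counit yc)
    have x0: "hit ?\<xi> x = 0" using hit_hit[OF \<psi> \<phi>(1) xc] \<phi>(2) by (simp add: hit_diff[OF counit_linear \<theta>] hit_counit xc)
    obtain \<eta> where \<eta>: "fnl \<eta>" "y = hit \<eta> (hit ?\<xi> y)" using regen[OF orbitI[OF \<xi>] n] by blast
    obtain \<zeta> where \<zeta>: "fnl \<zeta>" "x = hit \<zeta> y" using orbitE[OF x(1)] by blast
    have "x = hit \<zeta> (hit \<eta> (hit ?\<xi> y))" using \<zeta>(2) \<eta>(2) by simp
    also have "\<dots> = hit \<eta> (hit \<zeta> (hit ?\<xi> y))" by (rule hit_comm[OF \<eta>(1) \<zeta>(1) hit_closed[OF \<xi> yc]])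
    also have "hit \<zeta> (hit ?\<xi> y) = hit ?\<xi> (hit \<zeta> y)" by (rule hit_comm[OF \<xi> \<zeta>(1) yc])
    also have "hit \<eta> (hit ?\<xi> (hit \<zeta> y)) = 0" using \<zeta>(2) x0 linear_on_zero[OF V vector_space hit_lin[OF \<eta>(1)]] by simp
    finally show False using x(2) by simp
  qed
  obtain \<omega> where \<omega>': "linear_on (scale H) (*) UNIV UNIV \<omega>" and \<omega>y: "\<omega> y = 1" and \<omega>core: "\<And>m. m \<in> core \<Longrightarrow> \<omega> m = 0"
    using separating_functional[OF core(1) y(2)] by blast
  have \<omega>: "fnl \<omega>" by (rule linear_on_mono[OF \<omega>']) auto
  define j where "j = sweedler H (\<lambda>p q. scale H (\<omega> q) (N p))"
  have jl: "linear_on (scale H) (scale H) (carrier H) (carrier H) j"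
    unfolding j_def by (intro coalg.lin_sweedler_arg[OF V] bilinear_onI lin_scale1[OF V] lin_scale2[OF V] \<omega> N_lin N_closed)
  note jc = linear_on_closed[OF jl]
  \<comment> \<open>Evaluating \<open>j v\<close> at a functional is the same as letting the
    functional act on \<open>v\<close> and then applying \<open>\<omega>\<close>; all properties of
    \<open>j\<close> are read off from this duality.\<close>
  have \<psi>j: "\<psi> (j v) = \<omega> (hit \<psi> v)" if \<psi>: "fnl \<psi>" and v: "v \<in> carrier H" for \<psi> v
  proof -
    have "\<psi> (j v) = sweedler H (\<lambda>p q. \<psi> (scale H (\<omega> q) (N p))) v"
      unfolding j_def by (rule coalg.sweedler_hom[OF v V vs_field \<psi>]) (intro scale_closed N_closed)
    also have "\<dots> = sweedler H (\<lambda>p q. \<omega> (scale H (\<psi> (N p)) q)) v"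
      by (intro coalg.sweedler_cong[OF v]) (simp add: linear_on_scale[OF \<psi>] linear_on_scale[OF \<omega>] N_closed mult.commute)
    also have "\<dots> = \<omega> (hit \<psi> v)"
      unfolding hit_def by (rule coalg.sweedler_hom[symmetric, OF v V vs_field \<omega>]) (rule scale_closed)
    finally show ?thesis .
  qed
  have jker: "v \<in> core" if v: "v \<in> orbit y" and j0: "j v = 0" for v
  proof (rule ccontr)
    assume "v \<notin> core"
    then obtain \<phi> where \<phi>: "fnl \<phi>" "y = hit \<phi> v" using regen[OF v] by blast
    have "\<omega> y = \<phi> (j v)" unfolding \<phi>(2) using \<psi>j[OF \<phi>(1) Vc[OF v]] by simp
    also have "\<dots> = 0" unfolding j0 by (rule linear_on_zero[OF V vs_field \<phi>(1)])
    finally show False using \<omega>y by simp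
  qed
  define E where "E = j ` orbit y"
  have E: "vsp (scale H) E" unfolding E_def
    by (rule linear_on_image[OF Vy vector_space linear_on_mono[OF jl _ subset_UNIV]]) (use Vc in auto)
  have Ec: "l \<in> carrier H" if "l \<in> E" for l using that jc Vc unfolding E_def by auto
  let ?sl = "\<lambda>\<chi> x. sweedler H (\<lambda>u v. scale H (\<chi> u) (N v)) x"
  have sl_lin: "linear_on (scale H) (scale H) (carrier H) (carrier H) (?sl \<chi>)" if "fnl \<chi>" for \<chi>
    by (intro coalg.lin_sweedler_arg[OF V] bilinear_onI lin_scale1[OF V] lin_scale2[OF V] that N_lin N_closed)
  \<comment> \<open>A functional that vanishes on \<open>E\<close> moves \<open>y\<close> into
    \<open>core\<close>, so it kills \<open>x\<close> by \<open>ann\<close>. Therefore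
    \<open>x\<^sub>1 \<otimes> N x\<^sub>2\<close> lies in \<open>H \<otimes> E\<close>, the domain
    on which the section below is controlled.\<close>
  have slx: "?sl \<chi> x \<in> E" if \<chi>: "fnl \<chi>" for \<chi>
  proof (rule ccontr)
    assume nE: "?sl \<chi> x \<notin> E"
    obtain \<psi> where \<psi>': "linear_on (scale H) (*) UNIV UNIV \<psi>" and \<psi>1: "\<psi> (?sl \<chi> x) = 1" and \<psi>E: "\<And>m. m \<in> E \<Longrightarrow> \<psi> m = 0"
      using separating_functional[OF E nE] by blast
    have \<psi>: "fnl \<psi>" by (rule linear_on_mono[OF \<psi>']) auto
    have "hit \<psi> y \<in> core"
    proof (rule ccontr)
      assume "hit \<psi> y \<notin> core"
      then obtain \<phi> where \<phi>: "fnl \<phi>" "y = hit \<phi> (hit \<psi> y)" using regen[OF orbitI[OF \<psi>]] by blast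
      have "\<omega> y = \<omega> (hit \<psi> (hit \<phi> y))" using \<phi>(2) hit_comm[OF \<psi> \<phi>(1) yc] by simp
      also have "\<dots> = \<psi> (j (hit \<phi> y))" by (rule \<psi>j[symmetric, OF \<psi> hit_closed[OF \<phi>(1) yc]])
      also have "\<dots> = 0" using \<psi>E orbitI[OF \<phi>(1)] unfolding E_def by blast
      finally show False using \<omega>y by simp
    qed
    then have "hit \<psi> x = 0" by (rule ann[OF \<psi>])
    then have "\<chi> (hit \<psi> x) = 0" using linear_on_zero[OF V vs_field \<chi>] by simp
    moreover have "\<chi> (hit \<psi> x) = sweedler H (\<lambda>u v. \<psi> (N u) * \<chi> v) x"
    proof -
      have "\<chi> (hit \<psi> x) = sweedler H (\<lambda>u v. \<chi> (scale H (\<psi> (N u)) v)) x"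
        unfolding hit_def by (rule coalg.sweedler_hom[OF xc V vs_field \<chi>]) (rule scale_closed)
      also have "\<dots> = sweedler H (\<lambda>u v. \<psi> (N u) * \<chi> v) x"
        by (intro coalg.sweedler_cong[OF xc] linear_on_scale[OF \<chi>])
      finally show ?thesis .
    qed
    moreover have "\<psi> (?sl \<chi> x) = sweedler H (\<lambda>v u. \<chi> v * \<psi> (N u)) x"
    proof -
      have "\<psi> (?sl \<chi> x) = sweedler H (\<lambda>u v. \<psi> (scale H (\<chi> u) (N v))) x"
        by (rule coalg.sweedler_hom[OF xc V vs_field \<psi>]) (intro scale_closed N_closed)
      also have "\<dots> = sweedler H (\<lambda>u v. \<chi> u * \<psi> (N v)) x"
        by (intro coalg.sweedler_cong[OF xc] linear_on_scale[OF \<psi>] N_closed)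
      finally show ?thesis .
    qed
    moreover have "sweedler H (\<lambda>v u. \<chi> v * \<psi> (N u)) x = sweedler H (\<lambda>u v. \<psi> (N u) * \<chi> v) x"
      using coalg.cocomm[OF xc vsp_UNIV[OF vs_field], of "\<lambda>u v. \<psi> (N u) * \<chi> v"]
      by (simp add: mult.commute bilinear_onI lin_mult1 lin_mult2 fnl_N \<psi> \<chi>)
    ultimately show False using \<psi>1 by simp
  qed
  have jV: "linear_on (scale H) (scale H) (orbit y) UNIV j" by (rule linear_on_mono[OF jl]) (use Vc in auto)
  obtain g where gl: "linear_on (scale H) (scale H) UNIV (orbit y) g" and gj: "\<And>v. v \<in> orbit y \<Longrightarrow> j (g (j v)) = j v"
    using linear_on_section[OF Vy vector_space jV] by blast
  have gV: "g l \<in> orbit y" for l by (rule linear_on_closed[OF gl UNIV_I])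
  have gH: "linear_on (scale H) (scale H) (carrier H) (carrier H) g"
    by (rule linear_on_mono[OF gl]) (use Vc in auto)
  note gc = linear_on_closed[OF gH]
  have jg: "j (g l) = l" if "l \<in> E" for l using that gj unfolding E_def by auto
  let ?L = "\<lambda>\<phi> l. sweedler H (\<lambda>p q. scale H (\<phi> p) q) l"
  \<comment> \<open>Colinearity of \<open>j\<close>: the coaction on \<open>v\<close> corresponds to
    the comultiplication of \<open>j v\<close>.\<close>
  have jR: "j (hit \<phi> v) = ?L \<phi> (j v)" if \<phi>: "fnl \<phi>" and v: "v \<in> carrier H" for \<phi> v
  proof -
    let ?F = "\<lambda>a b c. scale H (\<phi> (N a)) (scale H (\<omega> c) (N b))"
    have F: "trilinear_on H (scale H) (carrier H) ?F"
      by (intro trilinear_onI lin_scale1[OF V] lin_scale2[OF V] fnl_N \<phi> \<omega> N_lin N_closed scale_closed; assumption)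
    have "j (hit \<phi> v) = sweedler H (\<lambda>a w. j (scale H (\<phi> (N a)) w)) v"
      unfolding hit_def by (rule coalg.sweedler_hom[OF v V vector_space jl]) (rule scale_closed)
    also have "\<dots> = sweedler H (\<lambda>a w. scale H (\<phi> (N a)) (j w)) v"
      by (intro coalg.sweedler_cong[OF v] linear_on_scale[OF jl])
    also have "\<dots> = sweedler H (\<lambda>a w. sweedler H (\<lambda>b c. ?F a b c) w) v"
      unfolding j_def
      by (intro coalg.sweedler_cong[OF v] coalg.sweedler_hom[OF _ V vector_space lin_scale2[OF V lin_id]] scale_closed N_closed)
    also have "\<dots> = sweedler H (\<lambda>w c. sweedler H (\<lambda>a b. ?F a b c) w) v"
      by (rule coalg.coassoc3[symmetric, OF v V F])
    also have "\<dots> = sweedler H (\<lambda>w c. ?L \<phi> (scale H (\<omega> c) (N w))) v"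
    proof (rule coalg.sweedler_cong[OF v])
      fix w c assume wc: "w \<in> carrier H" "c \<in> carrier H"
      have b: "bilinear_on (scale H) (scale H) (scale H) (carrier H) (carrier H) (carrier H) (\<lambda>p q. scale H (\<phi> p) q)" by (rule hit_bil[OF \<phi>])
      have Ll: "linear_on (scale H) (scale H) (carrier H) (carrier H) (?L \<phi>)" by (rule coalg.lin_sweedler_arg[OF V b])
      have "?L \<phi> (scale H (\<omega> c) (N w)) = scale H (\<omega> c) (?L \<phi> (N w))" by (rule linear_on_scale[OF Ll N_closed[OF wc(1)]])
      also have "?L \<phi> (N w) = sweedler H (\<lambda>a b. scale H (\<phi> (N a)) (N b)) w"
        by (rule sweedler_map[OF coalg.comultiplication_axioms V N_map wc(1) V b])
      also have "scale H (\<omega> c) \<dots> = sweedler H (\<lambda>a b. scale H (\<omega> c) (scale H (\<phi> (N a)) (N b))) w"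
        by (rule coalg.sweedler_hom[OF wc(1) V vector_space lin_scale2[OF V lin_id]]) (intro scale_closed N_closed)
      finally show "sweedler H (\<lambda>a b. ?F a b c) w = ?L \<phi> (scale H (\<omega> c) (N w))"
        by (simp add: vsp_scale_simps(3)[OF vector_space] mult.commute)
    qed
    also have "\<dots> = ?L \<phi> (j v)"
      unfolding j_def
      by (rule coalg.sweedler_hom[symmetric, OF v V vector_space coalg.lin_sweedler_arg[OF V hit_bil[OF \<phi>]]]) (intro scale_closed N_closed)
    finally show ?thesis .
  qed
  \<comment> \<open>A linear section is not expected to be colinear, but on \<open>E\<close> its
    defect lies in the orbit and is killed by \<open>j\<close>, hence lies in
    \<open>core\<close>.\<close>
  have gcol: "hit \<phi> (g l) - g (?L \<phi> l) \<in> core" if \<phi>: "fnl \<phi>" and l: "l \<in> E" for \<phi> l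
  proof (rule jker)
    have R: "hit \<phi> (g l) \<in> orbit y" using orbit_sub[OF yc gV] orbitI[OF \<phi>] by blast
    show "hit \<phi> (g l) - g (?L \<phi> l) \<in> orbit y" by (rule vsp_diff[OF Vy R gV])
    have jRl: "j (hit \<phi> (g l)) = ?L \<phi> l" using jR[OF \<phi> gc[OF Ec[OF l]]] jg[OF l] by simp
    then have "?L \<phi> l \<in> E" using R unfolding E_def by (metis image_eqI)
    then have "j (g (?L \<phi> l)) = ?L \<phi> l" by (rule jg)
    then show "j (hit \<phi> (g l) - g (?L \<phi> l)) = 0"
      using linear_on_diff[OF V jl Vc[OF R] Vc[OF gV]] jRl by simp
  qed
  define k where "k = sweedler H (\<lambda>u v. circ (Tinv u) (g (N v)))"
  have kb: "bilinear_on (scale H) (scale H) (scale H) (carrier H) (carrier H) (carrier H) (\<lambda>u v. circ (Tinv u) (g (N v)))"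
    by (intro bilinear_onI lin_bil1[OF circ_bilinear] lin_bil2[OF circ_bilinear] Tinv_lin lin_comp[OF gH N_lin] Tinv_closed gc N_closed)
  have kl: "linear_on (scale H) (scale H) (carrier H) (carrier H) k"
    unfolding k_def by (rule coalg.lin_sweedler_arg[OF V kb])
  note kcl = linear_on_closed[OF kl]
  have Nk: "N (k x') = 0" if x': "x' \<in> carrier H" for x'
  proof -
    have "N (k x') = sweedler H (\<lambda>u v. N (circ (Tinv u) (g (N v)))) x'"
      unfolding k_def by (rule coalg.sweedler_hom[OF x' V vector_space N_lin]) (intro circ_closed Tinv_closed gc N_closed)
    also have "\<dots> = sweedler H (\<lambda>u v. 0) x'"
      using Vker[OF gV] by (intro coalg.sweedler_cong[OF x'])
        (simp add: N_circ Tinv_closed gc N_closed kerN_def linear_on_zero[OF V vector_space bilinear_onD1[OF mult_bilinear]])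
    finally show ?thesis by (simp add: sweedler_sum case_prod_unfold)
  qed
  \<comment> \<open>The coaction on \<open>k x'\<close> consists of \<open>N (Tinv u)\<close> from
    the first factor and, by colinearity of \<open>g\<close> modulo \<open>core\<close>, of a
    Sweedler factor of \<open>N v\<close> from the second; these are inverse to each other and
    cancel to the counit.\<close>
  have kcoinv: "coinv core (k x')" if x': "x' \<in> carrier H" and sl: "\<And>\<chi>. fnl \<chi> \<Longrightarrow> ?sl \<chi> x' \<in> E" for x'
    unfolding coinv_def
  proof (intro conjI allI impI)
    show "k x' \<in> carrier H" by (rule kcl[OF x'])
    fix \<psi> assume \<psi>: "fnl \<psi>"
    let ?f = "\<lambda>u h. \<psi> (N (Tinv u) \<cdot> h)"
    have f: "fnl (?f u)" if "u \<in> carrier H" for u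
      by (rule fnl_translate[OF \<psi> N_closed[OF Tinv_closed[OF that]]])
    have fu: "fnl (\<lambda>u. ?f u h)" if "h \<in> carrier H" for h
      by (rule lin_comp[OF \<psi> lin_bil1[OF mult_bilinear lin_comp[OF N_lin Tinv_lin] that]])
    let ?A = "\<lambda>u v. sweedler H (\<lambda>u1 u2. circ (Tinv u2) (hit (?f u1) (g v))) u"
    let ?D = "\<lambda>u v. sweedler H (\<lambda>u1 u2. circ (Tinv u2) (g (?L (?f u1) v))) u"
    have cl: "linear_on (scale H) (scale H) (carrier H) (carrier H) (circ (Tinv u2))" if "u2 \<in> carrier H" for u2
      by (rule bilinear_onD1[OF circ_bilinear Tinv_closed[OF that]])
    have Rfu: "linear_on (scale H) (scale H) (carrier H) (carrier H) (\<lambda>u1. hit (?f u1) v)" if "v \<in> carrier H" for v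
      unfolding hit_def by (intro coalg.lin_param[OF that V] lin_scale1[OF V] fu N_closed)
    have Lfu: "linear_on (scale H) (scale H) (carrier H) (carrier H) (\<lambda>u1. ?L (?f u1) v)" if "v \<in> carrier H" for v
      by (intro coalg.lin_param[OF that V] lin_scale1[OF V] fu)
    have Lfc: "?L (?f u1) v \<in> carrier H" if "u1 \<in> carrier H" "v \<in> carrier H" for u1 v
      by (rule linear_on_closed[OF Lfu[OF that(2)] that(1)])
    have Rfc: "hit (?f u1) v \<in> carrier H" if "u1 \<in> carrier H" "v \<in> carrier H" for u1 v
      by (rule linear_on_closed[OF Rfu[OF that(2)] that(1)])
    have Ll: "linear_on (scale H) (scale H) (carrier H) (carrier H) (?L (?f u1))" if "u1 \<in> carrier H" for u1
      by (rule coalg.lin_sweedler_arg[OF V hit_bil[OF f[OF that]]])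
    have Ab: "bilinear_on (scale H) (scale H) (scale H) (carrier H) (carrier H) (carrier H) ?A"
      by (intro bilinear_onI coalg.lin_param[OF _ V] coalg.lin_sweedler[OF V lin_id] lin_bil1[OF circ_bilinear] lin_comp[OF cl] Rfu
        lin_comp[OF hit_lin[OF f] gH] Tinv_lin gc Rfc; assumption)
    have Db: "bilinear_on (scale H) (scale H) (scale H) (carrier H) (carrier H) (carrier H) ?D"
      by (intro bilinear_onI coalg.lin_param[OF _ V] coalg.lin_sweedler[OF V lin_id] lin_bil1[OF circ_bilinear] lin_comp[OF cl] lin_comp[OF gH Lfu]
        lin_comp[OF gH Ll] Tinv_lin gc Lfc; assumption)
    have "hit \<psi> (k x') = sweedler H (\<lambda>u v. hit \<psi> (circ (Tinv u) (g (N v)))) x'"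
      unfolding k_def by (rule coalg.sweedler_hom[OF x' V vector_space hit_lin[OF \<psi>]]) (intro circ_closed Tinv_closed gc N_closed)
    also have "\<dots> = sweedler H (\<lambda>u v. ?A u (N v)) x'"
    proof (rule coalg.sweedler_cong[OF x'])
      fix u v assume uv: "u \<in> carrier H" "v \<in> carrier H"
      have "hit \<psi> (circ (Tinv u) (g (N v))) = sweedler H (\<lambda>c1 c2. circ c2 (hit (\<lambda>h. \<psi> (N c1 \<cdot> h)) (g (N v)))) (Tinv u)"
        by (rule hit_circ[OF \<psi> Tinv_closed[OF uv(1)] gc[OF N_closed[OF uv(2)]]])
      also have "\<dots> = ?A u (N v)"
      proof (rule sweedler_map[OF coalg.comultiplication_axioms V Tinv_map uv(1) V])
        have gN: "g (N v) \<in> carrier H" by (rule gc[OF N_closed[OF uv(2)]])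
        have l1: "linear_on (scale H) (scale H) (carrier H) (carrier H) (\<lambda>c. hit (\<lambda>h. \<psi> (N c \<cdot> h)) (g (N v)))"
          unfolding hit_def
          by (intro coalg.lin_param[OF gN V] lin_scale1[OF V] lin_comp[OF \<psi> lin_bil1[OF mult_bilinear N_lin]] N_closed)
        show "bilinear_on (scale H) (scale H) (scale H) (carrier H) (carrier H) (carrier H) (\<lambda>c1 c2. circ c2 (hit (\<lambda>h. \<psi> (N c1 \<cdot> h)) (g (N v))))"
          by (intro bilinear_onI lin_bil1[OF circ_bilinear] lin_bil2[OF circ_bilinear] l1 lin_id linear_on_closed[OF l1]; assumption)
      qed
      finally show "hit \<psi> (circ (Tinv u) (g (N v))) = ?A u (N v)" .
    qed
    finally have 1: "hit \<psi> (k x') = sweedler H (\<lambda>u v. ?A u (N v)) x'" .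
    \<comment> \<open>\<open>?A\<close> applies the coaction after \<open>g\<close> and
      \<open>?D\<close> before it. The slices of \<open>u \<otimes> N v\<close> lie in
      \<open>E\<close>, where \<open>gcol\<close> places the difference in
      \<open>core\<close>.\<close>
    have "sweedler H (\<lambda>u v. ?A u (N v) - ?D u (N v)) x' \<in> core"
    proof (rule sweedler_slice[OF coalg.comultiplication_axioms x' V V core(1) lin_id N_lin])
      show "bilinear_on (scale H) (scale H) (scale H) (carrier H) (carrier H) (carrier H) (\<lambda>u v. ?A u v - ?D u v)"
        by (intro bilinear_onI lin_diff[OF V] bilinear_onD1[OF Ab] bilinear_onD2[OF Ab] bilinear_onD1[OF Db] bilinear_onD2[OF Db])
      show "?sl \<chi> x' \<in> E" if "fnl \<chi>" for \<chi> by (rule sl[OF that])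
      fix u v assume uv: "u \<in> carrier H" "v \<in> E"
      show "?A u v - ?D u v \<in> core"
        unfolding coalg.sweedler_diff[symmetric]
      proof (rule coalg.sweedler_closed[OF uv(1) core(1)])
        fix u1 u2 assume *: "u1 \<in> carrier H" "u2 \<in> carrier H"
        have "circ (Tinv u2) (hit (?f u1) (g v) - g (?L (?f u1) v)) \<in> core"
          by (rule circ_core[OF Tinv_closed[OF *(2)] gcol[OF f[OF *(1)] uv(2)]])
        then show "circ (Tinv u2) (hit (?f u1) (g v)) - circ (Tinv u2) (g (?L (?f u1) v)) \<in> core"
          using linear_on_diff[OF V cl[OF *(2)] Rfc[OF *(1) gc[OF Ec[OF uv(2)]]] gc[OF Lfc[OF *(1) Ec[OF uv(2)]]]] by simp
      qed
    qed
    then have 2: "hit \<psi> (k x') - sweedler H (\<lambda>u v. ?D u (N v)) x' \<in> core"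
      unfolding 1 coalg.sweedler_diff .
    let ?F = "\<lambda>u1 u2 v1 v2. scale H (?f u1 (N v1)) (circ (Tinv u2) (g (N v2)))"
    have Fl: "linear_on (scale H) (scale H) (carrier H) (carrier H) (\<lambda>a. ?F a b c d)"
      "linear_on (scale H) (scale H) (carrier H) (carrier H) (\<lambda>b. ?F a b c d)"
      "linear_on (scale H) (scale H) (carrier H) (carrier H) (\<lambda>c. ?F a b c d)"
      "linear_on (scale H) (scale H) (carrier H) (carrier H) (\<lambda>d. ?F a b c d)"
      if "a \<in> carrier H" "b \<in> carrier H" "c \<in> carrier H" "d \<in> carrier H" for a b c d
      by (intro lin_scale1[OF V] lin_scale2[OF V] fu lin_comp[OF f N_lin] bilinear_onD1[OF kb] bilinear_onD2[OF kb]
         N_closed circ_closed Tinv_closed gc that)+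
    have "sweedler H (\<lambda>u v. ?D u (N v)) x' = sweedler H (\<lambda>u v. sweedler H (\<lambda>u1 u2. sweedler H (\<lambda>v1 v2. ?F u1 u2 v1 v2) v) u) x'"
    proof (intro coalg.sweedler_cong[OF x'] coalg.sweedler_cong)
      fix u v u1 u2 assume *: "v \<in> carrier H" "u1 \<in> carrier H" "u2 \<in> carrier H"
      have "?L (?f u1) (N v) = sweedler H (\<lambda>v1 v2. scale H (?f u1 (N v1)) (N v2)) v"
        by (rule sweedler_map[OF coalg.comultiplication_axioms V N_map *(1) V hit_bil[OF f[OF *(2)]]])
      then have "circ (Tinv u2) (g (?L (?f u1) (N v))) = sweedler H (\<lambda>v1 v2. circ (Tinv u2) (g (scale H (?f u1 (N v1)) (N v2)))) v"
        using coalg.sweedler_hom[OF *(1) V vector_space lin_comp[OF cl[OF *(3)] gH], of "\<lambda>v1 v2. scale H (?f u1 (N v1)) (N v2)"]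
        by (simp add: scale_closed N_closed)
      also have "\<dots> = sweedler H (\<lambda>v1 v2. ?F u1 u2 v1 v2) v"
        by (intro coalg.sweedler_cong[OF *(1)] linear_on_scale[OF lin_comp[OF cl[OF *(3)] gH]] N_closed)
      finally show "circ (Tinv u2) (g (?L (?f u1) (N v))) = sweedler H (\<lambda>v1 v2. ?F u1 u2 v1 v2) v" .
    qed
    \<comment> \<open>The exchange brings \<open>N (Tinv u1)\<close> next to \<open>N v1\<close>,
      and leaves \<open>k v\<close> as the remaining factor.\<close>
    also have "\<dots> = sweedler H (\<lambda>u v. sweedler H (\<lambda>u1 v1. sweedler H (\<lambda>u2 v2. ?F u1 u2 v1 v2) v) u) x'"
      by (rule coalg.mid4[OF x' V]; rule Fl; assumption)
    also have "\<dots> = sweedler H (\<lambda>u v. scale H (counit H u) (scale H (\<psi> \<one>) (k v))) x'"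
    proof (rule coalg.sweedler_cong[OF x'])
      fix u v assume uv: "u \<in> carrier H" "v \<in> carrier H"
      have "sweedler H (\<lambda>u1 v1. sweedler H (\<lambda>u2 v2. ?F u1 u2 v1 v2) v) u = sweedler H (\<lambda>u1 v1. scale H (?f u1 (N v1)) (k v)) u"
        unfolding k_def
        by (intro coalg.sweedler_cong[OF uv(1)] coalg.sweedler_hom[symmetric, OF uv(2) V vector_space lin_scale2[OF V lin_id]]
          circ_closed Tinv_closed gc N_closed)
      also have "\<dots> = scale H (sweedler H (\<lambda>u1 v1. ?f u1 (N v1)) u) (k v)"
        by (rule coalg.sweedler_hom[symmetric, OF uv(1) vsp_UNIV[OF vs_field] vector_space lin_scale1[OF V lin_id kcl[OF uv(2)]]]) simp
      also have "sweedler H (\<lambda>u1 v1. ?f u1 (N v1)) u = \<psi> (sweedler H (\<lambda>u1 v1. N (Tinv u1) \<cdot> N v1) u)"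
        by (rule coalg.sweedler_hom[symmetric, OF uv(1) V vs_field \<psi>]) (intro mult_closed N_closed Tinv_closed)
      also have "sweedler H (\<lambda>u1 v1. N (Tinv u1) \<cdot> N v1) u = sweedler H (\<lambda>u1 v1. antipode H (N u1) \<cdot> N v1) u"
        by (intro coalg.sweedler_cong[OF uv(1)]) (simp add: N_Tinv)
      also have "\<dots> = sweedler H (\<lambda>p q. antipode H p \<cdot> q) (N u)"
        by (rule sweedler_map[symmetric, OF coalg.comultiplication_axioms V N_map uv(1) V])
          (intro bilinear_onI Hlin1 Hlin2 antipode_linear lin_id antipode_closed)
      also have "\<dots> = scale H (counit H u) \<one>"
        using coalgebra_map_counit[OF N_map uv(1)] by (simp add: antipode_left N_closed uv)
      finally show "sweedler H (\<lambda>u1 v1. sweedler H (\<lambda>u2 v2. ?F u1 u2 v1 v2) v) u = scale H (counit H u) (scale H (\<psi> \<one>) (k v))"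
        by (simp add: linear_on_scale[OF \<psi> one_closed] vsp_scale_simps(3)[OF vector_space])
    qed
    also have "\<dots> = scale H (\<psi> \<one>) (k x')"
      by (rule coalg.counit_left'[OF x' V]) (intro lin_scale2[OF V] kl)
    finally show "hit \<psi> (k x') - scale H (\<psi> \<one>) (k x') \<in> core" using 2 by simp
  qed
  \<comment> \<open>\<open>x\<close> itself is replaced by a slice \<open>x'\<close> of its
    comultiplication. Slicing again amounts to convolving functionals, so \<open>slx\<close> still
    applies and \<open>k x'\<close> lies in \<open>core\<close>.\<close>
  have kslice: "sweedler H (\<lambda>a b. scale H (\<chi> a) (k b)) x \<in> core" if \<chi>: "fnl \<chi>" for \<chi>
  proof -
    define x' where "x' = ?L \<chi> x"
    have x': "x' \<in> carrier H" unfolding x'_def by (rule linear_on_closed[OF coalg.lin_sweedler_arg[OF V hit_bil[OF \<chi>]] xc])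
    have "?sl \<chi>' x' \<in> E" if \<chi>': "fnl \<chi>'" for \<chi>'
    proof -
      have "?sl \<chi>' x' = sweedler H (\<lambda>a b. ?sl \<chi>' (scale H (\<chi> a) b)) x"
        unfolding x'_def by (rule coalg.sweedler_hom[OF xc V vector_space sl_lin[OF \<chi>']]) (rule scale_closed)
      also have "\<dots> = sweedler H (\<lambda>a b. scale H (\<chi> a) (?sl \<chi>' b)) x"
        by (intro coalg.sweedler_cong[OF xc] linear_on_scale[OF sl_lin[OF \<chi>']])
      also have "\<dots> = sweedler H (\<lambda>a b. sweedler H (\<lambda>p q. scale H (\<chi> a) (scale H (\<chi>' p) (N q))) b) x"
        by (intro coalg.sweedler_cong[OF xc] coalg.sweedler_hom[OF _ V vector_space lin_scale2[OF V lin_id]] scale_closed N_closed)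
      also have "\<dots> = sweedler H (\<lambda>a q. sweedler H (\<lambda>p r. scale H (\<chi> p) (scale H (\<chi>' r) (N q))) a) x"
        by (rule coalg.coassoc3[symmetric, OF xc V])
          (intro trilinear_onI lin_scale1[OF V] lin_scale2[OF V] \<chi> \<chi>' N_lin N_closed scale_closed; assumption)
      also have "\<dots> = ?sl (fconv \<chi> \<chi>') x"
      proof (rule coalg.sweedler_cong[OF xc])
        fix a q assume aq: "a \<in> carrier H" "q \<in> carrier H"
        show "sweedler H (\<lambda>p r. scale H (\<chi> p) (scale H (\<chi>' r) (N q))) a = scale H (fconv \<chi> \<chi>' a) (N q)"
          unfolding fconv_def
          using coalg.sweedler_hom[OF aq(1) vsp_UNIV[OF vs_field] vector_space lin_scale1[OF V lin_id N_closed[OF aq(2)]], of "\<lambda>p r. \<chi> p * \<chi>' r"]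
          by (simp add: vsp_scale_simps(3)[OF vector_space])
      qed
      finally show ?thesis using slx[OF fconv_fnl[OF \<chi> \<chi>']] by simp
    qed
    then have "k x' \<in> core" by (intro coinv_in_core kcoinv Nk x')
    also have "k x' = sweedler H (\<lambda>a b. k (scale H (\<chi> a) b)) x"
      unfolding x'_def by (rule coalg.sweedler_hom[OF xc V vector_space kl]) (rule scale_closed)
    also have "\<dots> = sweedler H (\<lambda>a b. scale H (\<chi> a) (k b)) x"
      by (intro coalg.sweedler_cong[OF xc] linear_on_scale[OF kl])
    finally show ?thesis .
  qed
  let ?G = "\<lambda>a m. sweedler H (\<lambda>u p. scale H (\<omega> (circ p m)) u) a"
  have Gb: "bilinear_on (scale H) (scale H) (scale H) (carrier H) (carrier H) (carrier H) ?G"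
    by (intro bilinear_onI coalg.lin_param[OF _ V] coalg.lin_sweedler[OF V lin_id] lin_scale1[OF V] lin_scale2[OF V] lin_id
      lin_comp[OF \<omega>] bilinear_onD1[OF circ_bilinear] bilinear_onD2[OF circ_bilinear]; assumption)
  have "sweedler H (\<lambda>a b. ?G a (k b)) x \<in> {0}"
  proof (rule sweedler_slice[OF coalg.comultiplication_axioms xc V V _ lin_id kl Gb kslice])
    show "vsp (scale H) {0}" by (rule stableD(1)[OF stable_zero])
    fix a m assume am: "a \<in> carrier H" "m \<in> core"
    have "?G a m = sweedler H (\<lambda>u p. 0) a"
      by (intro coalg.sweedler_cong[OF am(1)]) (simp add: \<omega>core circ_core am vsp_scale_simps[OF vector_space])
    then show "?G a m \<in> {0}" by (simp add: sweedler_sum case_prod_unfold)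
  qed
  then have 0: "sweedler H (\<lambda>a b. ?G a (k b)) x = 0" by simp
  \<comment> \<open>The descendant inverse built into \<open>k\<close> cancels, so
    \<open>g (N v)\<close> is recovered from values of \<open>k\<close>.\<close>
  have kk: "sweedler H (\<lambda>p b. circ p (k b)) v = g (N v)" if v: "v \<in> carrier H" for v
  proof -
    have "sweedler H (\<lambda>p b. circ p (k b)) v = sweedler H (\<lambda>p b. sweedler H (\<lambda>q c. circ p (circ (Tinv q) (g (N c)))) b) v"
      unfolding k_def
      by (intro coalg.sweedler_cong[OF v] coalg.sweedler_hom[OF _ V vector_space bilinear_onD1[OF circ_bilinear]] circ_closed Tinv_closed gc N_closed)
    also have "\<dots> = sweedler H (\<lambda>a c. sweedler H (\<lambda>p q. circ p (circ (Tinv q) (g (N c)))) a) v"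
      by (rule coalg.coassoc3[symmetric, OF v V])
        (intro trilinear_onI lin_bil1[OF circ_bilinear] lin_bil2[OF circ_bilinear] lin_id Tinv_lin lin_comp[OF gH N_lin]
          Tinv_closed gc N_closed circ_closed; assumption)
    also have "\<dots> = sweedler H (\<lambda>a c. scale H (counit H a) (g (N c))) v"
      by (intro coalg.sweedler_cong[OF v] circ_Tinv_circ gc N_closed)
    also have "\<dots> = g (N v)" by (rule coalg.counit_left'[OF v V lin_comp[OF gH N_lin]])
    finally show ?thesis .
  qed
  \<comment> \<open>The sum that was just shown to vanish is evaluated a second time, through
    \<open>kk\<close>, and turns out to be \<open>x\<close>.\<close>
  have "sweedler H (\<lambda>a b. ?G a (k b)) x = sweedler H (\<lambda>u v. sweedler H (\<lambda>p b. scale H (\<omega> (circ p (k b))) u) v) x"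
    by (rule coalg.coassoc3[OF xc V])
      (intro trilinear_onI lin_scale1[OF V] lin_scale2[OF V] lin_id lin_comp[OF \<omega>] lin_comp[OF bilinear_onD1[OF circ_bilinear] kl]
        bilinear_onD2[OF circ_bilinear] kcl; assumption)
  also have "\<dots> = sweedler H (\<lambda>u v. scale H (\<omega> (g (N v))) u) x"
  proof (rule coalg.sweedler_cong[OF xc])
    fix u v assume uv: "u \<in> carrier H" "v \<in> carrier H"
    show "sweedler H (\<lambda>p b. scale H (\<omega> (circ p (k b))) u) v = scale H (\<omega> (g (N v))) u"
      unfolding kk[OF uv(2), symmetric]
      by (rule coalg.sweedler_hom[symmetric, OF uv(2) V vector_space lin_scale1[OF V \<omega> uv(1)]]) (intro circ_closed kcl)
  qed
  also have "\<dots> = sweedler H (\<lambda>u v. scale H (counit H (N v)) u) x"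
  proof -
    \<comment> \<open>The counit of \<open>j v\<close> is \<open>\<omega> v\<close>, because
      \<open>hit (counit H)\<close> is the identity.\<close>
    have \<epsilon>: "counit H l = \<omega> (g l)" if "l \<in> E" for l
      using \<psi>j[OF counit_linear gc[OF Ec[OF that]]] jg[OF that] hit_counit[OF gc[OF Ec[OF that]]] by simp
    have "sweedler H (\<lambda>u v. scale H (\<omega> (g (N v))) u - scale H (counit H (N v)) u) x \<in> {0}"
    proof (rule sweedler_slice[OF coalg.comultiplication_axioms xc V V _ lin_id N_lin _ slx])
      show "vsp (scale H) {0}" by (rule stableD(1)[OF stable_zero])
      show "bilinear_on (scale H) (scale H) (scale H) (carrier H) (carrier H) (carrier H) (\<lambda>u v. scale H (\<omega> (g v)) u - scale H (counit H v) u)"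
        by (intro bilinear_onI lin_diff[OF V] lin_scale1[OF V] lin_scale2[OF V] lin_id lin_comp[OF \<omega> gH] counit_linear)
      show "scale H (\<omega> (g v)) u - scale H (counit H v) u \<in> {0}" if "v \<in> E" for u v
        using \<epsilon>[OF that] by simp
    qed
    then show ?thesis by (simp add: coalg.sweedler_diff)
  qed
  also have "\<dots> = sweedler H (\<lambda>u v. scale H (counit H v) u) x"
    by (intro coalg.sweedler_cong[OF xc]) (simp add: coalgebra_map_counit[OF N_map])
  also have "\<dots> = x" by (rule coalg.counit_right[OF xc])
  finally show False using 0 x(2) by simp
qed

lemma N_lam_kernel:
  assumes "w \<in> carrier H" "y \<in> carrier H" "N y = 0"
  shows "N (lam w y) = 0"
  using core(3)[OF core(5)[OF assms(1)]] kerN_core assms(2,3) unfolding kerN_def by auto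

end

section \<open>The actions on points\<close>

text \<open>Every axiom for \<open>G\<close> is needed only at elements \<open>f x\<close>, where
  \<open>sweedler_map\<close> pulls it back to \<open>C\<close>. It serves the two images in the
  matched pair and the image of sigma.\<close>

lemma surjective_coalgebra_map:
  assumes C: "cocommutative_coalgebra C" and s: "vector_space (scale G)" and f: "coalgebra_map C G f"
    and onto: "carrier G = f ` carrier C"
  shows "cocommutative_coalgebra G"
proof -
  interpret C: cocommutative_coalgebra C by fact
  note fl = coalgebra_map_linear[OF f] and fc = coalgebra_map_closed[OF f]
  let ?GG = "tensor_space (scale G) (scale G) (carrier G) (carrier G)"
  let ?t = "tensor_of G G"
  have G: "vsp (scale G) (carrier G)"
    unfolding onto by (rule linear_on_image[OF C.vspC s fl])
  have D: "linear_on (scale C) tensor_scale (carrier C) ?GG (sweedler C (\<lambda>u v. ?t (f u) (f v)))"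
    by (intro C.lin_sweedler_arg[OF tensor_space_vsp] bilinear_onI lin_pure1 lin_pure2 fl fc)
  have comult: "comult G (f x) = sweedler C (\<lambda>u v. ?t (f u) (f v)) x" if "x \<in> carrier C" for x
    by (rule coalgebra_map_comult[OF f that])
  have counit: "counit G (f x) = counit C x" if "x \<in> carrier C" for x
    by (rule coalgebra_map_counit[OF f that])
  have trans: "linear_on (scale G) s' (carrier G) U h"
    if h: "\<And>x. x \<in> carrier C \<Longrightarrow> h (f x) = k x" and k: "linear_on (scale C) s' (carrier C) U k" for h k s' U
    unfolding linear_on_def onto
  proof (intro conjI ballI allI)
    fix y assume "y \<in> f ` carrier C"
    then obtain x where x: "x \<in> carrier C" "y = f x" by auto
    show "h y \<in> U" using x h linear_on_closed[OF k] by simp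
    show "h (scale G c y) = s' c (h y)" for c
      using x h linear_on_scale[OF k] linear_on_scale[OF fl, symmetric] vsp_scale[OF C.vspC] by simp
    fix y' assume "y' \<in> f ` carrier C"
    then obtain x' where x': "x' \<in> carrier C" "y' = f x'" by auto
    show "h (y + y') = h y + h y'"
      using x x' h linear_on_add[OF k] linear_on_add[OF fl, symmetric] vsp_add[OF C.vspC] by simp
  qed
  have Gc: "comultiplication G"
    using G trans[OF comult D] unfolding vsp_def by (intro comultiplication.intro) auto
  interpret G: comultiplication G by (rule Gc)
  note sw = sweedler_map[OF C.comultiplication_axioms G f]
  show ?thesis
  proof (intro cocommutative_coalgebra.intro Gc cocommutative_coalgebra_axioms.intro)
    show "linear_on (scale G) (*) (carrier G) UNIV (counit G)" by (rule trans[OF counit C.counit_linear])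
    fix y assume "y \<in> carrier G"
    then obtain x where x: "x \<in> carrier C" and y: "y = f x" unfolding onto by auto
    let ?Q = "pure_tensor (scale G) tensor_scale"
    let ?GGG = "tensor_space (scale G) tensor_scale (carrier G) ?GG"
    have Qb: "bilinear_on (scale G) tensor_scale tensor_scale (carrier G) ?GG ?GGG ?Q" by (rule pure_tensor_bilinear)
    note vv = tensor_space_vsp[of "scale G" tensor_scale "carrier G" ?GG]
    have t_in: "?t a b \<in> ?GG" if "a \<in> carrier G" "b \<in> carrier G" for a b using that by (rule pure_tensor_in)
    have in1: "bilinear_on (scale G) (scale G) tensor_scale (carrier G) (carrier G) ?GGG (\<lambda>p q. ?Q p (?t q w))" if "w \<in> carrier G" for w
      by (intro bilinear_onI lin_bil1[OF Qb] lin_bil2[OF Qb] lin_pure1 lin_id t_in that; assumption)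
    have out1: "bilinear_on (scale G) (scale G) tensor_scale (carrier G) (carrier G) ?GGG (\<lambda>u w. sweedler G (\<lambda>p q. ?Q p (?t q w)) u)"
    proof (rule bilinear_onI)
      show "linear_on (scale G) tensor_scale (carrier G) ?GGG (\<lambda>w. sweedler G (\<lambda>p q. ?Q p (?t q w)) u)" if "u \<in> carrier G" for u
        by (intro G.lin_param[OF that vv] lin_bil2[OF Qb] lin_pure2 lin_id)
      show "linear_on (scale G) tensor_scale (carrier G) ?GGG (\<lambda>u. sweedler G (\<lambda>p q. ?Q p (?t q w)) u)" if "w \<in> carrier G" for w
        by (rule G.lin_sweedler_arg[OF vv in1[OF that]])
    qed
    have out2: "bilinear_on (scale G) (scale G) tensor_scale (carrier G) (carrier G) ?GGG (\<lambda>u w. ?Q u (comult G w))"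
      by (intro bilinear_onI lin_bil1[OF Qb] lin_bil2[OF Qb] lin_id G.comult_linear G.comult_closed)
    have l: "linear_on (scale C) tensor_scale (carrier C) ?GGG (\<lambda>a. ?Q (f a) (?t (f b) (f c)))"
      "linear_on (scale C) tensor_scale (carrier C) ?GGG (\<lambda>b. ?Q (f a) (?t (f b) (f c)))"
      "linear_on (scale C) tensor_scale (carrier C) ?GGG (\<lambda>c. ?Q (f a) (?t (f b) (f c)))"
      if "a \<in> carrier C" "b \<in> carrier C" "c \<in> carrier C" for a b c
      by (intro lin_bil1[OF Qb] lin_bil2[OF Qb] lin_pure1 lin_pure2 fl t_in fc that)+
    have "sweedler G (\<lambda>u w. sweedler G (\<lambda>p q. ?Q p (?t q w)) u) y
      = sweedler C (\<lambda>u w. sweedler G (\<lambda>p q. ?Q p (?t q (f w))) (f u)) x"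
      unfolding y by (rule sw[OF x vv out1])
    also have "\<dots> = sweedler C (\<lambda>u w. sweedler C (\<lambda>p q. ?Q (f p) (?t (f q) (f w))) u) x"
      by (intro C.sweedler_cong[OF x] sw[OF _ vv in1] fc)
    also have "\<dots> = sweedler C (\<lambda>u w. sweedler C (\<lambda>p q. ?Q (f u) (?t (f p) (f q))) w) x"
      by (rule C.coassoc3[OF x vv]) (intro trilinear_onI l; assumption)
    also have "\<dots> = sweedler C (\<lambda>u w. ?Q (f u) (comult G (f w))) x"
    proof (rule C.sweedler_cong[OF x])
      fix u w assume uw: "u \<in> carrier C" "w \<in> carrier C"
      show "sweedler C (\<lambda>p q. ?Q (f u) (?t (f p) (f q))) w = ?Q (f u) (comult G (f w))"
        unfolding comult[OF uw(2)]
        by (rule C.sweedler_hom[symmetric, OF uw(2) tensor_space_vsp vs_tensor bilinear_onD1[OF Qb fc[OF uw(1)]]]) (intro t_in fc)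
    qed
    also have "\<dots> = sweedler G (\<lambda>u w. ?Q u (comult G w)) y"
      unfolding y by (rule sw[symmetric, OF x vv out2])
    finally show "sweedler G (\<lambda>u w. sweedler G (\<lambda>p q. ?Q p (?t q w)) u) y = sweedler G (\<lambda>u w. ?Q u (comult G w)) y" .
    have cl: "linear_on (scale G) (*) (carrier G) UNIV (counit G)" by (rule trans[OF counit C.counit_linear])
    have "sweedler G (\<lambda>u v. scale G (counit G u) v) y = sweedler C (\<lambda>u v. scale G (counit G (f u)) (f v)) x"
      unfolding y by (rule sw[OF x G]) (intro bilinear_onI lin_scale1[OF G] lin_scale2[OF G] cl lin_id)
    also have "\<dots> = sweedler C (\<lambda>u v. scale G (counit C u) (f v)) x"
      by (intro C.sweedler_cong[OF x]) (simp add: counit)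
    also have "\<dots> = y" unfolding y by (rule C.counit_left'[OF x G fl])
    finally show "sweedler G (\<lambda>u v. scale G (counit G u) v) y = y" .
    have "sweedler G (\<lambda>u v. scale G (counit G v) u) y = sweedler C (\<lambda>u v. scale G (counit G (f v)) (f u)) x"
      unfolding y by (rule sw[OF x G]) (intro bilinear_onI lin_scale1[OF G] lin_scale2[OF G] cl lin_id)
    also have "\<dots> = sweedler C (\<lambda>u v. scale G (counit C v) (f u)) x"
      by (intro C.sweedler_cong[OF x]) (simp add: counit)
    also have "\<dots> = y" unfolding y by (rule C.counit_right'[OF x G fl])
    finally show "sweedler G (\<lambda>u v. scale G (counit G v) u) y = y" .
    have "sweedler G (\<lambda>u v. ?t v u) y = sweedler C (\<lambda>u v. ?t (f v) (f u)) x"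
      unfolding y by (rule sw[OF x tensor_space_vsp[of "scale G" "scale G" "carrier G" "carrier G"]]) (intro bilinear_onI lin_pure1 lin_pure2 lin_id)
    also have "\<dots> = sweedler C (\<lambda>u v. ?t (f u) (f v)) x"
      by (rule C.cocomm[OF x tensor_space_vsp[of "scale G" "scale G" "carrier G" "carrier G"]])
        (intro bilinear_onI lin_pure1 lin_pure2 fl fc)
    finally show "sweedler G (\<lambda>u v. ?t v u) y = comult G y" unfolding y comult[OF x] .
  qed
qed

lemma coalgebra_map_image:
  assumes "coalgebra_map C G f" shows "coalgebra_map C (G\<lparr>carrier := f ` carrier C\<rparr>) f"
  using assms unfolding coalgebra_map_def linear_on_def by simp

lemma pairing_proj:
  assumes "coalgebra_pair A X" "cocommutative_coalgebra C" "f \<in> points C A" "g \<in> points C X"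
  shows "(\<lambda>c. proj1 A X (pairing C A X f g c)) = f" "(\<lambda>c. proj2 A X (pairing C A X f g c)) = g"
proof -
  interpret coalgebra_pair A X by fact
  interpret C: cocommutative_coalgebra C by fact
  note f = points_closed[OF assms(3)] and g = points_closed[OF assms(4)]
  note fm = points_map[OF assms(3)] and gm = points_map[OF assms(4)]
  show "(\<lambda>c. proj1 A X (pairing C A X f g c)) = f"
  proof
    fix c show "proj1 A X (pairing C A X f g c) = f c"
    proof (cases "c \<in> carrier C")
      case c: True
      have "proj1 A X (pairing C A X f g c) = sweedler C (\<lambda>u v. proj1 A X (pt (f u) (g v))) c"
        unfolding pairing_def using c
        by (auto intro!: C.sweedler_hom[OF c tensor_space_vsp A.vector_space proj1_linear] pt_in f g)
      also have "\<dots> = sweedler C (\<lambda>u v. scale A (counit C v) (f u)) c"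
        by (intro C.sweedler_cong[OF c]) (simp add: proj1_pure f g coalgebra_map_counit[OF gm])
      also have "\<dots> = f c" by (rule C.counit_right'[OF c A.vspC coalgebra_map_linear[OF fm]])
      finally show ?thesis .
    qed (simp add: pairing_def points_outside[OF assms(3)] linear_on_zero[OF tensor_space_vsp A.vector_space proj1_linear])
  qed
  show "(\<lambda>c. proj2 A X (pairing C A X f g c)) = g"
  proof
    fix c show "proj2 A X (pairing C A X f g c) = g c"
    proof (cases "c \<in> carrier C")
      case c: True
      have "proj2 A X (pairing C A X f g c) = sweedler C (\<lambda>u v. proj2 A X (pt (f u) (g v))) c"
        unfolding pairing_def using c
        by (auto intro!: C.sweedler_hom[OF c tensor_space_vsp X.vector_space proj2_linear] pt_in f g)
      also have "\<dots> = sweedler C (\<lambda>u v. scale X (counit C u) (g v)) c"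
        by (intro C.sweedler_cong[OF c]) (simp add: proj2_pure f g coalgebra_map_counit[OF fm])
      also have "\<dots> = g c" by (rule C.counit_left'[OF c X.vspC coalgebra_map_linear[OF gm]])
      finally show ?thesis .
    qed (simp add: pairing_def points_outside[OF assms(4)] linear_on_zero[OF tensor_space_vsp X.vector_space proj2_linear])
  qed
qed

text \<open>Naturality in the test coalgebra: what is known at universal points is pulled back to
  arbitrary ones.\<close>

lemma pairing_comp:
  assumes "coalgebra_pair A X" "cocommutative_coalgebra C" "cocommutative_coalgebra K"
    "f \<in> points K A" "g \<in> points K X" "q \<in> points C K"
  shows "pairing C A X (\<lambda>c. f (q c)) (\<lambda>c. g (q c)) = (\<lambda>c. pairing K A X f g (q c))"
proof
  interpret coalgebra_pair A X by fact
  interpret C: cocommutative_coalgebra C by fact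
  interpret K: cocommutative_coalgebra K by fact
  note fl = coalgebra_map_linear[OF points_map[OF assms(4)]] and gl = coalgebra_map_linear[OF points_map[OF assms(5)]]
  note fc = points_closed[OF assms(4)] and gc = points_closed[OF assms(5)]
  have b: "bilinear_on (scale K) (scale K) tensor_scale (carrier K) (carrier K) TS (\<lambda>u v. pt (f u) (g v))"
    by (intro bilinear_onI lin_pure1 lin_pure2 fl gl fc gc)
  fix c show "pairing C A X (\<lambda>c. f (q c)) (\<lambda>c. g (q c)) c = pairing K A X f g (q c)"
  proof (cases "c \<in> carrier C")
    case c: True
    then show ?thesis
      using sweedler_map[OF C.comultiplication_axioms K.vspC points_map[OF assms(6)] c tensor_space_vsp b]
      by (simp add: pairing_def points_closed[OF assms(6)])
  next
    case False
    then show ?thesis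
      using linear_on_zero[OF K.vspC vs_tensor K.lin_sweedler_arg[OF tensor_space_vsp b]]
      by (simp add: pairing_def points_outside[OF assms(6)])
  qed
qed

lemma cmul_comp:
  assumes "cocommutative_hopf_algebra H" "cocommutative_coalgebra C" "cocommutative_coalgebra K"
    "f \<in> points K H" "g \<in> points K H" "q \<in> points C K"
  shows "cmul C H (\<lambda>c. f (q c)) (\<lambda>c. g (q c)) = (\<lambda>c. cmul K H f g (q c))"
proof
  interpret H: cocommutative_hopf_algebra H by fact
  interpret C: cocommutative_coalgebra C by fact
  interpret K: cocommutative_coalgebra K by fact
  note fl = coalgebra_map_linear[OF points_map[OF assms(4)]] and gl = coalgebra_map_linear[OF points_map[OF assms(5)]]
  note fc = points_closed[OF assms(4)] and gc = points_closed[OF assms(5)]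
  have b: "bilinear_on (scale K) (scale K) (scale H) (carrier K) (carrier K) (carrier H) (\<lambda>u v. mult H (f u) (g v))"
    by (intro bilinear_onI H.Hlin1 H.Hlin2 fl gl fc gc)
  fix c show "cmul C H (\<lambda>c. f (q c)) (\<lambda>c. g (q c)) c = cmul K H f g (q c)"
  proof (cases "c \<in> carrier C")
    case c: True
    then show ?thesis
      using sweedler_map[OF C.comultiplication_axioms K.vspC points_map[OF assms(6)] c H.coalg.vspC b]
      by (simp add: cmul_def points_closed[OF assms(6)])
  next
    case False
    then show ?thesis
      using linear_on_zero[OF K.vspC H.vector_space K.lin_sweedler_arg[OF H.coalg.vspC b]]
      by (simp add: cmul_def points_outside[OF assms(6)])
  qed
qed

section \<open>The companion as a Rota-Baxter operator, and the values of the two actions at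
  arbitrary preimages\<close>

context rota_baxter_hopf
begin

interpretation pair: coalgebra_pair H H by (rule pair)
interpretation R1: rb_points H H B by (rule rb_pointsI[OF coalg.cocommutative_coalgebra_axioms])
interpretation R2: rb_points "tens H H" H B by (rule rb_pointsI[OF pair.coalgebra])

text \<open>By \<open>circ_via_conj\<close> the argument on the right of the Rota-Baxter identity
  for \<open>N\<close> is \<open>circ x y\<close>, so the identity is the multiplicativity of
  \<open>N\<close>.\<close>

lemma rb_tilde_rota_baxter: "rota_baxter_hopf H N"
proof (intro rota_baxter_hopf.intro cocommutative_hopf_algebra_axioms rota_baxter_hopf_axioms.intro N_map)
  fix x y assume x: "x \<in> carrier H" and y: "y \<in> carrier H"
  let ?F = "\<lambda>p q w. N p \<cdot> y \<cdot> antipode H (N q) \<cdot> w"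
  have l: "linear_on (scale H) (scale H) (carrier H) (carrier H) (\<lambda>p. ?F p q w)"
     "linear_on (scale H) (scale H) (carrier H) (carrier H) (\<lambda>q. ?F p q w)"
     "linear_on (scale H) (scale H) (carrier H) (carrier H) (\<lambda>w. ?F p q w)"
    if "p \<in> carrier H" "q \<in> carrier H" "w \<in> carrier H" for p q w
    by (intro Hlin1 Hlin2 N_lin lin_comp[OF antipode_linear N_lin] lin_id mult_closed antipode_closed N_closed y that)+
  have "sweedler3 H ?F x = sweedler H (\<lambda>u w. sweedler H (\<lambda>p q. ?F p q w) u) x"
    unfolding sweedler3_def by (rule coalg.coassoc3[symmetric, OF x V]) (intro trilinear_onI l; assumption)
  also have "\<dots> = sweedler H (\<lambda>u w. conj (N u) y \<cdot> w) x"
  proof (rule coalg.sweedler_cong[OF x])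
    fix u w assume uw: "u \<in> carrier H" "w \<in> carrier H"
    have "conj (N u) y = sweedler H (\<lambda>p q. N p \<cdot> (y \<cdot> antipode H (N q))) u"
      unfolding conj_def
      by (rule sweedler_map[OF coalg.comultiplication_axioms V N_map uw(1) V])
        (intro bilinear_onI Hlin1 Hlin2 antipode_linear lin_id mult_closed antipode_closed y)
    also have "\<dots> = sweedler H (\<lambda>p q. N p \<cdot> y \<cdot> antipode H (N q)) u"
      by (intro coalg.sweedler_cong[OF uw(1)]) (simp add: mult_assoc N_closed antipode_closed y)
    finally show "sweedler H (\<lambda>p q. ?F p q w) u = conj (N u) y \<cdot> w"
      using coalg.sweedler_hom[OF uw(1) V vector_space bilinear_onD2[OF mult_bilinear uw(2)], of "\<lambda>p q. N p \<cdot> y \<cdot> antipode H (N q)"]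
      by (simp add: mult_closed N_closed antipode_closed y)
  qed
  also have "\<dots> = circ x y" by (rule circ_via_conj[symmetric, OF x y])
  finally show "N x \<cdot> N y = N (sweedler3 H ?F x)" by (simp add: N_circ x y)
qed

text \<open>In a group N (x^-1) is x^-1 P (x^-1), so x N (x^-1) is P (x^-1), which is B x.\<close>

lemma rb_tilde_tilde: "x \<in> carrier H \<Longrightarrow> rb_tilde H N x = B x"
proof -
  assume x: "x \<in> carrier H"
  have "rb_tilde H N x = cm idp (\<lambda>c. N (idS c)) x"
    unfolding rb_tilde_def[of H N] cmul_def using x by (auto intro!: coalg.sweedler_cong)
  also have "(\<lambda>c. N (idS c)) = cm idS (\<lambda>c. P (idS c))"
    using R1.N_point[OF id_points(5)] unfolding R1.G.N_def by simp
  also have "cm idp (cm idS (\<lambda>c. P (idS c))) = (\<lambda>c. P (idS c))"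
  proof (rule R1.Q.cmul_inv_lin(2)[OF id_points(1)])
    show "R1.Q.lin (\<lambda>c. P (idS c))" by (rule R1.Q.points_lin[OF R1.G.P_closed[OF id_points(5)]])
    show "P (idS c) = 0" if "c \<notin> carrier H" for c
      by (rule points_outside[OF R1.G.P_closed[OF id_points(5)] that])
  qed
  finally show ?thesis using x by (simp add: antipode_antipode)
qed

text \<open>At the inverse of x the word for \<open>rb_antipode\<close> is (P x)^-1 x (P x), the
  inverse of T x. This links the prescribed right action to \<open>rho_alt\<close>.\<close>

lemma rb_antipode_alt: "x \<in> carrier H \<Longrightarrow> rb_antipode H B (antipode H x) = antipode H (Tinv x)"
proof -
  assume x: "x \<in> carrier H"
  let ?F = "\<lambda>u v w. antipode H (B u) \<cdot> antipode H v \<cdot> B w"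
  note Sl = antipode_linear and Sc = antipode_closed and Bl = B_lin and Bc = B_closed
  have b: "bilinear_on (scale H) (scale H) (scale H) (carrier H) (carrier H) (carrier H) (\<lambda>u y. sweedler H (\<lambda>v w. ?F u v w) y)"
    by (intro bilinear_onI coalg.lin_param[OF _ V] coalg.lin_sweedler[OF V lin_id] Hlin1 Hlin2 lin_comp[OF Sl Bl] Sl Bl mult_closed Sc Bc; assumption)
  have "rb_antipode H B (antipode H x) = sweedler H (\<lambda>u y. sweedler H (\<lambda>v w. ?F (antipode H u) v w) (antipode H y)) x"
    unfolding rb_antipode_def sweedler3_def
    by (rule sweedler_map[OF coalg.comultiplication_axioms V antipode_map x V b])
  also have "\<dots> = sweedler H (\<lambda>u y. sweedler H (\<lambda>v w. ?F (antipode H u) (antipode H v) (antipode H w)) y) x"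
    by (rule coalg.sweedler_cong[OF x], rule sweedler_map[OF coalg.comultiplication_axioms V antipode_map _ V], assumption)
      (intro bilinear_onI Hlin1 Hlin2 Sl Bl mult_closed Sc Bc; assumption)
  also have "\<dots> = sweedler H (\<lambda>u y. antipode H (P u) \<cdot> sweedler H (\<lambda>v w. v \<cdot> P w) y) x"
  proof (rule coalg.sweedler_cong[OF x])
    fix u y assume uy: "u \<in> carrier H" "y \<in> carrier H"
    have "antipode H (P u) \<cdot> sweedler H (\<lambda>v w. v \<cdot> P w) y = sweedler H (\<lambda>v w. antipode H (P u) \<cdot> (v \<cdot> P w)) y"
      by (rule coalg.sweedler_hom[OF uy(2) V vector_space bilinear_onD1[OF mult_bilinear]]) (intro mult_closed Sc Bc uy; assumption)+
    also have "\<dots> = sweedler H (\<lambda>v w. ?F (antipode H u) (antipode H v) (antipode H w)) y"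
      by (intro coalg.sweedler_cong[OF uy(2)]) (simp add: mult_assoc antipode_antipode Sc Bc uy)
    finally show "sweedler H (\<lambda>v w. ?F (antipode H u) (antipode H v) (antipode H w)) y = antipode H (P u) \<cdot> sweedler H (\<lambda>v w. v \<cdot> P w) y" ..
  qed
  also have "\<dots> = cm idSP (cm idp idP) x"
    unfolding cmul_def using x by (auto intro!: coalg.sweedler_cong arg_cong2[of _ _ _ _ "mult H"])
  also have "cm idSP (cm idp idP) = (\<lambda>c. antipode H (R1.G.T idp c))"
    unfolding R1.G.T_def using id_points by (simp add: R1.Q.G.inv_mul R1.Q.G.assoc R1.Q.cmul_point R1.Q.G.inv_inv)
  finally show ?thesis using x by (simp add: R1.T_point[OF id_points(1)])
qed

definition rho where "rho x y = R2.G.rho p1 p2 (pt x y)"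

lemma rhop: "R2.G.rho p1 p2 \<in> points (tens H H) H"
  by (intro R2.G.rho_closed pair.proj1_point pair.proj2_point)

lemma rho_lin: "linear_on tensor_scale (scale H) HH (carrier H) (R2.G.rho p1 p2)"
  using coalgebra_map_linear[OF points_map[OF rhop]] by simp

lemma rho_bilinear: "bilinear_on (scale H) (scale H) (scale H) (carrier H) (carrier H) (carrier H) rho"
  unfolding rho_def[abs_def] by (intro bilinear_onI lin_comp[OF rho_lin] lin_pure1 lin_pure2 lin_id)

lemmas rho_closed = bilinear_on_closed[OF rho_bilinear]

text \<open>The chosen preimage under \<open>B\<close> is harmless, since the formula uses it only
  through \<open>B\<close>. Two preimages under \<open>N\<close> differ by an element of the kernel,
  which \<open>N_lam_kernel\<close> absorbs.\<close>

lemma act_left: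
  assumes x: "x \<in> carrier H" and y: "y \<in> carrier H"
  shows "rb_act_left H B (P x) (N y) = N (lam x y)"
proof -
  define x' where "x' = inv_into (carrier H) B (P x)"
  define y' where "y' = inv_into (carrier H) N (N y)"
  have x': "x' \<in> carrier H" "B x' = P x"
    unfolding x'_def using antipode_closed[OF x] by (auto intro!: inv_into_into f_inv_into_f)
  have y': "y' \<in> carrier H" "N y' = N y"
    unfolding y'_def using y by (auto intro!: inv_into_into f_inv_into_f)
  let ?F = "\<lambda>u v. u \<cdot> y' \<cdot> antipode H v"
  have b: "bilinear_on (scale H) (scale H) (scale H) (carrier H) (carrier H) (carrier H) ?F"
    by (intro bilinear_onI Hlin1 Hlin2 lin_id antipode_linear mult_closed antipode_closed y')
  have "sweedler H (\<lambda>x1 x2. B x1 \<cdot> y' \<cdot> antipode H (B x2)) x' = sweedler H ?F (B x')"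
    by (rule sweedler_map[symmetric, OF coalg.comultiplication_axioms V coalgebra_map x'(1) V b])
  also have "\<dots> = sweedler H (\<lambda>u v. P u \<cdot> y' \<cdot> antipode H (P v)) x"
    unfolding x'(2) by (rule sweedler_map[OF coalg.comultiplication_axioms V P_map x V b])
  also have "\<dots> = lam x y'"
    unfolding lam_def by (intro coalg.sweedler_cong[OF x]) (simp add: mult_assoc B_closed antipode_closed y')
  finally have "rb_act_left H B (P x) (N y) = N (lam x y')"
    unfolding rb_act_left_def Let_def x'_def[symmetric] y'_def[symmetric] by simp
  also have "\<dots> = N (lam x y)"
  proof -
    have d: "y' - y \<in> carrier H" "N (y' - y) = 0"
      using vsp_diff[OF V] linear_on_diff[OF V N_lin] y y' by simp_all
    have "N (lam x (y' - y)) = 0" by (rule N_lam_kernel[OF x d])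
    then show ?thesis
      using linear_on_diff[OF V bilinear_onD1[OF lam_bilinear x] y'(1) y] linear_on_diff[OF V N_lin lam_closed[OF x y'(1)] lam_closed[OF x y]]
      by simp
  qed
  finally show ?thesis .
qed

text \<open>The chosen \<open>x'\<close> enters through \<open>rb_antipode\<close>, and all choices
  give arguments \<open>z'\<close> with the same value under \<open>B\<close>. So conjugation by the
  inverse of \<open>N y\<close> has to respect the kernel of \<open>B\<close>; this is
  \<open>N_lam_kernel\<close> for the operator \<open>N\<close>, whose companion is
  \<open>B\<close>.\<close>

lemma act_right:
  assumes x: "x \<in> carrier H" and y: "y \<in> carrier H"
  shows "rb_act_right H B (P x) (N y) = P (rho x y)"
proof -
  define x' where "x' = inv_into (carrier H) B (P x)"
  define y' where "y' = inv_into (carrier H) N (N y)"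
  have x': "x' \<in> carrier H" "B x' = P x"
    unfolding x'_def using antipode_closed[OF x] by (auto intro!: inv_into_into f_inv_into_f)
  have y': "y' \<in> carrier H" "N y' = N y"
    unfolding y'_def using y by (auto intro!: inv_into_into f_inv_into_f)
  note Sl = antipode_linear and Sc = antipode_closed and Bl = B_lin and Bc = B_closed
  define z' where "z' = rb_antipode H B x'"
  define z where "z = antipode H (Tinv x)"
  have z'_alt: "z' = antipode H (Tinv (antipode H x'))"
    using rb_antipode_alt[OF Sc[OF x'(1)]] unfolding z'_def antipode_antipode[OF x'(1)] .
  have zc: "z \<in> carrier H" "z' \<in> carrier H" unfolding z_def z'_alt by (intro Sc Tinv_closed x x')+
  have Bz: "B z' = B z"
    unfolding z_def z'_alt by (simp add: P_Tinv x x' Sc antipode_antipode)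
  let ?k = "\<lambda>z. sweedler H (\<lambda>u v. antipode H (N u) \<cdot> (z \<cdot> N v)) y"
  have kl: "linear_on (scale H) (scale H) (carrier H) (carrier H) ?k"
    by (intro coalg.lin_param[OF y V] Hlin1 Hlin2 lin_id mult_closed N_closed Sc)
  note kc = linear_on_closed[OF kl]
  have mul_ok: "bilinear_on (scale H) (scale H) (scale H) (carrier H) (carrier H) (carrier H) (\<lambda>u v. antipode H u \<cdot> (z' \<cdot> v))"
    by (intro bilinear_onI Hlin1 Hlin2 lin_id Sl mult_closed Sc zc)
  have "sweedler H (\<lambda>y1 y2. antipode H (N y1) \<cdot> z' \<cdot> N y2) y' = sweedler H (\<lambda>y1 y2. antipode H (N y1) \<cdot> (z' \<cdot> N y2)) y'"
    by (intro coalg.sweedler_cong[OF y'(1)]) (simp add: mult_assoc N_closed Sc zc)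
  also have "\<dots> = sweedler H (\<lambda>u v. antipode H u \<cdot> (z' \<cdot> v)) (N y)"
    unfolding y'(2)[symmetric] by (rule sweedler_map[symmetric, OF coalg.comultiplication_axioms V N_map y'(1) V mul_ok])
  also have "\<dots> = ?k z'"
    by (rule sweedler_map[OF coalg.comultiplication_axioms V N_map y V mul_ok])
  finally have 1: "rb_act_right H B (P x) (N y) = antipode H (B (?k z'))"
    unfolding rb_act_right_def Let_def x'_def[symmetric] y'_def[symmetric] z'_def by simp
  interpret K: rota_baxter_hopf H N by (rule rb_tilde_rota_baxter)
  \<comment> \<open>The argument is chosen so that the operator of the companion structure,
    \<open>N\<close> after the antipode, takes it to \<open>antipode H (N y)\<close>.\<close>
  have Klam: "K.lam (antipode H (Tinv y)) d = ?k d" if d: "d \<in> carrier H" for d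
  proof -
    let ?F = "\<lambda>u v. N (antipode H u) \<cdot> (d \<cdot> antipode H (N (antipode H v)))"
    have "coalgebra_map H H (\<lambda>y. antipode H (Tinv y))"
      by (rule coalgebra_map_comp[OF coalg.comultiplication_axioms V V Tinv_map antipode_map])
    then have "sweedler H ?F (antipode H (Tinv y)) = sweedler H (\<lambda>u v. ?F (antipode H (Tinv u)) (antipode H (Tinv v))) y"
      by (rule sweedler_map[OF coalg.comultiplication_axioms V _ y V])
        (intro bilinear_onI Hlin1 Hlin2 lin_comp[OF N_lin Sl] lin_comp[OF Sl lin_comp[OF N_lin Sl]] mult_closed N_closed Sc d)
    also have "\<dots> = ?k d"
      by (intro coalg.sweedler_cong[OF y]) (simp add: antipode_antipode N_Tinv Tinv_closed Sc N_closed)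
    finally show ?thesis unfolding K.lam_def .
  qed
  have "B (?k (z' - z)) = 0"
  proof -
    have d: "z' - z \<in> carrier H" by (rule vsp_diff[OF V zc(2,1)])
    have "B (z' - z) = 0" using Bz linear_on_diff[OF V Bl zc(2,1)] by simp
    then have "rb_tilde H N (K.lam (antipode H (Tinv y)) (z' - z)) = 0"
      by (intro K.N_lam_kernel Sc Tinv_closed y d) (simp add: rb_tilde_tilde d)
    then show ?thesis unfolding Klam[OF d] by (simp add: rb_tilde_tilde kc d)
  qed
  then have 2: "B (?k z') = B (?k z)"
    using linear_on_diff[OF V kl zc(2,1)] linear_on_diff[OF V Bl kc[OF zc(2)] kc[OF zc(1)]] by simp
  note p = pair.proj1_point pair.proj2_point
  let ?Np = "R2.G.N p2" and ?Tp = "R2.G.T p1"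
  let ?g = "cmul (tens H H) H (cmul (tens H H) H (\<lambda>c. antipode H (?Np c)) ?Tp) ?Np"
  note Np = R2.G.closed(2)[OF p(2)] and Tp = R2.G.closed(3)[OF p(1)]
  have g: "?g \<in> points (tens H H) H" by (intro R2.Q.cmul_point R2.Q.antipode_point Np Tp)
  let ?K = "cmul (tens H H) H (\<lambda>c. antipode H (?Tp c)) ?Np"
  have Kp: "?K \<in> points (tens H H) H" by (intro R2.Q.cmul_point R2.Q.antipode_point Np Tp)
  have Kl: "linear_on tensor_scale (scale H) HH (carrier H) ?K"
    using coalgebra_map_linear[OF points_map[OF Kp]] by simp
  have invg: "(\<lambda>c. antipode H (?g c)) = cmul (tens H H) H (\<lambda>c. antipode H (?Np c)) ?K"
    using Np Tp R2.Q.antipode_point[OF Np] R2.Q.antipode_point[OF Tp]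
    by (simp add: R2.Q.G.inv_mul R2.Q.cmul_point R2.Q.G.inv_inv)
  have Ke: "?K (pt x e) = z \<cdot> N e" if e: "e \<in> carrier H" for e
    unfolding cmul_def R2.T_point[OF p(1)] R2.N_point[OF p(2)] z_def
    using pair.eval_indep[OF x e V mult_bilinear lin_comp[OF Sl Tinv_lin] N_lin] pt_in_tens[OF x e] by simp
  have mflip: "bilinear_on (scale H) (scale H) (scale H) (carrier H) (carrier H) (carrier H) (\<lambda>a b. b \<cdot> a)"
    by (intro bilinear_onI Hlin1 Hlin2 lin_id)
  have "antipode H (?g (pt x y)) = cmul (tens H H) H (\<lambda>c. antipode H (N (p2 c))) ?K (pt x y)"
    using fun_cong[OF invg, of "pt x y"] unfolding R2.N_point[OF p(2)] .
  also have "\<dots> = sweedler (tens H H) (\<lambda>u v. antipode H (N (p2 u)) \<cdot> ?K v) (pt x y)"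
    unfolding cmul_def[of "tens H H" H "\<lambda>c. antipode H (N (p2 c))"] using pt_in_tens[OF x y] by simp
  also have "\<dots> = sweedler (tens H H) (\<lambda>u v. antipode H (N (p2 v)) \<cdot> ?K u) (pt x y)"
    by (rule R2.C.cocomm[symmetric, OF pt_in_tens[OF x y] V])
      (simp, intro bilinear_onI Hlin1 Hlin2 Kl lin_comp[OF lin_comp[OF Sl N_lin] pair.proj2_linear]
        linear_on_closed[OF Kl] Sc N_closed linear_on_closed[OF pair.proj2_linear])
  also have "\<dots> = sweedler H (\<lambda>x1 x2. antipode H (N x2) \<cdot> ?K (pt x x1)) y"
    by (rule pair.evalR[OF x y V mflip Kl lin_comp[OF Sl N_lin]])
  also have "\<dots> = sweedler H (\<lambda>x1 x2. antipode H (N x2) \<cdot> (z \<cdot> N x1)) y"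
    by (intro coalg.sweedler_cong[OF y]) (simp add: Ke)
  also have "\<dots> = ?k z"
    by (rule coalg.cocomm[OF y V]) (intro bilinear_onI Hlin1 Hlin2 N_lin lin_comp[OF Sl N_lin] mult_closed Sc N_closed zc)
  finally have 3: "antipode H (?g (pt x y)) = ?k z" .
  \<comment> \<open>\<open>rho_alt\<close> expresses \<open>rho\<close> as \<open>T\<close> of the
    conjugate \<open>?g\<close>, and \<open>P\<close> of a \<open>T\<close> is the antipode of
    \<open>P\<close>; together with the value of the antipode of \<open>?g\<close> this is the
    prescribed formula.\<close>
  have "P (rho x y) = P (R2.G.T ?g (pt x y))"
    unfolding rho_def using R2.G.rho_alt[OF p] by simp
  also have "\<dots> = antipode H (P (?g (pt x y)))"
    by (rule fun_cong[OF R2.G.P_T[OF g]])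
  finally show ?thesis unfolding 1 2 3 by simp
qed

end

context rb_points
begin

interpretation pair: coalgebra_pair H H by (rule R.pair)
interpretation R2: rb_points "tens H H" H B by (rule R.rb_pointsI[OF pair.coalgebra])

lemma circ_comp:
  assumes K: "cocommutative_coalgebra K" and f: "f \<in> points K H" and g: "g \<in> points K H" and q: "q \<in> points C K"
    and c: "c \<in> carrier C"
  shows "G.circ (\<lambda>c. f (q c)) (\<lambda>c. g (q c)) c = rb_group.circ (cmul K H) (\<lambda>f c. antipode H (f c)) (\<lambda>f c. R.P (f c)) f g (q c)"
proof -
  interpret K: rb_points K H B by (rule R.rb_pointsI[OF K])
  have fq: "(\<lambda>c. f (q c)) \<in> points C H" "(\<lambda>c. g (q c)) \<in> points C H"
    by (rule points_comp[OF C.comultiplication_axioms K.C.vspC R.V q points_map[OF f]])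
      (rule points_comp[OF C.comultiplication_axioms K.C.vspC R.V q points_map[OF g]])
  have "G.circ (\<lambda>c. f (q c)) (\<lambda>c. g (q c)) c = sweedler C (\<lambda>u v. R.circ (f (q u)) (g (q v))) c"
    by (rule circ_point[OF fq c])
  also have "\<dots> = sweedler K (\<lambda>u v. R.circ (f u) (g v)) (q c)"
    by (rule sweedler_map[symmetric, OF C.comultiplication_axioms K.C.vspC points_map[OF q] c R.V])
      (intro bilinear_onI lin_bil1[OF R.circ_bilinear] lin_bil2[OF R.circ_bilinear] K.Q.points_lin[OF f] K.Q.points_lin[OF g]
        points_closed[OF f] points_closed[OF g])
  also have "\<dots> = K.G.circ f g (q c)"
    by (rule K.circ_point[symmetric, OF f g points_closed[OF q c]])
  finally show ?thesis .
qed

lemma pair_eval: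
  assumes W: "W \<in> points (tens H H) H" and f: "f \<in> points C H" and g: "g \<in> points C H" and c: "c \<in> carrier C"
  shows "W (pairing C H H f g c) = sweedler C (\<lambda>u v. W (tensor_of H H (f u) (g v))) c"
  unfolding pairing_def using c coalgebra_map_linear[OF points_map[OF W]]
  by (auto intro!: C.sweedler_hom[OF c tensor_space_vsp R.vector_space] pair.pt_in points_closed[OF f] points_closed[OF g])

text \<open>The operation is computed once at the two projections and pulled back along the pairing
  of \<open>f\<close> and \<open>g\<close>.\<close>

lemma rho_point:
  assumes f: "f \<in> points C H" and g: "g \<in> points C H" and c: "c \<in> carrier C"
  shows "G.rho f g c = sweedler C (\<lambda>u v. R.rho (f u) (g v)) c"
proof -
  let ?q = "pairing C H H f g"
  have q: "?q \<in> points C (tens H H)" by (rule pair.pairing_point[OF C.cocommutative_coalgebra_axioms f g])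
  note p = pair.proj1_point pair.proj2_point
  have proj: "(\<lambda>c. R.p1 (?q c)) = f" "(\<lambda>c. R.p2 (?q c)) = g"
    by (rule pairing_proj[OF R.pair C.cocommutative_coalgebra_axioms f g])+
  have circ: "G.circ f g = (\<lambda>c. R2.G.circ R.p1 R.p2 (?q c))"
  proof (rule points_eqI)
    show "G.circ f g \<in> points C H" by (rule G.closed(1)[OF f g])
    show "(\<lambda>c. R2.G.circ R.p1 R.p2 (?q c)) \<in> points C H"
      by (rule points_comp[OF C.comultiplication_axioms _ R.V q points_map[OF R2.G.closed(1)[OF p]]]) (simp add: tensor_space_vsp)
    show "G.circ f g c = R2.G.circ R.p1 R.p2 (?q c)" if "c \<in> carrier C" for c
      using circ_comp[OF pair.coalgebra p q that] unfolding proj .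
  qed
  have lam: "G.lam f g = (\<lambda>c. R2.G.lam R.p1 R.p2 (?q c))"
  proof (rule points_eqI)
    show "G.lam f g \<in> points C H" by (rule G.closed(4)[OF f g])
    show "(\<lambda>c. R2.G.lam R.p1 R.p2 (?q c)) \<in> points C H"
      by (rule points_comp[OF C.comultiplication_axioms _ R.V q points_map[OF R2.G.closed(4)[OF p]]]) (simp add: tensor_space_vsp)
    fix c assume c: "c \<in> carrier C"
    have "R2.G.lam R.p1 R.p2 (?q c) = sweedler C (\<lambda>u v. R2.G.lam R.p1 R.p2 (tensor_of H H (f u) (g v))) c"
      by (rule pair_eval[OF R2.G.closed(4)[OF p] f g c])
    also have "\<dots> = sweedler C (\<lambda>u v. R.lam (f u) (g v)) c"
    proof (rule C.sweedler_cong[OF c])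
      fix u v assume uv: "u \<in> carrier C" "v \<in> carrier C"
      show "R2.G.lam R.p1 R.p2 (tensor_of H H (f u) (g v)) = R.lam (f u) (g v)"
        using R2.lam_point[OF p R.pt_in_tens[OF points_closed[OF f uv(1)] points_closed[OF g uv(2)]]]
          pair.eval_indep[OF points_closed[OF f uv(1)] points_closed[OF g uv(2)] R.V R.lam_bilinear lin_id lin_id] by simp
    qed
    also have "\<dots> = G.lam f g c" by (rule lam_point[symmetric, OF f g c])
    finally show "G.lam f g c = R2.G.lam R.p1 R.p2 (?q c)" ..
  qed
  have T: "G.T (G.lam f g) = (\<lambda>c. R2.G.T (R2.G.lam R.p1 R.p2) (?q c))"
    unfolding R2.T_point[OF R2.G.closed(4)[OF p]] T_point[OF G.closed(4)[OF f g]] fun_cong[OF lam] ..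
  have "G.rho f g c = R2.G.rho R.p1 R.p2 (?q c)"
    unfolding G.rho_def R2.G.rho_def T circ
    by (rule circ_comp[OF pair.coalgebra R2.G.closed(3)[OF R2.G.closed(4)[OF p]] R2.G.closed(1)[OF p] q c])
  also have "\<dots> = sweedler C (\<lambda>u v. R.rho (f u) (g v)) c"
    unfolding R.rho_def by (rule pair_eval[OF R2.G.rho_closed[OF p] f g c])
  finally show ?thesis .
qed

lemma act_left_point:
  assumes f: "f \<in> points C H" and g: "g \<in> points C H" and c: "c \<in> carrier C"
  shows "sweedler C (\<lambda>u v. rb_act_left H B (R.P (f u)) (R.N (g v))) c = R.N (G.lam f g c)"
proof -
  have "sweedler C (\<lambda>u v. rb_act_left H B (R.P (f u)) (R.N (g v))) c = sweedler C (\<lambda>u v. R.N (R.lam (f u) (g v))) c"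
    by (intro C.sweedler_cong[OF c] R.act_left points_closed[OF f] points_closed[OF g])
  also have "\<dots> = R.N (sweedler C (\<lambda>u v. R.lam (f u) (g v)) c)"
    by (rule C.sweedler_hom[symmetric, OF c R.V R.vector_space R.N_lin]) (intro R.lam_closed points_closed[OF f] points_closed[OF g])
  finally show ?thesis unfolding lam_point[OF f g c] .
qed

lemma act_right_point:
  assumes f: "f \<in> points C H" and g: "g \<in> points C H" and c: "c \<in> carrier C"
  shows "sweedler C (\<lambda>u v. rb_act_right H B (R.P (f u)) (R.N (g v))) c = R.P (G.rho f g c)"
proof -
  have "sweedler C (\<lambda>u v. rb_act_right H B (R.P (f u)) (R.N (g v))) c = sweedler C (\<lambda>u v. R.P (R.rho (f u) (g v))) c"
    by (intro C.sweedler_cong[OF c] R.act_right points_closed[OF f] points_closed[OF g])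
  also have "\<dots> = R.P (sweedler C (\<lambda>u v. R.rho (f u) (g v)) c)"
    by (rule C.sweedler_hom[symmetric, OF c R.V R.vector_space R.P_lin]) (intro R.rho_closed points_closed[OF f] points_closed[OF g])
  finally show ?thesis unfolding rho_point[OF f g c] .
qed

end

section \<open>The double cross product\<close>

text \<open>Bilinear data from which the product is formed. Its algebraic laws are later imported
  from \<open>rb_group\<close> by evaluation at points.\<close>

locale double_cross_data = coalgebra_pair A X
  for A :: "('k::field, 'a::ab_group_add) hopf" and X :: "('k, 'b::ab_group_add) hopf" +
  fixes l :: "'b \<Rightarrow> 'a \<Rightarrow> 'a" and r :: "'b \<Rightarrow> 'a \<Rightarrow> 'b"
  assumes l: "bilinear_on (scale X) (scale A) (scale A) (carrier X) (carrier A) (carrier A) l"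
    and r: "bilinear_on (scale X) (scale A) (scale X) (carrier X) (carrier A) (carrier X) r"
    and mA: "bilinear_on (scale A) (scale A) (scale A) (carrier A) (carrier A) (carrier A) (mult A)"
    and mX: "bilinear_on (scale X) (scale X) (scale X) (carrier X) (carrier X) (carrier X) (mult X)"
begin

lemmas vTS = tensor_space_vsp[of "scale A" "scale X" "carrier A" "carrier X"]
lemmas lc = bilinear_on_closed[OF l] and rc = bilinear_on_closed[OF r]
  and mAc = bilinear_on_closed[OF mA] and mXc = bilinear_on_closed[OF mX]

abbreviation "multD \<equiv> mult (double_cross_bialgebra A X l r)"

definition mult_term where
  "mult_term a x a' x' = sweedler X (\<lambda>x1 x2. sweedler A (\<lambda>a1 a2. pt (mult A a (l x1 a1)) (mult X (r x2 a2) x')) a') x"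

lemma core_lin:
  "a1 \<in> carrier A \<Longrightarrow> a2 \<in> carrier A \<Longrightarrow> x1 \<in> carrier X \<Longrightarrow> x2 \<in> carrier X \<Longrightarrow> x' \<in> carrier X \<Longrightarrow>
    linear_on (scale A) tensor_scale (carrier A) TS (\<lambda>a. pt (mult A a (l x1 a1)) (mult X (r x2 a2) x'))"
  "a \<in> carrier A \<Longrightarrow> a2 \<in> carrier A \<Longrightarrow> x1 \<in> carrier X \<Longrightarrow> x2 \<in> carrier X \<Longrightarrow> x' \<in> carrier X \<Longrightarrow>
    linear_on (scale A) tensor_scale (carrier A) TS (\<lambda>a1. pt (mult A a (l x1 a1)) (mult X (r x2 a2) x'))"
  "a \<in> carrier A \<Longrightarrow> a1 \<in> carrier A \<Longrightarrow> x1 \<in> carrier X \<Longrightarrow> x2 \<in> carrier X \<Longrightarrow> x' \<in> carrier X \<Longrightarrow>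
    linear_on (scale A) tensor_scale (carrier A) TS (\<lambda>a2. pt (mult A a (l x1 a1)) (mult X (r x2 a2) x'))"
  "a \<in> carrier A \<Longrightarrow> a1 \<in> carrier A \<Longrightarrow> a2 \<in> carrier A \<Longrightarrow> x2 \<in> carrier X \<Longrightarrow> x' \<in> carrier X \<Longrightarrow>
    linear_on (scale X) tensor_scale (carrier X) TS (\<lambda>x1. pt (mult A a (l x1 a1)) (mult X (r x2 a2) x'))"
  "a \<in> carrier A \<Longrightarrow> a1 \<in> carrier A \<Longrightarrow> a2 \<in> carrier A \<Longrightarrow> x1 \<in> carrier X \<Longrightarrow> x' \<in> carrier X \<Longrightarrow>
    linear_on (scale X) tensor_scale (carrier X) TS (\<lambda>x2. pt (mult A a (l x1 a1)) (mult X (r x2 a2) x'))"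
  "a \<in> carrier A \<Longrightarrow> a1 \<in> carrier A \<Longrightarrow> a2 \<in> carrier A \<Longrightarrow> x1 \<in> carrier X \<Longrightarrow> x2 \<in> carrier X \<Longrightarrow>
    linear_on (scale X) tensor_scale (carrier X) TS (\<lambda>x'. pt (mult A a (l x1 a1)) (mult X (r x2 a2) x'))"
  by (intro lin_pure1 lin_pure2 lin_bil1[OF mA] lin_bil2[OF mA] lin_bil1[OF mX] lin_bil2[OF mX] bilinear_onD1[OF l] bilinear_onD2[OF l]
    bilinear_onD1[OF r] bilinear_onD2[OF r] lin_id lc rc mAc mXc; assumption)+

lemma mult_term_lin:
  "x \<in> carrier X \<Longrightarrow> a' \<in> carrier A \<Longrightarrow> x' \<in> carrier X \<Longrightarrow> linear_on (scale A) tensor_scale (carrier A) TS (\<lambda>a. mult_term a x a' x')"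
  "a \<in> carrier A \<Longrightarrow> a' \<in> carrier A \<Longrightarrow> x' \<in> carrier X \<Longrightarrow> linear_on (scale X) tensor_scale (carrier X) TS (\<lambda>x. mult_term a x a' x')"
  "a \<in> carrier A \<Longrightarrow> x \<in> carrier X \<Longrightarrow> x' \<in> carrier X \<Longrightarrow> linear_on (scale A) tensor_scale (carrier A) TS (\<lambda>a'. mult_term a x a' x')"
  "a \<in> carrier A \<Longrightarrow> x \<in> carrier X \<Longrightarrow> a' \<in> carrier A \<Longrightarrow> linear_on (scale X) tensor_scale (carrier X) TS (\<lambda>x'. mult_term a x a' x')"
  unfolding mult_term_def
  by (intro X.lin_param[OF _ vTS] X.lin_sweedler[OF vTS lin_id] A.lin_param[OF _ vTS] A.lin_sweedler[OF vTS lin_id] core_lin; assumption)+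

lemma mult_term_bilinear:
  "a \<in> carrier A \<Longrightarrow> x \<in> carrier X \<Longrightarrow> bilinear_on (scale A) (scale X) tensor_scale (carrier A) (carrier X) TS (mult_term a x)"
  "a' \<in> carrier A \<Longrightarrow> x' \<in> carrier X \<Longrightarrow> bilinear_on (scale A) (scale X) tensor_scale (carrier A) (carrier X) TS (\<lambda>a x. mult_term a x a' x')"
  by (intro bilinear_onI mult_term_lin; assumption)+

lemma multD_def: "multD z w = lift_of A X (\<lambda>a x. lift_of A X (mult_term a x) w) z"
  unfolding double_cross_bialgebra_def mult_term_def by simp

lemma inner_lin: "a \<in> carrier A \<Longrightarrow> x \<in> carrier X \<Longrightarrow> linear_on tensor_scale tensor_scale TS TS (lift_of A X (mult_term a x))"
  by (rule lift_linear[OF A.vspC X.vspC vTS mult_term_bilinear(1)])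

lemma outer_bilinear:
  assumes t: "t \<in> TS"
  shows "bilinear_on (scale A) (scale X) tensor_scale (carrier A) (carrier X) TS (\<lambda>a x. lift_of A X (mult_term a x) t)"
  unfolding tensor_lift_rep case_prod_unfold using tensor_rep(1)[OF A.vspC t]
  by (intro bilinear_onI lin_sum_list[OF vTS] mult_term_lin) auto

lemma multD_bilinear: "bilinear_on tensor_scale tensor_scale tensor_scale TS TS TS multD"
proof (rule bilinear_onI)
  show "linear_on tensor_scale tensor_scale TS TS (multD t)" if t: "t \<in> TS" for t
    unfolding multD_def[abs_def] tensor_lift_rep[of _ _ _ _ "\<lambda>a x. lift_of A X (mult_term a x) _" t] case_prod_unfold
    using tensor_rep(1)[OF A.vspC t]
    by (intro lin_sum_list[OF vTS] inner_lin) auto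
  show "linear_on tensor_scale tensor_scale TS TS (\<lambda>t. multD t t')" if t: "t' \<in> TS" for t'
    unfolding multD_def[abs_def] by (rule lift_linear[OF A.vspC X.vspC vTS outer_bilinear[OF t]])
qed

lemma multD_pure:
  assumes "a \<in> carrier A" "x \<in> carrier X" "a' \<in> carrier A" "x' \<in> carrier X"
  shows "multD (pt a x) (pt a' x') = mult_term a x a' x'"
proof -
  have "multD (pt a x) (pt a' x') = lift_of A X (mult_term a x) (pt a' x')"
    unfolding multD_def by (rule lift_pure[OF A.vspC X.vspC vs_tensor outer_bilinear assms(1,2)]) (rule pt_in[OF assms(3,4)])
  also have "\<dots> = mult_term a x a' x'"
    by (rule lift_pure[OF A.vspC X.vspC vs_tensor mult_term_bilinear(1)[OF assms(1,2)] assms(3,4)])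
  finally show ?thesis .
qed

text \<open>On points the product is that of pairs, with the actions convolved to \<open>L\<close>
  and \<open>R\<close>. Coassociativity isolates the middle block formed by \<open>\<beta>\<close>
  and \<open>\<alpha>'\<close>; inside it \<open>mid4\<close> separates the arguments of the left
  action from those of the right action.\<close>

lemma multD_points:
  assumes C: "cocommutative_coalgebra C"
    and \<alpha>: "\<alpha> \<in> points C A" and \<beta>: "\<beta> \<in> points C X" and \<alpha>': "\<alpha>' \<in> points C A" and \<beta>': "\<beta>' \<in> points C X"
    and L: "\<And>c. c \<in> carrier C \<Longrightarrow> sweedler C (\<lambda>u v. l (\<beta> u) (\<alpha>' v)) c = L c"
    and R: "\<And>c. c \<in> carrier C \<Longrightarrow> sweedler C (\<lambda>u v. r (\<beta> u) (\<alpha>' v)) c = R c"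
    and c: "c \<in> carrier C"
  shows "sweedler C (\<lambda>u v. multD (pairing C A X \<alpha> \<beta> u) (pairing C A X \<alpha>' \<beta>' v)) c
    = pairing C A X (cmul C A \<alpha> L) (cmul C X R \<beta>') c"
proof -
  interpret C: cocommutative_coalgebra C by fact
  note al = coalgebra_map_linear[OF points_map[OF \<alpha>]] and bl = coalgebra_map_linear[OF points_map[OF \<beta>]]
    and al' = coalgebra_map_linear[OF points_map[OF \<alpha>']] and bl' = coalgebra_map_linear[OF points_map[OF \<beta>']]
  note ac = points_closed[OF \<alpha>] and bc = points_closed[OF \<beta>] and ac' = points_closed[OF \<alpha>'] and bc' = points_closed[OF \<beta>']
  let ?F = "\<lambda>u1 p q r' s v2. pt (mult A (\<alpha> u1) (l (\<beta> p) (\<alpha>' r'))) (mult X (r (\<beta> q) (\<alpha>' s)) (\<beta>' v2))"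
  have OmP: "mult_term (\<alpha> u1) (\<beta> u2) (\<alpha>' v1) (\<beta>' v2) = sweedler C (\<lambda>p q. sweedler C (\<lambda>r' s. ?F u1 p q r' s v2) v1) u2"
    if u: "u1 \<in> carrier C" "u2 \<in> carrier C" "v1 \<in> carrier C" "v2 \<in> carrier C" for u1 u2 v1 v2
  proof -
    have "mult_term (\<alpha> u1) (\<beta> u2) (\<alpha>' v1) (\<beta>' v2) = sweedler C (\<lambda>p q. sweedler A (\<lambda>a1 a2. pt (mult A (\<alpha> u1) (l (\<beta> p) a1)) (mult X (r (\<beta> q) a2) (\<beta>' v2))) (\<alpha>' v1)) u2"
      unfolding mult_term_def
      by (rule sweedler_map[OF C.comultiplication_axioms X.vspC points_map[OF \<beta>] u(2) vTS])
        (intro bilinear_onI A.lin_param[OF _ vTS] core_lin ac ac' bc' u; assumption)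
    also have "\<dots> = sweedler C (\<lambda>p q. sweedler C (\<lambda>r' s. ?F u1 p q r' s v2) v1) u2"
      by (rule C.sweedler_cong[OF u(2)], rule sweedler_map[OF C.comultiplication_axioms A.vspC points_map[OF \<alpha>'] u(3) vTS])
        (intro bilinear_onI core_lin ac bc bc' u; assumption)
    finally show ?thesis .
  qed
  define \<Phi> where "\<Phi> = (\<lambda>u1 u2 v1 v2. mult_term (\<alpha> u1) (\<beta> u2) (\<alpha>' v1) (\<beta>' v2))"
  have \<Phi>l: "linear_on (scale C) tensor_scale (carrier C) TS (\<lambda>a. \<Phi> a b c d)"
     "linear_on (scale C) tensor_scale (carrier C) TS (\<lambda>b. \<Phi> a b c d)"
     "linear_on (scale C) tensor_scale (carrier C) TS (\<lambda>c. \<Phi> a b c d)"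
     "linear_on (scale C) tensor_scale (carrier C) TS (\<lambda>d. \<Phi> a b c d)"
    if "a \<in> carrier C" "b \<in> carrier C" "c \<in> carrier C" "d \<in> carrier C" for a b c d
    unfolding \<Phi>_def
    by (rule lin_comp[OF mult_term_lin(1) al] lin_comp[OF mult_term_lin(2) bl] lin_comp[OF mult_term_lin(3) al'] lin_comp[OF mult_term_lin(4) bl'];
      intro ac bc ac' bc' that)+
  have Fl: "linear_on (scale C) tensor_scale (carrier C) TS (\<lambda>p. ?F u1 p q r' s v2)"
     "linear_on (scale C) tensor_scale (carrier C) TS (\<lambda>q. ?F u1 p q r' s v2)"
     "linear_on (scale C) tensor_scale (carrier C) TS (\<lambda>r'. ?F u1 p q r' s v2)"
     "linear_on (scale C) tensor_scale (carrier C) TS (\<lambda>s. ?F u1 p q r' s v2)"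
    if "u1 \<in> carrier C" "p \<in> carrier C" "q \<in> carrier C" "r' \<in> carrier C" "s \<in> carrier C" "v2 \<in> carrier C" for u1 p q r' s v2
    by (rule lin_comp[OF core_lin(4) bl] lin_comp[OF core_lin(5) bl] lin_comp[OF core_lin(2) al'] lin_comp[OF core_lin(3) al'];
      intro ac bc ac' bc' that)+
  have Lc: "L c \<in> carrier A" if "c \<in> carrier C" for c
    unfolding L[OF that, symmetric] by (intro C.sweedler_closed[OF that A.vspC] lc bc ac')
  have Rc: "R c \<in> carrier X" if "c \<in> carrier C" for c
    unfolding R[OF that, symmetric] by (intro C.sweedler_closed[OF that X.vspC] rc bc ac')
  have Ll: "linear_on (scale C) (scale A) (carrier C) (carrier A) L"
    by (rule linear_on_cong[OF C.lin_sweedler_arg[OF A.vspC] C.vspC L[symmetric]])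
      (intro bilinear_onI lin_comp[OF bilinear_onD1[OF l] al'] lin_comp[OF bilinear_onD2[OF l] bl] bc ac')
  have Rl: "linear_on (scale C) (scale X) (carrier C) (carrier X) R"
    by (rule linear_on_cong[OF C.lin_sweedler_arg[OF X.vspC] C.vspC R[symmetric]])
      (intro bilinear_onI lin_comp[OF bilinear_onD1[OF r] al'] lin_comp[OF bilinear_onD2[OF r] bl] bc ac')
  let ?H = "\<lambda>u1 m1 m2 v2. pt (mult A (\<alpha> u1) (L m1)) (mult X (R m2) (\<beta>' v2))"
  have Hl: "linear_on (scale C) tensor_scale (carrier C) TS (\<lambda>a. ?H a b c d)"
     "linear_on (scale C) tensor_scale (carrier C) TS (\<lambda>b. ?H a b c d)"
     "linear_on (scale C) tensor_scale (carrier C) TS (\<lambda>c. ?H a b c d)"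
     "linear_on (scale C) tensor_scale (carrier C) TS (\<lambda>d. ?H a b c d)"
    if "a \<in> carrier C" "b \<in> carrier C" "c \<in> carrier C" "d \<in> carrier C" for a b c d
    by (intro lin_pure1 lin_pure2 lin_bil1[OF mA] lin_bil2[OF mA] lin_bil1[OF mX] lin_bil2[OF mX] al Ll Rl bl' mAc mXc ac Lc Rc bc' that)+
  have "sweedler C (\<lambda>u v. multD (pairing C A X \<alpha> \<beta> u) (pairing C A X \<alpha>' \<beta>' v)) c
     = sweedler C (\<lambda>u v. sweedler C (\<lambda>u1 u2. sweedler C (\<lambda>v1 v2. \<Phi> u1 u2 v1 v2) v) u) c"
  proof (rule C.sweedler_cong[OF c])
    fix u v assume uv: "u \<in> carrier C" "v \<in> carrier C"
    have pv: "sweedler C (\<lambda>v1 v2. pt (\<alpha>' v1) (\<beta>' v2)) v \<in> TS" by (intro C.sweedler_closed[OF uv(2) vTS] pt_in ac' bc')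
    have "multD (pairing C A X \<alpha> \<beta> u) (pairing C A X \<alpha>' \<beta>' v)
      = sweedler C (\<lambda>u1 u2. multD (pt (\<alpha> u1) (\<beta> u2)) (sweedler C (\<lambda>v1 v2. pt (\<alpha>' v1) (\<beta>' v2)) v)) u"
      using C.sweedler_hom[OF uv(1) vTS vs_tensor bilinear_onD2[OF multD_bilinear pv], of "\<lambda>u1 u2. pt (\<alpha> u1) (\<beta> u2)"]
      by (simp add: pairing_def uv pt_in ac bc)
    also have "\<dots> = sweedler C (\<lambda>u1 u2. sweedler C (\<lambda>v1 v2. multD (pt (\<alpha> u1) (\<beta> u2)) (pt (\<alpha>' v1) (\<beta>' v2))) v) u"
      by (intro C.sweedler_cong[OF uv(1)] C.sweedler_hom[OF uv(2) vTS vs_tensor bilinear_onD1[OF multD_bilinear]] pt_in ac bc ac' bc')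
    also have "\<dots> = sweedler C (\<lambda>u1 u2. sweedler C (\<lambda>v1 v2. \<Phi> u1 u2 v1 v2) v) u"
      unfolding \<Phi>_def by (intro C.sweedler_cong[OF uv(1)] C.sweedler_cong[OF uv(2)] multD_pure ac bc ac' bc')
    finally show "multD (pairing C A X \<alpha> \<beta> u) (pairing C A X \<alpha>' \<beta>' v) = sweedler C (\<lambda>u1 u2. sweedler C (\<lambda>v1 v2. \<Phi> u1 u2 v1 v2) v) u" .
  qed
  also have "\<dots> = sweedler C (\<lambda>u1 v. sweedler C (\<lambda>m v2. sweedler C (\<lambda>u2 v1. \<Phi> u1 u2 v1 v2) m) v) c"
    by (rule C.coassoc4[OF c vTS]; rule \<Phi>l; assumption)
  also have "\<dots> = sweedler C (\<lambda>u1 v. sweedler C (\<lambda>m v2. sweedler C (\<lambda>m1 m2. ?H u1 m1 m2 v2) m) v) c"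
  proof (rule C.sweedler_cong[OF c], rule C.sweedler_cong, assumption)
    fix u1 v m v2 assume *: "u1 \<in> carrier C" "m \<in> carrier C" "v2 \<in> carrier C"
    have "sweedler C (\<lambda>u2 v1. \<Phi> u1 u2 v1 v2) m
      = sweedler C (\<lambda>u2 v1. sweedler C (\<lambda>p q. sweedler C (\<lambda>r' s. ?F u1 p q r' s v2) v1) u2) m"
      unfolding \<Phi>_def by (intro C.sweedler_cong[OF *(2)] OmP * )
    \<comment> \<open>After this exchange \<open>m1\<close> feeds only the left action and
      \<open>m2\<close> only the right action.\<close>
    also have "\<dots> = sweedler C (\<lambda>m1 m2. sweedler C (\<lambda>p r'. sweedler C (\<lambda>q s. ?F u1 p q r' s v2) m2) m1) m"
      by (rule C.mid4[OF *(2) vTS, where \<Phi> = "\<lambda>p q r' s. ?F u1 p q r' s v2"]; rule Fl; (assumption | rule *))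
    also have "\<dots> = sweedler C (\<lambda>m1 m2. ?H u1 m1 m2 v2) m"
    proof (rule C.sweedler_cong[OF *(2)])
      fix m1 m2 assume m: "m1 \<in> carrier C" "m2 \<in> carrier C"
      have "sweedler C (\<lambda>p r'. sweedler C (\<lambda>q s. ?F u1 p q r' s v2) m2) m1
         = sweedler C (\<lambda>p r'. pt (mult A (\<alpha> u1) (l (\<beta> p) (\<alpha>' r'))) (mult X (R m2) (\<beta>' v2))) m1"
      proof (rule C.sweedler_cong[OF m(1)])
        fix p r' assume pr: "p \<in> carrier C" "r' \<in> carrier C"
        have ll: "linear_on (scale X) tensor_scale (carrier X) TS (\<lambda>y. pt (mult A (\<alpha> u1) (l (\<beta> p) (\<alpha>' r'))) (mult X y (\<beta>' v2)))"
          by (intro lin_pure2 lin_bil1[OF mX] lin_id bc' mAc lc bc ac ac' pr * )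
        show "sweedler C (\<lambda>q s. ?F u1 p q r' s v2) m2 = pt (mult A (\<alpha> u1) (l (\<beta> p) (\<alpha>' r'))) (mult X (R m2) (\<beta>' v2))"
          unfolding R[OF m(2), symmetric]
          by (rule C.sweedler_hom[symmetric, OF m(2) X.vspC vs_tensor ll]) (intro rc bc ac')
      qed
      also have "\<dots> = ?H u1 m1 m2 v2"
      proof -
        have ll: "linear_on (scale A) tensor_scale (carrier A) TS (\<lambda>y. pt (mult A (\<alpha> u1) y) (mult X (R m2) (\<beta>' v2)))"
          by (intro lin_pure1 lin_bil2[OF mA] lin_id mXc Rc m bc' ac * )
        show ?thesis unfolding L[OF m(1), symmetric]
          by (rule C.sweedler_hom[symmetric, OF m(1) A.vspC vs_tensor ll]) (intro lc bc ac')
      qed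
      finally show "sweedler C (\<lambda>p r'. sweedler C (\<lambda>q s. ?F u1 p q r' s v2) m2) m1 = ?H u1 m1 m2 v2" .
    qed
    finally show "sweedler C (\<lambda>u2 v1. \<Phi> u1 u2 v1 v2) m = sweedler C (\<lambda>m1 m2. ?H u1 m1 m2 v2) m" by simp
  qed
  also have "\<dots> = sweedler C (\<lambda>u v. sweedler C (\<lambda>u1 m1. sweedler C (\<lambda>m2 v2. ?H u1 m1 m2 v2) v) u) c"
    by (rule C.coassoc4[symmetric, OF c vTS]; rule Hl; assumption)
  also have "\<dots> = sweedler C (\<lambda>u v. pt (cmul C A \<alpha> L u) (cmul C X R \<beta>' v)) c"
  proof (rule C.sweedler_cong[OF c])
    fix u v assume uv: "u \<in> carrier C" "v \<in> carrier C"
    have Rb: "cmul C X R \<beta>' v \<in> carrier X"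
      unfolding cmul_def using uv by (auto intro!: C.sweedler_closed[OF uv(2) X.vspC] mXc Rc bc')
    have "sweedler C (\<lambda>u1 m1. sweedler C (\<lambda>m2 v2. ?H u1 m1 m2 v2) v) u
      = sweedler C (\<lambda>u1 m1. pt (mult A (\<alpha> u1) (L m1)) (cmul C X R \<beta>' v)) u"
      unfolding cmul_def if_P[OF uv(2)]
      by (intro C.sweedler_cong[OF uv(1)] C.sweedler_hom[symmetric, OF uv(2) X.vspC vs_tensor bilinear_onD1[OF pure_tensor_bilinear[of _ _ "carrier A" "carrier X"]]]
        mAc ac Lc mXc Rc bc')
    also have "\<dots> = pt (cmul C A \<alpha> L u) (cmul C X R \<beta>' v)"
      unfolding cmul_def[of C A] if_P[OF uv(1)]
      by (rule C.sweedler_hom[symmetric, OF uv(1) A.vspC vs_tensor bilinear_onD2[OF pure_tensor_bilinear[of _ _ "carrier A" "carrier X"] Rb]])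
        (intro mAc ac Lc)
    finally show "sweedler C (\<lambda>u1 m1. sweedler C (\<lambda>m2 v2. ?H u1 m1 m2 v2) v) u = pt (cmul C A \<alpha> L u) (cmul C X R \<beta>' v)" .
  qed
  finally show ?thesis unfolding pairing_def using c by simp
qed

lemma sweedler_double_cross: "sweedler (double_cross A X l r) \<Omega> = sweedler (tens A X) \<Omega>"
  "sweedler (double_cross_bialgebra A X l r) \<Omega> = sweedler (tens A X) \<Omega>"
  unfolding sweedler_def[abs_def] double_cross_def double_cross_bialgebra_def tens_def by simp_all

end

lemma rb_minus_simps [simp]:
  "carrier (rb_minus H B) = rb_tilde H B ` carrier H" "scale (rb_minus H B) = scale H" "mult (rb_minus H B) = mult H"
  "one (rb_minus H B) = one H" "counit (rb_minus H B) = counit H" "comult (rb_minus H B) = comult H"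
  unfolding rb_minus_def by simp_all

lemma rb_plus_simps [simp]:
  "carrier (rb_plus H B) = B ` carrier H" "scale (rb_plus H B) = scale H" "mult (rb_plus H B) = mult H"
  "one (rb_plus H B) = one H" "counit (rb_plus H B) = counit H" "comult (rb_plus H B) = comult H"
  unfolding rb_plus_def by simp_all

context rota_baxter_hopf
begin

abbreviation "Hm \<equiv> rb_minus H B"
abbreviation "Hp \<equiv> rb_plus H B"
abbreviation "actl \<equiv> rb_act_left H B"
abbreviation "actr \<equiv> rb_act_right H B"
abbreviation "tp \<equiv> tensor_of Hm Hp"

lemma P_closed: "x \<in> carrier H \<Longrightarrow> P x \<in> carrier H"
  by (rule linear_on_closed[OF P_lin])

lemma N_Hm_map: "coalgebra_map H Hm N"
  unfolding rb_minus_def by (rule coalgebra_map_image[OF N_map])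

lemma B_Hp_map: "coalgebra_map H Hp B"
  unfolding rb_plus_def by (rule coalgebra_map_image[OF coalgebra_map])

lemma Hm_coalgebra: "cocommutative_coalgebra Hm"
  by (rule surjective_coalgebra_map[OF coalg.cocommutative_coalgebra_axioms _ N_Hm_map]) (simp_all add: vector_space)

lemma Hp_coalgebra: "cocommutative_coalgebra Hp"
  by (rule surjective_coalgebra_map[OF coalg.cocommutative_coalgebra_axioms _ B_Hp_map]) (simp_all add: vector_space)

lemma P_Hp_map: "coalgebra_map H Hp (\<lambda>x. P x)"
  by (rule coalgebra_map_comp[OF coalg.comultiplication_axioms V _ antipode_map B_Hp_map])
    (rule cocommutative_coalgebra.axioms(1)[OF Hp_coalgebra, THEN comultiplication.vspC])

lemma Hm_elim: "a \<in> carrier Hm \<Longrightarrow> \<exists>x\<in>carrier H. a = N x"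
  by auto

text \<open>The antipode is an involution, so \<open>P\<close> and \<open>B\<close> have the same
  image and \<open>P\<close> may parametrize it.\<close>

lemma Hp_elim: "a \<in> carrier Hp \<Longrightarrow> \<exists>x\<in>carrier H. a = P x"
  using antipode_closed antipode_antipode by (metis image_iff rb_plus_simps(1))

lemma N_in: "x \<in> carrier H \<Longrightarrow> N x \<in> carrier Hm"
  by simp

lemma P_in: "x \<in> carrier H \<Longrightarrow> P x \<in> carrier Hp"
  using antipode_closed by simp

lemma N_one: "N \<one> = \<one>" and P_one: "P \<one> = \<one>"
proof -
  interpret R1: rb_points H H B by (rule rb_pointsI[OF coalg.cocommutative_coalgebra_axioms])
  have c: "cone H H \<one> = \<one>"
    by (simp add: cone_def one_closed counit_one vsp_scale_simps(4)[OF vector_space])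
  show P: "P \<one> = \<one>" using fun_cong[OF R1.G.P_e, of \<one>] c by simp
  show "N \<one> = \<one>"
    using fun_cong[OF R1.N_point[OF R1.Q.cone_point], of \<one>] c unfolding R1.G.N_def by (simp add: R1.Q.cone_point)
qed

lemma Hm_pair: "coalgebra_pair Hm Hp"
  by (intro coalgebra_pair.intro Hm_coalgebra Hp_coalgebra)

interpretation A: cocommutative_coalgebra Hm by (rule Hm_coalgebra)
interpretation X: cocommutative_coalgebra Hp by (rule Hp_coalgebra)

lemma Hm_sub: "a \<in> carrier Hm \<Longrightarrow> a \<in> carrier H" and Hp_sub: "b \<in> carrier Hp \<Longrightarrow> b \<in> carrier H"
  using N_closed B_closed by auto

text \<open>The definition by chosen preimages hides linearity; \<open>act_left\<close> allows any
  preimages, in particular sums and multiples of given ones.\<close>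

lemma actl_bilinear: "bilinear_on (scale Hp) (scale Hm) (scale Hm) (carrier Hp) (carrier Hm) (carrier Hm) actl"
proof (rule bilinear_onI)
  fix b assume "b \<in> carrier Hp"
  then obtain x where x: "x \<in> carrier H" "b = P x" using Hp_elim by blast
  note L = bilinear_onD1[OF lam_bilinear x(1)]
  show "linear_on (scale Hm) (scale Hm) (carrier Hm) (carrier Hm) (actl b)"
    unfolding linear_on_def
  proof (intro conjI ballI allI)
    fix a assume "a \<in> carrier Hm"
    then obtain y where y: "y \<in> carrier H" "a = N y" using Hm_elim by blast
    have a: "actl b a = N (lam x y)" unfolding x y by (rule act_left[OF x(1) y(1)])
    show "actl b a \<in> carrier Hm" unfolding a by (intro N_in lam_closed x y)
    show "actl b (scale Hm c a) = scale Hm c (actl b a)" for c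
      using act_left[OF x(1) scale_closed[OF y(1)], of c] x y a lam_closed
      by (simp add: linear_on_scale[OF N_lin] linear_on_scale[OF L])
    fix a' assume "a' \<in> carrier Hm"
    then obtain y' where y': "y' \<in> carrier H" "a' = N y'" using Hm_elim by blast
    have a': "actl b a' = N (lam x y')" unfolding x y' by (rule act_left[OF x(1) y'(1)])
    show "actl b (a + a') = actl b a + actl b a'"
      using act_left[OF x(1) vsp_add[OF V y(1) y'(1)]] x y y' a a' lam_closed
      by (simp add: linear_on_add[OF N_lin] linear_on_add[OF L])
  qed
next
  fix a assume "a \<in> carrier Hm"
  then obtain y where y: "y \<in> carrier H" "a = N y" using Hm_elim by blast
  note L = bilinear_onD2[OF lam_bilinear y(1)]
  show "linear_on (scale Hp) (scale Hm) (carrier Hp) (carrier Hm) (\<lambda>b. actl b a)"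
    unfolding linear_on_def
  proof (intro conjI ballI allI)
    fix b assume "b \<in> carrier Hp"
    then obtain x where x: "x \<in> carrier H" "b = P x" using Hp_elim by blast
    have a: "actl b a = N (lam x y)" unfolding x y by (rule act_left[OF x(1) y(1)])
    show "actl b a \<in> carrier Hm" unfolding a by (intro N_in lam_closed x y)
    show "actl (scale Hp c b) a = scale Hm c (actl b a)" for c
      using act_left[OF scale_closed[OF x(1)] y(1), of c] x y a lam_closed
      by (simp add: linear_on_scale[OF N_lin] linear_on_scale[OF L] linear_on_scale[OF P_lin])
    fix b' assume "b' \<in> carrier Hp"
    then obtain x' where x': "x' \<in> carrier H" "b' = P x'" using Hp_elim by blast
    have a': "actl b' a = N (lam x' y)" unfolding x' y by (rule act_left[OF x'(1) y(1)])
    show "actl (b + b') a = actl b a + actl b' a"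
      using act_left[OF vsp_add[OF V x(1) x'(1)] y(1)] x y x' a a' lam_closed
      by (simp add: linear_on_add[OF N_lin] linear_on_add[OF L] linear_on_add[OF P_lin])
  qed
qed

lemma actr_bilinear: "bilinear_on (scale Hp) (scale Hm) (scale Hp) (carrier Hp) (carrier Hm) (carrier Hp) actr"
proof (rule bilinear_onI)
  fix b assume "b \<in> carrier Hp"
  then obtain x where x: "x \<in> carrier H" "b = P x" using Hp_elim by blast
  note L = bilinear_onD1[OF rho_bilinear x(1)]
  show "linear_on (scale Hm) (scale Hp) (carrier Hm) (carrier Hp) (actr b)"
    unfolding linear_on_def
  proof (intro conjI ballI allI)
    fix a assume "a \<in> carrier Hm"
    then obtain y where y: "y \<in> carrier H" "a = N y" using Hm_elim by blast
    have a: "actr b a = P (rho x y)" unfolding x y by (rule act_right[OF x(1) y(1)])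
    show "actr b a \<in> carrier Hp" unfolding a by (intro P_in rho_closed x y)
    show "actr b (scale Hm c a) = scale Hp c (actr b a)" for c
      using act_right[OF x(1) scale_closed[OF y(1)], of c] x y a rho_closed
      by (simp add: linear_on_scale[OF N_lin] linear_on_scale[OF P_lin] linear_on_scale[OF L])
    fix a' assume "a' \<in> carrier Hm"
    then obtain y' where y': "y' \<in> carrier H" "a' = N y'" using Hm_elim by blast
    have a': "actr b a' = P (rho x y')" unfolding x y' by (rule act_right[OF x(1) y'(1)])
    show "actr b (a + a') = actr b a + actr b a'"
      using act_right[OF x(1) vsp_add[OF V y(1) y'(1)]] x y y' a a' rho_closed
      by (simp add: linear_on_add[OF N_lin] linear_on_add[OF P_lin] linear_on_add[OF L])
  qed
next
  fix a assume "a \<in> carrier Hm"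
  then obtain y where y: "y \<in> carrier H" "a = N y" using Hm_elim by blast
  note L = bilinear_onD2[OF rho_bilinear y(1)]
  show "linear_on (scale Hp) (scale Hp) (carrier Hp) (carrier Hp) (\<lambda>b. actr b a)"
    unfolding linear_on_def
  proof (intro conjI ballI allI)
    fix b assume "b \<in> carrier Hp"
    then obtain x where x: "x \<in> carrier H" "b = P x" using Hp_elim by blast
    have a: "actr b a = P (rho x y)" unfolding x y by (rule act_right[OF x(1) y(1)])
    show "actr b a \<in> carrier Hp" unfolding a by (intro P_in rho_closed x y)
    show "actr (scale Hp c b) a = scale Hp c (actr b a)" for c
      using act_right[OF scale_closed[OF x(1)] y(1), of c] x y a rho_closed
      by (simp add: linear_on_scale[OF L] linear_on_scale[OF P_lin])
    fix b' assume "b' \<in> carrier Hp"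
    then obtain x' where x': "x' \<in> carrier H" "b' = P x'" using Hp_elim by blast
    have a': "actr b' a = P (rho x' y)" unfolding x' y by (rule act_right[OF x'(1) y(1)])
    show "actr (b + b') a = actr b a + actr b' a"
      using act_right[OF vsp_add[OF V x(1) x'(1)] y(1)] x y x' a a' rho_closed
      by (simp add: linear_on_add[OF L] linear_on_add[OF P_lin])
  qed
qed

lemma mult_restrict:
  assumes "W \<subseteq> carrier H" "\<And>x y. x \<in> W \<Longrightarrow> y \<in> W \<Longrightarrow> x \<cdot> y \<in> W"
  shows "bilinear_on (scale H) (scale H) (scale H) W W W (mult H)"
  using mult_bilinear assms unfolding bilinear_on_def linear_on_def by blast

lemma Hm_mult: "bilinear_on (scale Hm) (scale Hm) (scale Hm) (carrier Hm) (carrier Hm) (carrier Hm) (mult Hm)"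
  unfolding rb_minus_simps
proof (rule mult_restrict)
  show "N ` carrier H \<subseteq> carrier H" using N_closed by auto
  fix x y assume "x \<in> N ` carrier H" "y \<in> N ` carrier H"
  then obtain x' y' where "x' \<in> carrier H" "y' \<in> carrier H" "x = N x'" "y = N y'" by auto
  then show "x \<cdot> y \<in> N ` carrier H" using N_circ circ_closed by (metis image_eqI)
qed

lemma Hp_mult: "bilinear_on (scale Hp) (scale Hp) (scale Hp) (carrier Hp) (carrier Hp) (carrier Hp) (mult Hp)"
  unfolding rb_plus_simps
proof (rule mult_restrict)
  show "B ` carrier H \<subseteq> carrier H" using B_closed by auto
  fix x y assume "x \<in> B ` carrier H" "y \<in> B ` carrier H"
  then obtain x' y' where *: "x' \<in> carrier H" "y' \<in> carrier H" "x = P x'" "y = P y'"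
    using Hp_elim[unfolded rb_plus_simps] by metis
  have "x \<cdot> y = P (circ x' y')" unfolding * by (rule P_circ[symmetric, OF *(1,2)])
  then show "x \<cdot> y \<in> B ` carrier H" using P_in[OF circ_closed[OF *(1,2)]] by simp
qed

lemma dc_data: "double_cross_data Hm Hp actl actr"
  by (intro double_cross_data.intro double_cross_data_axioms.intro Hm_pair actl_bilinear actr_bilinear Hm_mult Hp_mult)

lemma points_N: "cocommutative_coalgebra C \<Longrightarrow> f \<in> points C H \<Longrightarrow> (\<lambda>c. N (f c)) \<in> points C Hm"
  by (rule points_comp[OF _ V A.vspC _ N_Hm_map]) (simp add: cocommutative_coalgebra_def)

lemma points_P: "cocommutative_coalgebra C \<Longrightarrow> f \<in> points C H \<Longrightarrow> (\<lambda>c. P (f c)) \<in> points C Hp"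
  by (rule points_comp[OF _ V X.vspC _ P_Hp_map]) (simp add: cocommutative_coalgebra_def)

end

context rb_points
begin

abbreviation "dmul \<equiv> mult (double_cross_bialgebra R.Hm R.Hp R.actl R.actr)"
text \<open>Reads a pair of points through \<open>N\<close> and \<open>P\<close>. By
  \<open>dpoint_mult\<close> this carries \<open>pmul\<close> to the double cross product, which is
  how associativity and inverses reach it.\<close>

definition dpoint where "dpoint p = pairing C R.Hm R.Hp (\<lambda>c. R.N (fst p c)) (\<lambda>c. R.P (snd p c))"

interpretation D: double_cross_data R.Hm R.Hp R.actl R.actr by (rule R.dc_data)

abbreviation "GG \<equiv> points C H \<times> points C H"

lemma dpoint_point: "p \<in> GG \<Longrightarrow> dpoint p \<in> points C (tens R.Hm R.Hp)"
  unfolding dpoint_def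
  by (rule D.pairing_point[OF C.cocommutative_coalgebra_axioms R.points_N[OF C.cocommutative_coalgebra_axioms] R.points_P[OF C.cocommutative_coalgebra_axioms]])
    (auto simp: mem_Times_iff)

lemma dpoint_lin: "p \<in> GG \<Longrightarrow> linear_on (scale C) tensor_scale (carrier C) D.TS (dpoint p)"
  using coalgebra_map_linear[OF points_map[OF dpoint_point]] by simp

lemma dpoint_mult:
  assumes "p \<in> GG" "q \<in> GG" and c: "c \<in> carrier C"
  shows "sweedler C (\<lambda>u v. dmul (dpoint p u) (dpoint q v)) c = dpoint (G.pmul p q) c"
proof -
  obtain f g f' g' where pq: "p = (f, g)" "q = (f', g')" "f \<in> points C H" "g \<in> points C H" "f' \<in> points C H" "g' \<in> points C H"
    using assms by auto
  note Ca = C.cocommutative_coalgebra_axioms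
  have cm: "cmul C R.Hm = cmul C H" "cmul C R.Hp = cmul C H"
    by (intro ext, simp add: cmul_def)+
  have "sweedler C (\<lambda>u v. dmul (pairing C R.Hm R.Hp (\<lambda>c. R.N (f c)) (\<lambda>c. R.P (g c)) u) (pairing C R.Hm R.Hp (\<lambda>c. R.N (f' c)) (\<lambda>c. R.P (g' c)) v)) c
    = pairing C R.Hm R.Hp (cmul C R.Hm (\<lambda>c. R.N (f c)) (\<lambda>c. R.N (G.lam g f' c))) (cmul C R.Hp (\<lambda>c. R.P (G.rho g f' c)) (\<lambda>c. R.P (g' c))) c"
    by (rule D.multD_points[OF Ca R.points_N[OF Ca pq(3)] R.points_P[OF Ca pq(4)] R.points_N[OF Ca pq(5)] R.points_P[OF Ca pq(6)]
       act_left_point[OF pq(4,5)] act_right_point[OF pq(4,5)] c])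
  moreover have "cmul C R.Hm (\<lambda>c. R.N (f c)) (\<lambda>c. R.N (G.lam g f' c)) = (\<lambda>c. R.N (G.circ f (G.lam g f') c))"
    unfolding cm(1) using G.N_circ[OF pq(3) G.closed(4)[OF pq(4,5)]]
    by (simp add: N_point pq G.closed)
  moreover have "cmul C R.Hp (\<lambda>c. R.P (G.rho g f' c)) (\<lambda>c. R.P (g' c)) = (\<lambda>c. R.P (G.circ (G.rho g f') g' c))"
    unfolding cm(2) using G.P_circ[OF G.rho_closed[OF pq(4,5)] pq(6)] by simp
  ultimately show ?thesis unfolding dpoint_def pq G.pmul_def by simp
qed

lemma dpoint_one: "c \<in> carrier C \<Longrightarrow> dpoint (cone C H, cone C H) c = tensor_scale (counit C c) (R.tp (one H) (one H))"
proof -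
  assume c: "c \<in> carrier C"
  have e: "(\<lambda>c. R.N (cone C H c)) = cone C H" "(\<lambda>c. R.P (cone C H c)) = cone C H"
    using N_point[OF Q.cone_point] G.P_e unfolding G.N_def by (simp_all add: Q.cone_point)
  have one: "one H \<in> carrier R.Hm" "one H \<in> carrier R.Hp"
    using R.N_in[OF R.one_closed] R.P_in[OF R.one_closed] R.N_one R.P_one by simp_all
  note u = pure_tensor_bilinear_UNIV[of "scale R.Hm" "scale R.Hp"]
  have "dpoint (cone C H, cone C H) c = sweedler C (\<lambda>u v. R.tp (cone C H u) (cone C H v)) c"
    unfolding dpoint_def fst_conv snd_conv e pairing_def using c by simp
  also have "\<dots> = sweedler C (\<lambda>u v. tensor_scale (counit C u) (tensor_scale (counit C v) (R.tp (one H) (one H)))) c"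
    by (intro C.sweedler_cong[OF c])
      (simp add: cone_def linear_on_scale[OF bilinear_onD1[OF u], simplified] linear_on_scale[OF bilinear_onD2[OF u], simplified] tensor_scale_def mult.left_commute)
  also have "\<dots> = tensor_scale (counit C c) (R.tp (one H) (one H))"
    by (rule C.counit_left'[OF c D.vTS]) (intro lin_scale1[OF D.vTS] C.counit_linear D.pt_in one)
  finally show ?thesis .
qed

end

section \<open>The embedding sigma and its multiplicative properties\<close>

context rota_baxter_hopf
begin

interpretation pair: coalgebra_pair H H by (rule pair)
interpretation R1: rb_points H H B by (rule rb_pointsI[OF coalg.cocommutative_coalgebra_axioms])
interpretation R2: rb_points "tens H H" H B by (rule rb_pointsI[OF pair.coalgebra])
interpretation D: double_cross_data Hm Hp actl actr by (rule dc_data)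

text \<open>The image of \<open>sig\<close> at the identity point, so that multiplicativity becomes
  a statement about groups; \<open>sigma_formula\<close> gives the explicit expression.\<close>

definition sigma where "sigma = R1.dpoint (R1.G.sig idp)"

lemma sigma_point: "sigma \<in> points H (tens Hm Hp)"
  unfolding sigma_def by (rule R1.dpoint_point[OF R1.G.sig_closed[OF id_points(1)]])

lemma sigma_lin: "linear_on (scale H) tensor_scale (carrier H) D.TS sigma"
  using coalgebra_map_linear[OF points_map[OF sigma_point]] by simp

lemma sigma_closed: "x \<in> carrier H \<Longrightarrow> sigma x \<in> D.TS"
  by (rule linear_on_closed[OF sigma_lin])

lemma sigma_formula: "x \<in> carrier H \<Longrightarrow> sigma x = sweedler H (\<lambda>u v. tp (N u) (antipode H (P v))) x"
  unfolding sigma_def R1.dpoint_def R1.G.sig_def pairing_def R1.T_point[OF id_points(1)]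
  by (auto intro!: coalg.sweedler_cong simp: P_Tinv)

lemma sigma_one: "sigma \<one> = tp \<one> \<one>"
proof -
  have t: "tp = tensor_of H H" by simp
  have b: "bilinear_on (scale H) (scale H) tensor_scale (carrier H) (carrier H) HH (\<lambda>u v. tp (N u) (antipode H (P v)))"
    unfolding t by (intro bilinear_onI lin_pure1 lin_pure2 N_lin SP_lin N_closed antipode_closed P_closed)
  show ?thesis
    unfolding sigma_formula[OF one_closed]
    using coalg.sweedler_comult[OF one_closed tensor_space_vsp b, of "[(\<one>, \<one>)]"]
    by (simp add: one_closed comult_one N_one P_one P_one[unfolded antipode_one] antipode_one)
qed

end

context rb_points
begin

text \<open>The identity point is universal, so \<open>sig\<close> at any point \<open>q\<close> is
  obtained from \<open>sigma\<close> by composition.\<close>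

lemma sigma_comp:
  assumes q: "q \<in> points C H" shows "dpoint (G.sig q) = (\<lambda>c. R.sigma (q c))"
proof -
  interpret R1: rb_points H H B by (rule R.rb_pointsI[OF R.coalg.cocommutative_coalgebra_axioms])
  note i = R.id_points(1) and Ha = R.coalg.cocommutative_coalgebra_axioms
  have qc: "q c \<in> carrier H" for c
    using points_closed[OF q] points_outside[OF q] vsp_0[OF R.V] by metis
  have "pairing C R.Hm R.Hp (\<lambda>c. R.N (R.idp (q c))) (\<lambda>c. R.P (R1.G.T R.idp (q c)))
    = (\<lambda>c. pairing H R.Hm R.Hp (\<lambda>c. R.N (R.idp c)) (\<lambda>c. R.P (R1.G.T R.idp c)) (q c))"
    by (rule pairing_comp[OF R.Hm_pair C.cocommutative_coalgebra_axioms Ha R.points_N[OF Ha i] R.points_P[OF Ha R1.G.closed(3)[OF i]] q])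
  then show ?thesis
    unfolding dpoint_def R.sigma_def R1.dpoint_def G.sig_def R1.G.sig_def fst_conv snd_conv T_point[OF q] R1.T_point[OF i]
    using qc by simp
qed

end

context rota_baxter_hopf
begin

interpretation pair: coalgebra_pair H H by (rule pair)
interpretation R1: rb_points H H B by (rule rb_pointsI[OF coalg.cocommutative_coalgebra_axioms])
interpretation R2: rb_points "tens H H" H B by (rule rb_pointsI[OF pair.coalgebra])
interpretation D: double_cross_data Hm Hp actl actr by (rule dc_data)

abbreviation "dmul \<equiv> mult (double_cross_bialgebra Hm Hp actl actr)"
abbreviation "T2 \<equiv> tens H H"

lemmas proj_points = pair.proj1_point pair.proj2_point
lemmas dmul_bil = D.multD_bilinear
lemmas dmul_closed = bilinear_on_closed[OF D.multD_bilinear]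

lemma cmul12: "x \<in> carrier H \<Longrightarrow> y \<in> carrier H \<Longrightarrow> cmul T2 H p1 p2 (pt x y) = x \<cdot> y"
  unfolding cmul_def using pt_in_tens pair.eval_indep[OF _ _ V mult_bilinear lin_id lin_id] by simp

text \<open>This is \<open>sig_mul\<close> at the two projections of
  \<open>H \<otimes> H\<close>.\<close>

lemma sigma_mult:
  assumes x: "x \<in> carrier H" and y: "y \<in> carrier H"
  shows "dmul (sigma x) (sigma y) = sigma (x \<cdot> y)"
proof -
  note s = R2.G.sig_closed[OF proj_points(1)] R2.G.sig_closed[OF proj_points(2)]
  have "dmul (sigma x) (sigma y) = sweedler T2 (\<lambda>u v. dmul (sigma (p1 u)) (sigma (p2 v))) (pt x y)"
    by (rule pair.eval_indep[symmetric, OF x y D.vTS dmul_bil sigma_lin sigma_lin])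
  also have "\<dots> = R2.dpoint (R2.G.pmul (R2.G.sig p1) (R2.G.sig p2)) (pt x y)"
    using R2.dpoint_mult[OF s pt_in_tens[OF x y]] unfolding R2.sigma_comp[OF proj_points(1)] R2.sigma_comp[OF proj_points(2)] .
  also have "R2.G.pmul (R2.G.sig p1) (R2.G.sig p2) = R2.G.sig (cmul T2 H p1 p2)"
    by (rule R2.G.sig_mul[OF proj_points])
  also have "R2.dpoint (R2.G.sig (cmul T2 H p1 p2)) (pt x y) = sigma (cmul T2 H p1 p2 (pt x y))"
    unfolding R2.sigma_comp[OF R2.Q.cmul_point[OF proj_points]] ..
  finally show ?thesis unfolding cmul12[OF x y] .
qed

text \<open>The surjection from \<open>H \<otimes> H\<close> onto the double cross product given by
  \<open>N\<close> and \<open>P\<close> on the factors. Equations between linear maps are tested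
  after composing with it, which is \<open>D_eqI\<close>.\<close>

definition N_tens_P where "N_tens_P = R2.dpoint (p1, p2)"

lemma proj_points_in: "(p1, p2) \<in> R2.GG"
  using proj_points by simp

lemma N_tens_P_point: "N_tens_P \<in> points T2 (tens Hm Hp)"
  unfolding N_tens_P_def by (rule R2.dpoint_point[OF proj_points_in])

lemma N_tens_P_lin: "linear_on tensor_scale tensor_scale HH D.TS N_tens_P"
  using coalgebra_map_linear[OF points_map[OF N_tens_P_point]] by simp

lemma N_tens_P_pure: "x \<in> carrier H \<Longrightarrow> y \<in> carrier H \<Longrightarrow> N_tens_P (pt x y) = tp (N x) (P y)"
  unfolding N_tens_P_def R2.dpoint_def pairing_def fst_conv snd_conv
  using pair.eval_indep[OF _ _ D.vTS pure_tensor_bilinear coalgebra_map_linear[OF N_Hm_map] coalgebra_map_linear[OF P_Hp_map]]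
    pt_in_tens by simp

lemma D_eqI:
  assumes s: "vector_space s" and f: "linear_on tensor_scale s D.TS U f" and g: "linear_on tensor_scale s D.TS U' g"
    and eq: "\<And>x y. x \<in> carrier H \<Longrightarrow> y \<in> carrier H \<Longrightarrow> f (N_tens_P (pt x y)) = g (N_tens_P (pt x y))" and z: "z \<in> D.TS"
  shows "f z = g z"
proof (rule D.tens_eqI[OF s f g _ z])
  fix a b assume "a \<in> carrier Hm" "b \<in> carrier Hp"
  then obtain x y where "x \<in> carrier H" "a = N x" "y \<in> carrier H" "b = P y"
    using Hm_elim Hp_elim by metis
  then show "f (tp a b) = g (tp a b)" using eq[of x y] by (simp add: N_tens_P_pure)
qed

lemma dmul_sigma_one:
  assumes "z \<in> D.TS" shows "dmul z (sigma \<one>) = z"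
proof (rule D_eqI[where f = "\<lambda>z. dmul z (sigma \<one>)" and g = "\<lambda>z. z", OF vs_tensor bilinear_onD2[OF dmul_bil sigma_closed[OF one_closed]] lin_id _ assms])
  fix x y assume x: "x \<in> carrier H" and y: "y \<in> carrier H"
  let ?e = "cone T2 H" and ?w = "pt x y"
  note w = pt_in_tens[OF x y]
  have ee: "(?e, ?e) \<in> R2.GG" by (simp add: R2.Q.cone_point)
  have l: "linear_on tensor_scale tensor_scale HH D.TS (\<lambda>u. dmul (N_tens_P u) (sigma \<one>))"
    by (intro lin_bil1[OF dmul_bil] N_tens_P_lin sigma_closed one_closed)
  have "N_tens_P ?w = R2.dpoint (R2.G.pmul (p1, p2) (?e, ?e)) ?w"
    unfolding N_tens_P_def R2.G.pmul_e(1)[OF proj_points_in] ..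
  also have "\<dots> = sweedler T2 (\<lambda>u v. dmul (N_tens_P u) (R2.dpoint (?e, ?e) v)) ?w"
    unfolding N_tens_P_def by (rule R2.dpoint_mult[symmetric, OF proj_points_in ee w])
  also have "\<dots> = sweedler T2 (\<lambda>u v. tensor_scale (counit T2 v) (dmul (N_tens_P u) (sigma \<one>))) ?w"
    by (intro pair.T.sweedler_cong[OF w])
      (simp add: R2.dpoint_one sigma_one[symmetric] linear_on_scale[OF bilinear_onD1[OF dmul_bil]] linear_on_closed[OF N_tens_P_lin] sigma_closed one_closed
        del: rb_minus_simps rb_plus_simps)
  also have "\<dots> = dmul (N_tens_P ?w) (sigma \<one>)"
    by (rule R2.C.counit_right'[OF w D.vTS]) (simp add: l del: rb_minus_simps rb_plus_simps)
  finally show "dmul (N_tens_P ?w) (sigma \<one>) = N_tens_P ?w" ..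
qed

text \<open>
  The antipode of the double cross product is only known to be some convolution inverse of the
  identity. Associativity against \<open>Im sigma\<close> is all that is needed to compute it on \<open>Im sigma\<close>.
\<close>

lemma dmul_sigma_assoc:
  assumes x: "x \<in> carrier H" and y: "y \<in> carrier H" and z: "z \<in> D.TS"
  shows "dmul (dmul z (sigma x)) (sigma y) = dmul z (sigma (x \<cdot> y))"
proof (rule D_eqI[where f = "\<lambda>z. dmul (dmul z (sigma x)) (sigma y)" and g = "\<lambda>z. dmul z (sigma (x \<cdot> y))" and U = D.TS and U' = D.TS, OF vs_tensor _ _ _ z])
  show "linear_on tensor_scale tensor_scale D.TS D.TS (\<lambda>z. dmul (dmul z (sigma x)) (sigma y))"
    "linear_on tensor_scale tensor_scale D.TS D.TS (\<lambda>z. dmul z (sigma (x \<cdot> y)))"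
    by (intro lin_bil1[OF dmul_bil] lin_id sigma_closed mult_closed x y)+
  fix a b assume a: "a \<in> carrier H" and b: "b \<in> carrier H"
  \<comment> \<open>Four independent variables \<open>a\<close>, \<open>b\<close>, \<open>x\<close>,
    \<open>y\<close> occur, so the group is that of the points of the tensor square of
    \<open>H \<otimes> H\<close>, and the variables are its iterated projections.\<close>
  interpret P3: coalgebra_pair T2 T2 by (intro coalgebra_pair.intro pair.coalgebra)
  interpret R3: rb_points "tens T2 T2" H B by (rule rb_pointsI[OF P3.coalgebra])
  let ?C = "tens T2 T2"
  let ?q1 = "proj1 T2 T2" and ?q2 = "proj2 T2 T2"
  let ?d = "pt a b" and ?w = "pt x y"
  let ?dw = "tensor_of T2 T2 ?d ?w"
  note q = P3.proj1_point P3.proj2_point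
  note d = pt_in_tens[OF a b] and w = pt_in_tens[OF x y]
  have dw: "tensor_of T2 T2 e f \<in> carrier ?C" if "e \<in> carrier T2" "f \<in> carrier T2" for e f
    using P3.pt_in[OF that] by simp
  note T2v = pair.T.vspC and Cc = P3.T.comultiplication_axioms
  let ?f1 = "\<lambda>c. p1 (?q1 c)" and ?f2 = "\<lambda>c. p2 (?q1 c)" and ?g = "\<lambda>c. p1 (?q2 c)" and ?h = "\<lambda>c. p2 (?q2 c)"
  have pts: "?f1 \<in> points ?C H" "?f2 \<in> points ?C H" "?g \<in> points ?C H" "?h \<in> points ?C H"
    by (rule points_comp[OF Cc T2v V q(1) points_map[OF proj_points(1)]] points_comp[OF Cc T2v V q(1) points_map[OF proj_points(2)]]
      points_comp[OF Cc T2v V q(2) points_map[OF proj_points(1)]] points_comp[OF Cc T2v V q(2) points_map[OF proj_points(2)]])+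
  have ff: "(?f1, ?f2) \<in> R3.GG" using pts by simp
  note sg = R3.G.sig_closed[OF pts(3)] and sh = R3.G.sig_closed[OF pts(4)]
  note Ta = pair.coalgebra and Ca = P3.coalgebra
  have F: "R3.dpoint (?f1, ?f2) = (\<lambda>c. N_tens_P (?q1 c))"
    unfolding R3.dpoint_def N_tens_P_def R2.dpoint_def fst_conv snd_conv
    by (rule pairing_comp[OF Hm_pair Ca Ta points_N[OF Ta proj_points(1)] points_P[OF Ta proj_points(2)] q(1)])
  have piDl: "linear_on (scale T2) tensor_scale (carrier T2) D.TS N_tens_P" using N_tens_P_lin by simp
  have s1: "linear_on (scale T2) tensor_scale (carrier T2) D.TS (\<lambda>e. sigma (p1 e))"
    "linear_on (scale T2) tensor_scale (carrier T2) D.TS (\<lambda>e. sigma (p2 e))"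
    using lin_comp[OF sigma_lin pair.proj1_linear] lin_comp[OF sigma_lin pair.proj2_linear] by simp_all
  let ?M = "R3.dpoint (R3.G.pmul (?f1, ?f2) (R3.G.sig ?g))"
  have M: "?M (tensor_of T2 T2 e f) = dmul (N_tens_P e) (sigma (p1 f))" if e: "e \<in> carrier T2" "f \<in> carrier T2" for e f
  proof -
    have "?M (tensor_of T2 T2 e f) = sweedler ?C (\<lambda>u v. dmul (N_tens_P (?q1 u)) (sigma (p1 (?q2 v)))) (tensor_of T2 T2 e f)"
      using R3.dpoint_mult[OF ff sg dw[OF e]] unfolding F R3.sigma_comp[OF pts(3)] by simp
    also have "\<dots> = dmul (N_tens_P e) (sigma (p1 f))"
      by (rule P3.eval_indep[OF e D.vTS dmul_bil piDl s1(1)])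
    finally show ?thesis .
  qed
  have Ml: "linear_on tensor_scale tensor_scale P3.TS D.TS ?M"
    using R3.dpoint_lin[OF R3.G.pmul_closed[OF ff sg]] by (simp del: rb_minus_simps rb_plus_simps)
  have "R3.dpoint (R3.G.pmul (R3.G.pmul (?f1, ?f2) (R3.G.sig ?g)) (R3.G.sig ?h)) ?dw
     = sweedler ?C (\<lambda>u v. dmul (?M u) (sigma (p2 (?q2 v)))) ?dw"
    using R3.dpoint_mult[OF R3.G.pmul_closed[OF ff sg] sh dw[OF d w]] unfolding R3.sigma_comp[OF pts(4)] by simp
  also have "\<dots> = sweedler T2 (\<lambda>e1 e2. dmul (?M (tensor_of T2 T2 ?d e1)) (sigma (p2 e2))) ?w"
    by (rule P3.evalR[OF d w D.vTS dmul_bil Ml s1(2)])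
  also have "\<dots> = sweedler T2 (\<lambda>e1 e2. dmul (dmul (N_tens_P ?d) (sigma (p1 e1))) (sigma (p2 e2))) ?w"
    by (rule pair.T.sweedler_cong[OF w]) (simp only: M[OF d])
  also have "\<dots> = dmul (dmul (N_tens_P ?d) (sigma x)) (sigma y)"
  proof -
    have pd: "N_tens_P ?d \<in> D.TS" using d linear_on_closed[OF N_tens_P_lin] by simp
    have m: "bilinear_on tensor_scale tensor_scale tensor_scale D.TS D.TS D.TS (\<lambda>s t. dmul (dmul (N_tens_P ?d) s) t)"
      by (intro bilinear_onI lin_bil1[OF dmul_bil] lin_bil2[OF dmul_bil] lin_id dmul_closed pd; assumption)
    show ?thesis by (rule pair.eval_indep[OF x y D.vTS m sigma_lin sigma_lin])
  qed
  finally have 1: "R3.dpoint (R3.G.pmul (R3.G.pmul (?f1, ?f2) (R3.G.sig ?g)) (R3.G.sig ?h)) ?dw = dmul (dmul (N_tens_P ?d) (sigma x)) (sigma y)" .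
  have gh: "cmul ?C H ?g ?h = (\<lambda>c. cmul T2 H p1 p2 (?q2 c))"
    by (rule cmul_comp[OF cocommutative_hopf_algebra_axioms Ca Ta proj_points q(2)])
  have ghp: "cmul ?C H ?g ?h \<in> points ?C H" by (rule R3.Q.cmul_point[OF pts(3,4)])
  have s2: "linear_on (scale T2) tensor_scale (carrier T2) D.TS (\<lambda>e. sigma (cmul T2 H p1 p2 e))"
    using lin_comp[OF sigma_lin R2.Q.points_lin[OF R2.Q.cmul_point[OF proj_points]]] .
  have "R3.dpoint (R3.G.pmul (?f1, ?f2) (R3.G.sig (cmul ?C H ?g ?h))) ?dw
    = sweedler ?C (\<lambda>u v. dmul (N_tens_P (?q1 u)) (sigma (cmul T2 H p1 p2 (?q2 v)))) ?dw"
    using R3.dpoint_mult[OF ff R3.G.sig_closed[OF ghp] dw[OF d w]] unfolding F R3.sigma_comp[OF ghp] unfolding gh by simp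
  also have "\<dots> = dmul (N_tens_P ?d) (sigma (cmul T2 H p1 p2 ?w))"
    by (rule P3.eval_indep[OF d w D.vTS dmul_bil piDl s2])
  finally have 2: "R3.dpoint (R3.G.pmul (?f1, ?f2) (R3.G.sig (cmul ?C H ?g ?h))) ?dw = dmul (N_tens_P ?d) (sigma (x \<cdot> y))"
    unfolding cmul12[OF x y] .
  have "R3.G.pmul (R3.G.pmul (?f1, ?f2) (R3.G.sig ?g)) (R3.G.sig ?h) = R3.G.pmul (?f1, ?f2) (R3.G.sig (cmul ?C H ?g ?h))"
    unfolding R3.G.sig_mul[OF pts(3,4), symmetric] by (rule R3.G.pmul_assoc[OF ff sg sh])
  then show "dmul (dmul (N_tens_P ?d) (sigma x)) (sigma y) = dmul (N_tens_P ?d) (sigma (x \<cdot> y))"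
    using 1 2 by simp
qed

section \<open>The antipode of the double cross product\<close>

abbreviation "dc_bialgebra \<equiv> double_cross_bialgebra Hm Hp actl actr"

lemma dc_bialgebra_simps: "carrier dc_bialgebra = D.TS" "scale dc_bialgebra = tensor_scale" "one dc_bialgebra = tp \<one> \<one>"
  "counit dc_bialgebra = counit (tens Hm Hp)" "comult dc_bialgebra = comult (tens Hm Hp)"
  unfolding double_cross_bialgebra_def tens_def by simp_all

lemma antipode_Hm: "linear_on (scale Hm) (scale Hm) (carrier Hm) (carrier Hm) (antipode H)"
  unfolding linear_on_def
proof (intro conjI ballI allI)
  fix a assume a: "a \<in> carrier Hm"
  then obtain x where x: "x \<in> carrier H" "a = N x" using Hm_elim by blast
  show "antipode H a \<in> carrier Hm" unfolding x(2) N_Tinv[OF x(1), symmetric] by (intro N_in Tinv_closed x)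
  show "antipode H (scale Hm c a) = scale Hm c (antipode H a)" for c
    using linear_on_scale[OF antipode_linear Hm_sub[OF a]] by simp
  show "antipode H (a + b) = antipode H a + antipode H b" if "b \<in> carrier Hm" for b
    by (rule linear_on_add[OF antipode_linear Hm_sub[OF a] Hm_sub[OF that]])
qed

lemma antipode_Hp: "linear_on (scale Hp) (scale Hp) (carrier Hp) (carrier Hp) (antipode H)"
  unfolding linear_on_def
proof (intro conjI ballI allI)
  fix a assume a: "a \<in> carrier Hp"
  then obtain x where x: "x \<in> carrier H" "a = P x" using Hp_elim by blast
  show "antipode H a \<in> carrier Hp" unfolding x(2) P_Tinv[OF x(1), symmetric] by (intro P_in Tinv_closed x)
  show "antipode H (scale Hp c a) = scale Hp c (antipode H a)" for c
    using linear_on_scale[OF antipode_linear Hp_sub[OF a]] by simp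
  show "antipode H (a + b) = antipode H a + antipode H b" if "b \<in> carrier Hp" for b
    by (rule linear_on_add[OF antipode_linear Hp_sub[OF a] Hp_sub[OF that]])
qed

text \<open>The group inverse \<open>pinv\<close> of a pair, written with the actions. It is a
  witness for the choice of antipode in \<open>double_cross\<close>.\<close>

definition dc_antipode where
  "dc_antipode = lift_of Hm Hp (\<lambda>a b. sweedler Hm (\<lambda>a1 a2. sweedler Hp (\<lambda>b1 b2.
     tp (actl (antipode H b1) (antipode H a1)) (actr (antipode H b2) (antipode H a2))) b) a)"

lemma dc_antipode_core:
  "a2 \<in> carrier Hm \<Longrightarrow> b1 \<in> carrier Hp \<Longrightarrow> b2 \<in> carrier Hp \<Longrightarrow> linear_on (scale Hm) tensor_scale (carrier Hm) D.TS
    (\<lambda>a1. tp (actl (antipode H b1) (antipode H a1)) (actr (antipode H b2) (antipode H a2)))"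
  "a1 \<in> carrier Hm \<Longrightarrow> b1 \<in> carrier Hp \<Longrightarrow> b2 \<in> carrier Hp \<Longrightarrow> linear_on (scale Hm) tensor_scale (carrier Hm) D.TS
    (\<lambda>a2. tp (actl (antipode H b1) (antipode H a1)) (actr (antipode H b2) (antipode H a2)))"
  "a1 \<in> carrier Hm \<Longrightarrow> a2 \<in> carrier Hm \<Longrightarrow> b2 \<in> carrier Hp \<Longrightarrow> linear_on (scale Hp) tensor_scale (carrier Hp) D.TS
    (\<lambda>b1. tp (actl (antipode H b1) (antipode H a1)) (actr (antipode H b2) (antipode H a2)))"
  "a1 \<in> carrier Hm \<Longrightarrow> a2 \<in> carrier Hm \<Longrightarrow> b1 \<in> carrier Hp \<Longrightarrow> linear_on (scale Hp) tensor_scale (carrier Hp) D.TS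
    (\<lambda>b2. tp (actl (antipode H b1) (antipode H a1)) (actr (antipode H b2) (antipode H a2)))"
  by (intro lin_pure1 lin_pure2 lin_bil1[OF actl_bilinear] lin_bil2[OF actl_bilinear] lin_bil1[OF actr_bilinear] lin_bil2[OF actr_bilinear]
    antipode_Hm antipode_Hp D.lc D.rc linear_on_closed[OF antipode_Hm] linear_on_closed[OF antipode_Hp]; assumption)+

lemma dc_antipode_bilinear:
  "bilinear_on (scale Hm) (scale Hp) tensor_scale (carrier Hm) (carrier Hp) D.TS
    (\<lambda>a b. sweedler Hm (\<lambda>a1 a2. sweedler Hp (\<lambda>b1 b2.
     tp (actl (antipode H b1) (antipode H a1)) (actr (antipode H b2) (antipode H a2))) b) a)"
  by (intro bilinear_onI D.X.lin_param[OF _ D.vTS] D.X.lin_sweedler[OF D.vTS lin_id] D.A.lin_param[OF _ D.vTS] D.A.lin_sweedler[OF D.vTS lin_id] dc_antipode_core; assumption)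

lemma dc_antipode_lin: "linear_on tensor_scale tensor_scale D.TS D.TS dc_antipode"
  unfolding dc_antipode_def by (rule lift_linear[OF D.A.vspC D.X.vspC D.vTS dc_antipode_bilinear])

abbreviation "dc_inverse \<equiv> R2.dpoint (R2.G.pinv (p1, p2))"

lemma dc_antipode_N_tens_P:
  assumes x: "x \<in> carrier H" and y: "y \<in> carrier H"
  shows "dc_antipode (N_tens_P (pt x y)) = dc_inverse (pt x y)"
proof -
  let ?G = "\<lambda>a1 a2 b1 b2. tp (actl (antipode H b1) (antipode H a1)) (actr (antipode H b2) (antipode H a2))"
  have "dc_antipode (N_tens_P (pt x y)) = sweedler Hm (\<lambda>a1 a2. sweedler Hp (\<lambda>b1 b2. ?G a1 a2 b1 b2) (P y)) (N x)"
    unfolding N_tens_P_pure[OF x y] dc_antipode_def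
    by (rule lift_pure[OF D.A.vspC D.X.vspC vs_tensor dc_antipode_bilinear N_in[OF x] P_in[OF y]])
  also have "\<dots> = sweedler H (\<lambda>x1 x2. sweedler Hp (\<lambda>b1 b2. ?G (N x1) (N x2) b1 b2) (P y)) x"
    by (rule sweedler_map[OF coalg.comultiplication_axioms D.A.vspC N_Hm_map x D.vTS])
      (intro bilinear_onI D.X.lin_param[OF _ D.vTS] dc_antipode_core P_in y; assumption)
  also have "\<dots> = sweedler H (\<lambda>x1 x2. sweedler H (\<lambda>y1 y2. ?G (N x1) (N x2) (P y1) (P y2)) y) x"
    by (rule coalg.sweedler_cong[OF x], rule sweedler_map[OF coalg.comultiplication_axioms D.X.vspC P_Hp_map y D.vTS])
      (intro bilinear_onI dc_antipode_core N_in; assumption)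
  also have "\<dots> = sweedler H (\<lambda>x1 x2. sweedler H (\<lambda>y1 y2. tp (N (lam (Tinv y1) (Tinv x1))) (P (rho (Tinv y2) (Tinv x2)))) y) x"
  proof (rule coalg.sweedler_cong[OF x], rule coalg.sweedler_cong[OF y])
    fix x1 x2 y1 y2 assume *: "x1 \<in> carrier H" "x2 \<in> carrier H" "y1 \<in> carrier H" "y2 \<in> carrier H"
    show "?G (N x1) (N x2) (P y1) (P y2) = tp (N (lam (Tinv y1) (Tinv x1))) (P (rho (Tinv y2) (Tinv x2)))"
      using act_left[OF Tinv_closed[OF *(3)] Tinv_closed[OF *(1)]] act_right[OF Tinv_closed[OF *(4)] Tinv_closed[OF *(2)]]
      by (simp add: N_Tinv P_Tinv * del: rb_minus_simps rb_plus_simps)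
  qed
  finally have 1: "dc_antipode (N_tens_P (pt x y)) = \<dots>" .
  let ?T1 = "R2.G.T p1" and ?T2 = "R2.G.T p2"
  note Tp = R2.G.closed(3)[OF proj_points(1)] R2.G.closed(3)[OF proj_points(2)]
  let ?l = "R2.G.lam ?T2 ?T1" and ?r = "R2.G.rho ?T2 ?T1"
  note lp = R2.G.closed(4)[OF Tp(2,1)] and rp = R2.G.rho_closed[OF Tp(2,1)]
  have le: "?l (pt a b) = lam (Tinv b) (Tinv a)" if ab: "a \<in> carrier H" "b \<in> carrier H" for a b
    using R2.lam_point[OF Tp(2,1) pt_in_tens[OF ab]] pair.eval_swap[OF ab V lam_bilinear Tinv_lin Tinv_lin]
    unfolding R2.T_point[OF proj_points(1)] R2.T_point[OF proj_points(2)] by simp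
  have re: "?r (pt a b) = rho (Tinv b) (Tinv a)" if ab: "a \<in> carrier H" "b \<in> carrier H" for a b
    using R2.rho_point[OF Tp(2,1) pt_in_tens[OF ab]] pair.eval_swap[OF ab V rho_bilinear Tinv_lin Tinv_lin]
    unfolding R2.T_point[OF proj_points(1)] R2.T_point[OF proj_points(2)] by simp
  have Nl: "linear_on tensor_scale (scale Hm) HH (carrier Hm) (\<lambda>u. N (?l u))"
    using coalgebra_map_linear[OF points_map[OF points_N[OF pair.coalgebra lp]]] by simp
  have Pr: "linear_on tensor_scale (scale Hp) HH (carrier Hp) (\<lambda>u. P (?r u))"
    using coalgebra_map_linear[OF points_map[OF points_P[OF pair.coalgebra rp]]] by simp
  have "dc_inverse (pt x y) = sweedler T2 (\<lambda>u v. tp (N (?l u)) (P (?r v))) (pt x y)"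
    unfolding R2.dpoint_def R2.G.pinv_def fst_conv snd_conv pairing_def using pt_in_tens[OF x y] by simp
  also have "\<dots> = sweedler H (\<lambda>x1 x2. sweedler H (\<lambda>y1 y2. tp (N (?l (pt x1 y1))) (P (?r (pt x2 y2)))) y) x"
    by (rule pair.sweedler_tens[OF x y D.vTS]) (intro bilinear_onI lin_pure1 lin_pure2 Nl Pr linear_on_closed[OF Nl] linear_on_closed[OF Pr])
  also have "\<dots> = sweedler H (\<lambda>x1 x2. sweedler H (\<lambda>y1 y2. tp (N (lam (Tinv y1) (Tinv x1))) (P (rho (Tinv y2) (Tinv x2)))) y) x"
    by (rule coalg.sweedler_cong[OF x], rule coalg.sweedler_cong[OF y]) (simp add: le re)
  finally show ?thesis unfolding 1 ..
qed

lemma dc_antipode_N_tens_P': "u \<in> carrier T2 \<Longrightarrow> dc_antipode (N_tens_P u) = dc_inverse u"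
proof -
  assume "u \<in> carrier T2"
  then have u: "u \<in> HH" by simp
  have l: "linear_on tensor_scale tensor_scale HH D.TS dc_inverse"
    using R2.dpoint_lin[OF R2.G.pinv_closed[OF proj_points_in]] by (simp del: rb_minus_simps rb_plus_simps)
  show ?thesis
    by (rule pair.tens_eqI[OF vs_tensor lin_comp[OF dc_antipode_lin N_tens_P_lin] l dc_antipode_N_tens_P u])
qed

text \<open>After composition with \<open>N_tens_P\<close> the two laws are \<open>pmul_pinv\<close>
  at the pair of projections.\<close>

lemma dc_bialgebra_antipode: "is_antipode dc_bialgebra dc_antipode"
proof -
  note pinv_in = R2.G.pinv_closed[OF proj_points_in]
  have cl: "linear_on tensor_scale (*) D.TS UNIV (counit (tens Hm Hp))"
    using D.counit_T .
  have rl: "linear_on tensor_scale tensor_scale D.TS D.TS (\<lambda>z. tensor_scale (counit (tens Hm Hp) z) (tp \<one> \<one>))"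
    using lin_scale1[OF D.vTS cl sigma_closed[OF one_closed]] unfolding sigma_one .
  have b1: "bilinear_on tensor_scale tensor_scale tensor_scale D.TS D.TS D.TS (\<lambda>u v. dmul (dc_antipode u) v)"
    by (intro bilinear_onI lin_bil1[OF dmul_bil] lin_bil2[OF dmul_bil] dc_antipode_lin lin_id linear_on_closed[OF dc_antipode_lin])
  have b2: "bilinear_on tensor_scale tensor_scale tensor_scale D.TS D.TS D.TS (\<lambda>u v. dmul u (dc_antipode v))"
    by (intro bilinear_onI lin_bil1[OF dmul_bil] lin_bil2[OF dmul_bil] dc_antipode_lin lin_id linear_on_closed[OF dc_antipode_lin])
  have eval: "sweedler (tens Hm Hp) \<Phi> (N_tens_P w) = sweedler T2 (\<lambda>u v. \<Phi> (N_tens_P u) (N_tens_P v)) w"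
    if w: "w \<in> carrier T2" and b: "bilinear_on tensor_scale tensor_scale tensor_scale D.TS D.TS D.TS \<Phi>" for w \<Phi>
    by (rule sweedler_map[OF pair.T.comultiplication_axioms _ points_map[OF N_tens_P_point] w D.vTS])
      (use D.vTS b in \<open>simp_all del: rb_minus_simps rb_plus_simps\<close>)
  have one: "R2.dpoint (cone T2 H, cone T2 H) w = tensor_scale (counit (tens Hm Hp) (N_tens_P w)) (tp \<one> \<one>)" if w: "w \<in> carrier T2" for w
    unfolding R2.dpoint_one[OF w] coalgebra_map_counit[OF points_map[OF N_tens_P_point] w] ..
  have "sweedler (tens Hm Hp) (\<lambda>u v. dmul (dc_antipode u) v) z = tensor_scale (counit (tens Hm Hp) z) (tp \<one> \<one>)" if z: "z \<in> D.TS" for z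
  proof (rule D_eqI[OF vs_tensor D.T_lin_sweedler[OF D.vTS b1] rl _ z])
    fix x y assume x: "x \<in> carrier H" and y: "y \<in> carrier H"
    note w = pt_in_tens[OF x y]
    have "sweedler (tens Hm Hp) (\<lambda>u v. dmul (dc_antipode u) v) (N_tens_P (pt x y)) = sweedler T2 (\<lambda>u v. dmul (dc_antipode (N_tens_P u)) (N_tens_P v)) (pt x y)"
      by (rule eval[OF w b1])
    also have "\<dots> = sweedler T2 (\<lambda>u v. dmul (dc_inverse u) (R2.dpoint (p1, p2) v)) (pt x y)"
      by (intro pair.T.sweedler_cong[OF w]) (simp only: dc_antipode_N_tens_P' N_tens_P_def[symmetric])
    also have "\<dots> = R2.dpoint (R2.G.pmul (R2.G.pinv (p1, p2)) (p1, p2)) (pt x y)" by (rule R2.dpoint_mult[OF pinv_in proj_points_in w])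
    finally show "sweedler (tens Hm Hp) (\<lambda>u v. dmul (dc_antipode u) v) (N_tens_P (pt x y)) = tensor_scale (counit (tens Hm Hp) (N_tens_P (pt x y))) (tp \<one> \<one>)"
      unfolding R2.G.pmul_pinv(2)[OF proj_points_in] one[OF w] .
  qed
  moreover have "sweedler (tens Hm Hp) (\<lambda>u v. dmul u (dc_antipode v)) z = tensor_scale (counit (tens Hm Hp) z) (tp \<one> \<one>)" if z: "z \<in> D.TS" for z
  proof (rule D_eqI[OF vs_tensor D.T_lin_sweedler[OF D.vTS b2] rl _ z])
    fix x y assume x: "x \<in> carrier H" and y: "y \<in> carrier H"
    note w = pt_in_tens[OF x y]
    have "sweedler (tens Hm Hp) (\<lambda>u v. dmul u (dc_antipode v)) (N_tens_P (pt x y)) = sweedler T2 (\<lambda>u v. dmul (N_tens_P u) (dc_antipode (N_tens_P v))) (pt x y)"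
      by (rule eval[OF w b2])
    also have "\<dots> = sweedler T2 (\<lambda>u v. dmul (R2.dpoint (p1, p2) u) (dc_inverse v)) (pt x y)"
      by (intro pair.T.sweedler_cong[OF w]) (simp only: dc_antipode_N_tens_P' N_tens_P_def[symmetric])
    also have "\<dots> = R2.dpoint (R2.G.pmul (p1, p2) (R2.G.pinv (p1, p2))) (pt x y)" by (rule R2.dpoint_mult[OF proj_points_in pinv_in w])
    finally show "sweedler (tens Hm Hp) (\<lambda>u v. dmul u (dc_antipode v)) (N_tens_P (pt x y)) = tensor_scale (counit (tens Hm Hp) (N_tens_P (pt x y))) (tp \<one> \<one>)"
      unfolding R2.G.pmul_pinv(1)[OF proj_points_in] one[OF w] .
  qed
  ultimately show ?thesis
    unfolding is_antipode_def D.sweedler_double_cross dc_bialgebra_simps using dc_antipode_lin by blast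
qed

lemma double_cross_fields:
  "carrier (rb_double_cross H B) = D.TS" "scale (rb_double_cross H B) = tensor_scale" "mult (rb_double_cross H B) = dmul"
  "one (rb_double_cross H B) = tp \<one> \<one>" "comult (rb_double_cross H B) = comult (tens Hm Hp)"
  "counit (rb_double_cross H B) = counit (tens Hm Hp)"
  unfolding rb_double_cross_def double_cross_def by (simp_all add: dc_bialgebra_simps del: rb_minus_simps rb_plus_simps)

lemma double_cross_antipode: "is_antipode dc_bialgebra (antipode (rb_double_cross H B))"
  unfolding rb_double_cross_def double_cross_def using someI[of "is_antipode dc_bialgebra", OF dc_bialgebra_antipode] by simp

text \<open>The antipode after \<open>sigma\<close>, and \<open>sigma\<close> after the antipode of
  \<open>H\<close>, are both convolution inverses of \<open>sigma\<close>. The first comes from the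
  choice in \<open>double_cross\<close>, so only the inverse laws are known of it.\<close>

lemma antipode_sigma:
  assumes x: "x \<in> carrier H"
  shows "antipode (rb_double_cross H B) (sigma x) = sigma (antipode H x)"
proof -
  let ?S = "antipode (rb_double_cross H B)"
  have Sl: "linear_on tensor_scale tensor_scale D.TS D.TS ?S"
    and left: "\<And>z. z \<in> D.TS \<Longrightarrow> sweedler (tens Hm Hp) (\<lambda>u v. dmul (?S u) v) z = tensor_scale (counit (tens Hm Hp) z) (tp \<one> \<one>)"
    using double_cross_antipode unfolding is_antipode_def D.sweedler_double_cross dc_bialgebra_simps by blast+
  have Ssl: "linear_on (scale H) tensor_scale (carrier H) D.TS (\<lambda>x. ?S (sigma x))" by (rule lin_comp[OF Sl sigma_lin])
  have sSl: "linear_on (scale H) tensor_scale (carrier H) D.TS (\<lambda>x. sigma (antipode H x))" by (rule lin_comp[OF sigma_lin antipode_linear])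
  show ?thesis
  proof (rule coalg.conv_inverse_unique[where g = "\<lambda>x. ?S (sigma x)" and h = "\<lambda>x. sigma (antipode H x)" and f = sigma and m = dmul and e = "sigma \<one>",
      OF D.vTS dmul_bil Ssl sigma_lin sSl])
    fix u assume u: "u \<in> carrier H"
    show "dmul (dmul (?S (sigma u)) (sigma v)) (sigma (antipode H w)) = dmul (?S (sigma u)) (dmul (sigma v) (sigma (antipode H w)))"
      if "v \<in> carrier H" "w \<in> carrier H" for v w
      using dmul_sigma_assoc[OF that(1) antipode_closed[OF that(2)] linear_on_closed[OF Ssl u]] sigma_mult[OF that(1) antipode_closed[OF that(2)]] by simp
    show "dmul (sigma \<one>) (sigma (antipode H u)) = sigma (antipode H u)"
      using sigma_mult[OF one_closed antipode_closed[OF u]] by (simp add: one_left antipode_closed u)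
    show "dmul (?S (sigma u)) (sigma \<one>) = ?S (sigma u)" by (rule dmul_sigma_one[OF linear_on_closed[OF Ssl u]])
    have b: "bilinear_on tensor_scale tensor_scale tensor_scale D.TS D.TS D.TS (\<lambda>u v. dmul (?S u) v)"
      by (intro bilinear_onI lin_bil1[OF dmul_bil] lin_bil2[OF dmul_bil] Sl lin_id linear_on_closed[OF Sl])
    have "sweedler H (\<lambda>p q. dmul (?S (sigma p)) (sigma q)) u = sweedler (tens Hm Hp) (\<lambda>p q. dmul (?S p) q) (sigma u)"
      by (rule sweedler_map[symmetric, OF coalg.comultiplication_axioms _ points_map[OF sigma_point] u D.vTS])
        (use D.vTS b in \<open>simp_all del: rb_minus_simps rb_plus_simps\<close>)
    also have "\<dots> = tensor_scale (counit H u) (sigma \<one>)"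
      unfolding left[OF sigma_closed[OF u]] sigma_one coalgebra_map_counit[OF points_map[OF sigma_point] u] ..
    finally show "sweedler H (\<lambda>p q. dmul (?S (sigma p)) (sigma q)) u = tensor_scale (counit H u) (sigma \<one>)" .
    have "sweedler H (\<lambda>p q. dmul (sigma p) (sigma (antipode H q))) u = sweedler H (\<lambda>p q. sigma (p \<cdot> antipode H q)) u"
      by (intro coalg.sweedler_cong[OF u] sigma_mult antipode_closed)
    also have "\<dots> = sigma (sweedler H (\<lambda>p q. p \<cdot> antipode H q) u)"
      by (rule coalg.sweedler_hom[symmetric, OF u V vs_tensor sigma_lin]) (intro mult_closed antipode_closed)
    finally show "sweedler H (\<lambda>p q. dmul (sigma p) (sigma (antipode H q))) u = tensor_scale (counit H u) (sigma \<one>)"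
      by (simp add: antipode_right u linear_on_scale[OF sigma_lin one_closed])
  qed (rule sigma_closed[OF one_closed] x)+
qed

end

section \<open>The multiplication map, the projection, and the operator on its image\<close>

context rota_baxter_hopf
begin

interpretation pair: coalgebra_pair H H by (rule pair)
interpretation R1: rb_points H H B by (rule rb_pointsI[OF coalg.cocommutative_coalgebra_axioms])
interpretation R2: rb_points "tens H H" H B by (rule rb_pointsI[OF pair.coalgebra])
interpretation D: double_cross_data Hm Hp actl actr by (rule dc_data)

lemma factorization:
  assumes x: "x \<in> carrier H"
  shows "sweedler H (\<lambda>u v. N u \<cdot> antipode H (P v)) x = x"
proof -
  note i = id_points(1)
  have "sweedler H (\<lambda>u v. N u \<cdot> antipode H (P v)) x = cmul H H (\<lambda>c. N (idp c)) (\<lambda>c. antipode H (P (idp c))) x"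
    unfolding cmul_def using x by (auto intro!: coalg.sweedler_cong)
  also have "cmul H H (\<lambda>c. N (idp c)) (\<lambda>c. antipode H (P (idp c))) = idp"
    using R1.G.N_inv_P[OF i] unfolding R1.N_point[OF i] .
  finally show ?thesis using x by simp
qed

definition "mu = lift_of Hm Hp (mult H)"

lemma mu_bilinear: "bilinear_on (scale Hm) (scale Hp) (scale H) (carrier Hm) (carrier Hp) (carrier H) (mult H)"
  unfolding rb_minus_simps rb_plus_simps by (rule bilinear_on_mono[OF mult_bilinear]) (auto simp: N_closed B_closed)

lemma mu_lin: "linear_on tensor_scale (scale H) D.TS (carrier H) mu"
  unfolding mu_def by (rule lift_linear[OF D.A.vspC D.X.vspC V mu_bilinear])

lemma mu_pure: "a \<in> carrier Hm \<Longrightarrow> b \<in> carrier Hp \<Longrightarrow> mu (tp a b) = a \<cdot> b"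
  unfolding mu_def by (rule lift_pure[OF D.A.vspC D.X.vspC vector_space mu_bilinear])

lemma SP_in: "x \<in> carrier H \<Longrightarrow> antipode H (P x) \<in> carrier Hp"
  unfolding P_Tinv[symmetric] by (intro P_in Tinv_closed)

lemma mu_sigma:
  assumes x: "x \<in> carrier H" shows "mu (sigma x) = x"
proof -
  have "mu (sigma x) = sweedler H (\<lambda>u v. mu (tp (N u) (antipode H (P v)))) x"
    unfolding sigma_formula[OF x]
    by (rule coalg.sweedler_hom[OF x tensor_space_vsp vector_space mu_lin]) (intro pure_tensor_in N_in SP_in)
  also have "\<dots> = sweedler H (\<lambda>u v. N u \<cdot> antipode H (P v)) x"
    by (intro coalg.sweedler_cong[OF x] mu_pure N_in SP_in)
  finally show ?thesis unfolding factorization[OF x] .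
qed

lemma sigma_inj: "inj_on sigma (carrier H)"
  by (rule inj_on_inverseI[of _ mu]) (rule mu_sigma)

text \<open>The right-hand side is the prescribed formula for the projection. It arises from
  \<open>sigma_formula\<close> because (x, y) \<mapsto> \<open>N x \<cdot> B y\<close> is a point of
  \<open>H \<otimes> H\<close> and so respects Sweedler factors.\<close>

lemma sigma_mult_N_B:
  assumes x: "x \<in> carrier H" and y: "y \<in> carrier H"
  shows "sigma (N x \<cdot> B y) = sweedler H (\<lambda>x1 x2. sweedler H (\<lambda>y1 y2.
    tp (N (N x1 \<cdot> B y1)) (antipode H (P (N x2 \<cdot> B y2)))) y) x"
proof -
  let ?f = "\<lambda>c. N (p1 c)" and ?g = "\<lambda>c. B (p2 c)"
  let ?m = "cmul T2 H ?f ?g"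
  let ?\<Psi> = "\<lambda>u v. tp (N u) (antipode H (P v))"
  note w = pt_in_tens[OF x y]
  have f: "?f \<in> points T2 H" "?g \<in> points T2 H"
    by (rule points_comp[OF pair.T.comultiplication_axioms V V proj_points(1) N_map] points_comp[OF pair.T.comultiplication_axioms V V proj_points(2) coalgebra_map])+
  note m = R2.Q.cmul_point[OF f]
  have me: "?m (pt a b) = N a \<cdot> B b" if ab: "a \<in> carrier H" "b \<in> carrier H" for a b
    unfolding cmul_def using pt_in_tens[OF ab] pair.eval_indep[OF ab V mult_bilinear N_lin B_lin] by simp
  have b: "bilinear_on (scale H) (scale H) tensor_scale (carrier H) (carrier H) HH ?\<Psi>"
    unfolding rb_minus_simps rb_plus_simps
    by (intro bilinear_onI lin_pure1 lin_pure2 N_lin SP_lin N_closed antipode_closed P_closed)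
  have ml: "linear_on tensor_scale (scale H) HH (carrier H) ?m"
    using R2.Q.points_lin[OF m] by simp
  have "sigma (N x \<cdot> B y) = sweedler H ?\<Psi> (?m (pt x y))"
    unfolding me[OF x y] by (rule sigma_formula) (intro mult_closed N_closed B_closed x y)
  also have "\<dots> = sweedler T2 (\<lambda>u v. ?\<Psi> (?m u) (?m v)) (pt x y)"
    by (rule sweedler_map[OF pair.T.comultiplication_axioms V points_map[OF m] w tensor_space_vsp b])
  also have "\<dots> = sweedler H (\<lambda>x1 x2. sweedler H (\<lambda>y1 y2. ?\<Psi> (?m (pt x1 y1)) (?m (pt x2 y2))) y) x"
    by (rule pair.sweedler_tens[OF x y tensor_space_vsp[of "scale H" "scale H" "carrier H" "carrier H"]])
      (intro bilinear_onI lin_comp[OF bilinear_onD1[OF b] ml] lin_comp[OF bilinear_onD2[OF b] ml] linear_on_closed[OF ml])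
  also have "\<dots> = sweedler H (\<lambda>x1 x2. sweedler H (\<lambda>y1 y2. ?\<Psi> (N x1 \<cdot> B y1) (N x2 \<cdot> B y2)) y) x"
    by (rule coalg.sweedler_cong[OF x], rule coalg.sweedler_cong[OF y]) (simp only: me)
  finally show ?thesis .
qed

lemma lift_cong:
  assumes "z \<in> D.TS" "\<And>a b. a \<in> carrier Hm \<Longrightarrow> b \<in> carrier Hp \<Longrightarrow> F a b = G a b"
  shows "lift_of Hm Hp F z = lift_of Hm Hp G z"
  unfolding tensor_lift_rep using tensor_rep(1)[OF D.A.vspC assms(1)] assms(2)
  by (intro arg_cong[of _ _ sum_list] map_cong) (auto simp: subset_iff)

text \<open>By \<open>sigma_mult_N_B\<close> the prescribed formula depends only on the product of
  the two components, so the choice of preimages disappears.\<close>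

lemma projection:
  assumes z: "z \<in> D.TS" shows "rb_projection H B z = sigma (mu z)"
proof -
  let ?F = "\<lambda>a b. sigma (a \<cdot> b)"
  have b: "bilinear_on (scale Hm) (scale Hp) tensor_scale (carrier Hm) (carrier Hp) D.TS ?F"
    by (intro bilinear_onI lin_comp[OF sigma_lin bilinear_onD1[OF mu_bilinear]] lin_comp[OF sigma_lin bilinear_onD2[OF mu_bilinear]])
  have "rb_projection H B z = lift_of Hm Hp ?F z"
    unfolding rb_projection_def Let_def
  proof (rule lift_cong[OF z])
    fix a b assume a: "a \<in> carrier Hm" and b: "b \<in> carrier Hp"
    let ?x = "inv_into (carrier H) N a" and ?y = "inv_into (carrier H) B b"
    have x: "?x \<in> carrier H" "N ?x = a" and y: "?y \<in> carrier H" "B ?y = b"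
      using a b by (simp_all add: inv_into_into f_inv_into_f)
    show "sweedler H (\<lambda>x1 x2. sweedler H (\<lambda>y1 y2. tensor_of H H (N (N x1 \<cdot> B y1))
        (antipode H (P (N x2 \<cdot> B y2)))) ?y) ?x = sigma (a \<cdot> b)"
      using sigma_mult_N_B[OF x(1) y(1)] x(2) y(2) by simp
  qed
  also have "\<dots> = sigma (mu z)"
    by (rule D.tens_eqI[OF vs_tensor lift_linear[OF D.A.vspC D.X.vspC D.vTS b] lin_comp[OF sigma_lin mu_lin] _ z])
      (simp only: lift_pure[OF D.A.vspC D.X.vspC vs_tensor b] mu_pure)
  finally show ?thesis .
qed

lemma projection_sigma: "x \<in> carrier H \<Longrightarrow> rb_projection H B (sigma x) = sigma x"
  by (simp only: projection sigma_closed mu_sigma)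

lemma image_carrier: "carrier (rb_image H B) = sigma ` carrier H"
proof -
  have "rb_projection H B ` D.TS = sigma ` carrier H"
  proof (intro equalityI subsetI; elim imageE)
    fix z w assume "w = rb_projection H B z" "z \<in> D.TS"
    then show "w \<in> sigma ` carrier H"
      using linear_on_closed[OF mu_lin] by (simp only: projection) blast
  next
    fix w x assume "w = sigma x" "x \<in> carrier H"
    then show "w \<in> rb_projection H B ` D.TS"
      by (metis image_eqI projection_sigma sigma_closed)
  qed
  then show ?thesis unfolding rb_image_def double_cross_fields by simp
qed

text \<open>The counit erases the second component of \<open>sigma x\<close>, leaving
  \<open>N x\<close> paired with \<open>1\<close>, and the product of these two is
  \<open>N x\<close>.\<close>

lemma image_op:
  assumes x: "x \<in> carrier H" shows "rb_image_op H B (sigma x) = sigma (N x)"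
proof -
  let ?E = "lift_of Hm Hp (\<lambda>x y. tensor_of H H x (scale H (counit H y) \<one>))"
  have t: "tensor_of H H = tp" by simp
  have one: "\<one> \<in> carrier Hp" using P_in[OF one_closed] unfolding P_one .
  have l1: "linear_on (scale Hp) (scale Hp) (carrier Hp) (carrier Hp) (\<lambda>y. scale H (counit H y) \<one>)"
    using lin_scale1[OF D.X.vspC D.X.counit_linear one] by simp
  have b: "bilinear_on (scale Hm) (scale Hp) tensor_scale (carrier Hm) (carrier Hp) D.TS (\<lambda>x y. tensor_of H H x (scale H (counit H y) \<one>))"
    unfolding t by (intro bilinear_onI lin_pure1 lin_pure2 l1 lin_id linear_on_closed[OF l1])
  note El = lift_linear[OF D.A.vspC D.X.vspC D.vTS b]
  have c: "counit H (antipode H (P v)) = counit H v" if "v \<in> carrier H" for v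
    using that by (simp add: antipode_counit P_closed coalgebra_map_counit[OF P_map])
  have l2: "linear_on (scale H) tensor_scale (carrier H) D.TS (\<lambda>u. tp (N u) \<one>)"
    by (intro lin_pure1 coalgebra_map_linear[OF N_Hm_map] one)
  have "?E (sigma x) = sweedler H (\<lambda>u v. ?E (tp (N u) (antipode H (P v)))) x"
    unfolding sigma_formula[OF x]
    by (rule coalg.sweedler_hom[OF x tensor_space_vsp vs_tensor El]) (intro pure_tensor_in N_in SP_in)
  also have "\<dots> = sweedler H (\<lambda>u v. tp (N u) (scale Hp (counit H v) \<one>)) x"
    by (intro coalg.sweedler_cong[OF x], subst lift_pure[OF D.A.vspC D.X.vspC vs_tensor b]) (auto simp: c intro: N_in SP_in simp del: rb_minus_simps(1) rb_plus_simps(1))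
  also have "\<dots> = sweedler H (\<lambda>u v. tensor_scale (counit H v) (tp (N u) \<one>)) x"
    by (intro coalg.sweedler_cong[OF x] linear_on_scale[OF bilinear_onD1[OF pure_tensor_bilinear[where V = "carrier Hm" and W = "carrier Hp"]]] N_in one)
  also have "\<dots> = tp (N x) \<one>"
    by (rule coalg.counit_right'[OF x D.vTS l2])
  finally have E: "?E (sigma x) = tp (N x) \<one>" .
  have "rb_image_op H B (sigma x) = rb_projection H B (tp (N x) \<one>)"
    unfolding rb_image_op_def E ..
  also have "\<dots> = sigma (mu (tp (N x) \<one>))" by (rule projection[OF pure_tensor_in[OF N_in[OF x] one]])
  also have "\<dots> = sigma (N x)" by (simp only: mu_pure[OF N_in[OF x] one] one_right N_closed x)
  finally show ?thesis .
qed

end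

section \<open>Transport of structure\<close>

text \<open>The carrier of \<open>G\<close> is the image of \<open>f\<close> and all operations are
  known on elements \<open>f x\<close>, so the axioms are inherited from \<open>H\<close>. The
  operator \<open>b\<close> is a parameter because both \<open>N\<close> and \<open>B\<close> are
  transported to the same \<open>G\<close>.\<close>

locale rota_baxter_transport = rota_baxter_hopf H b for H :: "('k::field, 'a::ab_group_add) hopf" (structure) and b +
  fixes G :: "('k, 'b::ab_group_add) hopf" and f b'
  assumes vector_space_G: "vector_space (scale G)" and f: "coalgebra_map H G f"
    and carrier_G: "carrier G = f ` carrier H" and f_inj: "inj_on f (carrier H)"
    and f_mult: "\<And>x y. x \<in> carrier H \<Longrightarrow> y \<in> carrier H \<Longrightarrow> f x \<cdot>\<^bsub>G\<^esub> f y = f (x \<cdot>\<^bsub>H\<^esub> y)"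
    and f_one: "\<one>\<^bsub>G\<^esub> = f \<one>\<^bsub>H\<^esub>"
    and f_antipode: "\<And>x. x \<in> carrier H \<Longrightarrow> antipode G (f x) = f (antipode H x)"
    and f_op: "\<And>x. x \<in> carrier H \<Longrightarrow> b' (f x) = f (b x)"
begin

lemma G_coalgebra: "cocommutative_coalgebra G"
  by (rule surjective_coalgebra_map[OF coalg.cocommutative_coalgebra_axioms vector_space_G f carrier_G])

sublocale GC: cocommutative_coalgebra G by (rule G_coalgebra)

definition "f_inv = inv_into (carrier H) f"

lemma f_inv_f: "x \<in> carrier H \<Longrightarrow> f_inv (f x) = x"
  unfolding f_inv_def by (rule inv_into_f_f[OF f_inj])

lemmas f_lin = coalgebra_map_linear[OF f] and f_closed = coalgebra_map_closed[OF f]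

lemma G_elim: assumes "z \<in> carrier G" obtains x where "x \<in> carrier H" "z = f x"
  using assms unfolding carrier_G by blast

lemma f_inv_closed: "z \<in> carrier G \<Longrightarrow> f_inv z \<in> carrier H"
  by (erule G_elim) (simp add: f_inv_f)

lemma f_inv_lin: "linear_on (scale G) (scale H) (carrier G) (carrier H) f_inv"
  unfolding linear_on_def
proof (intro conjI ballI allI f_inv_closed)
  fix z w c assume "z \<in> carrier G"
  then obtain x where x: "x \<in> carrier H" "z = f x" by (rule G_elim)
  show "f_inv (scale G c z) = scale H c (f_inv z)"
    using x by (simp add: linear_on_scale[OF f_lin, symmetric] f_inv_f vsp_scale[OF V])
  assume "w \<in> carrier G"
  then obtain y where y: "y \<in> carrier H" "w = f y" by (rule G_elim)
  show "f_inv (z + w) = f_inv z + f_inv w"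
    using x y by (simp add: linear_on_add[OF f_lin, symmetric] f_inv_f vsp_add[OF V])
qed

lemma sweedler_f:
  assumes x: "x \<in> carrier H" and U: "vsp s U" and "bilinear_on (scale G) (scale G) s (carrier G) (carrier G) U \<Phi>"
  shows "sweedler G \<Phi> (f x) = sweedler H (\<lambda>u v. \<Phi> (f u) (f v)) x"
  by (rule sweedler_map[OF coalg.comultiplication_axioms GC.vspC f assms])

lemma f_inv_map: "coalgebra_map G H f_inv"
  unfolding coalgebra_map_def
proof (intro conjI ballI f_inv_lin)
  fix z assume "z \<in> carrier G"
  then obtain x where x: "x \<in> carrier H" "z = f x" by (rule G_elim)
  show "counit H (f_inv z) = counit G z"
    using x by (simp add: f_inv_f coalgebra_map_counit[OF f])
  have b: "bilinear_on (scale G) (scale G) tensor_scale (carrier G) (carrier G) HH (\<lambda>u v. tensor_of H H (f_inv u) (f_inv v))"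
    by (intro bilinear_onI lin_pure1 lin_pure2 f_inv_lin f_inv_closed)
  have "sweedler G (\<lambda>u v. tensor_of H H (f_inv u) (f_inv v)) z = sweedler H (\<lambda>u v. tensor_of H H (f_inv (f u)) (f_inv (f v))) x"
    unfolding x(2) by (rule sweedler_f[OF x(1) tensor_space_vsp b])
  also have "\<dots> = sweedler H (\<lambda>u v. tensor_of H H u v) x"
    by (intro coalg.sweedler_cong[OF x(1)]) (simp add: f_inv_f)
  finally show "comult H (f_inv z) = sweedler G (\<lambda>u v. tensor_of H H (f_inv u) (f_inv v)) z"
    using x by (simp add: f_inv_f coalg.sweedler_pure)
qed

lemma mult_alt: "z \<in> carrier G \<Longrightarrow> w \<in> carrier G \<Longrightarrow> z \<cdot>\<^bsub>G\<^esub> w = f (f_inv z \<cdot> f_inv w)"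
  by (elim G_elim) (simp add: f_mult f_inv_f)

lemma bilinear_G: "bilinear_on (scale G) (scale G) (scale G) (carrier G) (carrier G) (carrier G) (mult G)"
proof -
  have b: "bilinear_on (scale G) (scale G) (scale G) (carrier G) (carrier G) (carrier G) (\<lambda>z w. f (f_inv z \<cdot> f_inv w))"
    by (intro bilinear_onI lin_comp[OF f_lin] Hlin1 Hlin2 f_inv_lin f_inv_closed)
  show ?thesis
    using b unfolding bilinear_on_def linear_on_def
    by (simp add: mult_alt vsp_add[OF GC.vspC] vsp_scale[OF GC.vspC])
qed

lemma antipode_G: "is_antipode G (antipode G)"
proof -
  have Sl: "linear_on (scale G) (scale G) (carrier G) (carrier G) (antipode G)"
    by (rule linear_on_cong[OF lin_comp[OF f_lin lin_comp[OF antipode_linear f_inv_lin]] GC.vspC])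
      (auto elim!: G_elim simp: f_antipode f_inv_f)
  note Sc = linear_on_closed[OF Sl]
  have b: "bilinear_on (scale G) (scale G) (scale G) (carrier G) (carrier G) (carrier G) (\<lambda>u v. antipode G u \<cdot>\<^bsub>G\<^esub> v)"
    "bilinear_on (scale G) (scale G) (scale G) (carrier G) (carrier G) (carrier G) (\<lambda>u v. u \<cdot>\<^bsub>G\<^esub> antipode G v)"
    by (intro bilinear_onI lin_bil1[OF bilinear_G] lin_bil2[OF bilinear_G] Sl lin_id Sc; assumption)+
  have "sweedler G (\<lambda>u v. antipode G u \<cdot>\<^bsub>G\<^esub> v) z = scale G (counit G z) \<one>\<^bsub>G\<^esub> \<and>
    sweedler G (\<lambda>u v. u \<cdot>\<^bsub>G\<^esub> antipode G v) z = scale G (counit G z) \<one>\<^bsub>G\<^esub>" if "z \<in> carrier G" for z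
  proof -
    obtain x where x: "x \<in> carrier H" "z = f x" using \<open>z \<in> carrier G\<close> by (rule G_elim)
    have "sweedler G (\<lambda>u v. antipode G u \<cdot>\<^bsub>G\<^esub> v) z = sweedler H (\<lambda>u v. f (antipode H u \<cdot> v)) x"
      unfolding x(2) sweedler_f[OF x(1) GC.vspC b(1)]
      by (intro coalg.sweedler_cong[OF x(1)]) (simp add: f_antipode f_mult antipode_closed)
    also have "\<dots> = f (sweedler H (\<lambda>u v. antipode H u \<cdot> v) x)"
      by (rule coalg.sweedler_hom[OF x(1) V vector_space_G f_lin, symmetric]) (intro mult_closed antipode_closed)
    finally have 1: "sweedler G (\<lambda>u v. antipode G u \<cdot>\<^bsub>G\<^esub> v) z = \<dots>" .
    have "sweedler G (\<lambda>u v. u \<cdot>\<^bsub>G\<^esub> antipode G v) z = sweedler H (\<lambda>u v. f (u \<cdot> antipode H v)) x"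
      unfolding x(2) sweedler_f[OF x(1) GC.vspC b(2)]
      by (intro coalg.sweedler_cong[OF x(1)]) (simp add: f_antipode f_mult antipode_closed)
    also have "\<dots> = f (sweedler H (\<lambda>u v. u \<cdot> antipode H v) x)"
      by (rule coalg.sweedler_hom[OF x(1) V vector_space_G f_lin, symmetric]) (intro mult_closed antipode_closed)
    finally show ?thesis
      using 1 x by (simp add: antipode_left antipode_right linear_on_scale[OF f_lin one_closed] f_one coalgebra_map_counit[OF f])
  qed
  then show ?thesis unfolding is_antipode_def using Sl by blast
qed

lemma comult_mult_G:
  assumes "z \<in> carrier G" "w \<in> carrier G"
  shows "comult G (z \<cdot>\<^bsub>G\<^esub> w) = sweedler G (\<lambda>u v. sweedler G (\<lambda>p q. tensor_of G G (u \<cdot>\<^bsub>G\<^esub> p) (v \<cdot>\<^bsub>G\<^esub> q)) w) z"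
proof -
  obtain x y where x: "x \<in> carrier H" "z = f x" and y: "y \<in> carrier H" "w = f y"
    using assms by (elim G_elim)
  let ?GG = "tensor_space (scale G) (scale G) (carrier G) (carrier G)"
  let ?L = "lift_of H H (\<lambda>u v. tensor_of G G (f u) (f v))"
  have bf: "bilinear_on (scale H) (scale H) tensor_scale (carrier H) (carrier H) ?GG (\<lambda>u v. tensor_of G G (f u) (f v))"
    by (intro bilinear_onI lin_pure1 lin_pure2 f_lin f_closed)
  note L = lift_linear[OF V V tensor_space_vsp bf]
  note Gc = bilinear_on_closed[OF bilinear_G]
  have b: "bilinear_on (scale G) (scale G) tensor_scale (carrier G) (carrier G) ?GG (\<lambda>p q. tensor_of G G (u \<cdot>\<^bsub>G\<^esub> p) (v \<cdot>\<^bsub>G\<^esub> q))"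
    if "u \<in> carrier G" "v \<in> carrier G" for u v
    by (intro bilinear_onI lin_pure1 lin_pure2 lin_bil2[OF bilinear_G] lin_id Gc that)
  have b2: "bilinear_on (scale G) (scale G) tensor_scale (carrier G) (carrier G) ?GG
    (\<lambda>u v. sweedler G (\<lambda>p q. tensor_of G G (u \<cdot>\<^bsub>G\<^esub> p) (v \<cdot>\<^bsub>G\<^esub> q)) w)"
    by (intro bilinear_onI GC.lin_param[OF _ tensor_space_vsp] assms lin_pure1 lin_pure2 lin_bil1[OF bilinear_G] lin_id Gc; assumption)
  have "comult G (z \<cdot>\<^bsub>G\<^esub> w) = ?L (comult H (x \<cdot> y))"
    unfolding x(2) y(2) f_mult[OF x(1) y(1)] coalgebra_map_comult[OF f mult_closed[OF x(1) y(1)]] sweedler_def ..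
  also have "\<dots> = sweedler H (\<lambda>u v. ?L (sweedler H (\<lambda>p q. tensor_of H H (u \<cdot> p) (v \<cdot> q)) y)) x"
    unfolding comult_mult[OF x(1) y(1)]
    by (rule coalg.sweedler_hom[OF x(1) tensor_space_vsp vs_tensor L])
      (intro coalg.sweedler_closed[OF y(1) tensor_space_vsp] pure_tensor_in mult_closed)
  also have "\<dots> = sweedler H (\<lambda>u v. sweedler H (\<lambda>p q. ?L (tensor_of H H (u \<cdot> p) (v \<cdot> q))) y) x"
    by (intro coalg.sweedler_cong[OF x(1)] coalg.sweedler_hom[OF y(1) tensor_space_vsp vs_tensor L] pure_tensor_in mult_closed)
  also have "\<dots> = sweedler H (\<lambda>u v. sweedler H (\<lambda>p q. tensor_of G G (f u \<cdot>\<^bsub>G\<^esub> f p) (f v \<cdot>\<^bsub>G\<^esub> f q)) y) x"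
    by (intro coalg.sweedler_cong[OF x(1)] coalg.sweedler_cong[OF y(1)])
      (simp add: lift_pure[OF V V vs_tensor bf] mult_closed f_mult)
  also have "\<dots> = sweedler H (\<lambda>u v. sweedler G (\<lambda>p q. tensor_of G G (f u \<cdot>\<^bsub>G\<^esub> p) (f v \<cdot>\<^bsub>G\<^esub> q)) w) x"
    unfolding y(2) by (intro coalg.sweedler_cong[OF x(1)] sweedler_f[OF y(1) tensor_space_vsp b, symmetric] f_closed)
  also have "\<dots> = sweedler G (\<lambda>u v. sweedler G (\<lambda>p q. tensor_of G G (u \<cdot>\<^bsub>G\<^esub> p) (v \<cdot>\<^bsub>G\<^esub> q)) w) z"
    unfolding x(2) by (rule sweedler_f[OF x(1) tensor_space_vsp b2, symmetric])
  finally show ?thesis .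
qed

lemma hopf_G: "cocommutative_hopf_algebra G"
proof (intro cocommutative_hopf_algebra.intro hopf_algebra.intro cocommutative_hopf_algebra_axioms.intro)
  show "\<one>\<^bsub>G\<^esub> \<in> carrier G" unfolding f_one by (rule f_closed[OF one_closed])
  show "comult G \<one>\<^bsub>G\<^esub> = tensor_of G G \<one>\<^bsub>G\<^esub> \<one>\<^bsub>G\<^esub>"
  proof -
    have "bilinear_on (scale H) (scale H) tensor_scale (carrier H) (carrier H)
        (tensor_space (scale G) (scale G) (carrier G) (carrier G)) (\<lambda>u v. tensor_of G G (f u) (f v))"
      by (intro bilinear_onI lin_pure1 lin_pure2 f_lin f_closed)
    then show ?thesis
      unfolding f_one coalgebra_map_comult[OF f one_closed]
      using coalg.sweedler_comult[OF one_closed tensor_space_vsp, where xs = "[(\<one>, \<one>)]"] by (simp add: one_closed comult_one)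
  qed
  show "counit G \<one>\<^bsub>G\<^esub> = 1" unfolding f_one by (simp add: coalgebra_map_counit[OF f] one_closed counit_one)
  fix x assume x: "x \<in> carrier G"
  then obtain x' where x': "x' \<in> carrier H" "x = f x'" by (rule G_elim)
  show "\<one>\<^bsub>G\<^esub> \<cdot>\<^bsub>G\<^esub> x = x" "x \<cdot>\<^bsub>G\<^esub> \<one>\<^bsub>G\<^esub> = x"
    unfolding f_one x'(2) using x'(1) by (simp_all add: f_mult one_closed one_left one_right)
  fix y assume y: "y \<in> carrier G"
  then obtain y' where y': "y' \<in> carrier H" "y = f y'" by (rule G_elim)
  show "counit G (x \<cdot>\<^bsub>G\<^esub> y) = counit G x * counit G y"
    using x' y' by (simp add: f_mult coalgebra_map_counit[OF f] mult_closed counit_mult)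
  fix z assume "z \<in> carrier G"
  then obtain z' where z': "z' \<in> carrier H" "z = f z'" by (rule G_elim)
  show "(x \<cdot>\<^bsub>G\<^esub> y) \<cdot>\<^bsub>G\<^esub> z = x \<cdot>\<^bsub>G\<^esub> (y \<cdot>\<^bsub>G\<^esub> z)"
    using x' y' z' by (simp add: f_mult mult_closed mult_assoc)
qed (fact vector_space_G GC.subspace bilinear_G GC.comult_linear GC.counit_linear GC.coassoc GC.counit_left
    GC.counit_right GC.cocommutative antipode_G comult_mult_G)+

lemma op_alt: "z \<in> carrier G \<Longrightarrow> b' z = f (b (f_inv z))"
  by (erule G_elim) (simp add: f_op f_inv_f)

lemma op_map: "coalgebra_map G G b'"
proof (rule coalgebra_map_cong[OF G_coalgebra])
  show "coalgebra_map G G (\<lambda>z. f (b (f_inv z)))"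
    by (rule coalgebra_map_comp[OF GC.comultiplication_axioms V GC.vspC f_inv_map
          coalgebra_map_comp[OF coalg.comultiplication_axioms V GC.vspC coalgebra_map f]])
qed (simp add: op_alt)

lemma rota_baxter_G: "rota_baxter_hopf G b'"
proof (intro rota_baxter_hopf.intro hopf_G rota_baxter_hopf_axioms.intro op_map)
  fix z w assume "z \<in> carrier G" "w \<in> carrier G"
  then obtain x y where x: "x \<in> carrier H" "z = f x" and y: "y \<in> carrier H" "w = f y"
    by (elim G_elim)
  interpret G: cocommutative_hopf_algebra G by (rule hopf_G)
  let ?\<Phi> = "\<lambda>u v q. b' u \<cdot>\<^bsub>G\<^esub> w \<cdot>\<^bsub>G\<^esub> antipode G (b' v) \<cdot>\<^bsub>G\<^esub> q"
  let ?\<Psi> = "\<lambda>u v q. b u \<cdot> y \<cdot> antipode H (b v) \<cdot> q"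
  have w: "w \<in> carrier G" unfolding y(2) by (rule f_closed[OF y(1)])
  note bl = coalgebra_map_linear[OF op_map]
  note bc = linear_on_closed[OF bl]
  have 1: "linear_on (scale G) (scale G) (carrier G) (carrier G) (\<lambda>u. ?\<Phi> u v q)" if "v \<in> carrier G" "q \<in> carrier G" for v q
    by (intro G.Hlin1 bl w G.antipode_closed bc that)
  have 2: "bilinear_on (scale G) (scale G) (scale G) (carrier G) (carrier G) (carrier G) (?\<Phi> u)" if "u \<in> carrier G" for u
    by (intro bilinear_onI G.Hlin1 G.Hlin2 lin_comp[OF G.antipode_linear bl] lin_id w G.mult_closed G.antipode_closed bc that)
  have 3: "bilinear_on (scale G) (scale G) (scale G) (carrier G) (carrier G) (carrier G) (\<lambda>u t. sweedler G (\<lambda>v q. ?\<Phi> u v q) t)"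
    by (intro bilinear_onI GC.lin_sweedler_arg[OF GC.vspC 2] GC.lin_param[OF _ GC.vspC] 1)
  have 4: "?\<Phi> (f u) (f v) (f q) = f (?\<Psi> u v q)" if "u \<in> carrier H" "v \<in> carrier H" "q \<in> carrier H" for u v q
    using that y by (simp add: f_op f_mult f_antipode mult_closed antipode_closed B_closed)
  have 5: "?\<Psi> u v q \<in> carrier H" if "u \<in> carrier H" "v \<in> carrier H" "q \<in> carrier H" for u v q
    using that y by (simp add: mult_closed antipode_closed B_closed)
  have 6: "sweedler H (?\<Psi> u) t \<in> carrier H" if "u \<in> carrier H" "t \<in> carrier H" for u t
    by (rule coalg.sweedler_closed[OF that(2) V 5[OF that(1)]])
  have "sweedler3 G ?\<Phi> z = sweedler H (\<lambda>u t. sweedler G (\<lambda>v q. ?\<Phi> (f u) v q) (f t)) x"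
    unfolding sweedler3_def x(2) by (rule sweedler_f[OF x(1) GC.vspC 3])
  also have "\<dots> = sweedler H (\<lambda>u t. sweedler H (\<lambda>v q. ?\<Phi> (f u) (f v) (f q)) t) x"
    by (intro coalg.sweedler_cong[OF x(1)] sweedler_f[OF _ GC.vspC 2] f_closed)
  also have "\<dots> = sweedler H (\<lambda>u t. f (sweedler H (?\<Psi> u) t)) x"
    by (intro coalg.sweedler_cong[OF x(1)], subst coalg.sweedler_hom[OF _ V vector_space_G f_lin])
      (auto intro!: coalg.sweedler_cong 4 5)
  also have "\<dots> = f (sweedler3 H ?\<Psi> x)"
    unfolding sweedler3_def by (rule coalg.sweedler_hom[OF x(1) V vector_space_G f_lin 6, symmetric])
  finally have "b' (sweedler3 G ?\<Phi> z) = f (b (sweedler3 H ?\<Psi> x))"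
    unfolding sweedler3_def by (simp add: f_op coalg.sweedler_closed[OF x(1) V 6])
  then show "b' z \<cdot>\<^bsub>G\<^esub> b' w = b' (sweedler3 G ?\<Phi> z)"
    using x y by (simp add: f_op f_mult B_closed rota_baxter)
qed

lemma isomorphic_G: "rota_baxter_isomorphic G b' H b"
  unfolding rota_baxter_isomorphic_def
proof (intro exI[of _ f_inv] conjI ballI)
  show "bij_betw f_inv (carrier G) (carrier H)"
    unfolding f_inv_def carrier_G by (rule bij_betw_inv_into) (simp add: bij_betw_def f_inj)
  show "f_inv (b' z) = b (f_inv z)" if "z \<in> carrier G" for z
    using that by (elim G_elim) (simp add: f_op f_inv_f B_closed)
  show "hopf_hom G H f_inv"
    unfolding hopf_hom_def f_one
    by (auto elim!: G_elim simp: f_inv_map f_mult f_antipode f_inv_f mult_closed antipode_closed one_closed)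
qed

text \<open>Passing to the companion commutes with transport, since it is a formula in the
  transported operations.\<close>

lemma rb_tilde_f:
  assumes x: "x \<in> carrier H" shows "rb_tilde G b' (f x) = f (rb_tilde H b x)"
proof -
  interpret G: cocommutative_hopf_algebra G by (rule hopf_G)
  note bl = coalgebra_map_linear[OF op_map]
  have b: "bilinear_on (scale G) (scale G) (scale G) (carrier G) (carrier G) (carrier G) (\<lambda>u v. u \<cdot>\<^bsub>G\<^esub> b' (antipode G v))"
    by (intro bilinear_onI G.Hlin1 G.Hlin2 lin_comp[OF bl G.antipode_linear] lin_id G.antipode_closed linear_on_closed[OF bl])
  have "rb_tilde G b' (f x) = sweedler H (\<lambda>u v. f (u \<cdot> b (antipode H v))) x"
    unfolding rb_tilde_def sweedler_f[OF x GC.vspC b]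
    by (intro coalg.sweedler_cong[OF x]) (simp add: f_op f_antipode f_mult antipode_closed B_closed)
  also have "\<dots> = f (rb_tilde H b x)"
    unfolding rb_tilde_def
    by (rule coalg.sweedler_hom[OF x V vector_space_G f_lin, symmetric]) (intro mult_closed antipode_closed B_closed)
  finally show ?thesis .
qed

end

context rota_baxter_hopf
begin

interpretation D: double_cross_data Hm Hp actl actr by (rule dc_data)

lemma image_fields:
  "scale (rb_image H B) = tensor_scale" "mult (rb_image H B) = dmul" "one (rb_image H B) = sigma \<one>"
  "comult (rb_image H B) = comult (tens Hm Hp)" "counit (rb_image H B) = counit (tens Hm Hp)"
  "antipode (rb_image H B) = antipode (rb_double_cross H B)"
  unfolding rb_image_def sigma_one by (simp_all add: double_cross_fields del: rb_minus_simps rb_plus_simps)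

lemma sigma_map: "coalgebra_map H (rb_image H B) sigma"
  using points_map[OF sigma_point] unfolding coalgebra_map_def image_fields image_carrier linear_on_def by simp

lemma transport_image:
  assumes b: "rota_baxter_hopf H b" and b': "\<And>x. x \<in> carrier H \<Longrightarrow> b' (sigma x) = sigma (b x)"
  shows "rota_baxter_transport H b (rb_image H B) sigma b'"
  by (intro rota_baxter_transport.intro b rota_baxter_transport_axioms.intro)
    (use b' sigma_mult antipode_sigma in \<open>simp_all add: image_fields image_carrier sigma_map sigma_inj vs_tensor del: rb_minus_simps rb_plus_simps\<close>)

end

theorem theorem3p8:
  fixes H :: "('k::field_char_0, 'h::ab_group_add) hopf"
    and B :: "'h \<Rightarrow> 'h"
  assumes "rota_baxter_hopf H B"
  defines "H\<^sub>1 \<equiv> rb_image H B"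
    and "B\<^sub>1 \<equiv> rb_image_op H B"
  shows "(rota_baxter_hopf H\<^sub>1 B\<^sub>1 \<and>
          rota_baxter_isomorphic H\<^sub>1 B\<^sub>1 H (rb_tilde H B)) \<and>
         (rota_baxter_hopf H\<^sub>1 (rb_tilde H\<^sub>1 B\<^sub>1) \<and>
          rota_baxter_isomorphic H\<^sub>1 (rb_tilde H\<^sub>1 B\<^sub>1) H B)"
proof -
  interpret rota_baxter_hopf H B by fact
  interpret T: rota_baxter_transport H "rb_tilde H B" "rb_image H B" sigma "rb_image_op H B"
    by (rule transport_image[OF rb_tilde_rota_baxter image_op])
  \<comment> \<open>The companion of the operator on the image is the transport of the companion of
    \<open>N\<close>, and that is \<open>B\<close> by \<open>rb_tilde_tilde\<close>.\<close>
  interpret T': rota_baxter_transport H B "rb_image H B" sigma "rb_tilde (rb_image H B) (rb_image_op H B)"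
    by (rule transport_image[OF assms(1)]) (simp only: T.rb_tilde_f rb_tilde_tilde)
  show ?thesis
    unfolding H\<^sub>1_def B\<^sub>1_def
    using T.rota_baxter_G T.isomorphic_G T'.rota_baxter_G T'.isomorphic_G by blast
qed

end
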